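(* Let $(z,z',w,w')\in\mathbb C^4$ be an admissible quadruple, let $A_{z,z',w,w'}$ be the generator of the Feller semigroup $P_\infty(t)$ on $C_0(\Omega)$ associated with $(z,z',w,w')$, and let $\widehat{\mathbb D}_{z,z',w,w'}$ be the operator on $\widehat R=R/J$ induced by the differential operator $\mathbb D_{z,z',w,w'}$. Identify, for every signature $\lambda\neq\varnothing$, the element $\widehat\sigma_\lambda\in\widehat R$ with the function $\widehat\sigma_\lambda(\omega)$ on $\Omega$ (this extends to a linear isomorphism $\iota$ from the linear span of the elements $\widehat\sigma_\lambda\in\widehat R$, $\lambda\ne\varnothing$, onto the space $\widehat{\mathscr F}\subset C_0(\Omega)$). Then the action of $A_{z,z',w,w'}$ on the functions $\widehat\sigma_\lambda(\omega)$ coincides with the action of $\widehat{\mathbb D}_{z,z',w,w'}$ on the elements $\widehat\sigma_\lambda$; that is, for every signature $\lambda\ne\varnothing$, the element $\widehat{\mathbb D}_{z,z',w,w'}\widehat\sigma_\lambda$ lies in the linear span of the elements $\widehat\sigma_\mu\in\widehat R$, $\mu\neq\varnothing$, and $$\iota\big(\widehat{\mathbb D}_{z,z',w,w'}\widehat\sigma_\lambda\big)=A_{z,z',w,w'}\,\widehat\sigma_\lambda(\,\cdot\,).$$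
   Context: Signatures and the algebra $R$. For $N\ge1$, $\mathbb S_N$ is the set of signatures of length $N$: vectors $\lambda=(\lambda_1\ge\dots\ge\lambda_N)\in\mathbb Z^N$; $\mathbb S_0=\{\varnothing\}$. Let $\varphi_n$, $n\in\mathbb Z$, be commuting formal variables of degree $1$, and $\varphi_\lambda=\varphi_{\lambda_1}\cdots\varphi_{\lambda_N}$ for $\lambda\in\mathbb S_N$, $\varphi_\varnothing=1$. $R=\bigoplus_{N\ge0}R_N$ is the commutative graded complex algebra of formal power series of bounded degree in the $\varphi_n$; $R_N$ consists of all formal sums $\sum_{\lambda\in\mathbb S_N}a_\lambda\varphi_\lambda$ with arbitrary $a_\lambda\in\mathbb C$. Set $\sigma_\lambda=\det[\varphi_{\lambda_i-i+j}]_{i,j=1}^N$ for $\lambda\in\mathbb S_N$ and $\sigma_\varnothing=1$. Put $\varphi=\sum_{n\in\mathbb Z}\varphi_n\in R$, $J=(\varphi-1)R$ (principal ideal), $\widehat R=R/J$; for $\psi\in R$, $\widehat\psi$ is its image in $\widehat R$. The differential operator. For arbitrary $(z,z',w,w')\in\mathbb C^4$, $$\mathbb D_{z,z',w,w'}=\sum_{n\in\mathbb Z}A_{nn}\frac{\partial^2}{\partial\varphi_n^2}+2\sum_{n_1>n_2}A_{n_1n_2}\frac{\partial^2}{\partial\varphi_{n_1}\partial\varphi_{n_2}}+\sum_{n\in\mathbb Z}B_n\frac{\partial}{\partial\varphi_n},$$ where for $n_1\ge n_2$ $$A_{n_1n_2}=\sum_{p=0}^\infty(n_1-n_2+2p+1)(\varphi_{n_1+p+1}\varphi_{n_2-p}+\varphi_{n_1+p}\varphi_{n_2-p-1})-(n_1-n_2)\varphi_{n_1}\varphi_{n_2}-2\sum_{p=1}^\infty(n_1-n_2+2p)\varphi_{n_1+p}\varphi_{n_2-p},$$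 $$B_n=(n+w+1)(n+w'+1)\varphi_{n+1}+(n-z-1)(n-z'-1)\varphi_{n-1}-\big((n-z)(n-z')+(n+w)(n+w')\big)\varphi_n.$$ It is a well-defined operator $R\to R$ (acting termwise on formal series) and preserves $J$, so it induces an operator $\widehat{\mathbb D}_{z,z',w,w'}$ on $\widehat R$. The space $\Omega$. $\Omega\subset\mathbb R_+^\infty\times\mathbb R_+^\infty\times\mathbb R_+^\infty\times\mathbb R_+^\infty\times\mathbb R_+\times\mathbb R_+$ is the set of $\omega=(\alpha^+,\beta^+;\alpha^-,\beta^-;\delta^+,\delta^-)$ with $\alpha^\pm=(\alpha^\pm_1\ge\alpha^\pm_2\ge\dots\ge0)$, $\beta^\pm=(\beta_1^\pm\ge\beta_2^\pm\ge\dots\ge0)$, $\sum_i(\alpha_i^\pm+\beta_i^\pm)\le\delta^\pm$, $\beta^+_1+\beta^-_1\le1$, with the topology induced by the product topology (it is locally compact). With $\gamma^\pm=\delta^\pm-\sum_i(\alpha_i^\pm+\beta_i^\pm)$ set $$\Phi(u;\omega)=e^{\gamma^+(u-1)+\gamma^-(u^{-1}-1)}\prod_{i=1}^\infty\frac{1+\beta_i^+(u-1)}{1-\alpha_i^+(u-1)}\,\frac{1+\beta_i^-(u^{-1}-1)}{1-\alpha_i^-(u^{-1}-1)},$$ which is holomorphic in a neighborhood of $|u|=1$; let $\Phi(u;\omega)=\sum_{n\in\mathbb Z}\widehat\varphi_n(\omega)u^n$ be its Laurent expansion there, and for $\lambda\in\mathbb S_N$, $N\ge1$, let $\widehat\sigma_\lambda(\omega)=\det[\widehat\varphi_{\lambda_i-i+j}(\omega)]_{i,j=1}^N$.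 These functions lie in $C_0(\Omega)$ (continuous functions vanishing at infinity). $\widehat{\mathscr F}\subset C_0(\Omega)$ is the linear span of the functions $\widehat\sigma_\lambda(\cdot)$ over all $\lambda\in\mathbb S_1\sqcup\mathbb S_2\sqcup\cdots$. A finite linear combination of the $\sigma_\lambda$ lies in $J$ iff the corresponding combination of the functions $\widehat\sigma_\lambda(\omega)$ vanishes identically, so the identification of $\widehat\sigma_\lambda\in\widehat R$ with $\widehat\sigma_\lambda(\omega)$ is consistent. The semigroups. Let $\mathscr Z\subset\mathbb C^2$ be the set of $(\zeta,\zeta')$ such that either $\zeta\in\mathbb C\setminus\mathbb Z$ and $\zeta'=\bar\zeta\in\mathbb C\setminus\mathbb Z$, or $\zeta,\zeta'\in\mathbb R\setminus\mathbb Z$ and $m<\zeta,\zeta'<m+1$ for some $m\in\mathbb Z$. A quadruple is admissible if $(z,z')\in\mathscr Z$, $(w,w')\in\mathscr Z$ and $z+z'+w+w'>-1$. Let $\mathrm{Dim}_N\lambda=\prod_{1\le i<j\le N}\frac{\lambda_i-\lambda_j-i+j}{j-i}$ and let $\varepsilon_1,\dots,\varepsilon_N$ be the standard basis of $\mathbb Z^N$. For $\nu\in\mathbb S_N$, $N\ge1$, put $r(\nu,\nu+\varepsilon_i)=(z-\nu_i+i-1)(z'-\nu_i+i-1)$ and $r(\nu,\nu-\varepsilon_i)=(w+\nu_i-i+N)(w'+\nu_i-i+N)$ whenever the second argument is in $\mathbb S_N$; $q(\nu,\mu)=\frac{\mathrm{Dim}_N\mu}{\mathrm{Dim}_N\nu}r(\nu,\mu)$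 for $\mu=\nu\pm\varepsilon_i\in\mathbb S_N$; $q(\nu,\mu)=0$ for all other $\mu\ne\nu$; $q(\nu,\nu)=-\sum_{\mu\ne\nu}q(\nu,\mu)$. Put $(D_Nf)(\nu)=\sum_{\mu\in\mathbb S_N}q(\nu,\mu)f(\mu)$. A Feller semigroup on a locally compact space $X$ is a strongly continuous semigroup of contractions of $C_0(X)$ given by Markov kernels; its generator is $Af=\lim_{t\to0+}(P(t)f-f)/t$ on the domain where the limit exists in norm. It is known that for admissible parameters and every $N\ge1$ there is a unique Feller semigroup $P_N(t)$ on $C_0(\mathbb S_N)$ whose generator is $f\mapsto D_Nf$ with domain $\{f\in C_0(\mathbb S_N): D_Nf\in C_0(\mathbb S_N)\}$. Let $\Lambda^\infty_N:C_0(\mathbb S_N)\to C_0(\Omega)$ be given by the Markov kernel $\Lambda^\infty_N(\omega,\lambda)=\mathrm{Dim}_N\lambda\cdot\widehat\sigma_\lambda(\omega)$, i.e. $(\Lambda^\infty_Nf)(\omega)=\sum_{\lambda\in\mathbb S_N}\Lambda_N^\infty(\omega,\lambda)f(\lambda)$. It is known that there is a unique Feller semigroup $P_\infty(t)$ on $C_0(\Omega)$ with $P_\infty(t)\Lambda^\infty_N=\Lambda^\infty_NP_N(t)$ for all $N\ge1$, $t\ge0$. $A_{z,z',w,w'}$ denotes its generator; $\widehat{\mathscr F}$ is contained in its domain. *)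

theory Defs
  imports
    "HOL-Probability.Probability"
    "HOL-Library.Multiset"
    "Jordan_Normal_Form.Determinant"
begin

section \<open>Signatures\<close>

definition signatures :: "nat \<Rightarrow> int list set" where
  "signatures N = {l. length l = N \<and> sorted_wrt (\<ge>) l}"

definition nonempty_signatures :: "int list set" where
  "nonempty_signatures = (\<Union>N\<in>{1..}. signatures N)"

text \<open>Lists are indexed from 0: the mathematical entry \<open>\<lambda>\<^sub>i\<close> is \<open>l ! (i - 1)\<close>. The expression
  \<open>\<lambda>\<^sub>i - i + j\<close> is invariant under the simultaneous shift of \<open>i\<close> and \<open>j\<close>. The following
  determinant is used both for \<open>\<sigma>\<^sub>\<lambda>\<close> in the formal algebra and for the functions on \<open>\<Omega>\<close>.\<close>

definition jacobi_trudi :: "(int \<Rightarrow> 'a::comm_ring_1) \<Rightarrow> int list \<Rightarrow> 'a" where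
  "jacobi_trudi c l =
     Determinant.det (Matrix.mat (length l) (length l) (\<lambda>(i, j). c (l ! i - int i + int j)))"

definition Dim :: "int list \<Rightarrow> real" where
  "Dim l = (\<Prod>j<length l. \<Prod>i<j. real_of_int (l ! i - l ! j - int i + int j) / real (j - i))"


section \<open>The algebra R of formal series of bounded degree\<close>

text \<open>A monomial in the variables \<open>\<phi>\<^sub>n\<close> is represented by the multiset of its indices (so
  \<open>\<phi>\<^sub>\<lambda>\<close> corresponds to \<open>mset \<lambda>\<close>, its degree being the size), and a formal series by its
  coefficient function.\<close>

typedef R = "{f :: int multiset \<Rightarrow> complex. \<exists>d. \<forall>M. size M > d \<longrightarrow> f M = 0}"
  morphisms coeff Abs_R
  by (rule exI[of _ "\<lambda>_. 0"]) auto

setup_lifting type_definition_R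

definition splittings :: "int multiset \<Rightarrow> (int multiset \<times> int multiset) set" where
  "splittings M = {(A, B). A + B = M}"

lemma finite_submultisets: "finite {A. A \<subseteq># M}"
proof (induction M)
  case empty
  show ?case by simp
next
  case (add x M)
  have "{A. A \<subseteq># add_mset x M} \<subseteq> {A. A \<subseteq># M} \<union> add_mset x ` {A. A \<subseteq># M}"
  proof
    fix A assume "A \<in> {A. A \<subseteq># add_mset x M}"
    then have A: "A \<subseteq># add_mset x M" by simp
    show "A \<in> {A. A \<subseteq># M} \<union> add_mset x ` {A. A \<subseteq># M}"
    proof (cases "x \<in># A")
      case True
      then obtain A' where "A = add_mset x A'" by (meson mset_add)
      with A show ?thesis by auto
    next
      case False
      with A have "A \<subseteq># M"
        by (metis diff_single_trivial insert_subset_eq_iff subset_eq_diff_conv add_mset_add_single)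
      then show ?thesis by simp
    qed
  qed
  with add show ?case
    by (meson finite_UnI finite_imageI finite_subset)
qed

lemma finite_splittings [simp, intro]: "finite (splittings M)"
proof -
  have "splittings M \<subseteq> {A. A \<subseteq># M} \<times> {A. A \<subseteq># M}"
    by (auto simp: splittings_def)
  then show ?thesis
    using finite_submultisets finite_subset by blast
qed

lemma splittings_empty [simp]: "splittings {#} = {({#}, {#})}"
  by (auto simp: splittings_def)

instantiation R :: comm_ring_1
begin

lift_definition zero_R :: R is "\<lambda>_. 0" by auto

lift_definition one_R :: R is "\<lambda>M. if M = {#} then 1 else 0"
  by (rule exI[of _ 0]) auto

lift_definition plus_R :: "R \<Rightarrow> R \<Rightarrow> R" is "\<lambda>f g M. f M + g M"
proof -
  fix f g :: "int multiset \<Rightarrow> complex"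
  assume "\<exists>d. \<forall>M. size M > d \<longrightarrow> f M = 0" "\<exists>d. \<forall>M. size M > d \<longrightarrow> g M = 0"
  then obtain d e where "\<forall>M. size M > d \<longrightarrow> f M = 0" "\<forall>M. size M > e \<longrightarrow> g M = 0" by blast
  then show "\<exists>d. \<forall>M. size M > d \<longrightarrow> f M + g M = 0"
    by (intro exI[of _ "max d e"]) auto
qed

lift_definition uminus_R :: "R \<Rightarrow> R" is "\<lambda>f M. - f M" by simp

lift_definition minus_R :: "R \<Rightarrow> R \<Rightarrow> R" is "\<lambda>f g M. f M - g M"
proof -
  fix f g :: "int multiset \<Rightarrow> complex"
  assume "\<exists>d. \<forall>M. size M > d \<longrightarrow> f M = 0" "\<exists>d. \<forall>M. size M > d \<longrightarrow> g M = 0"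
  then obtain d e where "\<forall>M. size M > d \<longrightarrow> f M = 0" "\<forall>M. size M > e \<longrightarrow> g M = 0" by blast
  then show "\<exists>d. \<forall>M. size M > d \<longrightarrow> f M - g M = 0"
    by (intro exI[of _ "max d e"]) auto
qed

lift_definition times_R :: "R \<Rightarrow> R \<Rightarrow> R" is "\<lambda>f g M. \<Sum>(A, B)\<in>splittings M. f A * g B"
proof -
  fix f g :: "int multiset \<Rightarrow> complex"
  assume "\<exists>d. \<forall>M. size M > d \<longrightarrow> f M = 0" "\<exists>d. \<forall>M. size M > d \<longrightarrow> g M = 0"
  then obtain d e where de: "\<forall>M. size M > d \<longrightarrow> f M = 0" "\<forall>M. size M > e \<longrightarrow> g M = 0" by blast
  have "(\<Sum>(A, B)\<in>splittings M. f A * g B) = 0" if "size M > d + e" for M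
  proof (rule sum.neutral, safe)
    fix A B assume "(A, B) \<in> splittings M"
    with that have "size A > d \<or> size B > e" by (auto simp: splittings_def)
    with de show "f A * g B = 0" by auto
  qed
  then show "\<exists>d. \<forall>M. size M > d \<longrightarrow> (\<Sum>(A, B)\<in>splittings M. f A * g B) = 0" by blast
qed

instance
proof
  fix a b c :: R
  show "a * b * c = a * (b * c)"
  proof (transfer, rule ext)
    fix f g h :: "int multiset \<Rightarrow> complex" and M
    let ?L = "SIGMA p:splittings M. splittings (fst p)"
    let ?R = "SIGMA p:splittings M. splittings (snd p)"
    have "(\<Sum>(A, B)\<in>splittings M. (\<Sum>(C, D)\<in>splittings A. f C * g D) * h B)
        = (\<Sum>((A, B), (C, D))\<in>?L. f C * g D * h B)"
      by (simp add: sum.Sigma case_prod_unfold sum_distrib_right)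
    also have "\<dots> = (\<Sum>((A, B), (C, D))\<in>?R. f A * (g C * h D))"
      by (rule sum.reindex_bij_witness[where
            i = "\<lambda>((A, B), (C, D)). ((A + C, D), (A, C))" and
            j = "\<lambda>((A, B), (C, D)). ((C, D + B), (D, B))"])
         (auto simp: splittings_def algebra_simps)
    also have "\<dots> = (\<Sum>(A, B)\<in>splittings M. f A * (\<Sum>(C, D)\<in>splittings B. g C * h D))"
      by (simp add: sum.Sigma case_prod_unfold sum_distrib_left)
    finally show "(\<Sum>(A, B)\<in>splittings M. (\<Sum>(C, D)\<in>splittings A. f C * g D) * h B)
        = (\<Sum>(A, B)\<in>splittings M. f A * (\<Sum>(C, D)\<in>splittings B. g C * h D))" .
  qed
  show "a * b = b * a"
    by (transfer, rule ext, rule sum.reindex_bij_witness[where i = prod.swap and j = prod.swap])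
       (auto simp: splittings_def algebra_simps)
  show "1 * a = a"
  proof (transfer, rule ext)
    fix f :: "int multiset \<Rightarrow> complex" and M
    have "(\<Sum>(A, B)\<in>splittings M. (if A = {#} then 1 else 0) * f B)
        = (\<Sum>(A, B)\<in>{({#} :: int multiset, M)}. (if A = {#} then 1 else 0) * f B)"
      by (rule sum.mono_neutral_right)
         (auto simp: splittings_def[of M] simp del: mult_eq_0_iff intro: finite_splittings[unfolded splittings_def] split: if_splits)
    then show "(\<Sum>(A, B)\<in>splittings M. (if A = {#} then 1 else 0) * f B) = f M" by simp
  qed
  show "(a + b) * c = a * c + b * c"
    by (transfer, rule ext) (simp add: case_prod_unfold algebra_simps sum.distrib)
  show "a + b + c = a + (b + c)" by (transfer) (simp add: algebra_simps)
  show "a + b = b + a" by (transfer) (simp add: algebra_simps)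
  show "0 + a = a" by (transfer) simp
  show "- a + a = 0" by (transfer) simp
  show "a - b = a + - b" by (transfer) simp
  show "(0::R) \<noteq> 1" by (transfer) (auto simp: fun_eq_iff)
qed

end

lift_definition scaleR_cplx :: "complex \<Rightarrow> R \<Rightarrow> R"  (infixr \<open>\<bullet>\<^sub>R\<close> 75) is "\<lambda>c f M. c * f M"
  by auto

lift_definition \<phi> :: "int \<Rightarrow> R" is "\<lambda>n M. if M = {#n#} then 1 else 0"
  by (rule exI[of _ 1]) auto

text \<open>Formal (coefficientwise) infinite sums. The result is meaningful for families of uniformly
  bounded degree in which every monomial occurs in finitely many members only; all
  families used below are of this kind (see \<open>coeff_formal_sum\<close>).\<close>

definition formal_sum :: "'i set \<Rightarrow> ('i \<Rightarrow> R) \<Rightarrow> R" where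
  "formal_sum I g = Abs_R (\<lambda>M. \<Sum>i | i \<in> I \<and> coeff (g i) M \<noteq> 0. coeff (g i) M)"

lemma coeff_formal_sum:
  assumes "\<And>i M. i \<in> I \<Longrightarrow> size M > d \<Longrightarrow> coeff (g i) M = 0"
  shows "coeff (formal_sum I g) M = (\<Sum>i | i \<in> I \<and> coeff (g i) M \<noteq> 0. coeff (g i) M)"
  unfolding formal_sum_def
  by (subst Abs_R_inverse) (auto intro!: exI[of _ d] sum.neutral simp: assms)

definition \<phi>_total :: R where
  "\<phi>_total = formal_sum UNIV \<phi>"

definition \<sigma> :: "int list \<Rightarrow> R" where
  "\<sigma> l = jacobi_trudi \<phi> l"


section \<open>The differential operator\<close>

lift_definition partial_deriv :: "int \<Rightarrow> R \<Rightarrow> R"  (\<open>\<partial>\<close>) is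
  "\<lambda>n f M. of_nat (count M n + 1) * f (add_mset n M)"
proof -
  fix n and f :: "int multiset \<Rightarrow> complex"
  assume "\<exists>d. \<forall>M. size M > d \<longrightarrow> f M = 0"
  then obtain d where "\<forall>M. size M > d \<longrightarrow> f M = 0" by blast
  then show "\<exists>d. \<forall>M. size M > d \<longrightarrow> of_nat (count M n + 1) * f (add_mset n M) = 0"
    by (intro exI[of _ d]) auto
qed

text \<open>Used for \<open>n1 \<ge> n2\<close> only.\<close>

definition op_A :: "int \<Rightarrow> int \<Rightarrow> R" where
  "op_A n1 n2 =
     formal_sum UNIV (\<lambda>p::nat. of_int (n1 - n2 + 2 * int p + 1) *
       (\<phi> (n1 + int p + 1) * \<phi> (n2 - int p) + \<phi> (n1 + int p) * \<phi> (n2 - int p - 1)))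
     - of_int (n1 - n2) * (\<phi> n1 * \<phi> n2)
     - 2 * formal_sum {1..} (\<lambda>p::nat. of_int (n1 - n2 + 2 * int p) *
         (\<phi> (n1 + int p) * \<phi> (n2 - int p)))"

definition op_B :: "complex \<Rightarrow> complex \<Rightarrow> complex \<Rightarrow> complex \<Rightarrow> int \<Rightarrow> R" where
  "op_B z z' w w' n =
     ((of_int n + w + 1) * (of_int n + w' + 1)) \<bullet>\<^sub>R \<phi> (n + 1)
     + ((of_int n - z - 1) * (of_int n - z' - 1)) \<bullet>\<^sub>R \<phi> (n - 1)
     - ((of_int n - z) * (of_int n - z') + (of_int n + w) * (of_int n + w')) \<bullet>\<^sub>R \<phi> n"

definition op_D :: "complex \<Rightarrow> complex \<Rightarrow> complex \<Rightarrow> complex \<Rightarrow> R \<Rightarrow> R" where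
  "op_D z z' w w' f =
     formal_sum UNIV (\<lambda>n. op_A n n * \<partial> n (\<partial> n f))
     + 2 * formal_sum {(n1, n2). n1 > n2} (\<lambda>(n1, n2). op_A n1 n2 * \<partial> n1 (\<partial> n2 f))
     + formal_sum UNIV (\<lambda>n. op_B z z' w w' n * \<partial> n f)"


section \<open>The quotient algebra\<close>

definition J :: "R set" where
  "J = range (\<lambda>h. (\<phi>_total - 1) * h)"

lemma J_closed: "0 \<in> J" "f \<in> J \<Longrightarrow> g \<in> J \<Longrightarrow> f + g \<in> J" "f \<in> J \<Longrightarrow> h * f \<in> J"
  "f \<in> J \<Longrightarrow> - f \<in> J"
proof -
  show "0 \<in> J" unfolding J_def by (rule range_eqI[of _ _ 0]) simp
  show "f + g \<in> J" if "f \<in> J" "g \<in> J"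
  proof -
    from that obtain u v where "f = (\<phi>_total - 1) * u" "g = (\<phi>_total - 1) * v"
      by (auto simp: J_def)
    then show ?thesis unfolding J_def by (intro range_eqI[of _ _ "u + v"]) (simp add: distrib_left)
  qed
  show "h * f \<in> J" if "f \<in> J"
  proof -
    from that obtain u where "f = (\<phi>_total - 1) * u" by (auto simp: J_def)
    then show ?thesis
      unfolding J_def by (intro range_eqI[of _ _ "h * u"]) (simp only: mult.left_commute)
  qed
  show "- f \<in> J" if "f \<in> J"
  proof -
    from that obtain u where "f = (\<phi>_total - 1) * u" by (auto simp: J_def)
    then show ?thesis unfolding J_def by (intro range_eqI[of _ _ "- u"]) simp
  qed
qed

lemma scale_eq_mult: "c \<bullet>\<^sub>R f = (c \<bullet>\<^sub>R 1) * f"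
proof (transfer, rule ext)
  fix c :: complex and f :: "int multiset \<Rightarrow> complex" and M
  have "(\<Sum>(A, B)\<in>splittings M. c * (if A = {#} then 1 else 0) * f B)
      = (\<Sum>(A, B)\<in>{({#} :: int multiset, M)}. c * (if A = {#} then 1 else 0) * f B)"
    by (rule sum.mono_neutral_right)
         (auto simp: splittings_def[of M] simp del: mult_eq_0_iff intro: finite_splittings[unfolded splittings_def] split: if_splits)
  then show "c * f M = (\<Sum>(A, B)\<in>splittings M. c * (if A = {#} then 1 else 0) * f B)" by simp
qed

quotient_type Rhat = R / "\<lambda>f g. f - g \<in> J"
  morphisms rep_Rhat cls
proof (rule equivpI)
  show "reflp (\<lambda>f g. f - g \<in> J)" by (rule reflpI) (simp add: J_closed)
  show "symp (\<lambda>f g. f - g \<in> J)" by (rule sympI) (metis J_closed(4) minus_diff_eq)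
  show "transp (\<lambda>f g. f - g \<in> J)"
    by (rule transpI) (metis J_closed(2) diff_add_cancel add_diff_eq)
qed

instantiation Rhat :: ab_group_add
begin

lift_definition zero_Rhat :: Rhat is 0 .

lift_definition plus_Rhat :: "Rhat \<Rightarrow> Rhat \<Rightarrow> Rhat" is "(+)"
  by (metis J_closed(2) add_diff_add)

lift_definition uminus_Rhat :: "Rhat \<Rightarrow> Rhat" is uminus
  by (metis J_closed(4) minus_diff_minus)

definition minus_Rhat :: "Rhat \<Rightarrow> Rhat \<Rightarrow> Rhat" where
  "minus_Rhat x y = x + - y"

instance
proof
  fix a b c :: Rhat
  show "a + b + c = a + (b + c)" by transfer (simp add: J_closed algebra_simps)
  show "a + b = b + a" by transfer (simp add: J_closed algebra_simps)
  show "0 + a = a" by transfer (simp add: J_closed)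
  show "- a + a = 0" by transfer (simp add: J_closed)
  show "a - b = a + - b" by (simp add: minus_Rhat_def)
qed

end

lift_definition scaleRhat :: "complex \<Rightarrow> Rhat \<Rightarrow> Rhat"  (infixr \<open>\<bullet>\<^sub>Q\<close> 75) is scaleR_cplx
  by (metis J_closed(3) scale_eq_mult right_diff_distrib)

lemma vector_space_Rhat: "vector_space scaleRhat"
proof
  fix a b :: complex and x y :: Rhat
  have R: "a \<bullet>\<^sub>R (f + g) = a \<bullet>\<^sub>R f + a \<bullet>\<^sub>R g" "(a + b) \<bullet>\<^sub>R f = a \<bullet>\<^sub>R f + b \<bullet>\<^sub>R f"
    "a \<bullet>\<^sub>R b \<bullet>\<^sub>R f = (a * b) \<bullet>\<^sub>R f" "1 \<bullet>\<^sub>R f = f" for a b f g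
    by (transfer, simp add: algebra_simps)+
  show "a \<bullet>\<^sub>Q (x + y) = a \<bullet>\<^sub>Q x + a \<bullet>\<^sub>Q y" by transfer (simp add: R J_closed)
  show "(a + b) \<bullet>\<^sub>Q x = a \<bullet>\<^sub>Q x + b \<bullet>\<^sub>Q x" by transfer (simp add: R J_closed)
  show "a \<bullet>\<^sub>Q b \<bullet>\<^sub>Q x = (a * b) \<bullet>\<^sub>Q x" by transfer (simp add: R J_closed)
  show "1 \<bullet>\<^sub>Q x = x" by transfer (simp add: R J_closed)
qed

definition \<sigma>_hat :: "int list \<Rightarrow> Rhat" where
  "\<sigma>_hat l = cls (\<sigma> l)"

text \<open>The operator induced on the quotient: its value on a class is the class of \<open>op_D f\<close> for
  every representative \<open>f\<close>, which is independent of \<open>f\<close> as \<open>op_D\<close> preserves \<open>J\<close>.\<close>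

definition op_Dhat :: "complex \<Rightarrow> complex \<Rightarrow> complex \<Rightarrow> complex \<Rightarrow> Rhat \<Rightarrow> Rhat" where
  "op_Dhat z z' w w' x = (THE y. \<forall>f. cls f = x \<longrightarrow> cls (op_D z z' w w' f) = y)"

definition span_\<sigma>_hat :: "Rhat set" where
  "span_\<sigma>_hat = module.span scaleRhat (\<sigma>_hat ` nonempty_signatures)"


section \<open>The space Omega and the functions on it\<close>

text \<open>A point is a tuple \<open>(\<alpha>\<^sup>+, \<beta>\<^sup>+, \<alpha>\<^sup>-, \<beta>\<^sup>-, \<delta>\<^sup>+, \<delta>\<^sup>-)\<close>; sequences are indexed from 0. The type
  carries the product topology.\<close>

type_synonym point =
  "(nat \<Rightarrow> real) \<times> (nat \<Rightarrow> real) \<times> (nat \<Rightarrow> real) \<times> (nat \<Rightarrow> real) \<times> real \<times> real"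

definition Omega :: "point set" where
  "Omega = {(ap, bp, am, bm, dp, dm).
     (\<forall>s\<in>{ap, bp, am, bm}. decseq s \<and> (\<forall>i. s i \<ge> 0)) \<and>
     summable (\<lambda>i. ap i + bp i) \<and> suminf (\<lambda>i. ap i + bp i) \<le> dp \<and>
     summable (\<lambda>i. am i + bm i) \<and> suminf (\<lambda>i. am i + bm i) \<le> dm \<and>
     bp 0 + bm 0 \<le> 1}"

fun Phi :: "complex \<Rightarrow> point \<Rightarrow> complex" where
  "Phi u (ap, bp, am, bm, dp, dm) =
     (let gp = dp - suminf (\<lambda>i. ap i + bp i); gm = dm - suminf (\<lambda>i. am i + bm i)
      in exp (of_real gp * (u - 1) + of_real gm * (inverse u - 1)) *
         prodinf (\<lambda>i. (1 + of_real (bp i) * (u - 1)) / (1 - of_real (ap i) * (u - 1)) *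
           ((1 + of_real (bm i) * (inverse u - 1)) / (1 - of_real (am i) * (inverse u - 1)))))"

text \<open>The coefficients of the Laurent expansion in some annulus around the unit circle.\<close>

definition phi_fun :: "point \<Rightarrow> int \<Rightarrow> complex" where
  "phi_fun \<omega> = (THE c. \<exists>r>0. \<forall>u. 1 - r < norm u \<and> norm u < 1 + r \<longrightarrow>
     ((\<lambda>n. c n * u powi n) has_sum Phi u \<omega>) UNIV)"

text \<open>Functions on a subset of a type are normalised to vanish outside of it.\<close>

definition \<sigma>_fun :: "int list \<Rightarrow> point \<Rightarrow> complex" where
  "\<sigma>_fun l \<omega> = (if \<omega> \<in> Omega then jacobi_trudi (phi_fun \<omega>) l else 0)"

text \<open>The identification of the span of the \<open>\<sigma>_hat l\<close> with the span of the functions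
  \<open>\<sigma>_fun l\<close>, extending \<open>\<sigma>_hat l \<mapsto> \<sigma>_fun l\<close> linearly: the common value of
  \<open>\<Sum> c l * \<sigma>_fun l\<close> over all representations \<open>x = \<Sum> c l \<bullet>\<^sub>Q \<sigma>_hat l\<close>.\<close>

definition \<iota> :: "Rhat \<Rightarrow> point \<Rightarrow> complex" where
  "\<iota> x = (THE F. \<forall>S c. finite S \<and> S \<subseteq> nonempty_signatures \<and> x = (\<Sum>l\<in>S. c l \<bullet>\<^sub>Q \<sigma>_hat l) \<longrightarrow>
     F = (\<lambda>\<omega>. \<Sum>l\<in>S. c l * \<sigma>_fun l \<omega>))"


section \<open>Feller semigroups\<close>

definition C0 :: "'a topology \<Rightarrow> ('a \<Rightarrow> complex) set" where
  "C0 X = {f. continuous_map X euclidean f \<and>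
     (\<forall>e>0. \<exists>K. compactin X K \<and> (\<forall>x\<in>topspace X - K. norm (f x) < e)) \<and>
     (\<forall>x. x \<notin> topspace X \<longrightarrow> f x = 0)}"

definition borel_of_top :: "'a topology \<Rightarrow> 'a measure" where
  "borel_of_top X = sigma (topspace X) {U. openin X U}"

text \<open>Linearity, positivity and contractivity are consequences of the representation
  by Markov kernels. The value of \<open>P t f\<close> is relevant for \<open>t \<ge> 0\<close> and \<open>f \<in> C0 X\<close> only.\<close>

definition feller_semigroup ::
    "'a topology \<Rightarrow> (real \<Rightarrow> ('a \<Rightarrow> complex) \<Rightarrow> 'a \<Rightarrow> complex) \<Rightarrow> bool" where
  "feller_semigroup X P \<longleftrightarrow>
     (\<forall>t\<ge>0. P t \<in> C0 X \<rightarrow> C0 X) \<and>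
     (\<forall>t\<ge>0. \<exists>K. K \<in> borel_of_top X \<rightarrow>\<^sub>M prob_algebra (borel_of_top X) \<and>
        (\<forall>f\<in>C0 X. \<forall>x\<in>topspace X. P t f x = (\<integral>y. f y \<partial>K x))) \<and>
     (\<forall>f\<in>C0 X. P 0 f = f) \<and>
     (\<forall>s\<ge>0. \<forall>t\<ge>0. \<forall>f\<in>C0 X. P (s + t) f = P s (P t f)) \<and>
     (\<forall>f\<in>C0 X. \<forall>t\<ge>0. uniform_limit (topspace X) (\<lambda>s. P s f) (P t f) (at t within {0..}))"

definition is_generator_value ::
    "'a topology \<Rightarrow> (real \<Rightarrow> ('a \<Rightarrow> complex) \<Rightarrow> 'a \<Rightarrow> complex) \<Rightarrow>
      ('a \<Rightarrow> complex) \<Rightarrow> ('a \<Rightarrow> complex) \<Rightarrow> bool" where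
  "is_generator_value X P f g \<longleftrightarrow> f \<in> C0 X \<and> g \<in> C0 X \<and>
     uniform_limit (topspace X) (\<lambda>t x. (P t f x - f x) / of_real t) g (at_right 0)"

definition generator_dom ::
    "'a topology \<Rightarrow> (real \<Rightarrow> ('a \<Rightarrow> complex) \<Rightarrow> 'a \<Rightarrow> complex) \<Rightarrow> ('a \<Rightarrow> complex) set" where
  "generator_dom X P = {f. \<exists>g. is_generator_value X P f g}"

definition generator ::
    "'a topology \<Rightarrow> (real \<Rightarrow> ('a \<Rightarrow> complex) \<Rightarrow> 'a \<Rightarrow> complex) \<Rightarrow>
      ('a \<Rightarrow> complex) \<Rightarrow> 'a \<Rightarrow> complex" where
  "generator X P f = (THE g. is_generator_value X P f g)"


section \<open>The Markov generators on signatures and the links\<close>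

text \<open>In the second case \<open>m < \<zeta>, \<zeta>' < m + 1\<close> entails non-integrality.\<close>

definition Zset :: "(complex \<times> complex) set" where
  "Zset = {(\<zeta>, \<zeta>'). (\<zeta> \<notin> \<int> \<and> \<zeta>' = cnj \<zeta>) \<or>
     (\<zeta> \<in> \<real> \<and> \<zeta>' \<in> \<real> \<and> (\<exists>m::int. of_int m < Re \<zeta> \<and> Re \<zeta> < of_int m + 1 \<and>
        of_int m < Re \<zeta>' \<and> Re \<zeta>' < of_int m + 1))}"

text \<open>For pairs in \<open>Zset\<close> the sum \<open>z + z' + w + w'\<close> is real.\<close>

definition admissible :: "complex \<Rightarrow> complex \<Rightarrow> complex \<Rightarrow> complex \<Rightarrow> bool" where
  "admissible z z' w w' \<longleftrightarrow> (z, z') \<in> Zset \<and> (w, w') \<in> Zset \<and> Re (z + z' + w + w') > -1"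

text \<open>The jump rate from \<open>n\<close> to \<open>m \<noteq> n\<close>. At most one index \<open>i\<close> contributes to the two sums, which
  correspond to \<open>m = n + \<epsilon>\<^sub>i\<close> and \<open>m = n - \<epsilon>\<^sub>i\<close>; the index \<open>i\<close> is shifted by one.\<close>

definition rate ::
    "complex \<Rightarrow> complex \<Rightarrow> complex \<Rightarrow> complex \<Rightarrow> int list \<Rightarrow> int list \<Rightarrow> complex" where
  "rate z z' w w' n m =
     (let N = length n in of_real (Dim m / Dim n) *
       ((\<Sum>i | i < N \<and> m = n[i := n ! i + 1].
           (z - of_int (n ! i) + of_nat i) * (z' - of_int (n ! i) + of_nat i)) +
        (\<Sum>i | i < N \<and> m = n[i := n ! i - 1].
           (w + of_int (n ! i) - of_nat (i + 1) + of_nat N) *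
           (w' + of_int (n ! i) - of_nat (i + 1) + of_nat N))))"

definition qmat ::
    "complex \<Rightarrow> complex \<Rightarrow> complex \<Rightarrow> complex \<Rightarrow> nat \<Rightarrow> int list \<Rightarrow> int list \<Rightarrow> complex" where
  "qmat z z' w w' N n m =
     (if m = n then - (\<Sum>\<^sub>\<infinity>k\<in>signatures N - {n}. rate z z' w w' n k) else rate z z' w w' n m)"

definition op_DN :: "complex \<Rightarrow> complex \<Rightarrow> complex \<Rightarrow> complex \<Rightarrow> nat \<Rightarrow>
    (int list \<Rightarrow> complex) \<Rightarrow> int list \<Rightarrow> complex" where
  "op_DN z z' w w' N f n =
     (if n \<in> signatures N then \<Sum>\<^sub>\<infinity>m\<in>signatures N. qmat z z' w w' N n m * f m else 0)"

abbreviation top_sig :: "nat \<Rightarrow> int list topology" where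
  "top_sig N \<equiv> discrete_topology (signatures N)"

abbreviation top_Omega :: "point topology" where
  "top_Omega \<equiv> top_of_set Omega"

definition link :: "nat \<Rightarrow> (int list \<Rightarrow> complex) \<Rightarrow> point \<Rightarrow> complex" where
  "link N f \<omega> = (\<Sum>\<^sub>\<infinity>l\<in>signatures N. of_real (Dim l) * \<sigma>_fun l \<omega> * f l)"

definition is_PN :: "complex \<Rightarrow> complex \<Rightarrow> complex \<Rightarrow> complex \<Rightarrow> nat \<Rightarrow>
    (real \<Rightarrow> (int list \<Rightarrow> complex) \<Rightarrow> int list \<Rightarrow> complex) \<Rightarrow> bool" where
  "is_PN z z' w w' N P \<longleftrightarrow>
     feller_semigroup (top_sig N) P \<and>
     generator_dom (top_sig N) P = {f \<in> C0 (top_sig N). op_DN z z' w w' N f \<in> C0 (top_sig N)} \<and>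
     (\<forall>f\<in>generator_dom (top_sig N) P. generator (top_sig N) P f = op_DN z z' w w' N f)"

definition is_Pinf :: "(nat \<Rightarrow> real \<Rightarrow> (int list \<Rightarrow> complex) \<Rightarrow> int list \<Rightarrow> complex) \<Rightarrow>
    (real \<Rightarrow> (point \<Rightarrow> complex) \<Rightarrow> point \<Rightarrow> complex) \<Rightarrow> bool" where
  "is_Pinf PN P \<longleftrightarrow> feller_semigroup top_Omega P \<and>
     (\<forall>N\<ge>1. \<forall>t\<ge>0. \<forall>f\<in>C0 (top_sig N). P t (link N f) = link N (PN N t f))"

end

theory Submission
  imports Defs "HOL-Library.Poly_Mapping" "HOL-Library.Function_Algebras"
    "HOL-Complex_Analysis.Complex_Analysis" "HOL-Real_Asymp.Real_Asymp"
begin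

text \<open>Write a Jacobi-Trudi determinant as the image of a monomial times the Vandermonde product
  \<open>\<Prod>(u\<^sub>j - u\<^sub>i)\<close>, \<open>i < j\<close>, under the linear map sending \<open>\<Prod>u\<^sub>i\<^bsup>m\<^sub>i\<^esup>\<close> to \<open>\<Prod>\<phi>\<^bsub>m\<^sub>i\<^esub>\<close>.
  The coefficients \<open>A\<close> of the operator satisfy a recurrence saying that multiplication by
  \<open>u\<^sub>j - u\<^sub>i\<close> turns the pair interaction into a first order expression in the Euler operators; since
  the Vandermonde product is divisible by \<open>u\<^sub>j - u\<^sub>i\<close> and the quotients add up to its logarithmic
  derivative, the whole second order part acts by row operations. Hence \<open>\<D>\<sigma>\<^sub>\<lambda>\<close> is a combination
  of the \<open>\<sigma>\<close> indexed by \<open>\<lambda>\<close> and its neighbours \<open>\<lambda> \<plusminus> \<epsilon>\<^sub>i\<close>; the off-diagonal coefficients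
  are visibly jump rates, and the diagonal one is identified with \<open>q(\<lambda>, \<lambda>)\<close> by partial fractions.

  On the analytic side, \<open>\<Phi>(u; \<omega>)\<close> is a limit of generating functions of sums of independent
  Bernoulli and geometric variables. Their densities are totally positive, and they are bounded in
  terms of mean and variance; both properties survive the limit. So the \<open>\<sigma>\<close> functions are
  nonnegative and vanish at infinity, and the links are contractions, their total mass being
  computed by a Vandermonde argument. Applying the intertwining relation to \<open>\<delta>\<^sub>\<lambda>/Dim \<lambda>\<close>, which the
  link maps to the \<open>\<sigma>\<close> function of \<open>\<lambda>\<close>, transports the generator of level \<open>N\<close> to \<open>\<Omega>\<close>.\<close>

subsection \<open>Determinants over function-indexed matrices\<close>

text \<open>Some obstacles are not visible in this outline. The operator applied to a Leibniz term
  yields coefficients that depend on the row and on the permutation; they turn out to be a function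
  of the row minus a function of the column. The row functions give the neighbours of \<lambda>,
  whereas a shifted column repeats the adjacent one, except at the edge of the matrix, where its
  coefficient is zero. Next, \<open>\<iota>\<close> is a definite description, so the passage from
  classes to functions has to be shown consistent. An element of \<open>J\<close> is a multiple of
  \<open>\<phi>_total - 1\<close> by an arbitrary formal series, about whose convergence at a point
  of \<Omega> nothing is known; evaluation therefore climbs through the degrees one by one. On
  \<Omega> itself, the sums of the \<alpha> and \<beta> parameters are not continuous in the product
  topology, and a \<beta> close to 1 adds to the mean but hardly to the variance. The first fact
  forces compensated products, the second one the use of the constraint on the two leading
  \<beta>.\<close>

definition ldet :: "nat \<Rightarrow> (nat \<Rightarrow> nat \<Rightarrow> 'a::comm_ring_1) \<Rightarrow> 'a" where
  "ldet n M = (\<Sum>p | p permutes {..<n}. of_int (sign p) * (\<Prod>i<n. M i (p i)))"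

lemma permutes_lessThan: "p permutes {..<n} \<Longrightarrow> i < n \<Longrightarrow> p i < n"
  by (metis permutes_in_image lessThan_iff)

lemma det_mat_eq_ldet: "Determinant.det (Matrix.mat n n (\<lambda>(i, j). M i j)) = ldet n M"
proof -
  have "Determinant.det (Matrix.mat n n (\<lambda>(i, j). M i j)) =
    (\<Sum>p | p permutes {0..<n}. signof p * (\<Prod>i = 0..<n. Matrix.mat n n (\<lambda>(i, j). M i j) $$ (i, p i)))"
    by (rule det_def'[OF mat_carrier])
  also have "\<dots> = ldet n M"
    unfolding ldet_def atLeast0LessThan
    by (intro sum.cong refl arg_cong2[of _ _ _ _ "(*)"] prod.cong)
       (auto simp: permutes_lessThan)
  finally show ?thesis .
qed

lemma jacobi_trudi_eq_ldet: "jacobi_trudi c l = ldet (length l) (\<lambda>i j. c (l ! i - int i + int j))"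
  unfolding jacobi_trudi_def det_mat_eq_ldet ..

lemma ldet_cong:
  assumes "\<And>i j. i < n \<Longrightarrow> j < n \<Longrightarrow> M i j = M' i j"
  shows "ldet n M = ldet n M'"
  unfolding ldet_def
  by (intro sum.cong refl arg_cong2[of _ _ _ _ "(*)"] prod.cong)
     (use assms in \<open>auto simp: permutes_lessThan\<close>)

lemma ldet_fun_upd:
  assumes "k < n"
  shows "ldet n (M(k := r))
      = (\<Sum>p | p permutes {..<n}. of_int (sign p) * (r (p k) * (\<Prod>i\<in>{..<n} - {k}. M i (p i))))"
  unfolding ldet_def
proof (intro sum.cong refl arg_cong2[of _ _ _ _ "(*)"])
  fix p assume "p \<in> {p. p permutes {..<n}}"
  show "(\<Prod>i<n. (M(k := r)) i (p i)) = r (p k) * (\<Prod>i\<in>{..<n} - {k}. M i (p i))"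
    using assms by (subst prod.remove[of _ k]) (auto intro!: prod.cong)
qed

lemma ldet_row_add:
  assumes "k < n"
  shows "ldet n (M(k := (\<lambda>j. a * r j + b * s j))) = a * ldet n (M(k := r)) + b * ldet n (M(k := s))"
  unfolding ldet_fun_upd[OF assms] sum_distrib_left sum.distrib[symmetric]
  by (rule sum.cong) (auto simp: algebra_simps)

lemma ldet_transpose: "ldet n (\<lambda>i j. M j i) = ldet n M"
proof -
  have "transpose_mat (Matrix.mat n n (\<lambda>(i, j). M i j)) = Matrix.mat n n (\<lambda>(i, j). M j i)"
    by (rule eq_matI) auto
  then show ?thesis
    using Determinant.det_transpose[of "Matrix.mat n n (\<lambda>(i, j). M i j)" n] by (simp add: det_mat_eq_ldet)
qed

lemma ldet_equal_rows:
  assumes "i < n" "j < n" "i \<noteq> j" "\<And>k. k < n \<Longrightarrow> M i k = M j k"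
  shows "ldet n M = 0"
proof -
  have "Determinant.det (Matrix.mat n n (\<lambda>(i, j). M i j)) = 0"
    by (rule Determinant.det_identical_rows[OF mat_carrier, of i j])
       (use assms in \<open>auto intro!: eq_vecI\<close>)
  then show ?thesis by (simp add: det_mat_eq_ldet)
qed

lemma ldet_equal_cols:
  assumes "i < n" "j < n" "i \<noteq> j" "\<And>k. k < n \<Longrightarrow> M k i = M k j"
  shows "ldet n M = 0"
  by (subst ldet_transpose[symmetric]) (rule ldet_equal_rows[of i n j], use assms in auto)

lemma ldet_permute_rows:
  assumes "p permutes {..<n}"
  shows "ldet n (\<lambda>i j. M (p i) j) = of_int (sign p) * ldet n M"
proof -
  have "Determinant.det (Matrix.mat n n (\<lambda>(i, j). Matrix.mat n n (\<lambda>(i, j). M i j) $$ (p i, j)))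
    = signof p * Determinant.det (Matrix.mat n n (\<lambda>(i, j). M i j))"
    by (rule Determinant.det_permute_rows) (use assms in \<open>auto simp: atLeast0LessThan\<close>)
  also have "Matrix.mat n n (\<lambda>(i, j). Matrix.mat n n (\<lambda>(i, j). M i j) $$ (p i, j))
      = Matrix.mat n n (\<lambda>(i, j). M (p i) j)"
    using assms by (intro eq_matI) (auto simp: permutes_lessThan)
  finally show ?thesis by (simp add: det_mat_eq_ldet)
qed

lemma ldet_permute_both:
  assumes "p permutes {..<n}"
  shows "ldet n (\<lambda>i j. M (p i) (p j)) = ldet n M"
proof -
  have "ldet n (\<lambda>i j. M (p i) (p j)) = of_int (sign p) * ldet n (\<lambda>i j. M i (p j))"
    by (rule ldet_permute_rows[OF assms, of "\<lambda>i j. M i (p j)"])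
  also have "ldet n (\<lambda>i j. M i (p j)) = ldet n (\<lambda>i j. M j (p i))"
    by (rule ldet_transpose[of n "\<lambda>i j. M i (p j)", symmetric])
  also have "ldet n (\<lambda>i j. M j (p i)) = of_int (sign p) * ldet n (\<lambda>i j. M j i)"
    by (rule ldet_permute_rows[OF assms, of "\<lambda>i j. M j i"])
  also have "ldet n (\<lambda>i j. M j i) = ldet n M" by (rule ldet_transpose)
  finally show ?thesis by (simp add: sign_def)
qed

lemma ldet_reverse: "ldet n (\<lambda>i j. M (n - 1 - i) (n - 1 - j)) = ldet n M"
proof -
  let ?p = "\<lambda>i. if i < n then n - 1 - i else i"
  have "?p permutes {..<n}"
    by (rule bij_imp_permutes, rule bij_betw_byWitness[where f' = ?p]) auto
  from ldet_permute_both[OF this, of M] show ?thesis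
    by (subst (asm) ldet_cong[where M' = "\<lambda>i j. M (n - 1 - i) (n - 1 - j)"]) auto
qed

lemma ldet_mult: "ldet n (\<lambda>i j. \<Sum>k<n. A i k * B k j) = ldet n A * ldet n B"
proof -
  have "Matrix.mat n n (\<lambda>(i, j). A i j) * Matrix.mat n n (\<lambda>(i, j). B i j)
      = Matrix.mat n n (\<lambda>(i, j). \<Sum>k<n. A i k * B k j)"
    by (rule eq_matI) (auto simp: scalar_prod_def atLeast0LessThan)
  then show ?thesis
    using Determinant.det_mult[of "Matrix.mat n n (\<lambda>(i, j). A i j)" n "Matrix.mat n n (\<lambda>(i, j). B i j)"]
    by (simp add: det_mat_eq_ldet)
qed

lemma ldet_upper_triangular:
  assumes "\<And>i j. i < n \<Longrightarrow> j < i \<Longrightarrow> M i j = 0"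
  shows "ldet n M = (\<Prod>i<n. M i i)"
proof -
  have "Determinant.det (Matrix.mat n n (\<lambda>(i, j). M i j))
      = prod_list (diag_mat (Matrix.mat n n (\<lambda>(i, j). M i j)))"
    by (rule Determinant.det_upper_triangular[OF _ mat_carrier]) (use assms in auto)
  also have "diag_mat (Matrix.mat n n (\<lambda>(i, j). M i j)) = map (\<lambda>i. M i i) [0..<n]"
    by (auto simp: diag_mat_def)
  finally show ?thesis by (simp add: det_mat_eq_ldet prod.distinct_set_conv_list[symmetric] atLeast0LessThan)
qed

lemma ldet_lower_triangular:
  assumes "\<And>i j. j < n \<Longrightarrow> i < j \<Longrightarrow> M i j = 0"
  shows "ldet n M = (\<Prod>i<n. M i i)"
  by (subst ldet_transpose[symmetric], rule ldet_upper_triangular) (use assms in auto)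

text \<open>With \<open>sum_cols_ldet\<close> this reads a sum of Leibniz terms with one perturbed
  factor as a sum of determinants: a weight depending on the row index replaces a row, a weight
  depending on \<open>p i\<close> replaces a column. \<open>op_D_jt\<close> produces both
  kinds.\<close>

lemma sum_rows_ldet:
  "(\<Sum>p | p permutes {..<n}. of_int (sign p) * (\<Sum>i<n. c i * (Y i (p i) * (\<Prod>k\<in>{..<n} - {i}. M k (p k)))))
    = (\<Sum>i<n. c i * ldet n (M(i := Y i)))"
proof -
  have "(\<Sum>i<n. c i * ldet n (M(i := Y i))) =
    (\<Sum>i<n. \<Sum>p | p permutes {..<n}. of_int (sign p) * (c i * (Y i (p i) * (\<Prod>k\<in>{..<n} - {i}. M k (p k)))))"
    by (intro sum.cong refl) (simp add: ldet_fun_upd sum_distrib_left mult.left_commute)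
  also have "\<dots> = (\<Sum>p | p permutes {..<n}. of_int (sign p) *
      (\<Sum>i<n. c i * (Y i (p i) * (\<Prod>k\<in>{..<n} - {i}. M k (p k)))))"
    by (subst sum.swap) (simp add: sum_distrib_left)
  finally show ?thesis ..
qed

lemma sum_cols_ldet:
  "(\<Sum>p | p permutes {..<n}. of_int (sign p) * (\<Sum>i<n. c (p i) * (Y i (p i) * (\<Prod>k\<in>{..<n} - {i}. M k (p k)))))
    = (\<Sum>j<n. c j * ldet n (\<lambda>i k. if k = j then Y i k else M i k))"
proof -
  have 1: "(\<Prod>i<n. if p i = p j then Y i (p i) else M i (p i)) = Y j (p j) * (\<Prod>k\<in>{..<n} - {j}. M k (p k))"
    if "p permutes {..<n}" "j < n" for p j
  proof -
    have "p i = p j \<longleftrightarrow> i = j" for i using permutes_inj[OF that(1)] by (auto dest: injD)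
    then show ?thesis using that(2) by (subst prod.remove[of _ j]) (auto intro!: prod.cong)
  qed
  have "(\<Sum>j<n. c j * ldet n (\<lambda>i k. if k = j then Y i k else M i k)) =
    (\<Sum>p | p permutes {..<n}. \<Sum>j<n. of_int (sign p) *
      (c j * (\<Prod>i<n. if p i = j then Y i (p i) else M i (p i))))"
    unfolding ldet_def sum_distrib_left by (subst sum.swap) (simp add: mult.left_commute)
  \<comment> \<open>Each column is p j for exactly one j, so the columns are reindexed along p; the
    condition p i = p j then selects the single row i = j.\<close>
  also have "\<dots> = (\<Sum>p | p permutes {..<n}. \<Sum>j<n. of_int (sign p) *
      (c (p j) * (\<Prod>i<n. if p i = p j then Y i (p i) else M i (p i))))"
  proof (rule sum.cong[OF refl])
    fix p assume "p \<in> {p. p permutes {..<n}}"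
    then have p: "p permutes {..<n}" by simp
    show "(\<Sum>j<n. of_int (sign p) * (c j * (\<Prod>i<n. if p i = j then Y i (p i) else M i (p i)))) =
      (\<Sum>j<n. of_int (sign p) * (c (p j) * (\<Prod>i<n. if p i = p j then Y i (p i) else M i (p i))))"
      by (rule sum.reindex_bij_betw[OF permutes_imp_bij[OF p], symmetric])
  qed
  also have "\<dots> = (\<Sum>p | p permutes {..<n}. of_int (sign p) *
      (\<Sum>i<n. c (p i) * (Y i (p i) * (\<Prod>k\<in>{..<n} - {i}. M k (p k)))))"
    unfolding sum_distrib_left by (intro sum.cong refl) (simp add: 1)
  finally show ?thesis ..
qed

subsection \<open>Vandermonde determinants\<close>

text \<open>The matrix of values is the matrix of powers times the coefficient matrix, which is
  upper triangular with unit diagonal.\<close>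

lemma ldet_monic:
  fixes p :: "nat \<Rightarrow> 'a::comm_ring_1 poly"
  assumes "\<And>j. j < n \<Longrightarrow> degree (p j) \<le> j" "\<And>j. j < n \<Longrightarrow> Polynomial.coeff (p j) j = 1"
  shows "ldet n (\<lambda>i j. poly (p j) (x i)) = ldet n (\<lambda>i j. x i ^ j)"
proof -
  have "ldet n (\<lambda>i j. poly (p j) (x i)) = ldet n (\<lambda>i j. \<Sum>k<n. x i ^ k * Polynomial.coeff (p j) k)"
  proof (rule ldet_cong)
    fix i j assume "i < n" "j < n"
    have "poly (p j) (x i) = (\<Sum>k\<le>degree (p j). Polynomial.coeff (p j) k * x i ^ k)"
      by (simp add: poly_altdef)
    also have "\<dots> = (\<Sum>k<n. Polynomial.coeff (p j) k * x i ^ k)"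
      by (rule sum.mono_neutral_left) (use assms(1)[OF \<open>j < n\<close>] \<open>j < n\<close> in \<open>auto simp: coeff_eq_0\<close>)
    finally show "poly (p j) (x i) = (\<Sum>k<n. x i ^ k * Polynomial.coeff (p j) k)"
      by (simp add: mult.commute)
  qed
  also have "\<dots> = ldet n (\<lambda>i j. x i ^ j) * ldet n (\<lambda>k j. Polynomial.coeff (p j) k)"
    by (rule ldet_mult)
  also have "ldet n (\<lambda>k j. Polynomial.coeff (p j) k) = (\<Prod>i<n. Polynomial.coeff (p i) i)"
    by (rule ldet_upper_triangular)
      (use assms(1) in \<open>auto intro!: coeff_eq_0\<close>, metis le_trans linorder_not_le nat_less_le
        order.strict_trans)
  also have "\<dots> = 1" using assms(2) by simp
  finally show ?thesis by simp
qed

text \<open>In the Newton basis the j-th polynomial vanishes at x_i for all i < j, so the matrix of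
  values is lower triangular.\<close>

lemma vandermonde:
  fixes x :: "nat \<Rightarrow> 'a::comm_ring_1"
  shows "ldet n (\<lambda>i j. x i ^ j) = (\<Prod>j<n. \<Prod>i<j. x j - x i)"
proof -
  let ?p = "\<lambda>j. \<Prod>i<j. [:- x i, 1:]"
  have p: "degree (?p j) \<le> j \<and> Polynomial.coeff (?p j) j = 1" for j
  proof (induction j)
    case (Suc j)
    have e: "?p (Suc j) = pCons 0 (?p j) - Polynomial.smult (x j) (?p j)"
      by (simp add: algebra_simps)
    have "degree (?p (Suc j)) \<le> Suc j"
      unfolding e using Suc
        by (intro degree_diff_le)
          (auto intro: order_trans[OF degree_pCons_le] order_trans[OF degree_smult_le])
    moreover have "Polynomial.coeff (?p (Suc j)) (Suc j) = 1"
      unfolding e using Suc by (simp add: coeff_eq_0)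
    ultimately show ?case by blast
  qed simp
  have "ldet n (\<lambda>i j. x i ^ j) = ldet n (\<lambda>i j. poly (?p j) (x i))"
    by (rule ldet_monic[symmetric]) (use p in auto)
  also have "\<dots> = (\<Prod>j<n. poly (?p j) (x j))"
    by (rule ldet_lower_triangular) (auto simp: poly_prod intro!: prod_zero bexI)
  finally show ?thesis by (simp add: poly_prod)
qed

section \<open>Monomials, scalars and coefficients in R\<close>

lemma R_eqI: "(\<And>M. coeff f M = coeff g M) \<Longrightarrow> f = g"
  by (metis coeff_inject ext)

lemmas coeff_simps [simp] = zero_R.rep_eq plus_R.rep_eq uminus_R.rep_eq minus_R.rep_eq scaleR_cplx.rep_eq

lemma coeff_R_sum [simp]: "coeff (\<Sum>i\<in>I. f i) M = (\<Sum>i\<in>I. coeff (f i) M)"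
  by (induction I rule: infinite_finite_induct) auto

lift_definition mon :: "int multiset \<Rightarrow> R" is "\<lambda>A M. if M = A then 1 else 0"
  by (metis less_irrefl)

lemma coeff_mon: "coeff (mon A) M = (if M = A then 1 else 0)"
  by (rule mon.rep_eq[THEN fun_cong])

lemma phi_eq_mon: "\<phi> n = mon {#n#}"
  by (rule R_eqI) (simp add: \<phi>.rep_eq coeff_mon)

lemma mon_empty: "mon {#} = 1"
  by (rule R_eqI) (simp add: one_R.rep_eq coeff_mon)

lemma coeff_mon_times:
  "coeff (mon A * f) M = (if A \<subseteq># M then coeff f (M - A) else 0)"
proof -
  have "coeff (mon A * f) M = (\<Sum>(B, C)\<in>splittings M. (if B = A then 1 else 0) * coeff f C)"
    by (simp add: times_R.rep_eq coeff_mon)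
  also have "\<dots> = (\<Sum>(B, C)\<in>splittings M \<inter> {A} \<times> UNIV. (if B = A then 1 else 0) * coeff f C)"
    by (rule sum.mono_neutral_right) (auto split: if_splits)
  also have "splittings M \<inter> {A} \<times> UNIV = (if A \<subseteq># M then {(A, M - A)} else {})"
    by (auto simp: splittings_def)
  also have "(\<Sum>(B, C)\<in>(if A \<subseteq># M then {(A, M - A)} else {}). (if B = A then 1 else 0) * coeff f C)
     = (if A \<subseteq># M then coeff f (M - A) else 0)"
    by simp
  finally show ?thesis .
qed

lemma mon_times: "mon A * mon B = mon (A + B)"
  by (rule R_eqI) (auto simp: coeff_mon_times coeff_mon subset_mset.diff_add)

lemma mon_prod: "finite I \<Longrightarrow> (\<Prod>i\<in>I. \<phi> (m i)) = mon (image_mset m (mset_set I))"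
  by (induction I rule: finite_induct) (auto simp: mon_empty phi_eq_mon mon_times)

lemma scale_mult_left: "(c \<bullet>\<^sub>R f) * g = c \<bullet>\<^sub>R (f * g)"
  by (metis scale_eq_mult mult.assoc)

lemma scale_mult_right: "f * (c \<bullet>\<^sub>R g) = c \<bullet>\<^sub>R (f * g)"
  by (metis scale_mult_left mult.commute)

lemma scale_add: "c \<bullet>\<^sub>R (f + g) = c \<bullet>\<^sub>R f + c \<bullet>\<^sub>R g"
  and scale_add_left: "(a + b) \<bullet>\<^sub>R f = a \<bullet>\<^sub>R f + b \<bullet>\<^sub>R f"
  and scale_scale: "a \<bullet>\<^sub>R b \<bullet>\<^sub>R f = (a * b) \<bullet>\<^sub>R f"
  and scale_one: "1 \<bullet>\<^sub>R f = f"
  and scale_zero: "0 \<bullet>\<^sub>R f = 0"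
  and scale_zero_right: "c \<bullet>\<^sub>R 0 = 0"
  and scale_minus_left: "(- a) \<bullet>\<^sub>R f = - (a \<bullet>\<^sub>R f)"
  and scale_diff_left: "(a - b) \<bullet>\<^sub>R f = a \<bullet>\<^sub>R f - b \<bullet>\<^sub>R f"
  by (rule R_eqI; simp add: algebra_simps)+

lemma of_nat_eq_scale: "of_nat k = of_nat k \<bullet>\<^sub>R (1::R)"
  by (induction k) (auto simp: scale_zero scale_add_left scale_one)

lemma of_int_eq_scale: "of_int k = of_int k \<bullet>\<^sub>R (1::R)"
proof (cases k)
  case (nonneg n)
  then show ?thesis by (simp add: of_nat_eq_scale)
next
  case (neg n)
  have "(of_int k :: R) = - of_nat (Suc n)" using neg by simp
  also have "\<dots> = (- of_nat (Suc n)) \<bullet>\<^sub>R 1"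
    by (simp only: scale_minus_left of_nat_eq_scale)
  finally show ?thesis using neg by simp
qed

lemma of_int_times: "of_int k * f = of_int k \<bullet>\<^sub>R (f::R)"
  by (metis of_int_eq_scale scale_eq_mult)

lemma numeral_times: "numeral k * f = numeral k \<bullet>\<^sub>R (f::R)"
  by (metis of_int_times of_int_numeral)

subsection \<open>Degree bounds and formal sums\<close>

definition deg_le :: "R \<Rightarrow> nat \<Rightarrow> bool" where
  "deg_le f d \<longleftrightarrow> (\<forall>M. size M > d \<longrightarrow> coeff f M = 0)"

lemma ex_deg_le: "\<exists>d. deg_le f d"
  using coeff[of f] by (auto simp: deg_le_def)

lemma deg_le_times: "deg_le f d \<Longrightarrow> deg_le g e \<Longrightarrow> deg_le (f * g) (d + e)"
  unfolding deg_le_def times_R.rep_eq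
proof (intro allI impI sum.neutral, safe)
  fix M A B assume *: "\<forall>M. d < size M \<longrightarrow> coeff f M = 0" "\<forall>M. e < size M \<longrightarrow> coeff g M = 0"
    "d + e < size M" "(A, B) \<in> splittings M"
  then have "size A > d \<or> size B > e" by (auto simp: splittings_def)
  with * show "coeff f A * coeff g B = 0" by auto
qed

lemma deg_le_add: "deg_le f d \<Longrightarrow> deg_le g d \<Longrightarrow> deg_le (f + g) d"
  and deg_le_diff: "deg_le f d \<Longrightarrow> deg_le g d \<Longrightarrow> deg_le (f - g) d"
  and deg_le_scale: "deg_le f d \<Longrightarrow> deg_le (c \<bullet>\<^sub>R f) d"
  and deg_le_mon: "size A \<le> d \<Longrightarrow> deg_le (mon A) d"
  by (auto simp: deg_le_def coeff_mon)

lemma deg_le_deriv: "deg_le f d \<Longrightarrow> deg_le (\<partial> n f) d"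
  by (auto simp: deg_le_def partial_deriv.rep_eq)

text \<open>Trades the support of a formal sum, which depends on the family and on M, for any
  convenient finite superset S, so that several formal sums can be compared over the same index
  set.\<close>

lemma coeff_formal_sum_finite:
  assumes "\<And>i. i \<in> I \<Longrightarrow> deg_le (g i) d"
    and "finite S" "\<And>i. i \<in> I \<Longrightarrow> coeff (g i) M \<noteq> 0 \<Longrightarrow> i \<in> S"
  shows "coeff (formal_sum I g) M = (\<Sum>i\<in>S \<inter> I. coeff (g i) M)"
proof -
  have "coeff (formal_sum I g) M = (\<Sum>i | i \<in> I \<and> coeff (g i) M \<noteq> 0. coeff (g i) M)"
    by (rule coeff_formal_sum) (use assms(1) in \<open>auto simp: deg_le_def\<close>)
  also have "\<dots> = (\<Sum>i\<in>S \<inter> I. coeff (g i) M)"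
    by (rule sum.mono_neutral_left) (use assms in auto)
  finally show ?thesis .
qed

lemma deg_le_formal_sum:
  assumes "\<And>i. i \<in> I \<Longrightarrow> deg_le (g i) d"
  shows "deg_le (formal_sum I g) d"
  unfolding deg_le_def
proof (intro allI impI)
  fix M :: "int multiset" assume M: "d < size M"
  have "coeff (formal_sum I g) M = (\<Sum>i | i \<in> I \<and> coeff (g i) M \<noteq> 0. coeff (g i) M)"
    by (rule coeff_formal_sum) (use assms(1) in \<open>auto simp: deg_le_def\<close>)
  then show "coeff (formal_sum I g) M = 0"
    using assms M by (auto simp: deg_le_def intro: sum.neutral)
qed

lemma coeff_phi_total: "coeff \<phi>_total M = (if size M = 1 then 1 else 0)"
proof -
  have d: "deg_le (\<phi> n) 1" for n by (simp add: phi_eq_mon deg_le_mon)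
  show ?thesis
  proof (cases "size M = 1")
    case True
    then obtain n where n: "M = {#n#}" by (metis size_1_singleton_mset)
    have "coeff \<phi>_total M = (\<Sum>i\<in>{n} \<inter> UNIV. coeff (\<phi> i) M)"
      unfolding \<phi>_total_def
      by (rule coeff_formal_sum_finite[where d = 1]) (use n d in \<open>auto simp: \<phi>.rep_eq split: if_splits\<close>)
    with n show ?thesis by (simp add: \<phi>.rep_eq)
  next
    case False
    have "coeff \<phi>_total M = (\<Sum>i\<in>{} \<inter> UNIV. coeff (\<phi> i) M)"
      unfolding \<phi>_total_def
      by (rule coeff_formal_sum_finite[where d = 1]) (use False d in \<open>auto simp: \<phi>.rep_eq split: if_splits\<close>)
    with False show ?thesis by simp
  qed
qed

text \<open>Only factors of degree one count: one index of M is removed, and each distinct index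
  occurs once, whatever its multiplicity.\<close>

lemma coeff_phi_total_times:
  "coeff (\<phi>_total * f) M = (\<Sum>n\<in>set_mset M. coeff f (M - {#n#}))"
proof -
  have "coeff (\<phi>_total * f) M = (\<Sum>(A, B)\<in>splittings M. coeff \<phi>_total A * coeff f B)"
    by (simp add: times_R.rep_eq)
  also have "\<dots> = (\<Sum>(A, B)\<in>(\<lambda>n. ({#n#}, M - {#n#})) ` set_mset M. coeff \<phi>_total A * coeff f B)"
  proof (rule sum.mono_neutral_right, goal_cases)
    case 3
    show ?case
    proof (safe, rule ccontr)
      fix A B assume AB: "(A, B) \<in> splittings M"
        "(A, B) \<notin> (\<lambda>n. ({#n#}, M - {#n#})) ` set_mset M" "coeff \<phi>_total A * coeff f B \<noteq> 0"
      then have "size A = 1" by (auto simp: coeff_phi_total split: if_splits)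
      then obtain n where "A = {#n#}" by (metis size_1_singleton_mset)
      then have "n \<in># M" "B = M - {#n#}" using AB by (auto simp: splittings_def)
      with AB(2) \<open>A = {#n#}\<close> show False by auto
    qed
  next
    case 2
    show ?case by (auto simp: splittings_def)
  qed simp
  also have "\<dots> = (\<Sum>n\<in>set_mset M. coeff f (M - {#n#}))"
    by (subst sum.reindex) (auto intro!: inj_onI simp: coeff_phi_total)
  finally show ?thesis .
qed

subsection \<open>Coefficients of the operator\<close>

text \<open>The coefficient of \<open>\<phi> x * \<phi> y\<close>, x \<ge> y, in
  \<open>op_A n1 n2\<close>. Throughout the definition of \<open>op_A\<close> the integer weight
  equals the difference x - y of the indices, so it factors out; what remains depends only on x + y
  and on the position of x relative to n1.\<close>

definition cA :: "int \<Rightarrow> int \<Rightarrow> int \<Rightarrow> int \<Rightarrow> int" where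
  "cA n1 n2 x y = (x - y) *
     ((if x + y = n1 + n2 + 1 \<and> x > n1 then 1 else 0) +
      (if x + y = n1 + n2 - 1 \<and> x \<ge> n1 then 1 else 0) -
      (if x + y = n1 + n2 then (if x > n1 then 2 else if x = n1 then 1 else 0) else 0))"

lemma pair_mset_eq: "(x::int) \<ge> y \<Longrightarrow> a \<ge> b \<Longrightarrow> {#x, y#} = {#a, b#} \<longleftrightarrow> x = a \<and> y = b"
  by (auto simp: add_eq_conv_ex add_mset_eq_single)

lemma coeff_scale_phi2: "coeff (of_int k * (\<phi> a * \<phi> b)) M = (if M = {#a, b#} then of_int k else 0)"
  by (auto simp: of_int_times phi_eq_mon mon_times coeff_mon add_mset_commute)

lemma coeff_scale_phi2': "coeff (of_int k * (\<phi> a * \<phi> b + \<phi> a' * \<phi> b')) M =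
   (if M = {#a, b#} then of_int k else 0) + (if M = {#a', b'#} then of_int k else 0)"
  by (simp only: distrib_left coeff_simps coeff_scale_phi2)

lemma deg_le_phi2: "deg_le (of_int k * (\<phi> a * \<phi> b)) 2" "deg_le (of_int k * (\<phi> a * \<phi> b + \<phi> a' * \<phi> b')) 2"
  by (auto simp: of_int_times phi_eq_mon mon_times intro!: deg_le_scale deg_le_mon deg_le_add)

lemma deg_le_op_A: "deg_le (op_A n1 n2) 2"
  unfolding op_A_def numeral_times
  by (intro deg_le_diff deg_le_formal_sum deg_le_phi2 deg_le_scale)

lemma coeff_op_A:
  assumes "n1 \<ge> n2" "x \<ge> y"
  shows "coeff (op_A n1 n2) {#x, y#} = of_int (cA n1 n2 x y)"
proof -
  let ?M = "{#x, y#}"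
  let ?k = "\<lambda>p. n1 - n2 + 2 * int p + 1"
  let ?g = "\<lambda>p. of_int (?k p) * (\<phi> (n1 + int p + 1) * \<phi> (n2 - int p) + \<phi> (n1 + int p) * \<phi> (n2 - int p - 1))"
  let ?k2 = "\<lambda>p. n1 - n2 + 2 * int p"
  let ?h = "\<lambda>p. of_int (?k2 p) * (\<phi> (n1 + int p) * \<phi> (n2 - int p))"
  have cg: "coeff (?g p) ?M = (if x = n1 + int p + 1 \<and> y = n2 - int p then of_int (?k p) else 0) +
       (if x = n1 + int p \<and> y = n2 - int p - 1 then of_int (?k p) else 0)" for p
    unfolding coeff_scale_phi2' using assms by (subst (1 2) pair_mset_eq) auto
  have ch: "coeff (?h p) ?M = (if x = n1 + int p \<and> y = n2 - int p then of_int (?k2 p) else 0)" for p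
    unfolding coeff_scale_phi2 using assms by (subst pair_mset_eq) auto
  have f1: "coeff (formal_sum UNIV ?g) ?M = (\<Sum>p\<in>S \<inter> UNIV. coeff (?g p) ?M)"
    if "finite S" "\<And>p. coeff (?g p) ?M \<noteq> 0 \<Longrightarrow> p \<in> S" for S
    by (rule coeff_formal_sum_finite[OF deg_le_phi2(2)]) (use that in auto)
  have f2: "coeff (formal_sum {1..} ?h) ?M = (\<Sum>p\<in>S \<inter> {1..}. coeff (?h p) ?M)"
    if "finite S" "\<And>p. coeff (?h p) ?M \<noteq> 0 \<Longrightarrow> p \<in> S" for S
    by (rule coeff_formal_sum_finite[OF deg_le_phi2(1)]) (use that in auto)
  have 1: "coeff (formal_sum UNIV ?g) ?M
      = of_int ((x - y) * ((if x + y = n1 + n2 + 1 \<and> x > n1 then 1 else 0) +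
      (if x + y = n1 + n2 - 1 \<and> x \<ge> n1 then 1 else 0)))"
  proof -
    consider (A) "x + y = n1 + n2 + 1" "x > n1" | (B) "x + y = n1 + n2 - 1" "x \<ge> n1"
      | (C) "\<not> (x + y = n1 + n2 + 1 \<and> x > n1)" "\<not> (x + y = n1 + n2 - 1 \<and> x \<ge> n1)" by blast
    then show ?thesis
    proof cases
      case A
      then obtain q where "x = n1 + int q + 1" "y = n2 - int q"
        using zle_iff_zadd[of "n1 + 1" x] by (auto simp: algebra_simps)
      then show ?thesis by (subst f1[of "{q}"], unfold cg) (auto split: if_splits)
    next
      case B
      then obtain q where "x = n1 + int q" "y = n2 - int q - 1"
        using zle_iff_zadd[of n1 x] by (auto simp: algebra_simps)
      then show ?thesis by (subst f1[of "{q}"], unfold cg) (auto split: if_splits)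
    next
      case C
      then have "coeff (?g p) ?M = 0" for p unfolding cg by auto
      then have "coeff (formal_sum UNIV ?g) ?M = 0" by (subst f1[of "{}"]) auto
      moreover have "(if x + y = n1 + n2 + 1 \<and> x > n1 then 1 else 0) = (0::int)"
        "(if x + y = n1 + n2 - 1 \<and> x \<ge> n1 then 1 else 0) = (0::int)" using C by auto
      ultimately show ?thesis by (simp only:) simp
    qed
  qed
  have 2: "coeff (formal_sum {1..} ?h) ?M = of_int ((x - y) * (if x + y = n1 + n2 \<and> x > n1 then 1 else 0))"
  proof (cases "x + y = n1 + n2 \<and> x > n1")
    case True
    then obtain q where q: "x = n1 + int q" "y = n2 - int q"
      using zle_iff_zadd[of n1 x] by (auto simp: algebra_simps)
    with True have "q \<ge> 1" by auto
    with q show ?thesis by (subst f2[of "{q}"], unfold ch) (auto split: if_splits)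
  next
    case False
    then have "coeff (?h p) ?M = 0" if "p \<ge> 1" for p using that unfolding ch by auto
    \<comment> \<open>The index 0 belongs to S because \<open>?h 0\<close> may well contain the
      monomial; intersecting with {1..} removes it again.\<close>
    then have "coeff (formal_sum {1..} ?h) ?M = (\<Sum>p\<in>{0} \<inter> {1..}. coeff (?h p) ?M)"
      by (intro f2) (auto, metis One_nat_def Suc_leI neq0_conv)
    with False show ?thesis by (simp only:) simp
  qed
  have 3: "coeff (of_int (n1 - n2) * (\<phi> n1 * \<phi> n2)) ?M
      = of_int ((x - y) * (if x + y = n1 + n2 \<and> x = n1 then 1 else 0))"
    unfolding coeff_scale_phi2 using assms by (subst pair_mset_eq) auto
  have "cA n1 n2 x y = (x - y) * ((if x + y = n1 + n2 + 1 \<and> x > n1 then 1 else 0) +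
      (if x + y = n1 + n2 - 1 \<and> x \<ge> n1 then 1 else 0)) - (x - y) * (if x + y = n1 + n2 \<and> x = n1 then 1 else 0)
      - 2 * ((x - y) * (if x + y = n1 + n2 \<and> x > n1 then 1 else 0))"
    unfolding cA_def by (cases "x > n1"; cases "x = n1") (simp_all add: algebra_simps)
  then show ?thesis
    unfolding op_A_def numeral_times coeff_simps 1 2 3 by (simp only: of_int_diff of_int_mult of_int_numeral)
qed

lemma coeff_op_A_size:
  assumes "size M \<noteq> 2"
  shows "coeff (op_A n1 n2) M = 0"
proof -
  have ne: "M \<noteq> {#a, b#}" for a b using assms by auto
  have z: "coeff (formal_sum I g) M = 0"
    if "\<And>i. coeff (g i) M = 0" "\<And>i. deg_le (g i) 2" for I :: "nat set" and g
    by (subst coeff_formal_sum_finite[where d = 2 and S = "{}"]) (auto simp: that)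
  show ?thesis
    unfolding op_A_def numeral_times coeff_simps
    by (subst (1 2) z) (simp_all only: deg_le_phi2 coeff_scale_phi2' coeff_scale_phi2 ne if_False, simp_all)
qed

text \<open>Extends the coefficients symmetrically to all pairs of indices. The sum over n1 > n2
  with its factor 2 and the diagonal sum then merge into one sum over all ordered pairs.\<close>

definition op_As :: "int \<Rightarrow> int \<Rightarrow> R" where
  "op_As n1 n2 = op_A (max n1 n2) (min n1 n2)"

lemma op_As_commute: "op_As n1 n2 = op_As n2 n1"
  by (simp add: op_As_def max.commute min.commute)

lemma mset_size2_cases:
  assumes "size M = 2"
  obtains x y :: int where "x \<ge> y" "M = {#x, y#}"
proof -
  obtain a N where "M = add_mset a N" "size N = Suc 0"
    using assms size_eq_Suc_imp_eq_union[of M "Suc 0"] by (auto simp: numeral_2_eq_2)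
  moreover then obtain b where "N = {#b#}" using size_1_singleton_mset[of N] by auto
  ultimately have "M = {#a, b#}" by simp
  then show ?thesis using that[of a b] that[of b a] by (cases "a \<ge> b") (auto simp: add_mset_commute)
qed

text \<open>If \<open>hull_in M S\<close>, only derivatives with respect to \<open>\<phi>\<^sub>n\<close>, \<open>n \<in> S\<close>, contribute to the
  coefficient of \<open>M\<close> in the operator; all formal sums become finite sums over \<open>S\<close>.\<close>

definition hull_in :: "int multiset \<Rightarrow> int set \<Rightarrow> bool" where
  "hull_in M S \<longleftrightarrow> finite S \<and> (\<forall>x\<in>#M. \<forall>y\<in>#M. {x - 1..y + 1} \<subseteq> S)"

lemma ex_hull_in:
  assumes "finite T"
  obtains S where "hull_in M S" "T \<subseteq> S"
proof -
  let ?S = "T \<union> (\<Union>x\<in>set_mset M. \<Union>y\<in>set_mset M. {x - 1..y + 1})"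
  have "hull_in M ?S" using assms by (auto simp: hull_in_def)
  with that show ?thesis by blast
qed

lemma hull_in_subset: "hull_in M S \<Longrightarrow> A \<subseteq># M \<Longrightarrow> hull_in A S"
  unfolding hull_in_def by (meson mset_subset_eqD)

text \<open>The terms of \<open>op_A\<close> never move the indices towards each other:
  \<open>\<phi> x * \<phi> y\<close> with x \<ge> y occurs only if n1 and n2 both lie between y and
  x.\<close>

lemma coeff_op_As_in:
  assumes "coeff (op_As n1 n2) A \<noteq> 0" "hull_in A S"
  shows "n1 \<in> S" "n2 \<in> S"
proof -
  have "size A = 2" using assms coeff_op_A_size by (auto simp: op_As_def)
  then obtain x y where xy: "x \<ge> y" "A = {#x, y#}" by (rule mset_size2_cases)
  then have "cA (max n1 n2) (min n1 n2) x y \<noteq> 0"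
    using assms(1) by (simp add: op_As_def coeff_op_A)
  then have "y \<le> min n1 n2 \<and> max n1 n2 \<le> x"
    by (auto simp: cA_def split: if_splits)
  moreover have "{y - 1..x + 1} \<subseteq> S" using assms(2) xy by (auto simp: hull_in_def)
  ultimately show "n1 \<in> S" "n2 \<in> S" by auto
qed

lemma coeff_times_op_As_in:
  assumes "coeff (op_As n1 n2 * g) M \<noteq> 0" "hull_in M S"
  shows "n1 \<in> S \<and> n2 \<in> S"
proof -
  from assms(1) have "\<exists>p\<in>splittings M. (case p of (A, B) \<Rightarrow> coeff (op_As n1 n2) A * coeff g B) \<noteq> 0"
    unfolding times_R.rep_eq by (meson sum.neutral)
  then obtain A B where "(A, B) \<in> splittings M" "coeff (op_As n1 n2) A \<noteq> 0"
    by auto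
  then show ?thesis using coeff_op_As_in[of n1 n2 A S] hull_in_subset[OF assms(2), of A]
    by (auto simp: splittings_def)
qed

lemma coeff_op_B_times:
  "coeff (op_B z z' w w' n * g) M =
     ((of_int n + w + 1) * (of_int n + w' + 1)) * (if n + 1 \<in># M then coeff g (M - {#n + 1#}) else 0)
     + ((of_int n - z - 1) * (of_int n - z' - 1)) * (if n - 1 \<in># M then coeff g (M - {#n - 1#}) else 0)
     - ((of_int n - z) * (of_int n - z') + (of_int n + w) * (of_int n + w')) *
       (if n \<in># M then coeff g (M - {#n#}) else 0)"
  unfolding op_B_def
  by (simp only: ring_distribs left_diff_distrib coeff_simps scale_mult_left phi_eq_mon coeff_mon_times
    single_subset_iff)

lemma coeff_op_B_times_in:
  assumes "coeff (op_B z z' w w' n * g) M \<noteq> 0" "hull_in M S"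
  shows "n \<in> S"
proof -
  have "n + 1 \<in># M \<or> n - 1 \<in># M \<or> n \<in># M"
    using assms(1) unfolding coeff_op_B_times by (auto split: if_splits)
  then show ?thesis using assms(2) unfolding hull_in_def by fastforce
qed

lemma deriv_commute: "\<partial> n (\<partial> m f) = \<partial> m (\<partial> n f)"
  by (rule R_eqI) (auto simp: partial_deriv.rep_eq add_mset_commute)

lemma deg_le_op_B: "deg_le (op_B z z' w w' n) 1"
  unfolding op_B_def by (intro deg_le_add deg_le_diff deg_le_scale) (auto simp: phi_eq_mon intro!: deg_le_mon)

text \<open>All three formal sums become finite, so later proofs can exchange summations freely. The
  pairs n1 < n2 are obtained from n1 > n2 by the symmetry of \<open>op_As\<close> and of second
  derivatives.\<close>

lemma coeff_op_D:
  assumes S: "hull_in M S"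
  shows "coeff (op_D z z' w w' f) M = (\<Sum>n1\<in>S. \<Sum>n2\<in>S. coeff (op_As n1 n2 * \<partial> n1 (\<partial> n2 f)) M)
     + (\<Sum>n\<in>S. coeff (op_B z z' w w' n * \<partial> n f) M)"
proof -
  obtain d where d: "deg_le f d" using ex_deg_le by blast
  have fin: "finite S" using S by (simp add: hull_in_def)
  let ?c = "\<lambda>(n1, n2). coeff (op_As n1 n2 * \<partial> n1 (\<partial> n2 f)) M"
  have 1: "coeff (formal_sum UNIV (\<lambda>n. op_A n n * \<partial> n (\<partial> n f))) M = (\<Sum>n\<in>S. ?c (n, n))"
  proof -
    have "coeff (formal_sum UNIV (\<lambda>n. op_A n n * \<partial> n (\<partial> n f))) M
        = (\<Sum>n\<in>S \<inter> UNIV. coeff (op_A n n * \<partial> n (\<partial> n f)) M)"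
    proof (rule coeff_formal_sum_finite[where d = "2 + d"])
      show "deg_le (op_A n n * \<partial> n (\<partial> n f)) (2 + d)" for n
        by (intro deg_le_times deg_le_op_A deg_le_deriv d)
      show "n \<in> S" if "coeff (op_A n n * \<partial> n (\<partial> n f)) M \<noteq> 0" for n
        using coeff_times_op_As_in[OF _ S, of n n] that by (simp add: op_As_def)
    qed (fact fin)
    then show ?thesis by (simp add: op_As_def)
  qed
  have 2: "coeff (formal_sum {(n1, n2). n1 > n2} (\<lambda>(n1, n2). op_A n1 n2 * \<partial> n1 (\<partial> n2 f))) M
    = (\<Sum>p\<in>S \<times> S \<inter> {(n1, n2). n1 > n2}. ?c p)"
  proof -
    have eq: "coeff (op_A n1 n2 * \<partial> n1 (\<partial> n2 f)) M = ?c (n1, n2)" if "n1 > n2" for n1 n2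
      using that by (simp add: op_As_def max_def min_def)
    have "coeff (formal_sum {(n1, n2). n1 > n2} (\<lambda>(n1, n2). op_A n1 n2 * \<partial> n1 (\<partial> n2 f))) M
       = (\<Sum>p\<in>S \<times> S \<inter> {(n1, n2). n1 > n2}. coeff (case p of (n1, n2) \<Rightarrow> op_A n1 n2 * \<partial> n1 (\<partial> n2 f)) M)"
    proof (rule coeff_formal_sum_finite[where d = "2 + d"])
      fix p :: "int \<times> int" assume p: "p \<in> {(n1, n2). n1 > n2}"
        "coeff (case p of (n1, n2) \<Rightarrow> op_A n1 n2 * \<partial> n1 (\<partial> n2 f)) M \<noteq> 0"
      obtain n1 n2 where n: "p = (n1, n2)" by force
      have "coeff (op_As n1 n2 * \<partial> n1 (\<partial> n2 f)) M \<noteq> 0" using p n eq[of n2 n1] by auto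
      from coeff_times_op_As_in[OF this S] show "p \<in> S \<times> S" using n by auto
    next
      fix p :: "int \<times> int"
      show "deg_le (case p of (n1, n2) \<Rightarrow> op_A n1 n2 * \<partial> n1 (\<partial> n2 f)) (2 + d)"
        by (cases p) (simp only: prod.case, intro deg_le_times deg_le_op_A deg_le_deriv d)
    qed (use fin in auto)
    also have "\<dots> = (\<Sum>p\<in>S \<times> S \<inter> {(n1, n2). n1 > n2}. ?c p)"
      by (rule sum.cong) (auto simp: eq)
    finally show ?thesis .
  qed
  have 3: "coeff (formal_sum UNIV (\<lambda>n. op_B z z' w w' n * \<partial> n f)) M
      = (\<Sum>n\<in>S. coeff (op_B z z' w w' n * \<partial> n f) M)"
    by (subst coeff_formal_sum_finite[where d = "1 + d" and S = S])
       (use S d fin coeff_op_B_times_in[OF _ S] deg_le_times[OF deg_le_op_B deg_le_deriv[OF d]] in auto)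
  have "(\<Sum>n1\<in>S. \<Sum>n2\<in>S. ?c (n1, n2)) = (\<Sum>p\<in>S \<times> S. ?c p)"
    by (simp add: sum.cartesian_product)
  also have "\<dots> = (\<Sum>p\<in>(S \<times> S \<inter> {(n1, n2). n1 > n2}) \<union> (S \<times> S \<inter> {(n1, n2). n1 < n2}). ?c p)
      + (\<Sum>p\<in>S \<times> S \<inter> {(n1, n2). n1 = n2}. ?c p)"
    by (subst sum.union_disjoint[symmetric]) (use fin in \<open>auto intro!: sum.cong\<close>)
  also have "(\<Sum>p\<in>(S \<times> S \<inter> {(n1, n2). n1 > n2}) \<union> (S \<times> S \<inter> {(n1, n2). n1 < n2}). ?c p) =
     (\<Sum>p\<in>S \<times> S \<inter> {(n1, n2). n1 > n2}. ?c p) + (\<Sum>p\<in>S \<times> S \<inter> {(n1, n2). n1 < n2}. ?c p)"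
    by (rule sum.union_disjoint) (use fin in auto)
  also have "(\<Sum>p\<in>S \<times> S \<inter> {(n1, n2). n1 < n2}. ?c p) = (\<Sum>p\<in>S \<times> S \<inter> {(n1, n2). n1 > n2}. ?c p)"
    by (rule sum.reindex_bij_witness[where i = prod.swap and j = prod.swap])
       (auto simp: op_As_commute deriv_commute)
  also have "(\<Sum>p\<in>S \<times> S \<inter> {(n1, n2). n1 = n2}. ?c p) = (\<Sum>n\<in>S. ?c (n, n))"
    by (rule sum.reindex_bij_witness[where i = "\<lambda>n. (n, n)" and j = fst]) auto
  finally have "(\<Sum>n1\<in>S. \<Sum>n2\<in>S. ?c (n1, n2)) = 2 * (\<Sum>p\<in>S \<times> S \<inter> {(n1, n2). n1 > n2}. ?c p) + (\<Sum>n\<in>S. ?c (n, n))"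
    by simp
  then show ?thesis
    unfolding op_D_def numeral_times coeff_simps 1 2 3 by simp
qed


section \<open>Linearity of the operator and invariance of the ideal\<close>

lemma deriv_add: "\<partial> n (f + g) = \<partial> n f + \<partial> n g"
  and deriv_scale: "\<partial> n (c \<bullet>\<^sub>R f) = c \<bullet>\<^sub>R \<partial> n f"
  and deriv_diff: "\<partial> n (f - g) = \<partial> n f - \<partial> n g"
  by (rule R_eqI; simp add: partial_deriv.rep_eq algebra_simps)+

lemma op_D_add: "op_D z z' w w' (f + g) = op_D z z' w w' f + op_D z z' w w' g"
proof (rule R_eqI)
  fix M
  obtain S where S: "hull_in M S" using ex_hull_in[of "{}"] by auto
  show "coeff (op_D z z' w w' (f + g)) M = coeff (op_D z z' w w' f + op_D z z' w w' g) M"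
    by (simp add: coeff_op_D[OF S] deriv_add distrib_left sum.distrib)
qed

lemma op_D_scale: "op_D z z' w w' (c \<bullet>\<^sub>R f) = c \<bullet>\<^sub>R op_D z z' w w' f"
proof (rule R_eqI)
  fix M
  obtain S where S: "hull_in M S" using ex_hull_in[of "{}"] by auto
  show "coeff (op_D z z' w w' (c \<bullet>\<^sub>R f)) M = coeff (c \<bullet>\<^sub>R op_D z z' w w' f) M"
    by (simp add: coeff_op_D[OF S] deriv_scale scale_mult_right sum_distrib_left distrib_left)
qed

lemma op_D_zero: "op_D z z' w w' 0 = 0"
  using op_D_scale[of z z' w w' 0 0] by (simp add: scale_zero scale_zero_right)

lemma op_D_diff: "op_D z z' w w' (f - g) = op_D z z' w w' f - op_D z z' w w' g"
  by (metis add_diff_cancel diff_add_cancel op_D_add)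

lemma op_D_sum: "op_D z z' w w' (\<Sum>i\<in>I. f i) = (\<Sum>i\<in>I. op_D z z' w w' (f i))"
  by (induction I rule: infinite_finite_induct) (auto simp: op_D_add op_D_zero)

lemma deriv_mon: "\<partial> n (mon A) = of_nat (count A n) * mon (A - {#n#})"
proof (rule R_eqI)
  fix M
  have "coeff (\<partial> n (mon A)) M = (if add_mset n M = A then of_nat (count (add_mset n M) n) else 0)"
    by (auto simp: partial_deriv.rep_eq coeff_mon)
  also have "\<dots> = (if M = A - {#n#} then of_nat (count A n) else 0)"
    by (cases "n \<in># A") (auto simp: not_in_iff)
  also have "\<dots> = coeff (of_nat (count A n) * mon (A - {#n#})) M"
    by (simp add: of_nat_eq_scale[of "count A n"] scale_mult_left coeff_mon)
  finally show "coeff (\<partial> n (mon A)) M = coeff (of_nat (count A n) * mon (A - {#n#})) M" .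
qed

text \<open>The product rule for \<open>\<phi>_total\<close>, whose partial derivatives are all
  equal to 1.\<close>

lemma deriv_phi_times: "\<partial> n (\<phi>_total * f) = f + \<phi>_total * \<partial> n f"
proof (rule R_eqI)
  fix M
  have A: "add_mset n M - {#m#} = add_mset n (M - {#m#})" if "m \<noteq> n" for m
    using that by (simp add: add_mset_diff_bothsides diff_union_swap2 diff_add_mset_swap)
  have "coeff (\<partial> n (\<phi>_total * f)) M = of_nat (count M n + 1) *
      (\<Sum>m\<in>insert n (set_mset M). coeff f (add_mset n M - {#m#}))"
    by (simp add: partial_deriv.rep_eq coeff_phi_total_times)
  also have "(\<Sum>m\<in>insert n (set_mset M). coeff f (add_mset n M - {#m#})) =
     coeff f M + (\<Sum>m\<in>set_mset M - {n}. coeff f (add_mset n (M - {#m#})))"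
    by (subst sum.insert_remove) (auto intro!: sum.cong simp: A)
  finally have 1: "coeff (\<partial> n (\<phi>_total * f)) M = of_nat (count M n + 1) * coeff f M +
     (\<Sum>m\<in>set_mset M - {n}. of_nat (count M n + 1) * coeff f (add_mset n (M - {#m#})))"
    by (simp add: distrib_left sum_distrib_left)
  have "coeff (\<phi>_total * \<partial> n f) M
      = (\<Sum>m\<in>set_mset M. of_nat (count (M - {#m#}) n + 1) * coeff f (add_mset n (M - {#m#})))"
    by (simp add: partial_deriv.rep_eq coeff_phi_total_times)
  \<comment> \<open>The term m = n has weight \<open>count M n\<close> here, but
    \<open>count M n + 1\<close> on the other side; the excess is the summand f.\<close>
  also have "\<dots> = (\<Sum>m\<in>set_mset M - {n}. of_nat (count (M - {#m#}) n + 1) * coeff f (add_mset n (M - {#m#})))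
     + of_nat (count M n) * coeff f M"
  proof (cases "n \<in># M")
    case True
    then have "Suc (count M n - Suc 0) = count M n" by simp
    with True show ?thesis by (subst sum.remove[of _ n]) (simp_all flip: of_nat_Suc)
  qed (auto simp: not_in_iff)
  also have "(\<Sum>m\<in>set_mset M - {n}. of_nat (count (M - {#m#}) n + 1) * coeff f (add_mset n (M - {#m#}))) =
     (\<Sum>m\<in>set_mset M - {n}. of_nat (count M n + 1) * coeff f (add_mset n (M - {#m#})))"
    by (rule sum.cong) auto
  finally show "coeff (\<partial> n (\<phi>_total * f)) M = coeff (f + \<phi>_total * \<partial> n f) M"
    unfolding 1 coeff_simps by (simp add: algebra_simps)
qed

text \<open>For fixed n1 each of the three families in \<open>cA\<close> is hit by one n2. They
  contribute 1 + 1 - 2 if y < n1 < x and 1 - 1 if n1 is an end point of the interval; if x = y, the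
  factor x - y vanishes. The margin of one around the interval makes sure that S contains those
  n2.\<close>

lemma sum_cA_eq_0:
  assumes "finite S" "{y - 1..x + 1} \<subseteq> S" "x \<ge> y"
  shows "(\<Sum>n2\<in>S. cA (max n1 n2) (min n1 n2) x y) = 0"
proof -
  have e: "cA (max n1 n2) (min n1 n2) x y = (x - y) *
     ((if n2 = x + y - n1 - 1 then (if y \<le> n1 \<and> n1 < x then 1 else 0) else 0) +
      (if n2 = x + y - n1 + 1 then (if y < n1 \<and> n1 \<le> x then 1 else 0) else 0) -
      (if n2 = x + y - n1 then (if y < n1 \<and> n1 < x then 2 else
        if n1 = x \<or> n1 = y then 1 else 0) else 0))" for n2
  proof -
    have mm: "max n1 n2 + min n1 n2 = n1 + n2" by linarith
    consider "n2 = x + y - n1 - 1" | "n2 = x + y - n1 + 1" | "n2 = x + y - n1"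
      | "n2 \<noteq> x + y - n1 - 1" "n2 \<noteq> x + y - n1 + 1" "n2 \<noteq> x + y - n1" by blast
    then show ?thesis
    proof cases
      case 1
      then have "x > max n1 n2 \<longleftrightarrow> y \<le> n1 \<and> n1 < x" by auto
      then show ?thesis unfolding cA_def mm using 1 by simp
    next
      case 2
      then have "x \<ge> max n1 n2 \<longleftrightarrow> y < n1 \<and> n1 \<le> x" by auto
      then show ?thesis unfolding cA_def mm using 2 by simp
    next
      case 3
      then have "x > max n1 n2 \<longleftrightarrow> y < n1 \<and> n1 < x" "x = max n1 n2 \<longleftrightarrow> (n1 = x \<or> n1 = y) \<and> y \<le> n1 \<and> n1 \<le> x"
        by auto
      then show ?thesis unfolding cA_def mm using 3 assms(3) by auto
    qed (simp add: cA_def mm algebra_simps)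
  qed
  have "(\<Sum>n2\<in>S. cA (max n1 n2) (min n1 n2) x y) = (x - y) *
     ((\<Sum>n2\<in>S. if n2 = x + y - n1 - 1 then (if y \<le> n1 \<and> n1 < x then 1 else 0) else 0) +
      (\<Sum>n2\<in>S. if n2 = x + y - n1 + 1 then (if y < n1 \<and> n1 \<le> x then 1 else 0) else 0) -
      (\<Sum>n2\<in>S. if n2 = x + y - n1 then (if y < n1 \<and> n1 < x then 2 else
        if n1 = x \<or> n1 = y then 1 else 0) else 0))"
    unfolding e by (simp only: sum_distrib_left[symmetric] sum.distrib sum_subtractf)
  also have "\<dots> = (x - y) *
     ((if y \<le> n1 \<and> n1 < x then 1 else 0) + (if y < n1 \<and> n1 \<le> x then 1 else 0) -
      (if y < n1 \<and> n1 < x then 2 else if n1 = x \<or> n1 = y then 1 else 0))"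
  proof -
    have "y \<le> n1 \<Longrightarrow> n1 \<le> x \<Longrightarrow> {x + y - n1 - 1, x + y - n1 + 1, x + y - n1} \<subseteq> S"
      using assms(2) by force
    then show ?thesis using assms(1,3) by (cases "y \<le> n1 \<and> n1 \<le> x") auto
  qed
  also have "\<dots> = 0" using assms(3) by auto
  finally show ?thesis .
qed

lemma sum_op_As_times_eq_0:
  assumes "hull_in M S"
  shows "(\<Sum>n2\<in>S. coeff (op_As n1 n2 * g) M) = 0"
proof -
  have z: "(\<Sum>n2\<in>S. coeff (op_As n1 n2) A) = 0" if "A \<subseteq># M" for A
  proof (cases "size A = 2")
    case True
    then obtain x y where xy: "x \<ge> y" "A = {#x, y#}" by (rule mset_size2_cases)
    have "{y - 1..x + 1} \<subseteq> S" "finite S"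
      using hull_in_subset[OF assms that] xy by (auto simp: hull_in_def)
    from sum_cA_eq_0[OF this(2,1) xy(1)] show ?thesis
      by (simp add: xy op_As_def coeff_op_A flip: of_int_sum)
  qed (simp add: op_As_def coeff_op_A_size)
  have "(\<Sum>n2\<in>S. coeff (op_As n1 n2 * g) M)
      = (\<Sum>(A, B)\<in>splittings M. (\<Sum>n2\<in>S. coeff (op_As n1 n2) A) * coeff g B)"
    unfolding times_R.rep_eq case_prod_unfold sum_distrib_right by (rule sum.swap)
  also have "\<dots> = 0" by (rule sum.neutral) (auto simp: splittings_def z)
  finally show ?thesis .
qed

text \<open>The sum telescopes: with p n = (n + w)(n + w') and q n = (n - z)(n - z'), the
  coefficients of \<open>op_B\<close> at n are p (n + 1), q (n - 1) and - (p n + q n), each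
  evaluated at the index of its \<phi>.\<close>

lemma sum_op_B_times_eq_0:
  assumes "hull_in M S"
  shows "(\<Sum>n\<in>S. coeff (op_B z z' w w' n * g) M) = 0"
proof -
  let ?c = "\<lambda>n. if n \<in># M then coeff g (M - {#n#}) else 0"
  let ?p = "\<lambda>n::int. (of_int n + w) * (of_int n + w') * ?c n"
  let ?q = "\<lambda>n::int. (of_int n - z) * (of_int n - z') * ?c n"
  have fin: "finite S" using assms by (simp add: hull_in_def)
  \<comment> \<open>S contains both neighbours of every index of M, hence a shift by one moves
    nothing out of the range of summation.\<close>
  have sh: "(\<Sum>n\<in>S. F (n + k)) = (\<Sum>n\<in>set_mset M. F n)"
    if F: "\<And>n. n \<notin># M \<Longrightarrow> F n = 0" and k: "k = 0 \<or> k = 1 \<or> k = -1" for F :: "int \<Rightarrow> complex" and k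
  proof -
    have "(\<Sum>n\<in>S. F (n + k)) = (\<Sum>n\<in>(\<lambda>n. n + k) ` S. F n)"
      by (subst sum.reindex) (auto intro!: inj_onI)
    also have "\<dots> = (\<Sum>n\<in>set_mset M. F n)"
    proof (rule sum.mono_neutral_right)
      show "set_mset M \<subseteq> (\<lambda>n. n + k) ` S"
      proof
        fix n assume "n \<in># M"
        then have "{n - 1..n + 1} \<subseteq> S" using assms by (auto simp: hull_in_def)
        then have "n - k \<in> S" using k by auto
        then show "n \<in> (\<lambda>n. n + k) ` S" by force
      qed
    qed (use fin F in auto)
    finally show ?thesis .
  qed
  have "(\<Sum>n\<in>S. coeff (op_B z z' w w' n * g) M) = (\<Sum>n\<in>S. ?p (n + 1) + ?q (n + -1) - (?q (n + 0) + ?p (n + 0)))"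
    unfolding coeff_op_B_times by (rule sum.cong) (auto simp: algebra_simps)
  also have "\<dots> = (\<Sum>n\<in>S. ?p (n + 1)) + (\<Sum>n\<in>S. ?q (n + -1)) - ((\<Sum>n\<in>S. ?q (n + 0)) + (\<Sum>n\<in>S. ?p (n + 0)))"
    by (simp only: sum.distrib sum_subtractf)
  also have "\<dots> = (\<Sum>n\<in>set_mset M. ?p n) + (\<Sum>n\<in>set_mset M. ?q n)
      - ((\<Sum>n\<in>set_mset M. ?q n) + (\<Sum>n\<in>set_mset M. ?p n))"
    by (subst sh[of ?p], simp, simp, subst sh[of ?q], simp, simp, subst sh[of ?q], simp, simp, subst
      sh[of ?p], simp, simp, rule refl)
  finally show ?thesis by simp
qed

text \<open>By the product rule the extra terms are sums of \<open>op_As\<close> over one index and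
  of \<open>op_B\<close> over its index, and these vanish. Commuting with
  \<open>\<phi>_total\<close> gives the invariance of \<open>J\<close>.\<close>

lemma op_D_phi_total_times: "op_D z z' w w' (\<phi>_total * f) = \<phi>_total * op_D z z' w w' f"
proof (rule R_eqI)
  fix M
  obtain S where S: "hull_in M S" using ex_hull_in[of "{}"] by auto
  have S': "hull_in (M - {#m#}) S" for m using hull_in_subset[OF S] by simp
  let ?A = "\<lambda>n1 n2 g. coeff (op_As n1 n2 * g) M"
  have dd: "\<partial> n1 (\<partial> n2 (\<phi>_total * f)) = \<partial> n1 f + \<partial> n2 f + \<phi>_total * \<partial> n1 (\<partial> n2 f)" for n1 n2
    by (simp add: deriv_phi_times deriv_add)
  have "(\<Sum>n1\<in>S. \<Sum>n2\<in>S. ?A n1 n2 (\<partial> n1 (\<partial> n2 (\<phi>_total * f)))) =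
    (\<Sum>n1\<in>S. \<Sum>n2\<in>S. ?A n1 n2 (\<partial> n1 f)) + (\<Sum>n1\<in>S. \<Sum>n2\<in>S. ?A n1 n2 (\<partial> n2 f))
    + (\<Sum>n1\<in>S. \<Sum>n2\<in>S. ?A n1 n2 (\<phi>_total * \<partial> n1 (\<partial> n2 f)))"
    by (simp add: dd distrib_left sum.distrib)
  also have "(\<Sum>n1\<in>S. \<Sum>n2\<in>S. ?A n1 n2 (\<partial> n1 f)) = 0"
    by (simp add: sum_op_As_times_eq_0[OF S])
  also have "(\<Sum>n1\<in>S. \<Sum>n2\<in>S. ?A n1 n2 (\<partial> n2 f)) = 0"
    by (subst sum.swap) (simp add: op_As_commute[of _ "_::int"] sum_op_As_times_eq_0[OF S])
  finally have 1: "(\<Sum>n1\<in>S. \<Sum>n2\<in>S. ?A n1 n2 (\<partial> n1 (\<partial> n2 (\<phi>_total * f)))) =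
    (\<Sum>n1\<in>S. \<Sum>n2\<in>S. ?A n1 n2 (\<phi>_total * \<partial> n1 (\<partial> n2 f)))" by simp
  have 2: "(\<Sum>n\<in>S. coeff (op_B z z' w w' n * \<partial> n (\<phi>_total * f)) M) =
     (\<Sum>n\<in>S. coeff (op_B z z' w w' n * (\<phi>_total * \<partial> n f)) M)"
    by (simp add: deriv_phi_times distrib_left sum.distrib sum_op_B_times_eq_0[OF S])
  have "coeff (op_D z z' w w' (\<phi>_total * f)) M =
    (\<Sum>n1\<in>S. \<Sum>n2\<in>S. coeff (\<phi>_total * (op_As n1 n2 * \<partial> n1 (\<partial> n2 f))) M) +
    (\<Sum>n\<in>S. coeff (\<phi>_total * (op_B z z' w w' n * \<partial> n f)) M)"
    unfolding coeff_op_D[OF S] 1 2 by (simp only: mult.left_commute)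
  also have "\<dots> = (\<Sum>m\<in>set_mset M. coeff (op_D z z' w w' f) (M - {#m#}))"
    unfolding coeff_op_D[OF S'] coeff_phi_total_times sum.distrib
  proof (intro arg_cong2[of _ _ _ _ "(+)"])
    have sw: "(\<Sum>n1\<in>S. \<Sum>n2\<in>S. \<Sum>m\<in>T. F n1 n2 m) = (\<Sum>m\<in>T. \<Sum>n1\<in>S. \<Sum>n2\<in>S. F n1 n2 m)"
      for F :: "int \<Rightarrow> int \<Rightarrow> int \<Rightarrow> complex" and T
    proof -
      have "(\<Sum>n1\<in>S. \<Sum>n2\<in>S. \<Sum>m\<in>T. F n1 n2 m) = (\<Sum>n1\<in>S. \<Sum>m\<in>T. \<Sum>n2\<in>S. F n1 n2 m)"
        by (intro sum.cong refl sum.swap)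
      also have "\<dots> = (\<Sum>m\<in>T. \<Sum>n1\<in>S. \<Sum>n2\<in>S. F n1 n2 m)" by (rule sum.swap)
      finally show ?thesis .
    qed
    show "(\<Sum>n1\<in>S. \<Sum>n2\<in>S. \<Sum>m\<in>set_mset M. coeff (op_As n1 n2 * \<partial> n1 (\<partial> n2 f)) (M - {#m#})) =
      (\<Sum>m\<in>set_mset M. \<Sum>n1\<in>S. \<Sum>n2\<in>S. coeff (op_As n1 n2 * \<partial> n1 (\<partial> n2 f)) (M - {#m#}))"
      by (rule sw)
  qed (rule sum.swap)
  also have "\<dots> = coeff (\<phi>_total * op_D z z' w w' f) M"
    by (simp add: coeff_phi_total_times)
  finally show "coeff (op_D z z' w w' (\<phi>_total * f)) M = coeff (\<phi>_total * op_D z z' w w' f) M" .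
qed

lemma op_Dhat_cls: "op_Dhat z z' w w' (cls f) = cls (op_D z z' w w' f)"
proof -
  have J: "op_D z z' w w' f - op_D z z' w w' g \<in> J" if fg: "f - g \<in> J" for f g
  proof -
    obtain h where "f - g = (\<phi>_total - 1) * h" using fg unfolding J_def by blast
    then have "op_D z z' w w' f - op_D z z' w w' g = (\<phi>_total - 1) * op_D z z' w w' h"
      unfolding op_D_diff[symmetric] by (simp add: left_diff_distrib op_D_phi_total_times op_D_diff)
    then show ?thesis by (simp add: J_def)
  qed
  show ?thesis
    unfolding op_Dhat_def
    by (rule the_equality) (auto simp: Rhat.abs_eq_iff J J_closed(1))
qed

subsection \<open>The operator on monomials\<close>

lemma sum_mset_eq_sum_count:
  fixes F :: "'a \<Rightarrow> 'b::semiring_1"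
  assumes "finite S" "set_mset A \<subseteq> S"
  shows "(\<Sum>x\<in>#A. F x) = (\<Sum>x\<in>S. of_nat (count A x) * F x)"
  using assms(2)
proof (induction A)
  case (add a A)
  have "(\<Sum>x\<in>S. of_nat (count (add_mset a A) x) * F x) =
    (\<Sum>x\<in>S. of_nat (count A x) * F x + (if x = a then F x else 0))"
    by (rule sum.cong) (auto simp: algebra_simps)
  with add assms(1) show ?case by (simp add: sum.distrib add.commute)
qed simp

lemma sum_deriv_mon:
  assumes "finite S" "set_mset A \<subseteq> S"
  shows "(\<Sum>n\<in>S. X n * \<partial> n (mon A)) = (\<Sum>n\<in>#A. X n * mon (A - {#n#}))"
proof -
  have "(\<Sum>n\<in>S. X n * \<partial> n (mon A)) = (\<Sum>n\<in>set_mset A. X n * \<partial> n (mon A))"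
    by (rule sum.mono_neutral_right) (use assms in \<open>auto simp: deriv_mon not_in_iff\<close>)
  also have "\<dots> = (\<Sum>n\<in>set_mset A. of_nat (count A n) * (X n * mon (A - {#n#})))"
    by (simp add: deriv_mon algebra_simps)
  also have "\<dots> = (\<Sum>n\<in>#A. X n * mon (A - {#n#}))"
    by (simp add: sum_mset_eq_sum_count[of "set_mset A"])
  finally show ?thesis .
qed

text \<open>Differentiation brings down multiplicities; summing over the multiset, each entry as
  often as it occurs, absorbs them. Removing one copy of n2 in the inner sum accounts for two
  derivatives in the same variable.\<close>

lemma op_D_mon:
  "op_D z z' w w' (mon A) =
     (\<Sum>n2\<in>#A. \<Sum>n1\<in>#A - {#n2#}. op_As n1 n2 * mon (A - {#n2#} - {#n1#}))
     + (\<Sum>n\<in>#A. op_B z z' w w' n * mon (A - {#n#}))"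
proof (rule R_eqI)
  fix M
  obtain S where S: "hull_in M S" "set_mset A \<subseteq> S" using ex_hull_in[of "set_mset A"] by auto
  have fin: "finite S" using S by (simp add: hull_in_def)
  have "(\<Sum>n1\<in>S. \<Sum>n2\<in>S. op_As n1 n2 * \<partial> n1 (\<partial> n2 (mon A))) =
     (\<Sum>n2\<in>S. (\<Sum>n1\<in>S. op_As n1 n2 * \<partial> n1 (mon (A - {#n2#}))) * of_nat (count A n2))"
  proof -
    have c: "\<partial> n1 (of_nat k * f) = \<partial> n1 f * of_nat k" for n1 k f
      by (simp add: of_nat_eq_scale[of k] scale_mult_left scale_mult_right deriv_scale)
    show ?thesis
      by (subst sum.swap) (simp add: deriv_mon[of _ A] c sum_distrib_right mult.assoc)
  qed
  also have "\<dots> = (\<Sum>n2\<in>S. (\<Sum>n1\<in>#A - {#n2#}. op_As n1 n2 * mon (A - {#n2#} - {#n1#})) * of_nat (count A n2))"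
    by (intro sum.cong refl arg_cong2[of _ _ _ _ "(*)"] sum_deriv_mon fin) (use S(2) in \<open>auto dest: in_diffD\<close>)
  also have "\<dots> = (\<Sum>n2\<in>set_mset A. (\<Sum>n1\<in>#A - {#n2#}. op_As n1 n2 * mon (A - {#n2#} - {#n1#})) *
      of_nat (count A n2))"
    by (rule sum.mono_neutral_right) (use S fin in \<open>auto simp: not_in_iff\<close>)
  also have "\<dots> = (\<Sum>n2\<in>#A. \<Sum>n1\<in>#A - {#n2#}. op_As n1 n2 * mon (A - {#n2#} - {#n1#}))"
    by (simp add: sum_mset_eq_sum_count[of "set_mset A" A] mult.commute)
  finally have 1: "(\<Sum>n1\<in>S. \<Sum>n2\<in>S. op_As n1 n2 * \<partial> n1 (\<partial> n2 (mon A))) =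
     (\<Sum>n2\<in>#A. \<Sum>n1\<in>#A - {#n2#}. op_As n1 n2 * mon (A - {#n2#} - {#n1#}))" .
  show "coeff (op_D z z' w w' (mon A)) M
      = coeff ((\<Sum>n2\<in>#A. \<Sum>n1\<in>#A - {#n2#}. op_As n1 n2 * mon (A - {#n2#} - {#n1#}))
     + (\<Sum>n\<in>#A. op_B z z' w w' n * mon (A - {#n#}))) M"
    unfolding coeff_op_D[OF S(1)] 1[symmetric] sum_deriv_mon[OF fin S(2), symmetric] by simp
qed

lemma op_D_prod_phi:
  assumes "finite I"
  shows "op_D z z' w w' (\<Prod>i\<in>I. \<phi> (m i)) =
     (\<Sum>i\<in>I. \<Sum>j\<in>I - {i}. op_As (m i) (m j) * (\<Prod>k\<in>I - {i, j}. \<phi> (m k)))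
     + (\<Sum>i\<in>I. op_B z z' w w' (m i) * (\<Prod>k\<in>I - {i}. \<phi> (m k)))"
proof -
  have d: "image_mset m (mset_set I) - {#m i#} = image_mset m (mset_set (I - {i}))" if "i \<in> I" "finite I"
    for i I
    using that by (simp add: mset_set.remove)
  have s: "(\<Sum>n\<in>#image_mset m (mset_set I). F n) = (\<Sum>i\<in>I. F (m i))" for F :: "int \<Rightarrow> R" and I
    by (simp add: sum_unfold_sum_mset image_mset.compositionality comp_def)
  show ?thesis
    unfolding mon_prod[OF assms] op_D_mon s
  proof (intro arg_cong2[of _ _ _ _ "(+)"] sum.cong refl)
    fix i assume i: "i \<in> I"
    show "op_B z z' w w' (m i) * mon (image_mset m (mset_set I) - {#m i#}) =
      op_B z z' w w' (m i) * (\<Prod>k\<in>I - {i}. \<phi> (m k))"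
      using assms by (simp add: mon_prod d i)
    have "(\<Sum>n1\<in>#image_mset m (mset_set (I - {i})). op_As n1 (m i) *
        mon (image_mset m (mset_set (I - {i})) - {#n1#}))
       = (\<Sum>j\<in>I - {i}. op_As (m j) (m i) * mon (image_mset m (mset_set (I - {i})) - {#m j#}))"
      by (rule s)
    also have "\<dots> = (\<Sum>j\<in>I - {i}. op_As (m i) (m j) * (\<Prod>k\<in>I - {i, j}. \<phi> (m k)))"
    proof (rule sum.cong[OF refl])
      fix j assume j: "j \<in> I - {i}"
      have "I - {i} - {j} = I - {i, j}" by auto
      then show "op_As (m j) (m i) * mon (image_mset m (mset_set (I - {i})) - {#m j#}) =
        op_As (m i) (m j) * (\<Prod>k\<in>I - {i, j}. \<phi> (m k))"
        using assms j by (simp add: mon_prod d op_As_commute)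
    qed
    finally show "(\<Sum>n1\<in>#image_mset m (mset_set I) - {#m i#}. op_As n1 (m i) *
        mon (image_mset m (mset_set I) - {#m i#} - {#n1#}))
      = (\<Sum>j\<in>I - {i}. op_As (m i) (m j) * (\<Prod>k\<in>I - {i, j}. \<phi> (m k)))"
      using assms i by (simp only: d)
  qed
qed

subsection \<open>Laurent polynomials\<close>

text \<open>Exponents are functions on all of \<open>nat\<close>; only the variables with index below \<open>N\<close> will occur.\<close>

type_synonym laurent = "(nat \<Rightarrow> int) \<Rightarrow>\<^sub>0 complex"

abbreviation umon :: "(nat \<Rightarrow> int) \<Rightarrow> laurent" where
  "umon m \<equiv> Poly_Mapping.single m 1"

lemma laurent_induct [case_names zero add]:
  fixes Q :: laurent
  assumes "P 0" and "\<And>m c Q. P Q \<Longrightarrow> P (Poly_Mapping.single m c + Q)"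
  shows "P Q"
proof (induction Q rule: update_induct)
  case (update f a b)
  have "Poly_Mapping.update a b f = Poly_Mapping.single a b + f"
    using update(1) by (intro poly_mapping_eqI)
      (auto simp: lookup_update lookup_add lookup_single when_def in_keys_iff)
  with assms(2) update show ?case by metis
qed (fact assms(1))

definition lin :: "((nat \<Rightarrow> int) \<Rightarrow> R) \<Rightarrow> laurent \<Rightarrow> R" where
  "lin W P = (\<Sum>m\<in>Poly_Mapping.keys P. Poly_Mapping.lookup P m \<bullet>\<^sub>R W m)"

lemma lin_superset:
  assumes "finite S" "Poly_Mapping.keys P \<subseteq> S"
  shows "lin W P = (\<Sum>m\<in>S. Poly_Mapping.lookup P m \<bullet>\<^sub>R W m)"
  unfolding lin_def by (rule sum.mono_neutral_left) (use assms in \<open>auto simp: in_keys_iff scale_zero\<close>)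

lemma lin_add: "lin W (P + Q) = lin W P + lin W Q"
proof -
  let ?S = "Poly_Mapping.keys P \<union> Poly_Mapping.keys Q"
  have "lin W (P + Q) = (\<Sum>m\<in>?S. Poly_Mapping.lookup (P + Q) m \<bullet>\<^sub>R W m)"
    by (rule lin_superset) (auto simp: keys_add)
  also have "\<dots> = (\<Sum>m\<in>?S. Poly_Mapping.lookup P m \<bullet>\<^sub>R W m) + (\<Sum>m\<in>?S. Poly_Mapping.lookup Q m \<bullet>\<^sub>R W m)"
    by (simp add: lookup_add scale_add_left sum.distrib)
  also have "\<dots> = lin W P + lin W Q" by (simp add: lin_superset[of ?S])
  finally show ?thesis .
qed

lemma lin_single: "lin W (Poly_Mapping.single m c) = c \<bullet>\<^sub>R W m"
  by (subst lin_superset[of "{m}"]) (auto simp: lookup_single)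

lemma lin_zero [simp]: "lin W 0 = 0"
  by (simp add: lin_def)

lemma lin_minus: "lin W (- P) = - lin W P"
  using lin_add[of W P "- P"] by (simp add: eq_neg_iff_add_eq_0 add.commute)

lemma lin_diff: "lin W (P - Q) = lin W P - lin W Q"
  using lin_add[of W P "- Q"] by (simp add: lin_minus)

lemma lin_sum: "lin W (\<Sum>i\<in>I. F i) = (\<Sum>i\<in>I. lin W (F i))"
  by (induction I rule: infinite_finite_induct) (auto simp: lin_add)

lemma of_int_laurent: "(of_int k :: laurent) = Poly_Mapping.single 0 (of_int k)"
  by (simp add: single_of_int)

lemma lin_of_int_times: "lin W (of_int k * P) = of_int k * lin W P"
proof (induction P rule: laurent_induct)
  case (add m c Q)
  then show ?case
    by (simp add: distrib_left lin_add of_int_laurent mult_single lin_single of_int_times scale_scale del: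
      single_of_int)
qed simp

text \<open>The Euler operator \<open>u\<^sub>i \<partial>/\<partial>u\<^sub>i\<close>.\<close>

definition theta :: "nat \<Rightarrow> laurent \<Rightarrow> laurent" where
  "theta i = Poly_Mapping.mapp (\<lambda>m c. of_int (m i) * c)"

lemma lookup_theta: "Poly_Mapping.lookup (theta i P) m = of_int (m i) * Poly_Mapping.lookup P m"
  by (auto simp: theta_def lookup_mapp when_def in_keys_iff)

lemma theta_add: "theta i (P + Q) = theta i P + theta i Q"
  and theta_diff: "theta i (P - Q) = theta i P - theta i Q"
  and theta_zero [simp]: "theta i 0 = 0"
  and theta_single: "theta i (Poly_Mapping.single m c) = Poly_Mapping.single m (of_int (m i) * c)"
  by (rule poly_mapping_eqI; simp add: lookup_theta lookup_add lookup_minus lookup_single when_def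
    algebra_simps)+

lemma theta_minus: "theta i (- P) = - theta i P"
  using theta_diff[of i 0 P] by simp

lemma theta_sum: "theta i (\<Sum>k\<in>I. F k) = (\<Sum>k\<in>I. theta i (F k))"
  by (induction I rule: infinite_finite_induct) (auto simp: theta_add)

lemma theta_mult: "theta i (P * Q) = theta i P * Q + P * theta i Q"
proof (induction P rule: laurent_induct)
  case (add m c P)
  have "theta i (Poly_Mapping.single m c * Q) = theta i (Poly_Mapping.single m c) * Q
      + Poly_Mapping.single m c * theta i Q"
  proof (induction Q rule: laurent_induct)
    case (add m' c' Q)
    have key: "theta i (Poly_Mapping.single m c * Poly_Mapping.single m' c') =
      theta i (Poly_Mapping.single m c) * Poly_Mapping.single m' c' + Poly_Mapping.single m c *
        theta i (Poly_Mapping.single m' c')"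
      unfolding mult_single theta_single single_add[symmetric] by (simp add: algebra_simps)
    show ?case unfolding distrib_left theta_add add.IH key by (simp only: ac_simps)
  qed simp
  with add show ?case by (simp add: distrib_right theta_add algebra_simps)
qed simp

lemma theta_of_int_times: "theta i (of_int k * P) = of_int k * theta i P"
  by (simp add: theta_mult of_int_laurent theta_single del: single_of_int)

lemma theta_prod:
  assumes "finite S"
  shows "theta i (\<Prod>p\<in>S. F p) = (\<Sum>p\<in>S. theta i (F p) * (\<Prod>q\<in>S - {p}. F q))"
  using assms
proof (induction S rule: finite_induct)
  case empty
  have "theta i 1 = 0" using theta_single[of i 0 1] by simp
  then show ?case by simp
next
  case (insert a S)
  have "(\<Sum>p\<in>S. theta i (F p) * (\<Prod>q\<in>insert a S - {p}. F q)) = F a * (\<Sum>p\<in>S. theta i (F p) * (\<Prod>q\<in>S - {p}. F q))"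
    unfolding sum_distrib_left
  proof (rule sum.cong[OF refl])
    fix p assume "p \<in> S"
    then have "insert a S - {p} = insert a (S - {p})" using insert by auto
    with insert show "theta i (F p) * (\<Prod>q\<in>insert a S - {p}. F q) = F a * (theta i (F p) * (\<Prod>q\<in>S - {p}. F q))"
      by (simp add: mult.left_commute)
  qed
  with insert show ?case by (simp add: theta_mult)
qed

definition ei :: "nat \<Rightarrow> nat \<Rightarrow> int" where
  "ei i = (\<lambda>k. if k = i then 1 else 0)"

lemma ei_simps [simp]: "ei i i = 1" "k \<noteq> i \<Longrightarrow> ei i k = 0"
  by (auto simp: ei_def)

abbreviation X :: "nat \<Rightarrow> laurent" where "X i \<equiv> umon (ei i)"
abbreviation Xi :: "nat \<Rightarrow> laurent" where "Xi i \<equiv> umon (- ei i)"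

lemma umon_mult: "umon m * umon k = umon (m + k)"
  by (simp add: mult_single)

lemma X_Xi: "X i * Xi i = 1"
  by (simp add: umon_mult)

lemma theta_umon: "theta i (umon m) = of_int (m i) * umon m"
  by (simp add: theta_single of_int_laurent mult_single del: single_of_int)

lemma theta_X: "theta i (X i) = X i" "j \<noteq> i \<Longrightarrow> theta i (X j) = 0" "theta i (Xi i) = - Xi i"
    "theta i 1 = 0"
proof -
  show "theta i (X i) = X i" unfolding theta_umon by simp
  show "j \<noteq> i \<Longrightarrow> theta i (X j) = 0" unfolding theta_umon by simp
  show "theta i (Xi i) = - Xi i" unfolding theta_umon by simp
  have "theta i (umon 0) = 0" unfolding theta_umon by simp
  then show "theta i 1 = 0" by simp
qed

subsection \<open>The pair interaction\<close>

text \<open>Under the linear map sending \<open>u\<^sub>1\<^sup>a u\<^sub>2\<^sup>b\<close> to \<open>op_As a b\<close>, the left-hand side is the image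
  of \<open>(u\<^sub>2 - u\<^sub>1) u\<^sub>1\<^sup>a u\<^sub>2\<^sup>b\<close> for \<open>a = n1 - 1\<close> and \<open>b = n2 - 1\<close>.\<close>

lemma op_As_recurrence:
  "op_As (n1 - 1) n2 - op_As n1 (n2 - 1) =
     of_int (n1 - n2) * (\<phi> n1 * \<phi> n2 + \<phi> (n1 - 1) * \<phi> (n2 - 1))
     - of_int (n1 - 1 - n2) * (\<phi> (n1 - 1) * \<phi> n2)
     - of_int (n1 - n2 + 1) * (\<phi> n1 * \<phi> (n2 - 1))"
proof -
  have gt: "op_As (n1 - 1) n2 - op_As n1 (n2 - 1) =
     of_int (n1 - n2) * (\<phi> n1 * \<phi> n2 + \<phi> (n1 - 1) * \<phi> (n2 - 1))
     - of_int (n1 - 1 - n2) * (\<phi> (n1 - 1) * \<phi> n2)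
     - of_int (n1 - n2 + 1) * (\<phi> n1 * \<phi> (n2 - 1))" (is "?L = ?R") if g: "n1 > n2" for n1 n2
  proof (rule R_eqI)
    fix M
    have As: "op_As (n1 - 1) n2 = op_A (n1 - 1) n2" "op_As n1 (n2 - 1) = op_A n1 (n2 - 1)"
      using g by (cases "n1 - 1 = n2"; auto simp: op_As_def max_def min_def)+
    show "coeff ?L M = coeff ?R M"
    proof (cases "size M = 2")
      case True
      then obtain x y where xy: "x \<ge> y" "M = {#x, y#}" by (rule mset_size2_cases)
      have c: "cA (n1 - 1) n2 x y - cA n1 (n2 - 1) x y =
         (if x = n1 \<and> y = n2 then n1 - n2 else 0) + (if x = n1 - 1 \<and> y = n2 - 1 then n1 - n2 else 0)
         - (if x = n1 - 1 \<and> y = n2 then n1 - 1 - n2 else 0)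
         - (if x = n1 \<and> y = n2 - 1 then n1 - n2 + 1 else 0)"
      proof -
        consider "x + y = n1 + n2" | "x + y = n1 + n2 - 2" | "x + y = n1 + n2 - 1"
          | "x + y \<noteq> n1 + n2" "x + y \<noteq> n1 + n2 - 2" "x + y \<noteq> n1 + n2 - 1" by blast
        then show ?thesis by cases (auto simp: cA_def)
      qed
      have "coeff ?L M = of_int (cA (n1 - 1) n2 x y - cA n1 (n2 - 1) x y)"
        unfolding As xy(2) using g xy(1) by (simp add: coeff_op_A)
      moreover have "coeff ?R M
          = of_int ((if x = n1 \<and> y = n2 then n1 - n2 else 0) +
            (if x = n1 - 1 \<and> y = n2 - 1 then n1 - n2 else 0)
         - (if x = n1 - 1 \<and> y = n2 then n1 - 1 - n2 else 0)
         - (if x = n1 \<and> y = n2 - 1 then n1 - n2 + 1 else 0))"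
        unfolding coeff_simps coeff_scale_phi2 coeff_scale_phi2' xy(2)
        using g xy(1) by (simp add: pair_mset_eq)
      ultimately show ?thesis unfolding c by simp
    next
      case False
      then have "M \<noteq> {#a, b#}" for a b by auto
      with False show ?thesis
        unfolding coeff_simps coeff_scale_phi2 coeff_scale_phi2' As by (simp add: coeff_op_A_size)
    qed
  qed
  \<comment> \<open>Exchanging n1 and n2 changes the sign of both sides, so only n1 > n2 needs the
    coefficients; for n1 = n2 both sides vanish.\<close>
  consider "n1 > n2" | "n1 = n2" | "n1 < n2" by linarith
  then show ?thesis
  proof cases
    case 1 then show ?thesis by (rule gt)
  next
    case 2
    have "op_As (n1 - 1) n1 = op_As n1 (n1 - 1)" by (rule op_As_commute)
    then show ?thesis unfolding 2[symmetric] by (simp add: algebra_simps)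
  next
    case 3
    then show ?thesis using gt[OF 3] op_As_commute[of "n2 - 1" n1] op_As_commute[of n2 "n1 - 1"]
      by (simp add: algebra_simps)
  qed
qed

definition WN :: "nat \<Rightarrow> (nat \<Rightarrow> int) \<Rightarrow> R" where
  "WN N m = (\<Prod>k<N. \<phi> (m k))"

text \<open>The image of a monomial after its variables i and j have been contracted to the
  coefficient \<open>op_As\<close>, which is one summand of \<open>op_D\<close> on the corresponding
  product of \<phi>.\<close>

definition WA :: "nat \<Rightarrow> nat \<Rightarrow> nat \<Rightarrow> (nat \<Rightarrow> int) \<Rightarrow> R" where
  "WA N i j m = op_As (m i) (m j) * (\<Prod>k\<in>{..<N} - {i, j}. \<phi> (m k))"

lemma WN_split2:
  assumes "i < N" "j < N" "i \<noteq> j"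
  shows "WN N m = \<phi> (m i) * \<phi> (m j) * (\<Prod>k\<in>{..<N} - {i, j}. \<phi> (m k))"
proof -
  have "{..<N} - {i} - {j} = {..<N} - {i, j}" by auto
  then show ?thesis unfolding WN_def using assms
    by (subst prod.remove[of _ i], simp, simp, subst prod.remove[of _ j]) (auto simp: mult.assoc)
qed

text \<open>This is \<open>op_As_recurrence\<close> with n1 = m i + 1 and n2 = m j + 1: its
  right-hand side is the image of (theta i - theta j) applied to (u_i - 1)(u_j - 1) times the
  monomial, since theta i - theta j multiplies a monomial by the difference of the two
  exponents.\<close>

lemma lin_WA:
  assumes ij: "i < N" "j < N" "i \<noteq> j"
  shows "lin (WA N i j) ((X j - X i) * Q)
      = lin (WN N) (theta i ((X i - 1) * (X j - 1) * Q) - theta j ((X i - 1) * (X j - 1) * Q))"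
proof (induction Q rule: laurent_induct)
  case (add m c Q)
  have "lin (WA N i j) ((X j - X i) * Poly_Mapping.single m c) =
    lin (WN N) (theta i ((X i - 1) * (X j - 1) * Poly_Mapping.single m c) -
      theta j ((X i - 1) * (X j - 1) * Poly_Mapping.single m c))"
  proof -
    let ?P = "\<Prod>k\<in>{..<N} - {i, j}. \<phi> (m k)"
    let ?s = "\<lambda>m. Poly_Mapping.single m c"
    have prod_eq: "(\<Prod>k\<in>{..<N} - {i, j}. \<phi> (m' k)) = ?P" if "\<And>k. k \<noteq> i \<Longrightarrow> k \<noteq> j \<Longrightarrow> m' k = m k" for m'
      by (rule prod.cong) (use that in auto)
    have 1: "(X j - X i) * ?s m = ?s (m + ei j) - ?s (m + ei i)"
      by (simp add: algebra_simps mult_single)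
    have 2: "(X i - 1) * (X j - 1) * ?s m = ?s (m + ei i + ei j) - ?s (m + ei i) - ?s (m + ei j) + ?s m"
      by (simp add: algebra_simps mult_single)
    have L: "lin (WA N i j) ((X j - X i) * ?s m) =
       c \<bullet>\<^sub>R ((op_As (m i + 1 - 1) (m j + 1) - op_As (m i + 1) (m j + 1 - 1)) * ?P)"
    proof -
      have W1: "WA N i j (m + ei j) = op_As (m i) (m j + 1) * ?P"
        and W2: "WA N i j (m + ei i) = op_As (m i + 1) (m j) * ?P"
        unfolding WA_def using ij by (simp_all add: prod_eq[of "m + ei j"] prod_eq[of "m + ei i"])
      have "c \<bullet>\<^sub>R (a * ?P) - c \<bullet>\<^sub>R (b * ?P) = c \<bullet>\<^sub>R ((a - b) * ?P)" for a b
        unfolding left_diff_distrib by (rule R_eqI) (simp add: right_diff_distrib)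
      then show ?thesis unfolding 1 lin_diff lin_single W1 W2 by simp
    qed
    have R: "lin (WN N) (theta i ((X i - 1) * (X j - 1) * ?s m) - theta j ((X i - 1) * (X j - 1) * ?s m))
      = c \<bullet>\<^sub>R ((of_int (m i + 1 - (m j + 1)) * (\<phi> (m i + 1) * \<phi> (m j + 1) + \<phi> (m i + 1 - 1) * \<phi> (m j + 1 - 1))
     - of_int (m i + 1 - 1 - (m j + 1)) * (\<phi> (m i + 1 - 1) * \<phi> (m j + 1))
     - of_int (m i + 1 - (m j + 1) + 1) * (\<phi> (m i + 1) * \<phi> (m j + 1 - 1))) * ?P)"
    proof -
      have W: "WN N (m + ei i + ei j) = \<phi> (m i + 1) * \<phi> (m j + 1) * ?P" "WN N (m + ei i)
          = \<phi> (m i + 1) * \<phi> (m j) * ?P"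
        "WN N (m + ei j) = \<phi> (m i) * \<phi> (m j + 1) * ?P" "WN N m = \<phi> (m i) * \<phi> (m j) * ?P"
        unfolding WN_split2[OF ij] using ij
          by (simp_all add: prod_eq[of "m + ei i + ei j"] prod_eq[of "m + ei j"] prod_eq[of "m + ei i"])
      have e: "(m + ei i + ei j) i = m i + 1" "(m + ei i + ei j) j = m j + 1" "(m + ei i) i = m i + 1"
         "(m + ei i) j = m j" "(m + ei j) i = m i" "(m + ei j) j = m j + 1" using ij by auto
      show ?thesis
        unfolding 2
        unfolding theta_add theta_diff theta_single lin_diff lin_add lin_single W e of_int_times
          left_diff_distrib distrib_left
          distrib_right scale_mult_left scale_add add_diff_cancel_right'
        by (rule R_eqI) (simp add: algebra_simps)
    qed
    show ?thesis unfolding L R op_As_recurrence ..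
  qed
  with add show ?case by (simp add: distrib_left theta_add lin_add lin_diff)
qed simp

subsection \<open>The alternant and its logarithmic derivative\<close>

definition pairs :: "nat \<Rightarrow> (nat \<times> nat) set" where
  "pairs N = {(i, j). i < j \<and> j < N}"

lemma finite_pairs [simp]: "finite (pairs N)"
  by (rule finite_subset[of _ "{..<N} \<times> {..<N}"]) (auto simp: pairs_def)

definition alt :: "nat \<Rightarrow> laurent" where
  "alt N = (\<Prod>(i, j)\<in>pairs N. X j - X i)"

text \<open>The quotient of \<open>alt N\<close> by \<open>u\<^sub>j - u\<^sub>i\<close>, for \<open>i \<noteq> j\<close> in either order.\<close>

definition alt_div :: "nat \<Rightarrow> nat \<Rightarrow> nat \<Rightarrow> laurent" where
  "alt_div N i j = (if i < j then (\<Prod>(k, l)\<in>pairs N - {(i, j)}. X l - X k)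
     else - (\<Prod>(k, l)\<in>pairs N - {(j, i)}. X l - X k))"

lemma alt_div_antisym: "i \<noteq> j \<Longrightarrow> alt_div N j i = - alt_div N i j"
  by (auto simp: alt_div_def)

lemma alt_eq_mult_div:
  assumes "i < N" "j < N" "i \<noteq> j"
  shows "alt N = (X j - X i) * alt_div N i j"
proof -
  have *: "alt N = (X j - X i) * alt_div N i j" if "i < j" "j < N" for i j
    using that unfolding alt_def alt_div_def
    by (subst prod.remove[of _ "(i, j)"]) (use finite_pairs[of N] in \<open>auto simp: pairs_def\<close>)
  show ?thesis
  proof (cases "i < j")
    case False
    then have "alt N = (X i - X j) * alt_div N j i" using * assms by auto
    with assms show ?thesis by (simp add: alt_div_antisym[of j i] algebra_simps)
  qed (use * assms in auto)
qed

text \<open>By the product rule only the N - 1 factors containing u_i survive. The sign convention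
  of \<open>alt_div\<close> makes each of them contribute - u_i times the quotient, in whichever
  order the pair occurs.\<close>

lemma theta_alt:
  assumes i: "i < N"
  shows "theta i (alt N) = - X i * (\<Sum>j\<in>{..<N} - {i}. alt_div N i j)"
proof -
  let ?F = "\<lambda>p. theta i (X (snd p) - X (fst p)) * (\<Prod>q\<in>pairs N - {p}. X (snd q) - X (fst q))"
  let ?h = "\<lambda>j. if i < j then (i, j) else (j, i)"
  have "theta i (alt N) = (\<Sum>p\<in>pairs N. ?F p)"
    unfolding alt_def case_prod_unfold by (rule theta_prod) simp
  also have "\<dots> = (\<Sum>p\<in>?h ` ({..<N} - {i}). ?F p)"
  proof (rule sum.mono_neutral_right)
    show "?h ` ({..<N} - {i}) \<subseteq> pairs N" using i by (auto simp: pairs_def)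
    show "\<forall>p\<in>pairs N - ?h ` ({..<N} - {i}). ?F p = 0"
    proof
      fix p assume p: "p \<in> pairs N - ?h ` ({..<N} - {i})"
      have "fst p \<noteq> i"
      proof
        assume "fst p = i"
        with p have "p = ?h (snd p)" "snd p \<in> {..<N} - {i}" by (auto simp: pairs_def)
        with p show False by blast
      qed
      moreover have "snd p \<noteq> i"
      proof
        assume "snd p = i"
        with p have "p = ?h (fst p)" "fst p \<in> {..<N} - {i}" by (auto simp: pairs_def)
        with p show False by blast
      qed
      ultimately show "?F p = 0" by (simp add: theta_diff theta_X(2))
    qed
  qed simp
  also have "\<dots> = (\<Sum>j\<in>{..<N} - {i}. ?F (?h j))"
    by (rule sum.reindex[unfolded comp_def]) (auto simp: inj_on_def split: if_splits)
  also have "\<dots> = (\<Sum>j\<in>{..<N} - {i}. - X i * alt_div N i j)"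
  proof (rule sum.cong[OF refl])
    fix j assume j: "j \<in> {..<N} - {i}"
    show "?F (?h j) = - X i * alt_div N i j"
      using j by (cases "i < j") (auto simp: alt_div_def theta_diff theta_X case_prod_unfold)
  qed
  finally show ?thesis by (simp only: sum_distrib_left)
qed

text \<open>Exponents from N on are set to 0, as in \<open>Ux\<close>: exponent functions that
  differ there would be different monomials.\<close>

definition mm :: "nat \<Rightarrow> (nat \<Rightarrow> int) \<Rightarrow> (nat \<Rightarrow> nat) \<Rightarrow> nat \<Rightarrow> int" where
  "mm N x p = (\<lambda>k. if k < N then x k + int (p k) else 0)"

definition Ux :: "nat \<Rightarrow> (nat \<Rightarrow> int) \<Rightarrow> laurent" where
  "Ux N x = umon (\<lambda>k. if k < N then x k else 0)"

lemma umon_const_zero: "umon (\<lambda>k. 0) = 1"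
  using single_one[where 'a = "nat \<Rightarrow> int" and 'b = complex] by (simp add: zero_fun_def)

lemma X_power: "X i ^ n = umon (\<lambda>k. if k = i then int n else 0)"
proof (induction n)
  case (Suc n)
  have "ei i + (\<lambda>k. if k = i then int n else 0) = (\<lambda>k. if k = i then int (Suc n) else 0)"
    by (rule ext) (simp add: ei_def)
  with Suc show ?case by (simp add: umon_mult)
next
  case 0
  have "(\<lambda>k. if k = i then int 0 else 0) = (\<lambda>k. 0)" by (rule ext) simp
  then show ?case by (simp only: umon_const_zero power_0)
qed

lemma prod_X_power: "finite I \<Longrightarrow> (\<Prod>i\<in>I. X i ^ q i) = umon (\<lambda>k. if k \<in> I then int (q k) else 0)"
proof (induction I rule: finite_induct)
  case (insert a I)
  have "(\<lambda>k. if k = a then int (q a) else 0) + (\<lambda>k. if k \<in> I then int (q k) else 0) =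
    (\<lambda>k. if k \<in> insert a I then int (q k) else 0)"
    by (rule ext) (use insert in auto)
  with insert show ?case by (simp add: X_power umon_mult)
qed (simp add: umon_const_zero)

text \<open>The Leibniz expansion of the Vandermonde determinant, shifted by x.
  \<open>lin (WN N)\<close> sends it to the determinant \<open>jt N x\<close>.\<close>

lemma Ux_alt: "Ux N x * alt N = (\<Sum>p | p permutes {..<N}. of_int (sign p) * umon (mm N x p))"
proof -
  have "alt N = (\<Prod>j<N. \<Prod>i<j. X j - X i)"
    unfolding alt_def by (subst prod.Sigma) (auto intro!: prod.reindex_bij_witness[where i = prod.swap
      and j = prod.swap] simp: pairs_def)
  also have "\<dots> = ldet N (\<lambda>i j. X i ^ j)" by (rule vandermonde[symmetric])
  also have "\<dots> = (\<Sum>p | p permutes {..<N}. of_int (sign p) * umon (\<lambda>k. if k \<in> {..<N} then int (p k) else 0))"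
    unfolding ldet_def by (simp add: prod_X_power)
  finally have "Ux N x * alt N
      = (\<Sum>p | p permutes {..<N}. of_int (sign p) * (Ux N x * umon (\<lambda>k. if k \<in> {..<N} then int (p k) else 0)))"
    by (simp only: sum_distrib_left mult.left_commute)
  moreover have "Ux N x * umon (\<lambda>k. if k \<in> {..<N} then int (p k) else 0) = umon (mm N x p)" for p
  proof -
    have "(\<lambda>k. if k < N then x k else 0) + (\<lambda>k. if k \<in> {..<N} then int (p k) else 0) = mm N x p"
      by (rule ext) (simp add: mm_def)
    then show ?thesis by (simp add: Ux_def umon_mult)
  qed
  ultimately show ?thesis by (simp only:)
qed

text \<open>What theta i is applied to when \<open>lin_WA\<close> is used on \<open>alt N\<close>
  for a fixed i and summed over all partners j.\<close>

definition Qi :: "nat \<Rightarrow> nat \<Rightarrow> laurent" where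
  "Qi N i = (\<Sum>j\<in>{..<N} - {i}. (X i - 1) * (X j - 1) * alt_div N i j)"

abbreviation gi :: "nat \<Rightarrow> laurent" where "gi i \<equiv> X i + Xi i - 2"

text \<open>Eliminates the quotients. Since u_j - 1 = (u_i - 1) + (u_j - u_i), \<open>Qi N i\<close>
  is (u_i - 1)^2 times the sum of the quotients plus (N - 1)(u_i - 1) times \<open>alt N\<close>.
  Moreover (u_i - 1)^2 = u_i \<open>gi i\<close>, and \<open>theta_alt\<close> turns u_i times the
  sum of the quotients into a derivative of \<open>alt N\<close>.\<close>

lemma theta_gi_alt:
  assumes i: "i < N"
  shows "theta i (gi i * alt N) = (X i - Xi i) * alt N - Qi N i + of_int (int N - 1) * (X i - 1) * alt N"
proof -
  let ?A = "\<Sum>j\<in>{..<N} - {i}. alt_div N i j"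
  have gX: "gi i * X i = (X i - 1) * (X i - 1)"
    using X_Xi[of i] by (simp add: algebra_simps)
  have "(X i - 1) * (X i - 1) * ?A
      = (\<Sum>j\<in>{..<N} - {i}. (X i - 1) * (X j - 1) * alt_div N i j - (X i - 1) * alt N)"
    unfolding sum_distrib_left
  proof (rule sum.cong[OF refl])
    fix j assume "j \<in> {..<N} - {i}"
    then have "alt N = (X j - X i) * alt_div N i j" using alt_eq_mult_div[of i N j] i by auto
    moreover have "(X i - 1) * (X i - 1) * alt_div N i j = (X i - 1) * (X j - 1) * alt_div N i j
        - (X i - 1) * ((X j - X i) * alt_div N i j)"
      by (simp add: algebra_simps)
    ultimately show "(X i - 1) * (X i - 1) * alt_div N i j = (X i - 1) * (X j - 1) * alt_div N i j
        - (X i - 1) * alt N"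
      by (simp only:)
  qed
  also have "\<dots> = Qi N i - of_nat (card ({..<N} - {i})) * ((X i - 1) * alt N)"
    by (simp add: sum_subtractf Qi_def)
  also have "of_nat (card ({..<N} - {i})) = (of_int (int N - 1) :: laurent)"
    using i by (simp add: of_nat_diff)
  finally have 1: "(X i - 1) * (X i - 1) * ?A = Qi N i - of_int (int N - 1) * ((X i - 1) * alt N)" .
  have "theta i 2 = 0" using theta_of_int_times[of i 2 1] theta_X(4) by simp
  then have tg: "theta i (gi i) = X i - Xi i"
    by (simp add: theta_add theta_diff theta_X)
  have "theta i (gi i * alt N) = (X i - Xi i) * alt N - (gi i * X i) * ?A"
    unfolding theta_mult tg theta_alt[OF i] by (simp add: algebra_simps)
  also have "\<dots> = (X i - Xi i) * alt N - Qi N i + of_int (int N - 1) * (X i - 1) * alt N"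
    unfolding gX 1 by (simp only: algebra_simps)
  finally show ?thesis .
qed

text \<open>An operator in the single variable u_i that replaces the interaction of i with all other
  variables. The term with a compensates for theta i acting on the prefactor \<open>Ux N x\<close>,
  with a = x i.\<close>

definition Lop :: "nat \<Rightarrow> nat \<Rightarrow> int \<Rightarrow> laurent \<Rightarrow> laurent" where
  "Lop N i a F = theta i ((X i - Xi i) * F + of_int (int N - 1) * ((X i - 1) * F) - theta i (gi i * F)
      + of_int a * (gi i * F))"

lemma Lop_add: "Lop N i a (F + G) = Lop N i a F + Lop N i a G"
  unfolding Lop_def distrib_left theta_add theta_diff by (simp only: algebra_simps)

lemma Lop_of_int: "Lop N i a (of_int k * F) = of_int k * Lop N i a F"
  unfolding Lop_def mult.left_commute[of _ "of_int k"] theta_of_int_times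
  by (simp only: distrib_left[symmetric] right_diff_distrib[symmetric] theta_of_int_times)

lemma Lop_sum: "Lop N i a (\<Sum>k\<in>I. of_int (s k) * F k) = (\<Sum>k\<in>I. of_int (s k) * Lop N i a (F k))"
proof (induction I rule: infinite_finite_induct)
  case empty
  show ?case using Lop_of_int[of N i a 0 0] by simp
next
  case (infinite A)
  show ?case using infinite Lop_of_int[of N i a 0 0] by simp
qed (simp add: Lop_add Lop_of_int)

lemma theta_Ux_Qi:
  assumes i: "i < N"
  shows "theta i (Ux N x * Qi N i) = Lop N i (x i) (Ux N x * alt N)"
proof -
  have t: "theta i (Ux N x) = of_int (x i) * Ux N x"
    unfolding Ux_def theta_umon using i by simp
  have "theta i (gi i * (Ux N x * alt N)) = theta i (Ux N x * (gi i * alt N))" by (simp only: ac_simps)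
  also have "\<dots> = of_int (x i) * Ux N x * (gi i * alt N) + Ux N x * theta i (gi i * alt N)"
    unfolding theta_mult[of i "Ux N x"] t ..
  finally have 1: "theta i (gi i * (Ux N x * alt N)) = of_int (x i) * Ux N x * (gi i * alt N) +
     Ux N x * ((X i - Xi i) * alt N - Qi N i + of_int (int N - 1) * (X i - 1) * alt N)"
    unfolding theta_gi_alt[OF i] .
  show ?thesis unfolding Lop_def 1 by (rule arg_cong[of _ _ "theta i"]) (simp only: algebra_simps)
qed

text \<open>The antisymmetry of \<open>alt_div\<close> turns the difference theta i - theta j of
  \<open>lin_WA\<close> into a sum of two terms exchanged by swapping i and j. Over ordered pairs
  both give the same, whence the factor 2, and for fixed i the sum over j can be moved
  inside.\<close>

lemma lin_pair_sum:
  "(\<Sum>i<N. \<Sum>j\<in>{..<N} - {i}. lin (WA N i j) (Ux N x * alt N)) =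
     2 * (\<Sum>i<N. lin (WN N) (Lop N i (x i) (Ux N x * alt N)))"
proof -
  let ?H = "\<lambda>i j. (X i - 1) * (X j - 1) * (Ux N x * alt_div N i j)"
  let ?T = "\<lambda>i j. lin (WN N) (theta i (?H i j))"
  have "(\<Sum>i<N. \<Sum>j\<in>{..<N} - {i}. lin (WA N i j) (Ux N x * alt N)) =
    (\<Sum>i<N. \<Sum>j\<in>{..<N} - {i}. ?T i j + ?T j i)"
  proof (intro sum.cong refl)
    fix i j assume ij: "i \<in> {..<N}" "j \<in> {..<N} - {i}"
    then have "Ux N x * alt N = (X j - X i) * (Ux N x * alt_div N i j)"
      using alt_eq_mult_div[of i N j] by (auto simp: mult.left_commute)
    then have "lin (WA N i j) (Ux N x * alt N) = lin (WN N) (theta i (?H i j) - theta j (?H i j))"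
      using lin_WA[of i N j] ij by simp
    moreover have "?H i j = - ?H j i" using ij alt_div_antisym[of i j N] by (simp add: mult.commute)
    then have "theta j (?H i j) = - theta j (?H j i)" using theta_minus[of j "?H j i"] by simp
    ultimately show "lin (WA N i j) (Ux N x * alt N) = ?T i j + ?T j i" by (simp add: lin_add)
  qed
  also have "\<dots> = (\<Sum>i<N. \<Sum>j\<in>{..<N} - {i}. ?T i j) + (\<Sum>i<N. \<Sum>j\<in>{..<N} - {i}. ?T j i)"
    by (simp add: sum.distrib)
  also have "(\<Sum>i<N. \<Sum>j\<in>{..<N} - {i}. ?T j i) = (\<Sum>i<N. \<Sum>j\<in>{..<N} - {i}. ?T i j)"
  proof -
    have "(\<Sum>i<N. \<Sum>j\<in>{..<N} - {i}. ?T j i) = (\<Sum>(i, j)\<in>Sigma {..<N} (\<lambda>i. {..<N} - {i}). ?T j i)"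
      by (rule sum.Sigma) auto
    also have "\<dots> = (\<Sum>(i, j)\<in>Sigma {..<N} (\<lambda>i. {..<N} - {i}). ?T i j)"
      by (rule sum.reindex_bij_witness[where i = prod.swap and j = prod.swap]) auto
    also have "\<dots> = (\<Sum>i<N. \<Sum>j\<in>{..<N} - {i}. ?T i j)" by (rule sum.Sigma[symmetric]) auto
    finally show ?thesis .
  qed
  also have "(\<Sum>i<N. \<Sum>j\<in>{..<N} - {i}. ?T i j) = (\<Sum>i<N. lin (WN N) (Lop N i (x i) (Ux N x * alt N)))"
  proof (rule sum.cong[OF refl])
    fix i assume "i \<in> {..<N}"
    then have i: "i < N" by simp
    have "(\<Sum>j\<in>{..<N} - {i}. ?T i j) = lin (WN N) (theta i (\<Sum>j\<in>{..<N} - {i}. ?H i j))"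
      by (simp only: lin_sum theta_sum)
    also have "(\<Sum>j\<in>{..<N} - {i}. ?H i j) = Ux N x * Qi N i"
      unfolding Qi_def sum_distrib_left by (simp only: mult.left_commute mult.assoc)
    finally show "(\<Sum>j\<in>{..<N} - {i}. ?T i j) = lin (WN N) (Lop N i (x i) (Ux N x * alt N))"
      unfolding theta_Ux_Qi[OF i] .
  qed
  finally show ?thesis by simp
qed

subsection \<open>The action on Jacobi-Trudi determinants\<close>

definition cst :: "complex \<Rightarrow> R" where "cst c = c \<bullet>\<^sub>R 1"

lemma scale_eq_cst: "c \<bullet>\<^sub>R f = cst c * f"
  unfolding cst_def by (rule scale_eq_mult)

lemma cst_simps: "cst (a + b) = cst a + cst b" "cst (a - b) = cst a - cst b" "cst (- a) = - cst a"
    "cst (a * b) = cst a * cst b" "cst 0 = 0" "cst 1 = 1"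
  by (simp_all add: cst_def scale_add_left scale_diff_left scale_minus_left scale_zero scale_one
      scale_scale flip: scale_eq_mult scale_mult_left)

lemma cst_of_int: "cst (of_int k) = of_int k"
  by (simp add: cst_def of_int_eq_scale[symmetric])

text \<open>Only the exponent of u_i moves, by 1, -1 or 0, so a single factor of the product of
  \<phi> changes. This is the form in which the interaction can be added to
  \<open>op_B\<close>.\<close>

lemma lin_Lop_umon:
  assumes i: "i < N"
  shows "2 * lin (WN N) (Lop N i a (umon m)) =
     (cst (2 * of_int ((m i + 1) * (int N + a - (m i + 1)))) * \<phi> (m i + 1)
     + cst (2 * of_int ((m i - 1) * (a - 1 - (m i - 1)))) * \<phi> (m i - 1)
     + cst (2 * of_int (m i * (2 * m i - 2 * a - (int N - 1)))) * \<phi> (m i)) * (\<Prod>k\<in>{..<N} - {i}. \<phi> (m k))"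
proof -
  let ?P = "\<Prod>k\<in>{..<N} - {i}. \<phi> (m k)"
  have W: "WN N m' = \<phi> (m' i) * ?P" if "\<And>k. k \<noteq> i \<Longrightarrow> m' k = m k" for m'
    unfolding WN_def using i by (subst prod.remove[of _ i]) (auto intro!: prod.cong simp: that)
  have W3: "WN N (ei i + m) = \<phi> (m i + 1) * ?P" "WN N (- ei i + m) = \<phi> (m i - 1) * ?P" "WN N m = \<phi> (m i) * ?P"
    using W[of "ei i + m"] W[of "- ei i + m"] W[of m] by (simp_all add: algebra_simps)
  have e: "(ei i + m) i = m i + 1" "(- ei i + m) i = m i - 1" by auto
  have 2: "(2::laurent) = of_int 2" by simp
  have LL: "Lop N i a (umon m) =
    of_int (((ei i + m) i) * (1 + (int N - 1) - (ei i + m) i + a)) * umon (ei i + m)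
    + of_int (((- ei i + m) i) * (- 1 - (- ei i + m) i + a)) * umon (- ei i + m)
    + of_int (m i * (- (int N - 1) + 2 * m i - 2 * a)) * umon m"
    unfolding Lop_def left_diff_distrib distrib_right umon_mult mult_1 theta_add theta_diff
      theta_of_int_times 2
      theta_umon right_diff_distrib distrib_left of_int_add of_int_diff of_int_mult of_int_minus of_int_1
    by (simp add: algebra_simps)
  show ?thesis
    unfolding LL e lin_add lin_of_int_times lin_single scale_one W3 cst_simps(4) cst_of_int
    by (simp add: algebra_simps cst_of_int[of 2, simplified])
qed

lemma sum_rows_cols_ldet:
  "(\<Sum>p | p permutes {..<n}. of_int (sign p) *
      (\<Sum>i<n. (r i - c (p i)) * (Y i (p i) * (\<Prod>k\<in>{..<n} - {i}. M k (p k)))))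
    = (\<Sum>i<n. r i * ldet n (M(i := Y i))) - (\<Sum>j<n. c j * ldet n (\<lambda>i k. if k = j then Y i k else M i k))"
  unfolding sum_rows_ldet[symmetric] sum_cols_ldet[symmetric]
  by (simp add: left_diff_distrib right_diff_distrib sum_subtractf)

lemma op_D_of_int: "op_D z z' w w' (of_int k * f) = of_int k * op_D z z' w w' f"
  by (simp add: of_int_times op_D_scale)

abbreviation jt :: "nat \<Rightarrow> (nat \<Rightarrow> int) \<Rightarrow> R" where
  "jt N x \<equiv> ldet N (\<lambda>i j. \<phi> (x i + int j))"

text \<open>For each of the three shifts of the i-th factor, the interaction and \<open>op_B\<close>
  together have a coefficient that is a function of x i minus a function of p i. The row functions
  give the stated terms. Raising column j repeats column j + 1, unless j = N - 1, where
  \<open>?cA\<close> vanishes; lowering it repeats column j - 1, unless j = 0, where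
  \<open>?cB\<close> vanishes. The unshifted column terms remain as a scalar.\<close>

theorem op_D_jt:
  defines "s \<equiv> \<lambda>w w' z z' :: complex. w + w' - z - z'"
  shows "op_D z z' w w' (jt N x) =
     (\<Sum>i<N. ((of_int (x i) + of_nat N + w) * (of_int (x i) + of_nat N + w')) \<bullet>\<^sub>R jt N (x(i := x i + 1)))
     + (\<Sum>i<N. ((of_int (x i) - 1 - z) * (of_int (x i) - 1 - z')) \<bullet>\<^sub>R jt N (x(i := x i - 1)))
     - ((\<Sum>i<N. 2 * (of_int (x i))\<^sup>2 + 2 * (of_nat N - 1) * of_int (x i) + s w w' z z' * of_int (x i) +
       (w * w' + z * z'))
        - (\<Sum>j<N. 2 * (of_nat j)\<^sup>2 - 2 * (of_nat N - 1) * of_nat j - s w w' z z' * of_nat j)) \<bullet>\<^sub>R jt N x"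
proof -
  let ?s = "s w w' z z'"
  let ?F = "Ux N x * alt N"
  let ?m = "\<lambda>p k. x k + int (p k)"
  let ?P = "\<lambda>p i. \<Prod>k\<in>{..<N} - {i}. \<phi> (?m p k)"
  let ?rA = "\<lambda>i. (of_int (x i) + of_nat N + w) * (of_int (x i) + of_nat N + w')"
  let ?cA = "\<lambda>j. (of_nat N - 1 - of_nat j) * (of_nat N - 1 - of_nat j + w + w')"
  let ?rB = "\<lambda>i. (of_int (x i) - 1 - z) * (of_int (x i) - 1 - z')"
  let ?cB = "\<lambda>j. of_nat j * (of_nat j + z + z')"
  let ?rC = "\<lambda>i. 2 * (of_int (x i))\<^sup>2 + 2 * (of_nat N - 1) * of_int (x i) + ?s * of_int (x i)
      + (w * w' + z * z')"
  let ?cC = "\<lambda>j. 2 * (of_nat j)\<^sup>2 - 2 * (of_nat N - 1) * of_nat j - ?s * of_nat j"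
  let ?Z = "\<lambda>i j. \<phi> (x i + int j)"
  let ?Y = "\<lambda>i j. \<phi> (x i + int j + 1)"
  let ?V = "\<lambda>i j. \<phi> (x i + int j - 1)"
  have yy: "ldet N (?Z(i := ?Y i)) = jt N (x(i := x i + 1))" for i
    by (rule ldet_cong) (auto simp: algebra_simps)
  have vv: "ldet N (?Z(i := ?V i)) = jt N (x(i := x i - 1))" for i
    by (rule ldet_cong) (auto simp: algebra_simps)
  have zz: "ldet N (?Z(i := ?Z i)) = jt N x" for i
    by (rule ldet_cong) auto
  have "op_D z z' w w' (jt N x)
      = (\<Sum>p | p permutes {..<N}. of_int (sign p) * op_D z z' w w' (\<Prod>k<N. \<phi> (?m p k)))"
    by (simp add: ldet_def op_D_sum op_D_of_int)
  also have "\<dots> = (\<Sum>p | p permutes {..<N}. of_int (sign p) * (\<Sum>i<N. \<Sum>j\<in>{..<N} - {i}. WA N i j (mm N x p)))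
     + (\<Sum>p | p permutes {..<N}. of_int (sign p) * (\<Sum>i<N. op_B z z' w w' (?m p i) * ?P p i))"
  proof -
    have e: "op_D z z' w w' (\<Prod>k<N. \<phi> (?m p k)) = (\<Sum>i<N. \<Sum>j\<in>{..<N} - {i}. WA N i j (mm N x p))
      + (\<Sum>i<N. op_B z z' w w' (?m p i) * ?P p i)" for p
    proof -
      have "op_D z z' w w' (\<Prod>k<N. \<phi> (?m p k))
          = (\<Sum>i<N. \<Sum>j\<in>{..<N} - {i}. op_As (?m p i) (?m p j) * (\<Prod>k\<in>{..<N} - {i, j}. \<phi> (?m p k)))
        + (\<Sum>i<N. op_B z z' w w' (?m p i) * ?P p i)"
        by (rule op_D_prod_phi) simp
      also have "(\<Sum>i<N. \<Sum>j\<in>{..<N} - {i}. op_As (?m p i) (?m p j) * (\<Prod>k\<in>{..<N} - {i, j}. \<phi> (?m p k))) =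
        (\<Sum>i<N. \<Sum>j\<in>{..<N} - {i}. WA N i j (mm N x p))"
        unfolding WA_def by (intro sum.cong refl arg_cong2[of _ _ _ _ "(*)"] prod.cong) (auto simp: mm_def)
      finally show ?thesis .
    qed
    show ?thesis unfolding e distrib_left by (rule sum.distrib)
  qed
  also have "(\<Sum>p | p permutes {..<N}. of_int (sign p) * (\<Sum>i<N. \<Sum>j\<in>{..<N} - {i}. WA N i j (mm N x p))) =
    (\<Sum>i<N. \<Sum>j\<in>{..<N} - {i}. lin (WA N i j) ?F)"
    unfolding Ux_alt lin_sum lin_of_int_times lin_single scale_one sum_distrib_left
    by (subst sum.swap, intro sum.cong refl sum.swap)
  also have "\<dots> = (\<Sum>i<N. 2 * lin (WN N) (Lop N i (x i) ?F))"
    by (simp add: lin_pair_sum sum_distrib_left)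
  also have "\<dots> = (\<Sum>p | p permutes {..<N}. of_int (sign p) *
      (\<Sum>i<N. 2 * lin (WN N) (Lop N i (x i) (umon (mm N x p)))))"
    unfolding Ux_alt Lop_sum lin_sum lin_of_int_times sum_distrib_left
    by (subst sum.swap) (simp only: mult.left_commute)
  finally have "op_D z z' w w' (jt N x) = (\<Sum>p | p permutes {..<N}. of_int (sign p) * (\<Sum>i<N.
       2 * lin (WN N) (Lop N i (x i) (umon (mm N x p))) + op_B z z' w w' (?m p i) * ?P p i))"
    by (simp add: sum.distrib distrib_left)
  also have "\<dots> = (\<Sum>p | p permutes {..<N}. of_int (sign p) * (\<Sum>i<N.
       (cst (?rA i) - cst (?cA (p i))) * (?Y i (p i) * ?P p i) + (cst (?rB i) - cst (?cB (p i))) *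
         (?V i (p i) * ?P p i)
       - (cst (?rC i) - cst (?cC (p i))) * (?Z i (p i) * ?P p i)))"
  proof (intro sum.cong refl arg_cong2[of _ _ _ _ "(*)"])
    fix p i assume "i \<in> {..<N}"
    then have i: "i < N" by simp
    have P: "(\<Prod>k\<in>{..<N} - {i}. \<phi> (mm N x p k)) = ?P p i" and mi: "mm N x p i = ?m p i"
      using i by (auto simp: mm_def intro!: prod.cong)
    let ?n = "?m p i"
    have B: "op_B z z' w w' ?n = cst ((of_int ?n + w + 1) * (of_int ?n + w' + 1)) * \<phi> (?n + 1)
       + cst ((of_int ?n - z - 1) * (of_int ?n - z' - 1)) * \<phi> (?n - 1)
       + cst (- ((of_int ?n - z) * (of_int ?n - z') + (of_int ?n + w) * (of_int ?n + w'))) * \<phi> ?n"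
      unfolding op_B_def scale_eq_cst cst_simps(3) by simp
    \<comment> \<open>With y = x i + N and k = N - 1 - p i the left-hand side is 2 (y - k) k + (y -
      k + w)(y - k + w'), in which the mixed terms y k cancel. The next two identities separate in
      the same way.\<close>
    have a: "cst (2 * of_int ((?n + 1) * (int N + x i - (?n + 1))))
        + cst ((of_int ?n + w + 1) * (of_int ?n + w' + 1))
       = cst (?rA i) - cst (?cA (p i))"
      unfolding cst_simps(1,2)[symmetric] by (rule arg_cong[of _ _ cst]) (simp add: algebra_simps)
    have b: "cst (2 * of_int ((?n - 1) * (x i - 1 - (?n - 1))))
        + cst ((of_int ?n - z - 1) * (of_int ?n - z' - 1))
       = cst (?rB i) - cst (?cB (p i))"
      unfolding cst_simps(1,2)[symmetric] by (rule arg_cong[of _ _ cst]) (simp add: algebra_simps)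
    have c: "cst (2 * of_int (?n * (2 * ?n - 2 * x i - (int N - 1))))
        + cst (- ((of_int ?n - z) * (of_int ?n - z') + (of_int ?n + w) * (of_int ?n + w')))
       = - (cst (?rC i) - cst (?cC (p i)))"
      unfolding cst_simps(1,2,3)[symmetric]
        by (rule arg_cong[of _ _ cst]) (simp add: algebra_simps s_def power2_eq_square)
    have "2 * lin (WN N) (Lop N i (x i) (umon (mm N x p))) + op_B z z' w w' ?n * ?P p i =
      (cst (2 * of_int ((?n + 1) * (int N + x i - (?n + 1)))) +
        cst ((of_int ?n + w + 1) * (of_int ?n + w' + 1))) * (?Y i (p i) * ?P p i)
      + (cst (2 * of_int ((?n - 1) * (x i - 1 - (?n - 1)))) +
        cst ((of_int ?n - z - 1) * (of_int ?n - z' - 1))) * (?V i (p i) * ?P p i)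
      + (cst (2 * of_int (?n * (2 * ?n - 2 * x i - (int N - 1)))) +
        cst (- ((of_int ?n - z) * (of_int ?n - z') + (of_int ?n + w) * (of_int ?n + w')))) *
          (?Z i (p i) * ?P p i)"
      unfolding lin_Lop_umon[OF i] P mi B
        by (simp only: distrib_left distrib_right mult.assoc add.assoc add.commute add.left_commute)
    then show "2 * lin (WN N) (Lop N i (x i) (umon (mm N x p))) + op_B z z' w w' ?n * ?P p i =
      (cst (?rA i) - cst (?cA (p i))) * (?Y i (p i) * ?P p i) + (cst (?rB i) - cst (?cB (p i))) *
        (?V i (p i) * ?P p i)
       - (cst (?rC i) - cst (?cC (p i))) * (?Z i (p i) * ?P p i)"
      unfolding a b c by (simp only: mult_minus_left add_uminus_conv_diff)
  qed
  also have "\<dots> =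
      ((\<Sum>i<N. cst (?rA i) * ldet N (?Z(i := ?Y i))) -
        (\<Sum>j<N. cst (?cA j) * ldet N (\<lambda>i k. if k = j then ?Y i k else ?Z i k)))
    + ((\<Sum>i<N. cst (?rB i) * ldet N (?Z(i := ?V i))) -
      (\<Sum>j<N. cst (?cB j) * ldet N (\<lambda>i k. if k = j then ?V i k else ?Z i k)))
    - ((\<Sum>i<N. cst (?rC i) * ldet N (?Z(i := ?Z i))) -
      (\<Sum>j<N. cst (?cC j) * ldet N (\<lambda>i k. if k = j then ?Z i k else ?Z i k)))"
    unfolding sum_rows_cols_ldet[symmetric]
      by (simp add: sum.distrib sum_subtractf distrib_left right_diff_distrib)
  also have "(\<Sum>j<N. cst (?cA j) * ldet N (\<lambda>i k. if k = j then ?Y i k else ?Z i k)) = 0"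
  proof (rule sum.neutral, safe)
    fix j assume j: "j < N"
    show "cst (?cA j) * ldet N (\<lambda>i k. if k = j then ?Y i k else ?Z i k) = 0"
    proof (cases "Suc j < N")
      case True
      have "ldet N (\<lambda>i k. if k = j then ?Y i k else ?Z i k) = 0"
        by (rule ldet_equal_cols[of j _ "Suc j"]) (use True in \<open>auto simp: algebra_simps\<close>)
      then show ?thesis by simp
    next
      case False
      with j have "N = Suc j" by simp
      then show ?thesis by (simp add: cst_simps)
    qed
  qed
  also have "(\<Sum>j<N. cst (?cB j) * ldet N (\<lambda>i k. if k = j then ?V i k else ?Z i k)) = 0"
  proof (rule sum.neutral, safe)
    fix j assume j: "j < N"
    show "cst (?cB j) * ldet N (\<lambda>i k. if k = j then ?V i k else ?Z i k) = 0"
    proof (cases j)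
      case (Suc k)
      have "ldet N (\<lambda>i k. if k = j then ?V i k else ?Z i k) = 0"
        by (rule ldet_equal_cols[of j _ k]) (use Suc j in auto)
      then show ?thesis by simp
    qed (simp add: cst_simps)
  qed
  finally have "op_D z z' w w' (jt N x) = (\<Sum>i<N. cst (?rA i) * jt N (x(i := x i + 1)))
      + (\<Sum>i<N. cst (?rB i) * jt N (x(i := x i - 1)))
     - ((\<Sum>i<N. cst (?rC i) * jt N x) - (\<Sum>j<N. cst (?cC j) * jt N x))" unfolding yy vv zz by simp
  also have "(\<Sum>i<N. cst (?rC i) * jt N x) - (\<Sum>j<N. cst (?cC j) * jt N x)
      = cst ((\<Sum>i<N. ?rC i) - (\<Sum>j<N. ?cC j)) * jt N x"
  proof -
    have "cst (\<Sum>i\<in>I. f i) = (\<Sum>i\<in>I. cst (f i))" for I :: "nat set" and f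
      by (induction I rule: infinite_finite_induct) (auto simp: cst_simps)
    then show ?thesis by (simp only: cst_simps(2) left_diff_distrib sum_distrib_right)
  qed
  finally show ?thesis by (simp only: scale_eq_cst)
qed

subsection \<open>Partial fractions\<close>

text \<open>For \<open>e = \<plusminus>1\<close> and \<open>x\<^sub>i = \<lambda>\<^sub>i - i\<close> this is the ratio of the dimensions of \<open>\<lambda> + e \<epsilon>\<^sub>i\<close> and \<open>\<lambda>\<close>.\<close>

definition pfc :: "real \<Rightarrow> ('i \<Rightarrow> real) \<Rightarrow> 'i set \<Rightarrow> 'i \<Rightarrow> real" where
  "pfc e x I i = (\<Prod>j\<in>I - {i}. 1 + e / (x i - x j))"

lemma pfc_insert:
  assumes "finite I" "a \<notin> I"
  shows "i \<in> I \<Longrightarrow> pfc e x (insert a I) i = pfc e x I i * (1 + e / (x i - x a))"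
    and "pfc e x (insert a I) a = (\<Prod>j\<in>I. 1 + e / (x a - x j))"
proof -
  show "pfc e x (insert a I) i = pfc e x I i * (1 + e / (x i - x a))" if "i \<in> I"
  proof -
    have "insert a I - {i} = insert a (I - {i})" using that assms by auto
    then show ?thesis using assms by (simp add: pfc_def mult.commute)
  qed
  show "pfc e x (insert a I) a = (\<Prod>j\<in>I. 1 + e / (x a - x j))"
    using assms by (simp add: pfc_def)
qed

text \<open>As a function of t, the product tends to 1 at infinity and has residue e times
  \<open>pfc e x I i\<close> at x i. In the induction, the expansion for I evaluated at t = x a
  supplies the coefficient of the new pole.\<close>

lemma pfc_expansion:
  assumes "finite I" "inj_on x I" "\<And>i. i \<in> I \<Longrightarrow> t \<noteq> x i"
  shows "(\<Prod>j\<in>I. 1 + e / (t - x j)) = 1 + e * (\<Sum>i\<in>I. pfc e x I i / (t - x i))"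
  using assms
proof (induction I arbitrary: t rule: finite_induct)
  case (insert a I)
  let ?c = "pfc e x I"
  let ?f = "\<lambda>t. 1 + e * (\<Sum>i\<in>I. ?c i / (t - x i))"
  have xa: "x a \<noteq> x i" if "i \<in> I" for i using insert that by (auto simp: inj_on_def)
  have IH: "(\<Prod>j\<in>I. 1 + e / (t - x j)) = ?f t" and IHa: "(\<Prod>j\<in>I. 1 + e / (x a - x j)) = ?f (x a)"
    using insert xa by auto
  have ta: "t - x a \<noteq> 0" and ti: "t - x i \<noteq> 0" if "i \<in> I" for i using insert.prems(2) that by auto
  have ta: "t - x a \<noteq> 0" using insert.prems(2) by auto
  have "(\<Sum>i\<in>insert a I. pfc e x (insert a I) i / (t - x i)) = ?f (x a) / (t - x a)
     + (\<Sum>i\<in>I. ?c i * (1 + e / (x i - x a)) / (t - x i))"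
    using insert by (simp add: pfc_insert IHa)
  also have "(\<Sum>i\<in>I. ?c i * (1 + e / (x i - x a)) / (t - x i)) =
     (\<Sum>i\<in>I. ?c i / (t - x i) * (1 + e / (t - x a)) - e / (t - x a) * (?c i / (x a - x i)))"
  proof (rule sum.cong[OF refl])
    fix i assume i: "i \<in> I"
    have nz: "x i - x a \<noteq> 0" "x a - x i \<noteq> 0" using xa[OF i] by auto
    show "?c i * (1 + e / (x i - x a)) / (t - x i) = ?c i / (t - x i) * (1 + e / (t - x a))
        - e / (t - x a) * (?c i / (x a - x i))"
      using nz ta ti[OF i] by (simp add: divide_simps) (simp add: algebra_simps)
  qed
  also have "\<dots> = (\<Sum>i\<in>I. ?c i / (t - x i)) * (1 + e / (t - x a)) - e / (t - x a) * (\<Sum>i\<in>I. ?c i / (x a - x i))"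
    by (simp add: sum_subtractf sum_distrib_left sum_distrib_right)
  finally have st: "(\<Sum>i\<in>insert a I. pfc e x (insert a I) i / (t - x i)) = ?f (x a) / (t - x a)
     + ((\<Sum>i\<in>I. ?c i / (t - x i)) * (1 + e / (t - x a)) - e / (t - x a) * (\<Sum>i\<in>I. ?c i / (x a - x i)))" .
  have "1 + e * ((1 + e * s2) / d + (s * (1 + e / d) - e / d * s2)) = (1 + e / d) * (1 + e * s)" if "d \<noteq> 0"
    for s s2 d :: real
    using that by (simp add: field_simps)
  then have "1 + e * (\<Sum>i\<in>insert a I. pfc e x (insert a I) i / (t - x i)) = (1 + e / (t - x a)) * ?f t"
    unfolding st using ta by blast
  moreover have "(\<Prod>j\<in>insert a I. 1 + e / (t - x j)) = (1 + e / (t - x a)) * ?f t"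
    using insert.hyps by (simp add: IH)
  ultimately show ?case by simp
qed simp

text \<open>Adding a point changes the sum by g (x a) and by a sum of divided differences of g. For
  polynomial g these have smaller degree, which makes the moments computable by recursion.\<close>

lemma pfc_sum_insert:
  assumes "finite I" "a \<notin> I" "inj_on x (insert a I)"
  shows "(\<Sum>i\<in>insert a I. pfc e x (insert a I) i * g (x i)) =
     (\<Sum>i\<in>I. pfc e x I i * g (x i)) + g (x a) + e * (\<Sum>i\<in>I. pfc e x I i * ((g (x i) - g (x a)) / (x i - x a)))"
proof -
  let ?c = "pfc e x I"
  have xa: "x a \<noteq> x i" if "i \<in> I" for i using assms that by (auto simp: inj_on_def)
  have IHa: "(\<Prod>j\<in>I. 1 + e / (x a - x j)) = 1 + e * (\<Sum>i\<in>I. ?c i / (x a - x i))"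
    using assms xa by (intro pfc_expansion) (auto simp: inj_on_def)
  have "(\<Sum>i\<in>insert a I. pfc e x (insert a I) i * g (x i)) = (1 + e * (\<Sum>i\<in>I. ?c i / (x a - x i))) * g (x a)
     + (\<Sum>i\<in>I. ?c i * (1 + e / (x i - x a)) * g (x i))"
    using assms by (simp add: pfc_insert IHa)
  also have "\<dots> = g (x a)
      + (\<Sum>i\<in>I. ?c i * (1 + e / (x i - x a)) * g (x i) + e * (?c i / (x a - x i)) * g (x a))"
    by (simp add: distrib_right sum.distrib sum_distrib_left sum_distrib_right mult.assoc)
  also have "(\<Sum>i\<in>I. ?c i * (1 + e / (x i - x a)) * g (x i) + e * (?c i / (x a - x i)) * g (x a)) =
    (\<Sum>i\<in>I. ?c i * g (x i) + e * (?c i * ((g (x i) - g (x a)) / (x i - x a))))"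
  proof (rule sum.cong[OF refl])
    fix i assume i: "i \<in> I"
    have "x a - x i = - (x i - x a)" by simp
    then have "e * (?c i / (x a - x i)) * g (x a) = - (e * ?c i * g (x a) / (x i - x a))"
      by (simp only: divide_minus_right) (simp add: mult.assoc)
    then show "?c i * (1 + e / (x i - x a)) * g (x i) + e * (?c i / (x a - x i)) * g (x a) =
       ?c i * g (x i) + e * (?c i * ((g (x i) - g (x a)) / (x i - x a)))"
      by (simp add: algebra_simps diff_divide_distrib)
  qed
  finally show ?thesis by (simp add: sum.distrib sum_distrib_left)
qed

text \<open>Degree 2 suffices because the jump rates are quadratic in the coordinates. The
  assumption on e treats the steps up and down together; the last summand of the second moment comes
  with e * e and hence does not depend on the sign.\<close>

lemma pfc_moments:
  assumes "finite I" "inj_on x I" "e * e = 1"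
  shows "(\<Sum>i\<in>I. pfc e x I i) = real (card I)"
    and "(\<Sum>i\<in>I. pfc e x I i * x i) = (\<Sum>i\<in>I. x i) + e * (real (card I) * (real (card I) - 1) / 2)"
    and "(\<Sum>i\<in>I. pfc e x I i * (x i)\<^sup>2) = (\<Sum>i\<in>I. (x i)\<^sup>2) + e * ((real (card I) - 1) * (\<Sum>i\<in>I. x i))
      + real (card I) * (real (card I) - 1) * (real (card I) - 2) / 6"
proof -
  have "(\<Sum>i\<in>I. pfc e x I i) = real (card I) \<and> (\<Sum>i\<in>I. pfc e x I i * x i) = (\<Sum>i\<in>I. x i)
      + e * (real (card I) * (real (card I) - 1) / 2)
    \<and> (\<Sum>i\<in>I. pfc e x I i * (x i)\<^sup>2) = (\<Sum>i\<in>I. (x i)\<^sup>2) + e * ((real (card I) - 1) * (\<Sum>i\<in>I. x i))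
      + real (card I) * (real (card I) - 1) * (real (card I) - 2) / 6"
    using assms(1,2)
  proof (induction I rule: finite_induct)
    case (insert a I)
    let ?c = "pfc e x I"
    let ?n = "real (card I)"
    have xa: "x i - x a \<noteq> 0" if "i \<in> I" for i using insert that by (auto simp: inj_on_def)
    have IH: "sum ?c I = ?n" "(\<Sum>i\<in>I. ?c i * x i) = (\<Sum>i\<in>I. x i) + e * (?n * (?n - 1) / 2)"
      "(\<Sum>i\<in>I. ?c i * (x i)\<^sup>2) = (\<Sum>i\<in>I. (x i)\<^sup>2) + e * ((?n - 1) * (\<Sum>i\<in>I. x i)) + ?n * (?n - 1) * (?n - 2) / 6"
      using insert by (auto simp: inj_on_def)
    note st = pfc_sum_insert[OF insert.hyps(1,2) insert.prems, of e]
    have 0: "(\<Sum>i\<in>insert a I. pfc e x (insert a I) i) = ?n + 1"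
      using st[of "\<lambda>_. 1"] IH(1) by simp
    have "(\<Sum>i\<in>I. ?c i * ((x i - x a) / (x i - x a))) = ?n"
      using IH(1) xa by (simp cong: sum.cong)
    then have 1: "(\<Sum>i\<in>insert a I. pfc e x (insert a I) i * x i) = (\<Sum>i\<in>I. x i) + e * (?n * (?n - 1) / 2)
        + x a + e * ?n"
      using st[of "\<lambda>y. y"] IH(2) by simp
    have "(\<Sum>i\<in>I. ?c i * (((x i)\<^sup>2 - (x a)\<^sup>2) / (x i - x a))) = (\<Sum>i\<in>I. ?c i * x i + x a * ?c i)"
    proof (rule sum.cong[OF refl])
      fix i assume "i \<in> I"
      have "((x i)\<^sup>2 - (x a)\<^sup>2) / (x i - x a) = x i + x a"
        using xa[OF \<open>i \<in> I\<close>] by (simp add: power2_eq_square square_diff_square_factored)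
      then show "?c i * (((x i)\<^sup>2 - (x a)\<^sup>2) / (x i - x a)) = ?c i * x i + x a * ?c i"
        by (simp add: algebra_simps)
    qed
    also have "\<dots> = (\<Sum>i\<in>I. x i) + e * (?n * (?n - 1) / 2) + x a * ?n"
      using IH(1,2) by (simp add: sum.distrib flip: sum_distrib_left)
    finally have 2: "(\<Sum>i\<in>insert a I. pfc e x (insert a I) i * (x i)\<^sup>2) = (\<Sum>i\<in>I. (x i)\<^sup>2)
        + e * ((?n - 1) * (\<Sum>i\<in>I. x i)) + ?n * (?n - 1) * (?n - 2) / 6
       + (x a)\<^sup>2 + e * ((\<Sum>i\<in>I. x i) + e * (?n * (?n - 1) / 2) + x a * ?n)"
      using st[of "\<lambda>y. y\<^sup>2"] IH(3) by simp
    have ee: "e * (e * t) = t" for t using assms(3) by (simp flip: mult.assoc)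
    have "card (insert a I) = card I + 1" using insert by simp
    then show ?case unfolding 0 1 2 using insert.hyps
      by (simp add: ee algebra_simps) (simp add: divide_simps algebra_simps)
  qed simp
  then show "(\<Sum>i\<in>I. pfc e x I i) = real (card I)"
    "(\<Sum>i\<in>I. pfc e x I i * x i) = (\<Sum>i\<in>I. x i) + e * (real (card I) * (real (card I) - 1) / 2)"
    "(\<Sum>i\<in>I. pfc e x I i * (x i)\<^sup>2) = (\<Sum>i\<in>I. (x i)\<^sup>2) + e * ((real (card I) - 1) * (\<Sum>i\<in>I. x i))
      + real (card I) * (real (card I) - 1) * (real (card I) - 2) / 6" by blast+
qed

subsection \<open>Dimensions and jump rates\<close>

text \<open>The strictly decreasing coordinates of a signature. As positions count from 0, they
  exceed \<lambda>_i - i by 1.\<close>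

definition sx :: "int list \<Rightarrow> nat \<Rightarrow> int" where
  "sx l i = l ! i - int i"

lemma signatures_length: "l \<in> signatures N \<Longrightarrow> length l = N"
  by (simp add: signatures_def)

lemma signatures_iff: "l \<in> signatures N \<longleftrightarrow> length l = N \<and> (\<forall>i j. i < j \<longrightarrow> j < N \<longrightarrow> sx l j < sx l i)"
proof
  assume "length l = N \<and> (\<forall>i j. i < j \<longrightarrow> j < N \<longrightarrow> sx l j < sx l i)"
  then have l: "length l = N" and s: "i < j \<Longrightarrow> j < N \<Longrightarrow> sx l j < sx l i" for i j by auto
  have "l ! (i + k) \<le> l ! i" if "i + k < N" for i k
    using that
  proof (induction k)
    case (Suc k)
    then show ?case using s[of "i + k" "i + Suc k"] by (simp add: sx_def)
  qed simp
  then have "l ! j \<le> l ! i" if "i < j" "j < N" for i j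
    using that by (metis le_add_diff_inverse less_imp_le)
  then show "l \<in> signatures N" using l by (auto simp: signatures_def sorted_wrt_iff_nth_less)
next
  assume l: "l \<in> signatures N"
  then have "l ! j \<le> l ! i" if "i < j" "j < N" for i j
    using that by (auto simp: signatures_def sorted_wrt_iff_nth_less)
  then have "sx l j < sx l i" if "i < j" "j < N" for i j
    using that unfolding sx_def by (smt (verit) of_nat_less_iff)
  then show "length l = N \<and> (\<forall>i j. i < j \<longrightarrow> j < N \<longrightarrow> sx l j < sx l i)"
    using signatures_length[OF l] by blast
qed

lemma signatures_sx: "l \<in> signatures N \<Longrightarrow> i < j \<Longrightarrow> j < N \<Longrightarrow> sx l j < sx l i"
  by (auto simp: signatures_iff)

lemma sx_inj_on: "l \<in> signatures N \<Longrightarrow> inj_on (sx l) {..<N}"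
proof (rule inj_onI)
  fix i j assume l: "l \<in> signatures N" and *: "i \<in> {..<N}" "j \<in> {..<N}" "sx l i = sx l j"
  then show "i = j" using signatures_sx[OF l, of i j] signatures_sx[OF l, of j i]
    by (cases i j rule: linorder_cases) auto
qed

lemma prod_pairs: "(\<Prod>j<N. \<Prod>i<j. G i j) = (\<Prod>(i, j)\<in>pairs N. G i j)"
  by (subst prod.Sigma) (auto intro!: prod.reindex_bij_witness[where i = prod.swap
    and j = prod.swap] simp: pairs_def)

lemma Dim_eq: "Dim l = (\<Prod>(i, j)\<in>pairs (length l). real_of_int (sx l i - sx l j) / real (j - i))"
  unfolding Dim_def prod_pairs[symmetric] by (simp add: sx_def algebra_simps)

lemma Dim_pos: "l \<in> signatures N \<Longrightarrow> Dim l > 0"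
  unfolding Dim_eq by (rule prod_pos)
    (auto simp: pairs_def signatures_length intro!: divide_pos_pos dest: signatures_sx)

lemma prod_pairs_split:
  assumes i: "i < N"
  shows "(\<Prod>p\<in>pairs N. G p) = (\<Prod>p\<in>{p\<in>pairs N. fst p \<noteq> i \<and> snd p \<noteq> i}. G p) *
      (\<Prod>j\<in>{..<N} - {i}. G (if i < j then (i, j) else (j, i)))"
proof -
  let ?h = "\<lambda>j. if i < j then (i, j) else (j, i)"
  have e: "pairs N = {p\<in>pairs N. fst p \<noteq> i \<and> snd p \<noteq> i} \<union> ?h ` ({..<N} - {i})"
  proof (intro equalityI subsetI)
    fix p assume p: "p \<in> pairs N"
    show "p \<in> {p\<in>pairs N. fst p \<noteq> i \<and> snd p \<noteq> i} \<union> ?h ` ({..<N} - {i})"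
    proof (cases "fst p = i \<or> snd p = i")
      case True
      then show ?thesis
      proof
        assume "fst p = i"
        with p have "p = ?h (snd p)" "snd p \<in> {..<N} - {i}" by (auto simp: pairs_def)
        then show ?thesis by blast
      next
        assume "snd p = i"
        with p have "p = ?h (fst p)" "fst p \<in> {..<N} - {i}" by (auto simp: pairs_def)
        then show ?thesis by blast
      qed
    qed (use p in auto)
  qed (use i in \<open>auto simp: pairs_def split: if_splits\<close>)
  have "(\<Prod>p\<in>pairs N. G p) = (\<Prod>p\<in>{p\<in>pairs N. fst p \<noteq> i \<and> snd p \<noteq> i}. G p) * (\<Prod>p\<in>?h ` ({..<N} - {i}). G p)"
    by (subst e, rule prod.union_disjoint) auto
  also have "(\<Prod>p\<in>?h ` ({..<N} - {i}). G p) = (\<Prod>j\<in>{..<N} - {i}. G (?h j))"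
    by (rule prod.reindex[unfolded comp_def]) (auto simp: inj_on_def split: if_splits)
  finally show ?thesis .
qed

lemma Dim_update:
  assumes l: "l \<in> signatures N" and i: "i < N"
  shows "Dim (l[i := l ! i + e]) = Dim l * pfc (of_int e) (\<lambda>k. of_int (sx l k)) {..<N} i"
proof -
  let ?m = "l[i := l ! i + e]"
  let ?G = "\<lambda>l p. real_of_int (sx l (fst p) - sx l (snd p)) / real (snd p - fst p)"
  let ?h = "\<lambda>j. if i < j then (i, j) else (j, i)"
  have N: "length l = N" using l by (rule signatures_length)
  have sxm: "sx ?m k = (if k = i then sx l i + e else sx l k)" for k
    using i N by (auto simp: sx_def)
  have "Dim ?m = (\<Prod>p\<in>{p\<in>pairs N. fst p \<noteq> i \<and> snd p \<noteq> i}. ?G ?m p) * (\<Prod>j\<in>{..<N} - {i}. ?G ?m (?h j))"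
    unfolding Dim_eq case_prod_unfold length_list_update N by (rule prod_pairs_split[OF i])
  also have "(\<Prod>p\<in>{p\<in>pairs N. fst p \<noteq> i \<and> snd p \<noteq> i}. ?G ?m p)
      = (\<Prod>p\<in>{p\<in>pairs N. fst p \<noteq> i \<and> snd p \<noteq> i}. ?G l p)"
    by (rule prod.cong) (auto simp: sxm)
  also have "(\<Prod>j\<in>{..<N} - {i}. ?G ?m (?h j))
      = (\<Prod>j\<in>{..<N} - {i}. ?G l (?h j) * (1 + real_of_int e / (of_int (sx l i) - of_int (sx l j))))"
  proof (rule prod.cong[OF refl])
    fix j assume j: "j \<in> {..<N} - {i}"
    then have "sx l i \<noteq> sx l j" using sx_inj_on[OF l] i by (auto simp: inj_on_def)
    then have nz: "real_of_int (sx l i) - of_int (sx l j) \<noteq> 0" "real_of_int (sx l j) - of_int (sx l i) \<noteq> 0"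
      by auto
    show "?G ?m (?h j) = ?G l (?h j) * (1 + real_of_int e / (of_int (sx l i) - of_int (sx l j)))"
    proof (cases "i < j")
      case True
      then show ?thesis using nz by (simp add: sxm divide_simps; simp add: algebra_simps)
    next
      case False
      with j have "j < i" by auto
      then show ?thesis using nz False by (simp add: sxm divide_simps; simp add: algebra_simps)
    qed
  qed
  also have "\<dots> = (\<Prod>j\<in>{..<N} - {i}. ?G l (?h j)) * pfc (of_int e) (\<lambda>k. of_int (sx l k)) {..<N} i"
    unfolding pfc_def by (rule prod.distrib)
  finally show ?thesis
    unfolding Dim_eq[of l] case_prod_unfold N prod_pairs_split[OF i, of "?G l"] by simp
qed

text \<open>A unit step that leaves the strictly decreasing sequences makes two coordinates
  coincide. Then both \<open>Dim\<close> and the Jacobi-Trudi determinant vanish, so sums over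
  neighbours may run over all i.\<close>

lemma Dim_nonsignature:
  assumes l: "l \<in> signatures N" and i: "i < N" and e: "e = 1 \<or> e = -1"
    and n: "l[i := l ! i + e] \<notin> signatures N"
  obtains j where "j < N" "j \<noteq> i" "sx l j = sx l i + e"
proof -
  let ?m = "l[i := l ! i + e]"
  have N: "length l = N" using l by (rule signatures_length)
  have sxm: "sx ?m k = (if k = i then sx l i + e else sx l k)" for k
    using i N by (auto simp: sx_def)
  from n N obtain a b where ab: "a < b" "b < N" "sx ?m a \<le> sx ?m b" by (auto simp: signatures_iff not_less)
  have lt: "sx l b < sx l a" by (rule signatures_sx[OF l ab(1,2)])
  show thesis
  proof (cases "a = i")
    case True
    then have "sx l i + e \<le> sx l b" using ab by (simp add: sxm)
    then have "sx l b = sx l i + e" using e lt True by auto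
    with ab True show thesis by (intro that[of b]) auto
  next
    case False
    then have b: "b = i" using ab lt by (auto simp: sxm split: if_splits)
    then have "sx l a \<le> sx l i + e" using ab False by (simp add: sxm)
    then have "sx l a = sx l i + e" using e lt b by auto
    with ab b show thesis by (intro that[of a]) auto
  qed
qed

lemma Dim_nonsignature_eq_0:
  assumes l: "l \<in> signatures N" and i: "i < N" and e: "e = 1 \<or> e = -1"
    and n: "l[i := l ! i + e] \<notin> signatures N"
  shows "Dim (l[i := l ! i + e]) = 0"
proof -
  obtain j where j: "j < N" "j \<noteq> i" "sx l j = sx l i + e" by (rule Dim_nonsignature[OF assms])
  have e0: "real_of_int e \<noteq> 0" using e by auto
  have z0: "1 + real_of_int e / (of_int (sx l i) - of_int (sx l j)) = 0" using e0 unfolding j(3) by simp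
  have "pfc (of_int e) (\<lambda>k. of_int (sx l k)) {..<N} i = 0"
    unfolding pfc_def using j z0 by (intro prod_zero bexI[of _ j]) auto
  then show ?thesis unfolding Dim_update[OF l i] by simp
qed

lemma jacobi_trudi_sx: "length l = N \<Longrightarrow> jacobi_trudi c l = ldet N (\<lambda>i j. c (sx l i + int j))"
  by (simp add: jacobi_trudi_eq_ldet sx_def)

lemma jacobi_trudi_nonsignature_eq_0:
  assumes l: "l \<in> signatures N" and i: "i < N" and e: "e = 1 \<or> e = -1"
    and n: "l[i := l ! i + e] \<notin> signatures N"
  shows "jacobi_trudi c (l[i := l ! i + e]) = 0"
proof -
  let ?m = "l[i := l ! i + e]"
  obtain j where j: "j < N" "j \<noteq> i" "sx l j = sx l i + e" by (rule Dim_nonsignature[OF assms])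
  have N: "length l = N" using l by (rule signatures_length)
  have "sx ?m j = sx ?m i" using i N j by (auto simp: sx_def)
  then have "ldet N (\<lambda>i j. c (sx ?m i + int j)) = 0"
    by (intro ldet_equal_rows[OF j(1) i j(2)]) simp
  then show ?thesis using N by (simp add: jacobi_trudi_sx)
qed

definition nbrs :: "int list \<Rightarrow> int list set" where
  "nbrs l = (\<lambda>i. l[i := l ! i + 1]) ` {..<length l} \<union> (\<lambda>i. l[i := l ! i - 1]) ` {..<length l}"

lemma finite_nbrs [simp]: "finite (nbrs l)"
  by (simp add: nbrs_def)

lemma not_in_nbrs: "l \<notin> nbrs l"
proof -
  have "l \<noteq> l[i := l ! i + e]" if "i < length l" "e \<noteq> 0" for i and e :: int
    using that by (metis add_cancel_right_right nth_list_update_eq)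
  from this[of _ 1] this[of _ "-1"] show ?thesis by (auto simp: nbrs_def)
qed

lemma update_eq_iff:
  assumes "length l = length m" "i < length l"
  shows "m = l[i := l ! i + e] \<longleftrightarrow> l = m[i := m ! i - (e::int)]"
  using assms by (auto simp: list_eq_iff_nth_eq nth_list_update)

text \<open>The factors r of the jump rates in the coordinates \<open>sx\<close>; passing from z -
  \<open>sx n i\<close> to \<open>sx n i\<close> - z costs two signs, which cancel.\<close>

definition upr :: "complex \<Rightarrow> complex \<Rightarrow> int list \<Rightarrow> nat \<Rightarrow> complex" where
  "upr z z' n i = (of_int (sx n i) - z) * (of_int (sx n i) - z')"

definition downr :: "complex \<Rightarrow> complex \<Rightarrow> int list \<Rightarrow> nat \<Rightarrow> complex" where
  "downr w w' n i = (of_int (sx n i) + of_nat (length n) - 1 + w) *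
      (of_int (sx n i) + of_nat (length n) - 1 + w')"

lemma rate_eq:
  "rate z z' w w' n m = of_real (Dim m / Dim n) *
     ((\<Sum>i | i < length n \<and> m = n[i := n ! i + 1]. upr z z' n i) +
      (\<Sum>i | i < length n \<and> m = n[i := n ! i - 1]. downr w w' n i))"
  unfolding rate_def Let_def upr_def downr_def sx_def by (simp add: algebra_simps)

lemma rate_not_nbr: "length m = length n \<Longrightarrow> n \<notin> nbrs m \<Longrightarrow> rate z z' w w' n m = 0"
  and rate_not_nbr': "m \<notin> nbrs n \<Longrightarrow> rate z z' w w' n m = 0"
proof -
  show "m \<notin> nbrs n \<Longrightarrow> rate z z' w w' n m = 0"
  proof -
    assume m: "m \<notin> nbrs n"
    then have "{i. i < length n \<and> m = n[i := n ! i + 1]} = {}" "{i. i < length n \<and> m = n[i := n ! i - 1]}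
        = {}"
      by (auto simp: nbrs_def)
    then show ?thesis unfolding rate_eq by (simp only: sum.empty) simp
  qed
  moreover assume len: "length m = length n" "n \<notin> nbrs m"
  have "m \<notin> nbrs n"
  proof
    assume "m \<in> nbrs n"
    then obtain i where i: "i < length n" "m = n[i := n ! i + 1] \<or> m = n[i := n ! i + (-1)]"
      by (auto simp: nbrs_def)
    with len have "n = m[i := m ! i - 1] \<or> n = m[i := m ! i - (-1)]"
      using update_eq_iff[of n m i 1] update_eq_iff[of n m i "-1"] by auto
    then have "n \<in> nbrs m" using i len by (auto simp: nbrs_def)
    with len show False by blast
  qed
  ultimately show "rate z z' w w' n m = 0" by blast
qed

lemma sum_nbrs_up:
  fixes F :: "nat \<Rightarrow> int list \<Rightarrow> 'b::comm_monoid_add"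
  assumes "length l = N" "e = 1 \<or> e = -1" and T: "T = nbrs l \<inter> S"
  shows "(\<Sum>k\<in>T. \<Sum>i | i < N \<and> k = l[i := l ! i + e]. F i k)
      = (\<Sum>i<N. if l[i := l ! i + e] \<in> S then F i (l[i := l ! i + e]) else 0)"
proof -
  have fT: "finite T" using T by simp
  have "(\<Sum>k\<in>T. \<Sum>i | i < N \<and> k = l[i := l ! i + e]. F i k)
      = (\<Sum>k\<in>T. \<Sum>i<N. if k = l[i := l ! i + e] then F i k else 0)"
    by (rule sum.cong[OF refl], rule sum.mono_neutral_cong_left) auto
  also have "\<dots> = (\<Sum>i<N. \<Sum>k\<in>T. if k = l[i := l ! i + e] then F i k else 0)" by (rule sum.swap)
  also have "\<dots> = (\<Sum>i<N. if l[i := l ! i + e] \<in> S then F i (l[i := l ! i + e]) else 0)"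
  proof (rule sum.cong[OF refl])
    fix i assume "i \<in> {..<N}"
    then have "l[i := l ! i + e] \<in> nbrs l" using assms by (auto simp: nbrs_def)
    then show "(\<Sum>k\<in>T. if k = l[i := l ! i + e] then F i k else 0)
        = (if l[i := l ! i + e] \<in> S then F i (l[i := l ! i + e]) else 0)"
      using fT T by (simp add: sum.delta)
  qed
  finally show ?thesis .
qed

text \<open>The right-hand side is the coefficient of the undisplaced determinant in
  \<open>op_D_jt\<close>. The total jump rate out of l is a sum of \<open>pfc\<close> weights times
  quadratic polynomials in the coordinates, hence known from \<open>pfc_moments\<close>.\<close>

lemma qmat_diag:
  fixes z z' w w' :: complex
  assumes l: "l \<in> signatures N"
  defines "s \<equiv> w + w' - z - z'"
  shows "qmat z z' w w' N l l =
      - ((\<Sum>i<N. 2 * (of_int (sx l i))\<^sup>2 + 2 * (of_nat N - 1) * of_int (sx l i) + s * of_int (sx l i) +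
        (w * w' + z * z'))
        - (\<Sum>j<N. 2 * (of_nat j)\<^sup>2 - 2 * (of_nat N - 1) * of_nat j - s * of_nat j))"
proof -
  have N: "length l = N" using l by (rule signatures_length)
  have D0: "Dim l \<noteq> 0" using Dim_pos[OF l] by simp
  let ?x = "\<lambda>k. real_of_int (sx l k)"
  have inj: "inj_on ?x {..<N}" using sx_inj_on[OF l] by (auto simp: inj_on_def)
  have "(\<Sum>\<^sub>\<infinity>k\<in>signatures N - {l}. rate z z' w w' l k) = (\<Sum>\<^sub>\<infinity>k\<in>nbrs l \<inter> signatures N. rate z z' w w' l k)"
    by (rule infsum_cong_neutral) (auto simp: rate_not_nbr' not_in_nbrs)
  also have "\<dots> = (\<Sum>k\<in>nbrs l \<inter> signatures N. rate z z' w w' l k)" by (rule infsum_finite) simp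
  also have "\<dots> = (\<Sum>k\<in>nbrs l \<inter> signatures N. \<Sum>i | i < N \<and> k = l[i := l ! i + 1].
      of_real (Dim k / Dim l) * upr z z' l i)
    + (\<Sum>k\<in>nbrs l \<inter> signatures N. \<Sum>i | i < N \<and> k = l[i := l ! i + -1]. of_real (Dim k / Dim l) *
      downr w w' l i)"
    unfolding rate_eq N by (simp add: sum.distrib distrib_left sum_distrib_left)
  also have "\<dots> = (\<Sum>i<N. of_real (Dim (l[i := l ! i + 1]) / Dim l) * upr z z' l i)
      + (\<Sum>i<N. of_real (Dim (l[i := l ! i + -1]) / Dim l) * downr w w' l i)"
    by (subst (1 2) sum_nbrs_up[OF N _ refl])
      (use Dim_nonsignature_eq_0[OF l, of _ 1] Dim_nonsignature_eq_0[OF l, of _ "-1", simplified] in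
        \<open>auto intro!: arg_cong2[of _ _ _ _ "(+)"] sum.cong\<close>)
  also have "\<dots> = (\<Sum>i<N. of_real (pfc 1 ?x {..<N} i) * upr z z' l i)
      + (\<Sum>i<N. of_real (pfc (-1) ?x {..<N} i) * downr w w' l i)"
    using Dim_update[OF l, of _ 1] Dim_update[OF l, of _ "-1"] D0 by simp
  also have "(\<Sum>i<N. of_real (pfc 1 ?x {..<N} i) * upr z z' l i) =
     of_real (\<Sum>i<N. pfc 1 ?x {..<N} i * (?x i)\<^sup>2) - (z + z') * of_real (\<Sum>i<N. pfc 1 ?x {..<N} i * ?x i)
     + z * z' * of_real (\<Sum>i<N. pfc 1 ?x {..<N} i)"
    unfolding of_real_sum sum_distrib_left sum_subtractf[symmetric] sum.distrib[symmetric]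
    by (rule sum.cong) (auto simp: upr_def power2_eq_square algebra_simps)
  also have "(\<Sum>i<N. of_real (pfc (-1) ?x {..<N} i) * downr w w' l i) =
     of_real (\<Sum>i<N. pfc (-1) ?x {..<N} i * (?x i)\<^sup>2) + (2 * (of_nat N - 1) + w + w') *
       of_real (\<Sum>i<N. pfc (-1) ?x {..<N} i * ?x i)
     + (of_nat N - 1 + w) * (of_nat N - 1 + w') * of_real (\<Sum>i<N. pfc (-1) ?x {..<N} i)"
    unfolding of_real_sum sum_distrib_left sum_subtractf[symmetric] sum.distrib[symmetric]
    by (rule sum.cong) (auto simp: downr_def N power2_eq_square algebra_simps)
  finally have 1: "qmat z z' w w' N l l = - (
     of_real (\<Sum>i<N. pfc 1 ?x {..<N} i * (?x i)\<^sup>2) - (z + z') * of_real (\<Sum>i<N. pfc 1 ?x {..<N} i * ?x i)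
     + z * z' * of_real (\<Sum>i<N. pfc 1 ?x {..<N} i) +
     (of_real (\<Sum>i<N. pfc (-1) ?x {..<N} i * (?x i)\<^sup>2) + (2 * (of_nat N - 1) + w + w') *
       of_real (\<Sum>i<N. pfc (-1) ?x {..<N} i * ?x i)
     + (of_nat N - 1 + w) * (of_nat N - 1 + w') * of_real (\<Sum>i<N. pfc (-1) ?x {..<N} i)))"
    by (simp add: qmat_def)
  have sj: "(\<Sum>j<n. (of_nat j :: complex)) = of_nat n * (of_nat n - 1) / 2"
    "(\<Sum>j<n. (of_nat j :: complex)\<^sup>2) = of_nat n * (of_nat n - 1) * (2 * of_nat n - 1) / 6" for n
    by (induction n) (simp_all add: divide_simps algebra_simps power2_eq_square)
  let ?X1 = "\<Sum>i<N. (of_int (sx l i) :: complex)"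
  let ?X2 = "\<Sum>i<N. (of_int (sx l i) :: complex)\<^sup>2"
  have R: "(\<Sum>i<N. 2 * (of_int (sx l i))\<^sup>2 + 2 * (of_nat N - 1) * of_int (sx l i) + s * of_int (sx l i)
      + (w * w' + z * z'))
     = 2 * ?X2 + (2 * (of_nat N - 1) + s) * ?X1 + of_nat N * (w * w' + z * z')"
    by (simp add: sum.distrib distrib_right flip: sum_distrib_left)
  have R': "(\<Sum>j<N. 2 * (of_nat j)\<^sup>2 - 2 * (of_nat N - 1) * of_nat j - s * of_nat j)
     = 2 * (\<Sum>j<N. (of_nat j :: complex)\<^sup>2) - (2 * (of_nat N - 1) + s) * (\<Sum>j<N. (of_nat j :: complex))"
    by (simp add: sum_subtractf distrib_right flip: sum_distrib_left)
  note m = pfc_moments[OF finite_lessThan inj]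
  show ?thesis
    unfolding 1 R R' sj
    by (simp add: m s_def) (simp add: divide_simps, simp add: algebra_simps power2_eq_square)
qed

section \<open>The operator on the elements sigma\<close>

definition nbhd :: "nat \<Rightarrow> int list \<Rightarrow> int list set" where
  "nbhd N l = insert l (nbrs l \<inter> signatures N)"

lemma finite_nbhd [simp]: "finite (nbhd N l)"
  by (simp add: nbhd_def)

lemma nbhd_subset: "l \<in> signatures N \<Longrightarrow> nbhd N l \<subseteq> signatures N"
  by (auto simp: nbhd_def)

lemma qmat_not_nbhd: "l \<in> signatures N \<Longrightarrow> n \<in> signatures N \<Longrightarrow> n \<notin> nbhd N l \<Longrightarrow> qmat z z' w w' N n l = 0"
  using rate_not_nbr[of l n z z' w w'] by (auto simp: qmat_def nbhd_def signatures_length)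

text \<open>The rate is the one from n to l, not from l to n: the sigma elements transform like the
  densities \<open>Dim n\<close> \<sigma>_n of the links, on which the generator acts by its
  transpose. Off the diagonal, \<open>Dim n / Dim l\<close> cancels the ratio of dimensions inside
  the rate and leaves the polynomial coefficients of \<open>op_D_jt\<close>.\<close>

theorem op_D_sigma:
  assumes l: "l \<in> signatures N"
  shows "op_D z z' w w' (\<sigma> l) = (\<Sum>n\<in>nbhd N l. (of_real (Dim n / Dim l) * qmat z z' w w' N n l) \<bullet>\<^sub>R \<sigma> n)"
proof -
  have N: "length l = N" using l by (rule signatures_length)
  have D0: "Dim l \<noteq> 0" using Dim_pos[OF l] by simp
  let ?d = "\<lambda>i. (of_int (sx l i) + of_nat N + w) * (of_int (sx l i) + of_nat N + w')"
  let ?u = "\<lambda>i. (of_int (sx l i) - 1 - z) * (of_int (sx l i) - 1 - z')"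
  have sig: "\<sigma> m = jt N (sx m)" if "length m = N" for m
    unfolding \<sigma>_def using that by (rule jacobi_trudi_sx)
  have up: "jt N ((sx l)(i := sx l i + e)) = \<sigma> (l[i := l ! i + e])" if "i < N" for i e
    by (subst sig) (use that N in \<open>auto intro!: ldet_cong arg_cong[of _ _ \<phi>] simp: sx_def\<close>)
  have sum_eq: "(\<Sum>n\<in>nbrs l \<inter> signatures N. (of_real (Dim n / Dim l) * rate z z' w w' n l) \<bullet>\<^sub>R \<sigma> n) =
     (\<Sum>i<N. ?d i \<bullet>\<^sub>R \<sigma> (l[i := l ! i + 1])) + (\<Sum>i<N. ?u i \<bullet>\<^sub>R \<sigma> (l[i := l ! i + -1]))"
  proof -
    have "(\<Sum>n\<in>nbrs l \<inter> signatures N. (of_real (Dim n / Dim l) * rate z z' w w' n l) \<bullet>\<^sub>R \<sigma> n) =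
      (\<Sum>n\<in>nbrs l \<inter> signatures N. (\<Sum>i | i < N \<and> n = l[i := l ! i + 1]. ?d i \<bullet>\<^sub>R \<sigma> n) +
        (\<Sum>i | i < N \<and> n = l[i := l ! i + -1]. ?u i \<bullet>\<^sub>R \<sigma> n))"
    proof (rule sum.cong[OF refl])
      fix n assume n: "n \<in> nbrs l \<inter> signatures N"
      then have nN: "length n = N" and Dn: "Dim n \<noteq> 0" using Dim_pos[of n N] by (auto simp: signatures_length)
      have "of_real (Dim n / Dim l) * rate z z' w w' n l
          = (\<Sum>i | i < N \<and> l = n[i := n ! i + 1]. upr z z' n i) +
            (\<Sum>i | i < N \<and> l = n[i := n ! i - 1]. downr w w' n i)"
        unfolding rate_eq nN using Dn D0 by simp
      also have "(\<Sum>i | i < N \<and> l = n[i := n ! i + 1]. upr z z' n i)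
          = (\<Sum>i | i < N \<and> n = l[i := l ! i + -1]. ?u i)"
        using update_eq_iff[of l n _ "-1"] N nN by (intro sum.cong) (auto simp: upr_def sx_def algebra_simps)
      also have "(\<Sum>i | i < N \<and> l = n[i := n ! i - 1]. downr w w' n i)
          = (\<Sum>i | i < N \<and> n = l[i := l ! i + 1]. ?d i)"
        using update_eq_iff[of l n _ "1"] N nN by (intro sum.cong) (auto simp: downr_def sx_def algebra_simps)
      finally have e: "of_real (Dim n / Dim l) * rate z z' w w' n l
          = (\<Sum>i | i < N \<and> n = l[i := l ! i + -1]. ?u i) + (\<Sum>i | i < N \<and> n = l[i := l ! i + 1]. ?d i)" .
      have ss: "(\<Sum>i\<in>I. f i) \<bullet>\<^sub>R g = (\<Sum>i\<in>I. f i \<bullet>\<^sub>R g)" for I :: "nat set" and f g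
        by (rule R_eqI) (simp add: sum_distrib_right)
      show "(of_real (Dim n / Dim l) * rate z z' w w' n l) \<bullet>\<^sub>R \<sigma> n
          = (\<Sum>i | i < N \<and> n = l[i := l ! i + 1]. ?d i \<bullet>\<^sub>R \<sigma> n) +
            (\<Sum>i | i < N \<and> n = l[i := l ! i + -1]. ?u i \<bullet>\<^sub>R \<sigma> n)"
        unfolding e scale_add_left ss by (rule add.commute)
    qed
    also have "\<dots> = (\<Sum>i<N. ?d i \<bullet>\<^sub>R \<sigma> (l[i := l ! i + 1])) + (\<Sum>i<N. ?u i \<bullet>\<^sub>R \<sigma> (l[i := l ! i + -1]))"
      unfolding sum.distrib
      by (subst (1 2) sum_nbrs_up[OF N _ refl])
         (use jacobi_trudi_nonsignature_eq_0[OF l, of _ 1 \<phi>]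
           jacobi_trudi_nonsignature_eq_0[OF l, of _ "-1" \<phi>, simplified] in
             \<open>auto intro!: arg_cong2[of _ _ _ _ "(+)"] sum.cong simp: \<sigma>_def scale_zero_right\<close>)
    finally show ?thesis .
  qed
  have "(\<Sum>n\<in>nbhd N l. (of_real (Dim n / Dim l) * qmat z z' w w' N n l) \<bullet>\<^sub>R \<sigma> n) =
     qmat z z' w w' N l l \<bullet>\<^sub>R \<sigma> l +
       (\<Sum>n\<in>nbrs l \<inter> signatures N. (of_real (Dim n / Dim l) * qmat z z' w w' N n l) \<bullet>\<^sub>R \<sigma> n)"
    unfolding nbhd_def using not_in_nbrs[of l] D0 by (subst sum.insert) auto
  also have "(\<Sum>n\<in>nbrs l \<inter> signatures N. (of_real (Dim n / Dim l) * qmat z z' w w' N n l) \<bullet>\<^sub>R \<sigma> n) =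
     (\<Sum>n\<in>nbrs l \<inter> signatures N. (of_real (Dim n / Dim l) * rate z z' w w' n l) \<bullet>\<^sub>R \<sigma> n)"
    by (rule sum.cong) (use not_in_nbrs[of l] in \<open>auto simp: qmat_def\<close>)
  finally have R: "(\<Sum>n\<in>nbhd N l. (of_real (Dim n / Dim l) * qmat z z' w w' N n l) \<bullet>\<^sub>R \<sigma> n) =
     qmat z z' w w' N l l \<bullet>\<^sub>R \<sigma> l +
       ((\<Sum>i<N. ?d i \<bullet>\<^sub>R \<sigma> (l[i := l ! i + 1])) + (\<Sum>i<N. ?u i \<bullet>\<^sub>R \<sigma> (l[i := l ! i + -1])))"
    unfolding sum_eq .
  have "op_D z z' w w' (\<sigma> l) = (\<Sum>i<N. ?d i \<bullet>\<^sub>R \<sigma> (l[i := l ! i + 1]))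
      + (\<Sum>i<N. ?u i \<bullet>\<^sub>R \<sigma> (l[i := l ! i + -1]))
     + qmat z z' w w' N l l \<bullet>\<^sub>R \<sigma> l"
  proof -
    have 1: "(\<Sum>i<N. ?d i \<bullet>\<^sub>R jt N ((sx l)(i := sx l i + 1))) = (\<Sum>i<N. ?d i \<bullet>\<^sub>R \<sigma> (l[i := l ! i + 1]))"
      by (rule sum.cong[OF refl]) (simp only: lessThan_iff up)
    have 2: "(\<Sum>i<N. ?u i \<bullet>\<^sub>R jt N ((sx l)(i := sx l i - 1))) = (\<Sum>i<N. ?u i \<bullet>\<^sub>R \<sigma> (l[i := l ! i + -1]))"
      by (rule sum.cong[OF refl])
        (simp only: lessThan_iff up[of _ "-1", unfolded add_uminus_conv_diff] add_uminus_conv_diff)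
    show ?thesis
      unfolding qmat_diag[OF l] scale_minus_left sig[OF N] op_D_jt 1 2 by simp
  qed
  then show ?thesis unfolding R by simp
qed

subsection \<open>Products of absolutely convergent sums\<close>

lemma has_sum_times:
  fixes f :: "'a \<Rightarrow> complex" and g :: "'b \<Rightarrow> complex"
  assumes f: "(f has_sum s) A" and g: "(g has_sum t) B"
  shows "((\<lambda>(x, y). f x * g y) has_sum (s * t)) (A \<times> B)"
proof (rule has_sum_SigmaI)
  have fa: "(\<lambda>x. norm (f x)) summable_on A" and ga: "(\<lambda>x. norm (g x)) summable_on B"
    using f g summable_on_def summable_on_iff_abs_summable_on_complex by blast+
  have n: "(\<Sum>\<^sub>\<infinity>y\<in>B. norm (f x) * norm (g y)) = norm (f x) * (\<Sum>\<^sub>\<infinity>y\<in>B. norm (g y))" for x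
    by (rule infsum_cmult_right')
  have "(\<lambda>p. norm (case p of (x, y) \<Rightarrow> f x * g y)) summable_on A \<times> B"
  proof (rule Infinite_Sum.abs_summable_on_Sigma_iff[THEN iffD2], intro conjI ballI)
    show "(\<lambda>y. norm (case (x, y) of (x, y) \<Rightarrow> f x * g y)) summable_on B" for x
      using ga by (simp add: norm_mult summable_on_cmult_right)
    show "(\<lambda>x. norm (\<Sum>\<^sub>\<infinity>y\<in>B. norm (case (x, y) of (x, y) \<Rightarrow> f x * g y))) summable_on A"
      using fa by (simp add: norm_mult n abs_mult summable_on_cmult_left)
  qed
  then show "(\<lambda>(x, y). f x * g y) summable_on A \<times> B" by (rule abs_summable_summable)
  show "((\<lambda>x. f x * t) has_sum s * t) A" by (rule has_sum_cmult_left[OF f])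
  show "((\<lambda>y. case (x, y) of (x, y) \<Rightarrow> f x * g y) has_sum f x * t) B" for x
    using has_sum_cmult_right[OF g, of "f x"] by simp
qed

subsection \<open>Fourier coefficients on the unit circle\<close>

text \<open>\<open>phi_fun\<close> is a definite description; a Fourier integral on the unit circle
  pins it down and is stable under pointwise limits of the generating function.\<close>

definition fc :: "(complex \<Rightarrow> complex) \<Rightarrow> int \<Rightarrow> complex" where
  "fc F n = integral {0..2 * pi} (\<lambda>t. F (cis t) * cis (- of_int n * t)) / (2 * pi)"

lemma cis_powi: "cis t powi n = cis (of_int n * t)"
  by (simp add: cis_power_int)

lemma integral_cis:
  "((\<lambda>t. cis (of_int k * t)) has_integral (if k = 0 then 2 * pi else 0)) {0..2 * pi}"
proof (cases "k = 0")
  case True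
  then show ?thesis using has_integral_const_real[of "1::complex" 0 "2 * pi"]
    by (simp add: scaleR_conv_of_real)
next
  case False
  have "((\<lambda>t. cis (of_int k * t)) has_integral (cis (of_int k * (2 * pi)) / (\<i> * of_int k)
      - cis (of_int k * 0) / (\<i> * of_int k))) {0..2 * pi}"
  proof (rule fundamental_theorem_of_calculus)
    fix t assume "t \<in> {0..2 * pi}"
    show "((\<lambda>t. cis (of_int k * t) / (\<i> * of_int k)) has_vector_derivative cis (of_int k * t))
        (at t within {0..2 * pi})"
    proof -
      have "((\<lambda>z. exp (\<i> * (of_int k * z)) / (\<i> * of_int k)) has_field_derivative exp (\<i> *
          (of_int k * of_real t))) (at (of_real t))"
      proof -
        have "- (\<i> * (e * \<i>)) = e" for e by (simp add: complex_eq_iff)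
        then show ?thesis using False by (auto intro!: derivative_eq_intros)
      qed
      from has_vector_derivative_real_field[OF this, of "{0..2 * pi}"] show ?thesis
        by (simp add: cis_conv_exp)
    qed
  qed simp
  moreover have "cis (of_int k * (2 * pi)) = 1"
    using cis_multiple_2pi[of "of_int k"] by (simp add: mult.commute mult.left_commute)
  ultimately show ?thesis using False by simp
qed

lemma fc_eqI:
  assumes "\<And>u. norm u = 1 \<Longrightarrow> ((\<lambda>n. c n * u powi n) has_sum F u) UNIV"
  shows "fc F n = c n"
proof -
  let ?e = "\<lambda>m t. c m * cis (of_int m * t) * cis (- of_int n * t)"
  have hs: "((\<lambda>m. ?e m t) has_sum (F (cis t) * cis (- of_int n * t))) UNIV" for t
    using has_sum_cmult_left[OF assms[of "cis t"], of "cis (- of_int n * t)"] by (simp add: cis_powi)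
  \<comment> \<open>Convergence at u = 1 already means absolute summability of \<open>c\<close>,
    which dominates the series on the whole circle.\<close>
  have "(c has_sum F 1) UNIV" using assms[of 1] by simp
  then have ca: "(\<lambda>m. norm (c m)) summable_on UNIV"
    using summable_on_def summable_on_iff_abs_summable_on_complex by blast
  have "uniform_limit {0..2 * pi} (\<lambda>X t. \<Sum>m\<in>X. ?e m t) (\<lambda>t. \<Sum>\<^sub>\<infinity>m\<in>UNIV. ?e m t) (finite_subsets_at_top UNIV)"
    by (rule Weierstrass_m_test_general[OF _ ca]) (simp add: norm_mult)
  then have ul: "uniform_limit {0..2 * pi} (\<lambda>X t. \<Sum>m\<in>X. ?e m t) (\<lambda>t. F (cis t) *
      cis (- of_int n * t)) (finite_subsets_at_top UNIV)"
    using infsumI[OF hs] by simp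
  obtain I J' where IJ: "\<And>X. ((\<lambda>t. \<Sum>m\<in>X. ?e m t) has_integral I X) {0..2 * pi}"
    "((\<lambda>t. F (cis t) * cis (- of_int n * t)) has_integral J') {0..2 * pi}"
      "(I \<longlongrightarrow> J') (finite_subsets_at_top UNIV)"
    by (rule uniform_limit_integral[OF ul]) (auto intro!: continuous_intros)
  have e: "?e m t = c m * cis (of_int (m - n) * t)" for m t
    by (simp add: cis_mult algebra_simps)
  have "I X = 2 * pi * c n" if "finite X" "n \<in> X" for X
  proof -
    have "((\<lambda>t. \<Sum>m\<in>X. ?e m t) has_integral (\<Sum>m\<in>X. c m * (if m - n = 0 then 2 * pi else 0))) {0..2 * pi}"
      unfolding e by (intro has_integral_sum that has_integral_mult_right integral_cis)
    then have "I X = (\<Sum>m\<in>X. c m * (if m - n = 0 then 2 * pi else 0))"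
      using IJ(1) has_integral_unique by blast
    also have "\<dots> = (\<Sum>m\<in>X. if m = n then 2 * pi * c n else 0)" by (rule sum.cong) auto
    finally show ?thesis using that by simp
  qed
  then have "eventually (\<lambda>X. I X = 2 * pi * c n) (finite_subsets_at_top UNIV)"
    unfolding eventually_finite_subsets_at_top by (intro exI[of _ "{n}"]) auto
  then have "J' = 2 * pi * c n"
    using IJ(3) tendsto_unique[OF finite_subsets_at_top_neq_bot IJ(3)] tendsto_eventually by metis
  then show ?thesis using IJ(2) by (simp add: fc_def integral_unique)
qed

lemma fc_tendsto:
  assumes cont: "\<And>k. continuous_on (sphere 0 1) (F k)"
    and bd: "\<And>k u. norm u = 1 \<Longrightarrow> norm (F k u) \<le> 1"
    and lim: "\<And>u. norm u = 1 \<Longrightarrow> (\<lambda>k. F k u) \<longlonglongrightarrow> G u"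
  shows "(\<lambda>k. fc (F k) n) \<longlonglongrightarrow> fc G n"
proof -
  have "(\<lambda>k. integral {0..2 * pi} (\<lambda>t. F k (cis t) * cis (- of_int n * t)))
      \<longlonglongrightarrow> integral {0..2 * pi} (\<lambda>t. G (cis t) * cis (- of_int n * t))"
  proof (rule dominated_convergence)
    show "(\<lambda>t. F k (cis t) * cis (- of_int n * t)) integrable_on {0..2 * pi}" for k
      by (intro integrable_continuous_interval continuous_intros continuous_on_compose2[OF cont]) auto
    show "(\<lambda>_. 1) integrable_on {0..2 * pi}" by (rule integrable_const_ivl)
    show "norm (F k (cis t) * cis (- of_int n * t)) \<le> 1" for k t
      using bd[of "cis t" k] by (simp add: norm_mult)
    show "(\<lambda>k. F k (cis t) * cis (- of_int n * t)) \<longlonglongrightarrow> G (cis t) * cis (- of_int n * t)" for t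
      by (intro tendsto_intros lim) simp
  qed
  then show ?thesis unfolding fc_def by (intro tendsto_intros) auto
qed

subsection \<open>Laurent expansions\<close>

lemma laurent_expansion_exists:
  assumes hol: "G1 holomorphic_on ball 0 R" "G2 holomorphic_on ball 0 R" and R: "R > 1"
  shows "\<exists>c. \<exists>r>0. \<forall>u. 1 - r < norm u \<and> norm u < 1 + r \<longrightarrow>
     ((\<lambda>n. c n * u powi n) has_sum (G1 u * G2 (inverse u))) UNIV"
proof -
  have ps: "((\<lambda>n. (deriv ^^ n) G 0 / fact n * u ^ n) has_sum G u) UNIV" if G: "G holomorphic_on ball 0 R"
    and u: "norm u < R" for G u
  proof -
    have s: "(\<lambda>n. (deriv ^^ n) G 0 / fact n * v ^ n) sums G v" if "norm v < R" for v
      using holomorphic_power_series[OF G, of v] that by simp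
    obtain v where v: "norm u < v" "v < R" using dense[OF u] by blast
    have "summable (\<lambda>n. (deriv ^^ n) G 0 / fact n * (of_real v) ^ n)"
      using s[of "of_real v"] v norm_ge_zero[of u]
        by (intro sums_summable) (auto simp: abs_if split: if_splits)
    then have "summable (\<lambda>n. norm ((deriv ^^ n) G 0 / fact n * u ^ n))"
      by (rule powser_insidea) (use v in auto)
    then show ?thesis using s[OF u] by (rule norm_summable_imp_has_sum)
  qed
  define a where "a = (\<lambda>n. (deriv ^^ n) G1 0 / fact n)"
  define b where "b = (\<lambda>n. (deriv ^^ n) G2 0 / fact n)"
  define c where "c = (\<lambda>n::int. \<Sum>\<^sub>\<infinity>(j, k)\<in>{(j, k). int j - int k = n}. a j * b k)"
  \<comment> \<open>Then 1 - r = 1 / R, so that the inverse of u stays in the disc of radius R, and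
    1 + r \<le> R amounts to R + 1 / R \<ge> 2.\<close>
  define r where "r = 1 - 1 / R"
  have r: "r > 0" "1 + r \<le> R" "1 - r = 1 / R"
  proof -
    have "R + 1 / R \<ge> 2" using R sum_squares_bound[of "R" 1] by (simp add: field_simps power2_eq_square)
    then show "r > 0" "1 + r \<le> R" "1 - r = 1 / R" using R by (auto simp: r_def)
  qed
  have "((\<lambda>n. c n * u powi n) has_sum (G1 u * G2 (inverse u))) UNIV" if u: "1 - r < norm u" "norm u < 1 + r"
    for u
  proof -
    have u0: "u \<noteq> 0" using u r R by auto
    have "inverse (norm u) < R" using u(1) r(3) R u0 by (simp add: field_simps)
    then have "norm (inverse u) < R" by (simp add: norm_inverse)
    have hs: "((\<lambda>(j, k). (a j * u ^ j) * (b k * inverse u ^ k)) has_sum (G1 u * G2 (inverse u)))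
        (UNIV \<times> UNIV)"
      unfolding a_def b_def
      by (rule has_sum_times[OF ps[OF hol(1)] ps[OF hol(2)]]) (use u r \<open>norm (inverse u) < R\<close> in auto)
    have e: "(a j * u ^ j) * (b k * inverse u ^ k) = a j * b k * u powi (int j - int k)" for j k
      using u0 by (simp add: power_int_diff power_inverse divide_inverse)
    let ?S = "SIGMA n:(UNIV::int set). {(j, k). int j - int k = n}"
    have "((\<lambda>(n, (j, k)). a j * b k * u powi n) has_sum (G1 u * G2 (inverse u))) ?S"
      using hs
      by (subst has_sum_reindex_bij_witness[where i = "\<lambda>(j, k). (int j - int k, (j, k))" and j = snd
        and T = "UNIV \<times> UNIV"
            and h = "\<lambda>(j, k). (a j * u ^ j) * (b k * inverse u ^ k)"])
         (auto simp: e)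
    moreover have "((\<lambda>p. case (n, p) of (n, (j, k)) \<Rightarrow> a j * b k * u powi n) has_sum c n * u powi n) {(j, k).
        int j - int k = n}" for n
    proof -
      have "(\<lambda>(j, k). a j * b k * u powi (int j - int k)) summable_on UNIV \<times> UNIV"
        using hs unfolding e summable_on_def by auto
      then have "(\<lambda>(j, k). a j * b k * u powi (int j - int k)) summable_on {(j, k). int j - int k = n}"
        by (rule summable_on_subset_banach) auto
      then have "(\<lambda>(j, k). a j * b k * u powi n) summable_on {(j, k). int j - int k = n}"
        by (subst summable_on_cong[where g = "\<lambda>(j, k). a j * b k * u powi (int j - int k)"]) auto
      moreover have "(\<lambda>(j, k). a j * b k * u powi n) = (\<lambda>p. (case p of (j, k) \<Rightarrow> a j * b k) * u powi n)"
        by auto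
      moreover have "(\<Sum>\<^sub>\<infinity>p\<in>{(j, k). int j - int k = n}. (case p of (j, k) \<Rightarrow> a j * b k) * u powi n)
          = c n * u powi n"
        unfolding c_def by (rule infsum_cmult_left')
      ultimately show ?thesis by (simp add: has_sum_iff case_prod_unfold)
    qed
    ultimately show ?thesis by (rule has_sum_Sigma')
  qed
  then show ?thesis using r(1) by blast
qed

subsection \<open>The generating function\<close>

definition fct :: "real \<Rightarrow> real \<Rightarrow> complex \<Rightarrow> complex" where
  "fct a b u = (1 + of_real b * (u - 1)) / (1 - of_real a * (u - 1))"

definition half_param :: "(nat \<Rightarrow> real) \<Rightarrow> (nat \<Rightarrow> real) \<Rightarrow> bool" where
  "half_param a b \<longleftrightarrow> decseq a \<and> decseq b \<and> (\<forall>i. 0 \<le> a i) \<and> (\<forall>i. 0 \<le> b i \<and> b i \<le> 1) \<and> summable (\<lambda>i. a i + b i)"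

definition half_gen :: "(nat \<Rightarrow> real) \<Rightarrow> (nat \<Rightarrow> real) \<Rightarrow> real \<Rightarrow> complex \<Rightarrow> complex" where
  "half_gen a b g u = exp (of_real g * (u - 1)) * prodinf (\<lambda>i. fct (a i) (b i) u)"

text \<open>The poles of the factors lie at 1 + 1 / a i, hence beyond this radius, which also makes
  sense for a 0 = 0 and keeps all denominators at distance at least 1/2 from 0.\<close>

definition half_rad :: "(nat \<Rightarrow> real) \<Rightarrow> real" where
  "half_rad a = 1 + 1 / (2 * (1 + a 0))"

lemma half_paramD:
  assumes "half_param a b"
  shows "0 \<le> a i" "a i \<le> a 0" "0 \<le> b i" "b i \<le> 1" "summable (\<lambda>i. a i + b i)"
  using assms by (auto simp: half_param_def decseq_def)

lemma half_rad: "half_param a b \<Longrightarrow> 1 < half_rad a" "half_param a b \<Longrightarrow> half_rad a \<le> 2"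
  using half_paramD(1)[of a b 0] by (auto simp: half_rad_def divide_simps)

lemma norm_den_ge:
  fixes u :: complex
  assumes "half_param a b" "norm u \<le> half_rad a"
  shows "norm (1 - of_real (a i) * (u - 1)) \<ge> 1 / 2"
proof -
  have a: "0 \<le> a i" "a i \<le> a 0" using half_paramD[OF assms(1)] by auto
  have "a i * Re u \<le> a i * half_rad a"
    using a assms(2) complex_Re_le_cmod[of u] by (intro mult_left_mono) auto
  also have "\<dots> \<le> a i + 1 / 2" using a by (simp add: half_rad_def field_simps)
  finally have "1 / 2 \<le> Re (1 - of_real (a i) * (u - 1))" by (simp add: algebra_simps)
  also have "\<dots> \<le> norm (1 - of_real (a i) * (u - 1))" by (rule complex_Re_le_cmod)
  finally show ?thesis .
qed

lemma fct_minus_1: "1 - of_real a * (u - 1) \<noteq> 0 \<Longrightarrow> fct a b u - 1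
    = of_real (a + b) * (u - 1) / (1 - of_real a * (u - 1))"
  by (simp add: fct_def divide_simps) (simp add: algebra_simps)

lemma norm_fct_minus_1:
  assumes "half_param a b" "norm u \<le> half_rad a"
  shows "norm (fct (a i) (b i) u - 1) \<le> 6 * (a i + b i)"
proof -
  have d: "norm (1 - of_real (a i) * (u - 1)) \<ge> 1 / 2" by (rule norm_den_ge[OF assms])
  then have nz: "1 - of_real (a i) * (u - 1) \<noteq> 0" by auto
  have "norm (u - 1) \<le> norm u + 1" using norm_triangle_ineq4[of u 1] by simp
  then have u1: "norm (u - 1) \<le> 3" using assms(2) half_rad(2)[OF assms(1)] by simp
  have ab: "0 \<le> a i + b i" using half_paramD[OF assms(1)] by (simp add: add_nonneg_nonneg)
  have "norm (fct (a i) (b i) u - 1) = (a i + b i) * norm (u - 1) / norm (1 - of_real (a i) * (u - 1))"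
    unfolding fct_minus_1[OF nz] norm_divide norm_mult norm_of_real using ab by simp
  \<comment> \<open>Here 3 bounds the norm of u - 1, as \<open>half_rad a\<close> is at most
    2.\<close>
  also have "\<dots> \<le> (a i + b i) * 3 / (1 / 2)"
    using ab u1 d by (intro frac_le mult_left_mono) auto
  finally show ?thesis by simp
qed

lemma convergent_prod_fct:
  assumes "half_param a b" "norm u \<le> half_rad a"
  shows "convergent_prod (\<lambda>i. fct (a i) (b i) u)"
proof (intro abs_convergent_prod_imp_convergent_prod summable_imp_abs_convergent_prod)
  have "summable (\<lambda>i. 6 * (a i + b i))" using half_paramD(5)[OF assms(1)] by (rule summable_mult)
  then show "summable (\<lambda>i. norm (fct (a i) (b i) u - 1))"
    by (rule summable_comparison_test[rotated]) (use norm_fct_minus_1[OF assms] in auto)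
qed

lemma fct_prod_LIMSEQ:
  assumes "half_param a b" "norm u \<le> half_rad a"
  shows "(\<lambda>n. \<Prod>i<n. fct (a i) (b i) u) \<longlonglongrightarrow> prodinf (\<lambda>i. fct (a i) (b i) u)"
  using convergent_prod_LIMSEQ[OF convergent_prod_fct[OF assms]] by (simp add: LIMSEQ_lessThan_iff_atMost)

lemma fct_holomorphic:
  assumes "half_param a b"
  shows "fct (a i) (b i) holomorphic_on ball 0 (half_rad a)"
    "continuous_on (cball 0 (half_rad a)) (fct (a i) (b i))"
proof -
  have nz: "1 - of_real (a i) * (u - 1) \<noteq> 0" if "u \<in> cball 0 (half_rad a)" for u :: complex
    using norm_den_ge[OF assms, of u i] that by auto
  show "continuous_on (cball 0 (half_rad a)) (fct (a i) (b i))"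
    unfolding fct_def[abs_def] by (intro continuous_intros) (use nz in auto)
  show "fct (a i) (b i) holomorphic_on ball 0 (half_rad a)"
    unfolding fct_def[abs_def] by (intro holomorphic_intros) (use nz in auto)
qed

lemma half_gen_holomorphic:
  assumes h: "half_param a b"
  shows "half_gen a b g holomorphic_on ball 0 (half_rad a)"
proof -
  let ?P = "\<lambda>n u. \<Prod>i<n. fct (a i) (b i) u"
  let ?C = "cball (0::complex) (half_rad a)"
  have "uniformly_convergent_on ?C ?P"
  proof (rule uniformly_convergent_on_prod')
    have "summable (\<lambda>i. 6 * (a i + b i))" using half_paramD(5)[OF h] by (rule summable_mult)
    then show "uniformly_convergent_on ?C (\<lambda>N x. \<Sum>n<N. norm (fct (a n) (b n) x - 1))"
      by (rule Weierstrass_m_test'[rotated]) (use norm_fct_minus_1[OF h] in auto)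
  qed (use fct_holomorphic[OF h] in auto)
  then obtain l where l: "uniform_limit ?C ?P l sequentially" by (auto simp: uniformly_convergent_on_def)
  have eq: "l u = prodinf (\<lambda>i. fct (a i) (b i) u)" if "u \<in> ?C" for u
    using LIMSEQ_unique[OF tendsto_uniform_limitI[OF l that] fct_prod_LIMSEQ[OF h]] that by simp
  have "l holomorphic_on ball 0 (half_rad a)"
  proof (rule holomorphic_uniform_sequence)
    show "?P n holomorphic_on ball 0 (half_rad a)" for n
      by (intro holomorphic_intros fct_holomorphic(1)[OF h])
    fix x :: complex assume "x \<in> ball 0 (half_rad a)"
    then obtain d where d: "0 < d" "cball x d \<subseteq> ball 0 (half_rad a)"
      using open_contains_cball[of "ball 0 (half_rad a)"] by blast
    then show "\<exists>d>0. cball x d \<subseteq> ball 0 (half_rad a) \<and> uniform_limit (cball x d) ?P l sequentially"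
      by (intro exI[of _ d] conjI uniform_limit_on_subset[OF l]) auto
  qed simp
  then have "(\<lambda>u. prodinf (\<lambda>i. fct (a i) (b i) u)) holomorphic_on ball 0 (half_rad a)"
    by (rule holomorphic_transform) (use eq in auto)
  then show ?thesis unfolding half_gen_def[abs_def] by (intro holomorphic_intros)
qed

text \<open>The numerator is a convex combination of 1 and u; the denominator is (1 + a) - a u and
  is bounded below by the reverse triangle inequality.\<close>

lemma norm_fct_le_1:
  assumes "0 \<le> a" "0 \<le> b" "b \<le> 1" "norm u = 1"
  shows "norm (fct a b u) \<le> 1"
proof -
  have "norm (1 + of_real b * (u - 1)) = norm (of_real (1 - b) + of_real b * u)" by (simp add: algebra_simps)
  also have "\<dots> \<le> norm (of_real (1 - b) :: complex) + norm (of_real b * u)" by (rule norm_triangle_ineq)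
  also have "\<dots> = 1" unfolding norm_mult norm_of_real using assms by simp
  finally have 1: "norm (1 + of_real b * (u - 1)) \<le> 1" .
  have "1 = norm (of_real (1 + a) :: complex) - norm (of_real a * u)"
    unfolding norm_mult norm_of_real using assms by simp
  also have "\<dots> \<le> norm (of_real (1 + a) - of_real a * u)" by (rule norm_triangle_ineq2)
  also have "\<dots> = norm (1 - of_real a * (u - 1))" by (simp add: algebra_simps)
  finally have 2: "1 \<le> norm (1 - of_real a * (u - 1))" .
  have "norm (1 + of_real b * (u - 1)) / norm (1 - of_real a * (u - 1)) \<le> 1 / 1"
    by (rule frac_le) (use 1 2 in auto)
  then show ?thesis by (simp add: fct_def norm_divide)
qed

section \<open>Laurent coefficients at the points of Omega\<close>

definition gam :: "(nat \<Rightarrow> real) \<Rightarrow> (nat \<Rightarrow> real) \<Rightarrow> real \<Rightarrow> real" where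
  "gam a b d = d - suminf (\<lambda>i. a i + b i)"

lemma OmegaD:
  assumes "(ap, bp, am, bm, dp, dm) \<in> Omega"
  shows "half_param ap bp" "half_param am bm" "0 \<le> gam ap bp dp" "0 \<le> gam am bm dm" "bp 0 + bm 0 \<le> 1"
proof -
  have *: "decseq s \<and> (\<forall>i. 0 \<le> s i)" if "s \<in> {ap, bp, am, bm}" for s
    using assms that by (auto simp: Omega_def)
  have s: "bp 0 + bm 0 \<le> 1" using assms by (auto simp: Omega_def)
  moreover have "bp i \<le> bp 0" "bm i \<le> bm 0" for i using * by (auto simp: decseq_def)
  moreover have "0 \<le> bp 0" "0 \<le> bm 0" using * by auto
  ultimately have b: "bp i \<le> 1" "bm i \<le> 1" for i by (meson add_increasing add_increasing2 order_trans)+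
  show "half_param ap bp" "half_param am bm" using * b assms by (auto simp: half_param_def Omega_def)
  show "0 \<le> gam ap bp dp" "0 \<le> gam am bm dm" using assms by (auto simp: gam_def Omega_def)
qed (use assms in \<open>auto simp: Omega_def\<close>)

lemma Phi_split:
  assumes "half_param ap bp" "half_param am bm" "norm u \<le> half_rad ap" "norm (inverse u) \<le> half_rad am"
  shows "Phi u (ap, bp, am, bm, dp, dm) = half_gen ap bp (gam ap bp dp) u *
      half_gen am bm (gam am bm dm) (inverse u)"
proof -
  have "prodinf (\<lambda>i. fct (ap i) (bp i) u * fct (am i) (bm i) (inverse u)) =
    prodinf (\<lambda>i. fct (ap i) (bp i) u) * prodinf (\<lambda>i. fct (am i) (bm i) (inverse u))"
    by (rule prodinf_mult[symmetric]) (use convergent_prod_fct assms in auto)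
  then show ?thesis
    by (simp add: half_gen_def gam_def fct_def exp_add mult_ac)
qed

lemma half_gen_bound:
  assumes h: "half_param a b" and g: "0 \<le> g" and u: "norm u = 1"
  shows "norm (half_gen a b g u) \<le> 1"
proof -
  have ur: "norm u \<le> half_rad a" using half_rad[OF h] u by simp
  have "norm (\<Prod>i<n. fct (a i) (b i) u) \<le> 1" for n
    unfolding prod_norm[symmetric] by (rule prod_le_1) (use half_paramD[OF h] u norm_fct_le_1 in auto)
  then have 1: "norm (prodinf (\<lambda>i. fct (a i) (b i) u)) \<le> 1"
    using LIMSEQ_le_const2[OF tendsto_norm[OF fct_prod_LIMSEQ[OF h ur]], of 1] by blast
  have "Re u \<le> 1" using complex_Re_le_cmod[of u] u by simp
  then have "norm (exp (of_real g * (u - 1))) \<le> 1"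
    using g by (simp add: norm_exp_eq_Re mult_nonneg_nonpos)
  with 1 show ?thesis unfolding half_gen_def norm_mult by (intro mult_le_one) auto
qed

lemma Phi_circle:
  assumes "\<omega> \<in> Omega"
  shows "norm u = 1 \<Longrightarrow> norm (Phi u \<omega>) \<le> 1" "continuous_on (sphere 0 1) (\<lambda>u. Phi u \<omega>)"
proof -
  obtain ap bp am bm dp dm where w: "\<omega> = (ap, bp, am, bm, dp, dm)" by (metis prod_cases6)
  note O = OmegaD[OF assms[unfolded w]]
  have r: "norm u \<le> half_rad ap" "norm (inverse u) \<le> half_rad am" if "norm u = 1" for u :: complex
    using half_rad(1)[OF O(1)] half_rad(1)[OF O(2)] that by (auto simp: norm_inverse)
  show "norm (Phi u \<omega>) \<le> 1" if "norm u = 1"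
    unfolding w Phi_split[OF O(1,2) r[OF that]] norm_mult
    by (intro mult_le_one half_gen_bound) (use O that in \<open>auto simp: norm_inverse\<close>)
  have "continuous_on (sphere 0 1) (half_gen ap bp (gam ap bp dp))"
    by (rule continuous_on_subset[OF holomorphic_on_imp_continuous_on[OF half_gen_holomorphic[OF O(1)]]])
       (use half_rad(1)[OF O(1)] in auto)
  moreover have "continuous_on (sphere 0 1) (\<lambda>u. half_gen am bm (gam am bm dm) (inverse u))"
    by (rule continuous_on_compose2[OF holomorphic_on_imp_continuous_on[OF half_gen_holomorphic[OF O(2)]]])
       (use half_rad(1)[OF O(2)] in \<open>auto intro!: continuous_intros simp: norm_inverse\<close>)
  ultimately have "continuous_on (sphere 0 1) (\<lambda>u. half_gen ap bp (gam ap bp dp) u *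
      half_gen am bm (gam am bm dm) (inverse u))"
    by (rule continuous_on_mult)
  then show "continuous_on (sphere 0 1) (\<lambda>u. Phi u \<omega>)"
    by (rule continuous_on_eq) (use r Phi_split[OF O(1,2)] w in auto)
qed

text \<open>Resolves the definite description. Existence comes from multiplying a power series in u
  with one in its inverse; uniqueness holds because every annulus in question contains the unit
  circle, where the coefficients are Fourier integrals.\<close>

lemma phi_fun_expansion:
  assumes "\<omega> \<in> Omega"
  shows "\<exists>r>0. \<forall>u. 1 - r < norm u \<and> norm u < 1 + r \<longrightarrow> ((\<lambda>n. phi_fun \<omega> n * u powi n) has_sum Phi u \<omega>) UNIV"
proof -
  obtain ap bp am bm dp dm where w: "\<omega> = (ap, bp, am, bm, dp, dm)" by (metis prod_cases6)
  note O = OmegaD[OF assms[unfolded w]]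
  let ?E = "\<lambda>c. \<exists>r>0. \<forall>u. 1 - r < norm u \<and> norm u < 1 + r \<longrightarrow> ((\<lambda>n. c n * u powi n) has_sum Phi u \<omega>) UNIV"
  define R where "R = min (half_rad ap) (half_rad am)"
  have R: "R > 1" "R \<le> half_rad ap" "R \<le> half_rad am" using half_rad(1)[OF O(1)] half_rad(1)[OF O(2)]
    by (auto simp: R_def)
  have "half_gen ap bp (gam ap bp dp) holomorphic_on ball 0 R"
    "half_gen am bm (gam am bm dm) holomorphic_on ball 0 R"
    by (rule holomorphic_on_subset[OF half_gen_holomorphic]; use O R in auto)+
  from laurent_expansion_exists[OF this R(1)] obtain c r where r: "r > 0"
    and c: "\<And>u. 1 - r < norm u \<Longrightarrow> norm u < 1 + r \<Longrightarrow>
      ((\<lambda>n. c n * u powi n) has_sum half_gen ap bp (gam ap bp dp) u *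
        half_gen am bm (gam am bm dm) (inverse u)) UNIV"
    by blast
  have ex: "?E c"
  proof (intro exI[of _ "min r (1 - 1 / R)"] conjI allI impI)
    show "0 < min r (1 - 1 / R)" using r R by auto
    fix u :: complex assume u: "1 - min r (1 - 1 / R) < norm u \<and> norm u < 1 + min r (1 - 1 / R)"
    have "1 + (1 - 1 / R) \<le> R" using R(1) sum_squares_bound[of R 1]
      by (simp add: field_simps power2_eq_square)
    then have "norm u \<le> R" using u by auto
    moreover have "norm (inverse u) \<le> R"
    proof -
      have "1 / R < norm u" using u by auto
      moreover have "0 < 1 / R" using R by simp
      ultimately have "0 < norm u" "1 / R < norm u" by linarith+
      then have "1 / norm u < R" using R(1) by (simp add: pos_divide_less_eq mult.commute)
      then show ?thesis by (simp add: norm_inverse divide_inverse)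
    qed
    ultimately have "Phi u \<omega> = half_gen ap bp (gam ap bp dp) u * half_gen am bm (gam am bm dm) (inverse u)"
      unfolding w using R by (intro Phi_split[OF O(1,2)]) linarith+
    moreover have "1 - r < norm u" "norm u < 1 + r" using u by auto
    ultimately show "((\<lambda>n. c n * u powi n) has_sum Phi u \<omega>) UNIV"
      using c[of u] by metis
  qed
  have fcE: "d n = fc (\<lambda>u. Phi u \<omega>) n" if d: "?E d" for d n
  proof (rule fc_eqI[symmetric])
    fix u :: complex assume "norm u = 1"
    moreover obtain r where "r > 0" "\<forall>u. 1 - r < norm u \<and> norm u < 1
        + r \<longrightarrow> ((\<lambda>n. d n * u powi n) has_sum Phi u \<omega>) UNIV"
      using d by blast
    ultimately show "((\<lambda>n. d n * u powi n) has_sum Phi u \<omega>) UNIV" by simp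
  qed
  have uniq: "c' = c''" if "?E c'" "?E c''" for c' c''
    by (rule ext) (simp only: fcE[OF that(1)] fcE[OF that(2)])
  have "phi_fun \<omega> = c" unfolding phi_fun_def
  proof (rule the_equality)
    show "?E c" by (rule ex)
    show "d = c" if "?E d" for d using uniq[OF that ex] .
  qed
  with ex show ?thesis by simp
qed

lemma phi_fun_has_sum:
  assumes "\<omega> \<in> Omega" "norm u = 1"
  shows "((\<lambda>n. phi_fun \<omega> n * u powi n) has_sum Phi u \<omega>) UNIV"
  using phi_fun_expansion[OF assms(1)] assms(2) by auto

lemma phi_fun_eq_fc:
  assumes "\<omega> \<in> Omega"
  shows "phi_fun \<omega> n = fc (\<lambda>u. Phi u \<omega>) n"
  by (rule fc_eqI[symmetric]) (rule phi_fun_has_sum[OF assms])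

subsection \<open>Totally positive sequences\<close>

definition sdec :: "nat \<Rightarrow> (nat \<Rightarrow> int) \<Rightarrow> bool" where
  "sdec N a \<longleftrightarrow> (\<forall>i j. i < j \<longrightarrow> j < N \<longrightarrow> a j < a i)"

text \<open>Only minors with consecutive columns are demanded, which are exactly the Jacobi-Trudi
  determinants of signatures. This class is already stable under the convolutions used
  below.\<close>

definition TP :: "(int \<Rightarrow> real) \<Rightarrow> bool" where
  "TP f \<longleftrightarrow> (\<forall>N a. sdec N a \<longrightarrow> 0 \<le> ldet N (\<lambda>i j. f (a i + int j)))"

lemma norm_ldet_le:
  fixes M :: "nat \<Rightarrow> nat \<Rightarrow> 'a::{comm_ring_1, real_normed_algebra_1}"
  assumes "\<And>i j. i < N \<Longrightarrow> j < N \<Longrightarrow> norm (M i j) \<le> 1"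
    and k: "k < N" "\<And>j. j < N \<Longrightarrow> norm (M k j) \<le> e"
  shows "norm (ldet N M) \<le> fact N * e"
proof -
  have "norm (ldet N M) \<le> (\<Sum>p | p permutes {..<N}. e)"
    unfolding ldet_def
  proof (rule sum_norm_le)
    fix p assume "p \<in> {p. p permutes {..<N}}"
    then have p: "p permutes {..<N}" by simp
    have "norm (of_int (sign p) * (\<Prod>i<N. M i (p i)) :: 'a) = norm (\<Prod>i<N. M i (p i))"
      by (auto simp: sign_def)
    also have "\<dots> = norm (M k (p k) * (\<Prod>i\<in>{..<N} - {k}. M i (p i)))"
      using k by (subst prod.remove[of _ k]) auto
    also have "\<dots> \<le> norm (M k (p k)) * norm (\<Prod>i\<in>{..<N} - {k}. M i (p i))" by (rule norm_mult_ineq)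
    also have "\<dots> \<le> e * 1"
    proof (rule mult_mono)
      have "norm (\<Prod>i\<in>{..<N} - {k}. M i (p i)) \<le> (\<Prod>i\<in>{..<N} - {k}. norm (M i (p i)))" by (rule norm_prod_le)
      also have "\<dots> \<le> 1" by (rule prod_le_1) (auto intro!: assms(1) intro: permutes_lessThan[OF p])
      finally show "norm (\<Prod>i\<in>{..<N} - {k}. M i (p i)) \<le> 1" .
      show "norm (M k (p k)) \<le> e" using k permutes_lessThan[OF p] by auto
      show "0 \<le> e" using k(2)[OF k(1)] norm_ge_zero order_trans by blast
    qed simp
    finally show "norm (of_int (sign p) * (\<Prod>i<N. M i (p i)) :: 'a) \<le> e" by simp
  qed
  also have "\<dots> = fact N * e" by (simp add: card_permutations)
  finally show ?thesis .
qed

lemma tendsto_ldet: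
  fixes M :: "'b \<Rightarrow> nat \<Rightarrow> nat \<Rightarrow> 'a::{comm_ring_1, real_normed_algebra_1}"
  assumes "\<And>i j. i < N \<Longrightarrow> j < N \<Longrightarrow> ((\<lambda>k. M k i j) \<longlongrightarrow> L i j) F"
  shows "((\<lambda>k. ldet N (M k)) \<longlongrightarrow> ldet N L) F"
  unfolding ldet_def
  by (intro tendsto_sum tendsto_mult tendsto_const tendsto_prod) (auto intro!: assms intro: permutes_lessThan)

text \<open>If some row is zero, so is the determinant. Otherwise a takes its N strictly decreasing
  values in {-N<..0}, which forces a i = - i and the identity matrix.\<close>

lemma TP_delta: "TP (\<lambda>n. if n = 0 then 1 else 0)"
  unfolding TP_def
proof (intro allI impI)
  fix N a assume a: "sdec N a"
  let ?M = "\<lambda>i j. if a i + int j = 0 then 1 else (0::real)"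
  show "0 \<le> ldet N ?M"
  proof (cases "\<exists>i<N. \<forall>j<N. a i + int j \<noteq> 0")
    case True
    then obtain i where i: "i < N" "\<And>j. j < N \<Longrightarrow> ?M i j = 0" by auto
    have "ldet N ?M = 0" unfolding ldet_def
    proof (rule sum.neutral, safe)
      fix p assume p: "p permutes {..<N}"
      have "?M i (p i) = 0" using i permutes_lessThan[OF p] by blast
      then have "(\<Prod>i<N. ?M i (p i)) = 0" using i(1) by (intro prod_zero bexI[of _ i]) auto
      then show "of_int (sign p) * (\<Prod>i<N. ?M i (p i)) = 0" by simp
    qed
    then show ?thesis by simp
  next
    case False
    then have bd: "- int N < a i \<and> a i \<le> 0" if "i < N" for i using that by fastforce
    have up: "a i \<le> - int i" if "i < N" for i
      using that
    proof (induction i)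
      case (Suc i)
      then have "a (Suc i) < a i" using a by (auto simp: sdec_def)
      with Suc show ?case by simp
    qed (use bd in auto)
    have lo: "a (N - 1 - k) \<ge> - int (N - 1 - k)" if "k < N" for k
      using that
    proof (induction k)
      case 0
      then show ?case using bd[of "N - 1"] by (auto simp: of_nat_diff)
    next
      case (Suc k)
      then have "a (N - 1 - k) < a (N - 1 - Suc k)" using a by (auto simp: sdec_def)
      with Suc show ?case by (auto simp: of_nat_diff)
    qed
    have "a i = - int i" if "i < N" for i
      using up[OF that] lo[of "N - 1 - i"] that by auto
    then have "ldet N ?M = ldet N (\<lambda>i j. if i = j then 1 else 0)" by (intro ldet_cong) auto
    also have "\<dots> = 1" by (subst ldet_upper_triangular) auto
    finally show ?thesis by simp
  qed
qed

lemma sdec_decrease: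
  assumes "sdec N a" "k < N" "\<not> (Suc k < N \<and> a k - 1 = a (Suc k))"
  shows "sdec N (a(k := a k - 1))"
  unfolding sdec_def
proof (intro allI impI)
  fix i j assume ij: "i < j" "j < N"
  have lt: "a j < a i" using assms ij by (auto simp: sdec_def)
  show "(a(k := a k - 1)) j < (a(k := a k - 1)) i"
  proof (cases "i = k")
    case True
    have "a j < a k - 1"
    proof (cases "j = Suc k")
      case True
      then show ?thesis using assms(3) lt \<open>i = k\<close> ij by auto
    next
      case False
      then have "a j < a (Suc k)" "a (Suc k) < a k" using assms(1) ij True by (auto simp: sdec_def)
      then show ?thesis by simp
    qed
    then show ?thesis using True ij by auto
  qed (use lt in auto)
qed

text \<open>Rows are converted from f to g from the top down. Converting row k gives a combination
  of two determinants, the second one with a k lowered by 1. If this makes it collide with row k +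
  1, both rows are still f-rows, hence equal, and the determinant is 0.\<close>

lemma TP_bernoulli:
  assumes f: "TP f" and b: "0 \<le> b" "b \<le> 1"
  shows "TP (\<lambda>n. (1 - b) * f n + b * f (n - 1))" (is "TP ?g")
  unfolding TP_def
proof (intro allI impI)
  fix N a assume "sdec N a"
  let ?R = "\<lambda>k a i j. if i < k then ?g (a i + int j) else f (a i + int j)"
  have "0 \<le> ldet N (?R k a)" if "k \<le> N" "sdec N a" for k a
    using that
  proof (induction k arbitrary: a)
    case 0
    then show ?case using f by (simp add: TP_def)
  next
    case (Suc k)
    let ?a' = "a(k := a k - 1)"
    have k: "k < N" using Suc by simp
    have "ldet N (?R (Suc k) a)
        = ldet N ((?R k a)(k := (\<lambda>j. (1 - b) * f (a k + int j) + b * f (a k + int j - 1))))"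
      by (rule ldet_cong) auto
    also have "\<dots> = (1 - b) * ldet N ((?R k a)(k := (\<lambda>j. f (a k + int j))))
        + b * ldet N ((?R k a)(k := (\<lambda>j. f (a k + int j - 1))))"
      by (rule ldet_row_add[OF k])
    also have "ldet N ((?R k a)(k := (\<lambda>j. f (a k + int j)))) = ldet N (?R k a)" by (rule ldet_cong) auto
    also have "ldet N ((?R k a)(k := (\<lambda>j. f (a k + int j - 1)))) = ldet N (?R k ?a')"
      by (rule ldet_cong) (auto simp: algebra_simps)
    finally have e: "ldet N (?R (Suc k) a) = (1 - b) * ldet N (?R k a) + b * ldet N (?R k ?a')" .
    have "0 \<le> ldet N (?R k ?a')"
    proof (cases "Suc k < N \<and> a k - 1 = a (Suc k)")
      case True
      then have "ldet N (?R k ?a') = 0" by (intro ldet_equal_rows[of k _ "Suc k"]) auto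
      then show ?thesis by simp
    qed (use Suc sdec_decrease k in auto)
    moreover have "0 \<le> ldet N (?R k a)" using Suc by auto
    ultimately show ?case unfolding e using b by simp
  qed
  from this[of N a] \<open>sdec N a\<close> have "0 \<le> ldet N (?R N a)" by simp
  also have "ldet N (?R N a) = ldet N (\<lambda>i j. ?g (a i + int j))" by (rule ldet_cong) auto
  finally show "0 \<le> ldet N (\<lambda>i j. ?g (a i + int j))" .
qed

text \<open>Here rows are converted from the bottom up, so that rows colliding after a step are both
  g-rows. The recursion for g reproduces a g-row in row k, so expanding does not end; after n rounds
  the remainder carries q ^ n, and the crude bound \<open>fact N\<close> on the determinant makes it
  disappear in the limit.\<close>

lemma TP_geometric:
  assumes f: "TP f" "\<And>n. 0 \<le> f n \<and> f n \<le> 1" and g: "\<And>n. 0 \<le> g n \<and> g n \<le> 1"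
    and rec: "\<And>n. g n = p * f n + q * g (n - 1)" and pq: "0 \<le> p" "0 \<le> q" "q < 1"
  shows "TP g"
  unfolding TP_def
proof (intro allI impI)
  fix N a assume "sdec N a"
  let ?R = "\<lambda>k a i j. if k \<le> i then g (a i + int j) else f (a i + int j)"
  have bound: "norm (ldet N (?R k a)) \<le> fact N" for k a
  proof (cases "N = 0")
    case True
    then show ?thesis by (simp add: ldet_def)
  next
    case False
    then show ?thesis using norm_ldet_le[of N "?R k a" 0 1] f(2) g by auto
  qed
  have "0 \<le> ldet N (?R (N - d) a)" if "d \<le> N" "sdec N a" for d a
    using that
  proof (induction d arbitrary: a)
    case 0
    have "ldet N (?R N a) = ldet N (\<lambda>i j. f (a i + int j))" by (rule ldet_cong) auto
    then show ?case using f(1) 0 by (simp add: TP_def)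
  next
    case (Suc d)
    define k where "k = N - Suc d"
    have k: "k < N" "Suc k = N - d" using Suc.prems by (auto simp: k_def)
    have IH: "0 \<le> ldet N (?R (Suc k) a)" if "sdec N a" for a
      using Suc.IH[OF _ that] Suc.prems(1) k(2) by simp
    have step: "ldet N (?R k a) = p * ldet N (?R (Suc k) a) + q * ldet N (?R k (a(k := a k - 1)))" for a
    proof -
      have "ldet N (?R k a) = ldet N ((?R k a)(k := (\<lambda>j. p * f (a k + int j) + q * g (a k + int j - 1))))"
        by (rule ldet_cong) (auto simp: rec[symmetric])
      also have "\<dots> = p * ldet N ((?R k a)(k := (\<lambda>j. f (a k + int j))))
          + q * ldet N ((?R k a)(k := (\<lambda>j. g (a k + int j - 1))))"
        by (rule ldet_row_add[OF k(1)])
      also have "ldet N ((?R k a)(k := (\<lambda>j. f (a k + int j)))) = ldet N (?R (Suc k) a)"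
        by (rule ldet_cong) auto
      also have "ldet N ((?R k a)(k := (\<lambda>j. g (a k + int j - 1)))) = ldet N (?R k (a(k := a k - 1)))"
        by (rule ldet_cong) (auto simp: algebra_simps)
      finally show ?thesis .
    qed
    have lower: "- (q ^ n * fact N) \<le> ldet N (?R k a)" if "sdec N a" for n a
      using that
    proof (induction n arbitrary: a)
      case 0
      then show ?case using bound[of k a] by (simp add: abs_le_iff)
    next
      case (Suc n)
      have "- (q ^ n * fact N) \<le> ldet N (?R k (a(k := a k - 1)))"
      proof (cases "Suc k < N \<and> a k - 1 = a (Suc k)")
        case True
        then have "ldet N (?R k (a(k := a k - 1))) = 0" by (intro ldet_equal_rows[of k _ "Suc k"]) auto
        then show ?thesis using pq by simp
      next
        case False
        show ?thesis by (rule Suc.IH[OF sdec_decrease[OF Suc.prems k(1) False]])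
      qed
      then have "q * (- (q ^ n * fact N)) \<le> q * ldet N (?R k (a(k := a k - 1)))" using pq
        by (intro mult_left_mono)
      moreover have "0 \<le> p * ldet N (?R (Suc k) a)" using IH[OF Suc.prems] pq by simp
      ultimately show ?case unfolding step[of a] by simp
    qed
    have "(\<lambda>n. - (q ^ n * fact N)) \<longlonglongrightarrow> - (0 * fact N)"
      by (intro tendsto_intros LIMSEQ_power_zero) (use pq in auto)
    then have "- (0 * fact N) \<le> ldet N (?R k a)"
      by (rule LIMSEQ_le_const2) (use lower Suc.prems in auto)
    then show ?case by (simp add: k_def)
  qed
  from this[of N a] \<open>sdec N a\<close> show "0 \<le> ldet N (\<lambda>i j. g (a i + int j))" by simp
qed

text \<open>Reversing rows and columns together keeps the determinant and restores the decreasing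
  order that negation destroys; the summand N - 1 realigns the columns.\<close>

lemma TP_reflect:
  assumes f: "TP f"
  shows "TP (\<lambda>n. f (- n))"
  unfolding TP_def
proof (intro allI impI)
  fix N a assume a: "sdec N a"
  let ?a = "\<lambda>i. - a (N - 1 - i) - int (N - 1)"
  have "sdec N ?a" unfolding sdec_def
  proof (intro allI impI)
    fix i j assume "i < j" "j < N"
    then have "N - 1 - j < N - 1 - i" "N - 1 - i < N" by auto
    then show "?a j < ?a i" using a by (auto simp: sdec_def)
  qed
  then have "0 \<le> ldet N (\<lambda>i j. f (?a i + int j))" using f by (simp add: TP_def)
  also have "\<dots> = ldet N (\<lambda>i j. f (?a (N - 1 - i) + int (N - 1 - j)))" by (rule ldet_reverse[symmetric])
  also have "\<dots> = ldet N (\<lambda>i j. f (- (a i + int j)))"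
    by (rule ldet_cong) (auto intro!: arg_cong[of _ _ f] simp: of_nat_diff)
  finally show "0 \<le> ldet N (\<lambda>i j. f (- (a i + int j)))" .
qed

subsection \<open>Convolutions of Bernoulli and geometric distributions\<close>

text \<open>For such convolutions \<open>f\<close>, with generating function \<open>H\<close>, \<open>m\<close> is the mean and \<open>w\<close> the
  variance. The two quantitative bounds are chosen to be stable under convolution with one more
  factor and under pointwise limits.\<close>

definition good :: "(int \<Rightarrow> real) \<Rightarrow> (complex \<Rightarrow> complex) \<Rightarrow> real \<Rightarrow> real \<Rightarrow> bool" where
  "good f H m w \<longleftrightarrow> TP f \<and> (\<forall>n. 0 \<le> f n \<and> f n \<le> 1) \<and>
     (\<forall>u. norm u = 1 \<longrightarrow> ((\<lambda>n. of_real (f n) * u powi n) has_sum H u) UNIV) \<and>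
     (\<forall>n. \<bar>of_int n - m\<bar> * f n \<le> 2 * w) \<and> 0 \<le> w \<and>
     (\<forall>u. norm u = 1 \<longrightarrow> (norm (H u))\<^sup>2 * (1 + 2 * (1 - Re u) * w) \<le> 1) \<and>
     continuous_on (sphere 0 1) H"

lemma Re_le_1: "norm u = 1 \<Longrightarrow> Re u \<le> 1"
  using complex_Re_le_cmod[of u] by simp

lemma good_norm_le_1:
  assumes "good f H m w" "norm u = 1"
  shows "norm (H u) \<le> 1"
proof -
  have "(norm (H u))\<^sup>2 * 1 \<le> (norm (H u))\<^sup>2 * (1 + 2 * (1 - Re u) * w)"
    using assms Re_le_1[OF assms(2)] by (intro mult_left_mono) (auto simp: good_def)
  also have "\<dots> \<le> 1" using assms by (auto simp: good_def)
  finally have "(norm (H u))\<^sup>2 \<le> 1\<^sup>2" by simp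
  then show ?thesis by (rule power2_le_imp_le) simp
qed

lemma good_one: "good (\<lambda>n. if n = 0 then 1 else 0) (\<lambda>u. 1) 0 0"
proof -
  have "((\<lambda>n. of_real (if n = 0 then 1 else 0) * u powi n) has_sum (\<Sum>n\<in>{0::int}.
      of_real (if n = 0 then 1 else 0) * u powi n)) UNIV" for u :: complex
    by (rule has_sum_finite_neutralI[where B = "{0}"]) auto
  then show ?thesis by (auto simp: good_def TP_delta)
qed

lemma good_reflect:
  assumes "good f H m w"
  shows "good (\<lambda>n. f (- n)) (\<lambda>u. H (inverse u)) (- m) w"
proof -
  have inv: "norm (inverse u) = 1" "Re (inverse u) = Re u" if "norm u = 1" for u :: complex
  proof -
    have "(Re u)\<^sup>2 + (Im u)\<^sup>2 = 1" using that cmod_power2[of u] by simp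
    then show "norm (inverse u) = 1" "Re (inverse u) = Re u" using that by (auto simp: norm_inverse)
  qed
  have "((\<lambda>n. of_real (f (- n)) * u powi n) has_sum H (inverse u)) UNIV" if u: "norm u = 1" for u
  proof -
    have "((\<lambda>n. of_real (f n) * inverse u powi n) has_sum H (inverse u)) UNIV"
      using assms inv[OF u] by (auto simp: good_def)
    then have "((\<lambda>n. of_real (f (- n)) * inverse u powi (- n)) has_sum H (inverse u)) UNIV"
      by (subst has_sum_reindex_bij_betw[of uminus UNIV UNIV "\<lambda>n. of_real (f n) * inverse u powi n", OF
        bij_uminus])
    then show ?thesis by (simp add: power_int_minus power_int_inverse)
  qed
  moreover have "\<bar>of_int n - - m\<bar> * f (- n) \<le> 2 * w" for n
  proof -
    have "\<bar>of_int (- n) - m\<bar> * f (- n) \<le> 2 * w" using assms unfolding good_def by blast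
    moreover have "\<bar>of_int n - - m\<bar> = \<bar>of_int (- n) - m\<bar>" by simp
    ultimately show ?thesis by (simp only:)
  qed
  moreover have "continuous_on (sphere 0 1) (\<lambda>u. H (inverse u))"
    by (rule continuous_on_compose2[of "sphere 0 1" H])
       (use assms in \<open>auto simp: good_def norm_inverse intro!: continuous_intros\<close>)
  moreover have "(norm (H (inverse u)))\<^sup>2 * (1 + 2 * (1 - Re u) * w) \<le> 1" if "norm u = 1" for u
  proof -
    have "(norm (H (inverse u)))\<^sup>2 * (1 + 2 * (1 - Re (inverse u)) * w) \<le> 1"
      using assms inv(1)[OF that] unfolding good_def by blast
    then show ?thesis unfolding inv(2)[OF that] .
  qed
  ultimately show ?thesis using assms TP_reflect unfolding good_def by blast
qed

text \<open>A Bernoulli factor has mean b and variance b (1 - b). Recentring costs b on the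
  unshifted and 1 - b on the shifted part, with weights 1 - b and b; the total 2 b (1 - b) explains
  the factor 2 in the moment bound of \<open>good\<close>.\<close>

lemma good_bernoulli:
  assumes good: "good f H m w" and b: "0 \<le> b" "b \<le> 1"
  shows "good (\<lambda>n. (1 - b) * f n + b * f (n - 1)) (\<lambda>u. (1 + of_real b * (u - 1)) * H u) (m + b) (w
      + b * (1 - b))"
proof -
  have f: "0 \<le> f n" "f n \<le> 1" "\<bar>of_int n - m\<bar> * f n \<le> 2 * w" for n using good by (auto simp: good_def)
  have w: "0 \<le> w" using good by (auto simp: good_def)
  have bb: "0 \<le> b * (1 - b)" using b by simp
  have hs: "((\<lambda>n. of_real ((1 - b) * f n + b * f (n - 1)) * u powi n) has_sum ((1 + of_real b * (u - 1)) *
      H u)) UNIV"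
    if u: "norm u = 1" for u
  proof -
    have u0: "u \<noteq> 0" using u by auto
    have 1: "((\<lambda>n. of_real (f n) * u powi n) has_sum H u) UNIV" using good u by (auto simp: good_def)
    have "bij_betw (\<lambda>n::int. n - 1) UNIV UNIV" by (rule bij_betw_byWitness[where f' = "\<lambda>n. n + 1"]) auto
    from 1[folded has_sum_reindex_bij_betw[OF this, of "\<lambda>n. of_real (f n) * u powi n"]]
    have "((\<lambda>n. of_real (f (n - 1)) * u powi (n - 1)) has_sum H u) UNIV" .
    then have 2: "((\<lambda>n. of_real b * u * (of_real (f (n - 1)) * u powi (n - 1))) has_sum (of_real b * u *
        H u)) UNIV"
      by (rule has_sum_cmult_right)
    have "of_real b * u * (of_real (f (n - 1)) * u powi (n - 1)) = of_real (b * f (n - 1)) * u powi n" for n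
      using u0 by (simp add: power_int_diff)
    with 2 have "((\<lambda>n. of_real (b * f (n - 1)) * u powi n) has_sum (of_real b * u * H u)) UNIV" by simp
    from has_sum_add[OF has_sum_cmult_right[OF 1, of "of_real (1 - b)"] this]
    show ?thesis by (simp add: algebra_simps)
  qed
  have mom: "\<bar>of_int n - (m + b)\<bar> * ((1 - b) * f n + b * f (n - 1)) \<le> 2 * (w + b * (1 - b))" for n
  proof -
    have "\<bar>of_int n - (m + b)\<bar> * f n \<le> (\<bar>of_int n - m\<bar> + b) * f n" using f b by (intro mult_right_mono) auto
    also have "\<dots> \<le> 2 * w + b" using f(3)[of n] mult_left_mono[OF f(2)[of n] b(1)] by (simp add: algebra_simps)
    finally have 1: "(1 - b) * (\<bar>of_int n - (m + b)\<bar> * f n) \<le> (1 - b) * (2 * w + b)" using b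
      by (intro mult_left_mono) auto
    have "\<bar>of_int n - (m + b)\<bar> * f (n - 1) \<le> (\<bar>of_int (n - 1) - m\<bar> + (1 - b)) * f (n - 1)" using f b
      by (intro mult_right_mono) auto
    also have "\<dots> \<le> 2 * w + (1 - b)" using f(3)[of "n - 1"] mult_left_mono[OF f(2)[of "n - 1"], of "1 - b"] b
      by (simp add: algebra_simps)
    finally have 2: "b * (\<bar>of_int n - (m + b)\<bar> * f (n - 1)) \<le> b * (2 * w + (1 - b))" using b
      by (intro mult_left_mono) auto
    have "\<bar>of_int n - (m + b)\<bar> * ((1 - b) * f n + b * f (n - 1)) =
      (1 - b) * (\<bar>of_int n - (m + b)\<bar> * f n) + b *
        (\<bar>of_int n - (m + b)\<bar> * f (n - 1))" by (simp only: algebra_simps)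
    also have "\<dots> \<le> (1 - b) * (2 * w + b) + b * (2 * w + (1 - b))" using 1 2 by (rule add_mono)
    also have "\<dots> = 2 * (w + b * (1 - b))" by (simp add: algebra_simps)
    finally show ?thesis .
  qed
  have nrm: "(norm ((1 + of_real b * (u - 1)) * H u))\<^sup>2 * (1 + 2 * (1 - Re u) * (w + b * (1 - b))) \<le> 1"
    if u: "norm u = 1" for u
  proof -
    define A where "A = 1 + 2 * (1 - Re u) * w"
    define x where "x = 2 * (1 - Re u) * (b * (1 - b))"
    have s: "0 \<le> 1 - Re u" using Re_le_1[OF u] by simp
    have A: "1 \<le> A" and x: "0 \<le> x" using s w bb by (auto simp: A_def x_def)
    have uu: "(Re u)\<^sup>2 + (Im u)\<^sup>2 = 1" using u cmod_power2[of u] by simp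
    have "(norm (1 + of_real b * (u - 1)))\<^sup>2 = (1 - b + b * Re u)\<^sup>2 + (b * Im u)\<^sup>2"
      by (simp add: cmod_power2 algebra_simps)
    also have "\<dots> = (1 - b)\<^sup>2 + 2 * b * (1 - b) * Re u + b\<^sup>2 * ((Re u)\<^sup>2 + (Im u)\<^sup>2)"
      by (simp add: power2_eq_square algebra_simps)
    also have "\<dots> = 1 - x" unfolding uu x_def by (simp add: power2_eq_square algebra_simps)
    finally have n: "(norm (1 + of_real b * (u - 1)))\<^sup>2 = 1 - x" .
    \<comment> \<open>The difference of the two sides is x (A - 1 + x). The new factor lowers the
      squared norm by 1 - x, which pays for the larger variance.\<close>
    have "(1 - x) * (A + x) \<le> A" using A x mult_nonneg_nonneg[OF x, of "A - 1 + x"]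
      by (simp add: algebra_simps)
    then have "(norm (H u))\<^sup>2 * ((1 - x) * (A + x)) \<le> (norm (H u))\<^sup>2 * A" by (intro mult_left_mono) auto
    also have "\<dots> \<le> 1" using good u by (auto simp: good_def A_def)
    finally have "(norm (H u))\<^sup>2 * ((1 - x) * (A + x)) \<le> 1" .
    moreover have "1 + 2 * (1 - Re u) * (w + b * (1 - b)) = A + x" by (simp add: A_def x_def algebra_simps)
    ultimately show ?thesis unfolding norm_mult power_mult_distrib n
      by (simp only: mult.assoc mult.left_commute mult.commute)
  qed
  have "0 \<le> (1 - b) * f n + b * f (n - 1) \<and> (1 - b) * f n + b * f (n - 1) \<le> 1" for n
  proof
    show "0 \<le> (1 - b) * f n + b * f (n - 1)" using f b by simp
    have "(1 - b) * f n + b * f (n - 1) \<le> (1 - b) * 1 + b * 1" using f b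
      by (intro add_mono mult_left_mono) auto
    then show "(1 - b) * f n + b * f (n - 1) \<le> 1" by simp
  qed
  moreover have "continuous_on (sphere 0 1) (\<lambda>u. (1 + of_real b * (u - 1)) * H u)"
    using good by (intro continuous_intros) (auto simp: good_def)
  ultimately show ?thesis
    unfolding good_def using hs mom nrm TP_bernoulli[OF _ b, of f] good w bb
    by (auto simp: good_def)
qed

text \<open>The factor is p / (1 - q u) with q = a / (1 + a): a geometric law of mean a and variance
  a (1 + a). Recentring costs k + a on the k-th shift, on average 2 a. The squared norm of the
  denominator is 1 + y, where y is the growth of the weight, so the norm bound persists.\<close>

lemma good_geometric:
  assumes good: "good f H m w" and a: "0 \<le> a"
  obtains g where "good g (\<lambda>u. H u / (1 - of_real a * (u - 1))) (m + a) (w + a * (1 + a))"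
proof -
  define p q where "p = 1 / (1 + a)" and "q = a / (1 + a)"
  have pq: "0 < p" "0 \<le> q" "q < 1" "p = 1 - q" using a by (auto simp: p_def q_def field_simps)
  have pa: "1 / p = 1 + a" using a by (simp add: p_def)
  have f: "0 \<le> f n" "f n \<le> 1" "\<bar>of_int n - m\<bar> * f n \<le> 2 * w" for n using good by (auto simp: good_def)
  have w: "0 \<le> w" using good by (auto simp: good_def)
  define c where "c = (\<lambda>k. p * q ^ k)"
  have c0: "0 \<le> c k" for k using pq by (simp add: c_def)
  have cs: "c sums 1"
    using sums_mult[OF geometric_sums[of q], of p] pq by (simp add: c_def)
  have csum: "summable c" using cs by (rule sums_summable)
  have kc: "(\<lambda>k. real k * c k) sums a"
  proof -
    have "(\<lambda>k. p * (of_nat (Suc k) * q ^ k)) sums (p * (1 / (1 - q)\<^sup>2))"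
      by (rule sums_mult[OF geometric_deriv_sums]) (use pq in auto)
    moreover have "p * (1 / (1 - q)\<^sup>2) = 1 + a" using pq pa by (simp add: power2_eq_square)
    ultimately have "(\<lambda>k. p * (of_nat (Suc k) * q ^ k) - c k) sums (1 + a - 1)" using cs
      by (intro sums_diff) auto
    then show ?thesis by (simp add: c_def algebra_simps)
  qed
  define g where "g = (\<lambda>n. suminf (\<lambda>k. c k * f (n - int k)))"
  have gs: "summable (\<lambda>k. c k * f (n - int k))" for n
    by (rule summable_comparison_test'[OF csum, of 0]) (use c0 f in \<open>auto simp: abs_mult mult_left_le\<close>)
  have g01: "0 \<le> g n \<and> g n \<le> 1" for n
  proof
    show "0 \<le> g n" unfolding g_def by (rule suminf_nonneg[OF gs]) (use c0 f in auto)
    have "g n \<le> suminf c" unfolding g_def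
      by (rule suminf_le[OF _ gs csum]) (use c0 f in \<open>auto simp: mult_left_le\<close>)
    then show "g n \<le> 1" using cs sums_unique by metis
  qed
  \<comment> \<open>Splitting off the first term of the geometric convolution gives the recursion on
    which \<open>TP_geometric\<close> rests.\<close>
  have rec: "g n = p * f n + q * g (n - 1)" for n
  proof -
    have "g n = c 0 * f (n - int 0) + (suminf (\<lambda>k. c (Suc k) * f (n - int (Suc k))))"
      unfolding g_def using suminf_split_head[OF gs[of n]] by simp
    also have "(suminf (\<lambda>k. c (Suc k) * f (n - int (Suc k)))) = (suminf (\<lambda>k. q * (c k * f (n - 1 - int k))))"
      by (simp add: c_def algebra_simps)
    also have "\<dots> = q * g (n - 1)" unfolding g_def by (rule suminf_mult[OF gs])
    finally show ?thesis by (simp add: c_def)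
  qed
  have den: "1 - of_real a * (u - 1) \<noteq> 0" if "norm u = 1" for u :: complex
  proof
    assume "1 - of_real a * (u - 1) = 0"
    then have "Re (1 - of_real a * (u - 1)) = 0" by simp
    moreover have "a * Re u \<le> a * 1" using a Re_le_1[OF that] by (intro mult_left_mono) auto
    ultimately show False by (simp add: algebra_simps)
  qed
  have hs: "((\<lambda>n. of_real (g n) * u powi n) has_sum (H u / (1 - of_real a * (u - 1)))) UNIV"
    if u: "norm u = 1" for u
  proof -
    have u0: "u \<noteq> 0" using u by auto
    have qu: "norm (of_real q * u) < 1" using pq u by (simp add: norm_mult)
    have "(\<lambda>k. of_real p * (of_real q * u) ^ k) sums (of_real p * (1 / (1 - of_real q * u)))"
      by (rule sums_mult[OF geometric_sums[OF qu]])
    moreover have "of_real p * (1 / (1 - of_real q * u)) = 1 / (1 - of_real a * (u - 1))"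
    proof -
      have a1: "of_real (1 + a) \<noteq> (0::complex)" using a
        by (metis add_nonneg_eq_0_iff of_real_eq_0_iff zero_le_one zero_neq_one)
      have "1 - of_real q * u = (1 - of_real a * (u - 1)) / of_real (1 + a)"
        using a1 unfolding q_def by (simp add: divide_simps) (simp add: algebra_simps)
      then show ?thesis using a1 by (simp add: p_def)
    qed
    moreover have "summable (\<lambda>k. norm (of_real p * (of_real q * u) ^ k))"
      using csum pq u by (simp add: norm_mult norm_power c_def)
    ultimately have S1: "((\<lambda>k. of_real p * (of_real q * u) ^ k) has_sum (1 / (1 - of_real a * (u - 1)))) UNIV"
      using norm_summable_imp_has_sum by metis
    have S2: "((\<lambda>n. of_real (f n) * u powi n) has_sum H u) UNIV" using good u by (auto simp: good_def)
    have hs: "((\<lambda>(k, n). (of_real p * (of_real q * u) ^ k) * (of_real (f n) * u powi n)) has_sum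
        (1 / (1 - of_real a * (u - 1)) * H u)) (UNIV \<times> UNIV)"
      by (rule has_sum_times[OF S1 S2])
    have e: "(of_real p * (of_real q * u) ^ k) * (of_real (f n) * u powi n)
        = of_real (c k * f n) * u powi (n + int k)" for k n
      using u0 by (simp add: c_def power_mult_distrib power_int_add)
    have "((\<lambda>(n, k). of_real (c k * f (n - int k)) * u powi n) has_sum (1 / (1 - of_real a * (u - 1)) *
        H u)) (UNIV \<times> UNIV)"
      using hs
      by (subst has_sum_reindex_bij_witness[where i = "\<lambda>(k, n). (n + int k, k)"
        and j = "\<lambda>(n, k). (k, n - int k)" and T = "UNIV \<times> UNIV"
            and h = "\<lambda>(k, n). (of_real p * (of_real q * u) ^ k) * (of_real (f n) * u powi n)"])
         (auto simp: e)
    moreover have "((\<lambda>k. case (n, k) of (n, k) \<Rightarrow> of_real (c k * f (n - int k)) *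
        u powi n) has_sum of_real (g n) * u powi n) UNIV" for n
    proof -
      have "((\<lambda>k. of_real (c k * f (n - int k)) :: complex) has_sum of_real (g n)) UNIV"
      proof (rule norm_summable_imp_has_sum)
        show "summable (\<lambda>k. norm (of_real (c k * f (n - int k)) :: complex))"
          using gs[of n] c0 f by (simp add: norm_mult)
        show "(\<lambda>k. of_real (c k * f (n - int k)) :: complex) sums of_real (g n)"
          unfolding g_def by (intro sums_of_real summable_sums gs)
      qed
      from has_sum_cmult_left[OF this, of "u powi n"] show ?thesis by simp
    qed
    ultimately have "((\<lambda>n. of_real (g n) * u powi n) has_sum (1 / (1 - of_real a * (u - 1)) * H u)) UNIV"
      by (rule has_sum_Sigma')
    then show ?thesis by simp
  qed
  have mom: "\<bar>of_int n - (m + a)\<bar> * g n \<le> 2 * (w + a * (1 + a))" for n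
  proof -
    have le: "\<bar>of_int n - (m + a)\<bar> * (c k * f (n - int k)) \<le> 2 * w * c k + real k * c k + a * c k" for k
    proof -
      have "\<bar>of_int n - (m + a)\<bar> * f (n - int k) \<le> (\<bar>of_int (n - int k) - m\<bar> + (real k + a)) * f (n - int k)"
        using f a by (intro mult_right_mono) auto
      also have "\<dots> \<le> 2 * w + (real k + a)"
        using f(3)[of "n - int k"] mult_left_mono[OF f(2)[of "n - int k"], of "real k + a"] a
          by (simp add: algebra_simps)
      finally have "c k * (\<bar>of_int n - (m + a)\<bar> * f (n - int k)) \<le> c k * (2 * w + (real k + a))"
        using c0 by (intro mult_left_mono)
      then show ?thesis by (simp add: algebra_simps)
    qed
    have s: "(\<lambda>k. 2 * w * c k + real k * c k + a * c k) sums (2 * w * 1 + a + a * 1)"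
      by (intro sums_add sums_mult cs kc)
    have "\<bar>of_int n - (m + a)\<bar> * g n = (suminf (\<lambda>k. \<bar>of_int n - (m + a)\<bar> * (c k * f (n - int k))))"
      unfolding g_def by (rule suminf_mult[OF gs, symmetric])
    also have "\<dots> \<le> (suminf (\<lambda>k. 2 * w * c k + real k * c k + a * c k))"
      by (rule suminf_le[OF le summable_mult[OF gs] sums_summable[OF s]])
    also have "\<dots> = 2 * w * 1 + a + a * 1" using s by (rule sums_unique[symmetric])
    also have "\<dots> \<le> 2 * (w + a * (1 + a))" using a by (simp add: algebra_simps)
    finally show ?thesis .
  qed
  have nrm: "(norm (H u / (1 - of_real a * (u - 1))))\<^sup>2 * (1 + 2 * (1 - Re u) * (w + a * (1 + a))) \<le> 1"
    if u: "norm u = 1" for u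
  proof -
    define A where "A = 1 + 2 * (1 - Re u) * w"
    define y where "y = 2 * (1 - Re u) * (a * (1 + a))"
    have y: "0 \<le> y" using Re_le_1[OF u] a by (auto simp: y_def)
    have uu: "(Re u)\<^sup>2 + (Im u)\<^sup>2 = 1" using u cmod_power2[of u] by simp
    have "(norm (1 - of_real a * (u - 1)))\<^sup>2 = (1 + a - a * Re u)\<^sup>2 + (a * Im u)\<^sup>2"
      by (simp add: cmod_power2 algebra_simps)
    also have "\<dots> = (1 + a)\<^sup>2 - 2 * a * (1 + a) * Re u + a\<^sup>2 * ((Re u)\<^sup>2 + (Im u)\<^sup>2)"
      by (simp add: power2_eq_square algebra_simps)
    also have "\<dots> = 1 + y" unfolding uu y_def by (simp add: power2_eq_square algebra_simps)
    finally have n: "(norm (1 - of_real a * (u - 1)))\<^sup>2 = 1 + y" .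
    have hA: "(norm (H u))\<^sup>2 * A \<le> 1" using good u by (auto simp: good_def A_def)
    have "(norm (H u))\<^sup>2 \<le> 1" using good_norm_le_1[OF good u] by (simp add: power_le_one)
    then have "(norm (H u))\<^sup>2 * y \<le> 1 * y" using y by (intro mult_right_mono)
    with hA have "(norm (H u))\<^sup>2 * (A + y) \<le> 1 + y" by (simp add: algebra_simps)
    then have "(norm (H u))\<^sup>2 / (1 + y) * (A + y) \<le> 1" using y by (simp add: divide_simps)
    moreover have "1 + 2 * (1 - Re u) * (w + a * (1 + a)) = A + y" by (simp add: A_def y_def algebra_simps)
    ultimately show ?thesis unfolding norm_divide power_divide n by (simp only:)
  qed
  have cont: "continuous_on (sphere 0 1) (\<lambda>u. H u / (1 - of_real a * (u - 1)))"
    using good den by (intro continuous_intros) (auto simp: good_def)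
  have "TP f" using good by (simp add: good_def)
  then have "TP g" by (rule TP_geometric[where g = g and f = f and p = p and q = q, OF _ _ g01 rec])
    (use f pq in auto)
  then have "good g (\<lambda>u. H u / (1 - of_real a * (u - 1))) (m + a) (w + a * (1 + a))"
    unfolding good_def using g01 hs mom nrm cont
      add_nonneg_nonneg[OF w mult_nonneg_nonneg[OF a, of "1 + a"]] a by simp
  then show thesis by (rule that)
qed

definition goodH :: "(complex \<Rightarrow> complex) \<Rightarrow> real \<Rightarrow> real \<Rightarrow> bool" where
  "goodH H m w \<longleftrightarrow> (\<exists>f. good f H m w)"

lemma goodH_one: "goodH (\<lambda>u. 1) 0 0"
  unfolding goodH_def using good_one by blast

lemma goodH_fct:
  assumes "goodH H m w" "0 \<le> a" "0 \<le> b" "b \<le> 1"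
  shows "goodH (\<lambda>u. fct a b u * H u) (m + (a + b)) (w + (a * (1 + a) + b * (1 - b)))"
proof -
  obtain f where "good f H m w" using assms by (auto simp: goodH_def)
  from good_bernoulli[OF this assms(3,4)] obtain g where
    "good g (\<lambda>u. (1 + of_real b * (u - 1)) * H u / (1 - of_real a * (u - 1))) (m + b + a) (w + b * (1 - b)
        + a * (1 + a))"
    using good_geometric[OF _ assms(2)] by blast
  moreover have "(\<lambda>u. (1 + of_real b * (u - 1)) * H u / (1 - of_real a * (u - 1))) = (\<lambda>u. fct a b u * H u)"
    by (simp add: fct_def)
  moreover have "m + b + a = m + (a + b)" "w + b * (1 - b) + a * (1 + a) = w + (a * (1 + a) + b * (1 - b))"
    by auto
  ultimately show ?thesis unfolding goodH_def by metis
qed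

lemma goodH_reflect: "goodH H m w \<Longrightarrow> goodH (\<lambda>u. H (inverse u)) (- m) w"
  unfolding goodH_def using good_reflect by blast

lemma goodH_prod:
  assumes "goodH H m w" "half_param a b"
  shows "goodH (\<lambda>u. (\<Prod>i<n. fct (a i) (b i) u) * H u) (m + (\<Sum>i<n. a i + b i)) (w
      + (\<Sum>i<n. a i * (1 + a i) + b i * (1 - b i)))"
proof (induction n)
  case (Suc n)
  have "goodH (\<lambda>u. fct (a n) (b n) u * ((\<Prod>i<n. fct (a i) (b i) u) * H u)) (m + (\<Sum>i<n. a i + b i)
      + (a n + b n))
     (w + (\<Sum>i<n. a i * (1 + a i) + b i * (1 - b i)) + (a n * (1 + a n) + b n * (1 - b n)))"
    by (rule goodH_fct[OF Suc]) (use half_paramD[OF assms(2)] in auto)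
  then show ?case by (simp add: mult_ac add_ac)
qed (use assms in simp)

lemma goodH_power:
  assumes "goodH H m w" "0 \<le> c"
  shows "goodH (\<lambda>u. fct c 0 u ^ n * H u) (m + real n * c) (w + real n * (c * (1 + c)))"
proof (induction n)
  case (Suc n)
  have "goodH (\<lambda>u. fct c 0 u * (fct c 0 u ^ n * H u)) (m + real n * c + (c + 0)) (w + real n * (c * (1 + c))
      + (c * (1 + c) + 0 * (1 - 0)))"
    by (rule goodH_fct[OF Suc]) (use assms in auto)
  then show ?case by (simp add: algebra_simps)
qed (use assms in simp)

text \<open>The exponential factor is replaced by k + 1 geometric factors of parameter g / (k + 1),
  a negative binomial law tending to the Poisson law. So the approximant is a finite product of
  admissible factors.\<close>

definition half_approx :: "(nat \<Rightarrow> real) \<Rightarrow> (nat \<Rightarrow> real) \<Rightarrow> real \<Rightarrow> nat \<Rightarrow> complex \<Rightarrow> complex" where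
  "half_approx a b g k u = fct (g / Suc k) 0 u ^ Suc k * (\<Prod>i<k. fct (a i) (b i) u)"

lemma goodH_half_approx:
  assumes "goodH H m w" "half_param a b" "0 \<le> g"
  shows "goodH (\<lambda>u. half_approx a b g k u * H u) (m + (\<Sum>i<k. a i + b i) + g)
     (w + (\<Sum>i<k. a i * (1 + a i) + b i * (1 - b i)) + g * (1 + g / Suc k))"
proof -
  have "goodH (\<lambda>u. fct (g / Suc k) 0 u ^ Suc k * ((\<Prod>i<k. fct (a i) (b i) u) * H u)) (m + (\<Sum>i<k. a i + b i)
      + real (Suc k) * (g / Suc k))
     (w + (\<Sum>i<k. a i * (1 + a i) + b i * (1 - b i)) + real (Suc k) * (g / Suc k * (1 + g / Suc k)))"
    by (rule goodH_power[OF goodH_prod[OF assms(1,2)]]) (use assms(3) in auto)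
  moreover have "real (Suc k) * (g / Suc k) = g" "real (Suc k) * (g / Suc k * (1 + g / Suc k))
      = g * (1 + g / Suc k)"
    by (auto simp del: of_nat_Suc)
  ultimately show ?thesis by (simp only: half_approx_def mult.assoc)
qed

text \<open>For numbers of norm at most 1, n-th powers differ by at most n times the difference of
  the bases. The bases 1 / (1 - x) and exp x agree to first order at 0 and x is of order 1 / n, so
  this tends to 0. The case of zero exponent is separate since x must approach 0 without reaching
  it.\<close>

lemma power_approx_exp:
  assumes "0 \<le> g" "norm u = 1"
  shows "(\<lambda>k. fct (g / Suc k) 0 u ^ Suc k) \<longlonglongrightarrow> exp (of_real g * (u - 1))"
proof (cases "of_real g * (u - 1) = 0")
  case True
  have "fct (g / Suc k) 0 u = 1" for k using True by (auto simp: fct_def)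
  then have 1: "(\<lambda>k. fct (g / Suc k) 0 u ^ Suc k) = (\<lambda>k. 1)" by (simp del: of_nat_Suc)
  show ?thesis unfolding 1 True by simp
next
  case False
  define t where "t = of_real g * (u - 1)"
  define x where "x = (\<lambda>k. t / of_nat (Suc k))"
  let ?h = "\<lambda>x::complex. 1 / (1 - x) - exp x"
  have t0: "t \<noteq> 0" using False by (simp add: t_def)
  have x0: "x k \<noteq> 0" for k using t0 by (simp add: x_def del: of_nat_Suc)
  have "x \<longlonglongrightarrow> 0" unfolding x_def by (rule LIMSEQ_Suc) (rule lim_const_over_n)
  then have xl: "filterlim x (at 0) sequentially" using x0 by (auto simp: filterlim_at)
  have "(?h has_field_derivative 0) (at 0)" by (auto intro!: derivative_eq_intros)
  then have "((\<lambda>x. ?h x / x) \<longlongrightarrow> 0) (at 0)" by (simp add: has_field_derivative_iff)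
  then have "(\<lambda>k. ?h (x k) / x k) \<longlonglongrightarrow> 0" using xl by (rule filterlim_compose)
  then have "(\<lambda>k. norm (?h (x k) / x k) * norm t) \<longlonglongrightarrow> 0 * norm t" by (intro tendsto_intros tendsto_norm_zero)
  then have l0: "(\<lambda>k. norm (?h (x k) / x k) * norm t) \<longlonglongrightarrow> 0" by simp
  have "norm (fct (g / Suc k) 0 u ^ Suc k - exp t) \<le> norm (?h (x k) / x k) * norm t" for k
  proof -
    have f: "fct (g / Suc k) 0 u = 1 / (1 - x k)" by (simp add: fct_def x_def t_def)
    have e: "exp t = exp (x k) ^ Suc k" using exp_of_nat_mult[of "Suc k" "x k"]
      by (simp add: x_def del: of_nat_Suc)
    have xr: "x k = of_real (g / Suc k) * (u - 1)" by (simp add: x_def t_def)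
    have "norm (fct (g / Suc k) 0 u) \<le> 1" by (rule norm_fct_le_1) (use assms in auto)
    moreover have "norm (exp (x k)) \<le> 1"
    proof -
      have "g * (Re u - 1) / real (Suc k) \<le> 0"
        using Re_le_1[OF assms(2)] assms(1) by (intro divide_nonpos_nonneg mult_nonneg_nonpos) auto
      then show ?thesis unfolding xr by (simp add: norm_exp_eq_Re del: of_nat_Suc)
    qed
    ultimately have "norm (fct (g / Suc k) 0 u ^ Suc k - exp (x k) ^ Suc k)
        \<le> real (Suc k) * norm (fct (g / Suc k) 0 u - exp (x k))"
      by (rule norm_power_diff)
    also have "\<dots> = norm (?h (x k) / x k) * norm t"
      unfolding f norm_divide x_def[THEN fun_cong, of k] using t0
        by (simp add: norm_divide x_def del: of_nat_Suc)
    finally show ?thesis unfolding e .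
  qed
  then have "(\<lambda>k. fct (g / Suc k) 0 u ^ Suc k - exp t) \<longlonglongrightarrow> 0"
    by (intro Lim_null_comparison[OF _ l0]) auto
  then show ?thesis unfolding t_def by (simp add: LIM_zero_iff)
qed

lemma half_approx_LIMSEQ:
  assumes "half_param a b" "0 \<le> g" "norm u = 1"
  shows "(\<lambda>k. half_approx a b g k u) \<longlonglongrightarrow> half_gen a b g u"
  unfolding half_approx_def half_gen_def
  by (intro tendsto_mult power_approx_exp fct_prod_LIMSEQ assms)
    (use half_rad(1)[OF assms(1)] assms(3) in auto)

lemma goodH_limit:
  assumes good: "\<And>k. goodH (H k) (m k) (w k)"
    and H: "\<And>u. norm u = 1 \<Longrightarrow> (\<lambda>k. H k u) \<longlonglongrightarrow> G u" and m: "m \<longlonglongrightarrow> M" and w: "w \<longlonglongrightarrow> W"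
  shows "\<exists>r. (\<forall>n. fc G n = of_real (r n)) \<and> TP r \<and> (\<forall>n. 0 \<le> r n \<and> r n \<le> 1) \<and>
    (\<forall>n. \<bar>of_int n - M\<bar> * r n \<le> 2 * W) \<and> (\<forall>u. norm u = 1 \<longrightarrow> (norm (G u))\<^sup>2 * (1 + 2 * (1 - Re u) * W) \<le> 1)"
proof -
  from good obtain f where f: "good (f k) (H k) (m k) (w k)" for k unfolding goodH_def by metis
  have fn: "fc (H k) n = of_real (f k n)" for k n
    by (rule fc_eqI) (use f in \<open>auto simp: good_def\<close>)
  have "(\<lambda>k. fc (H k) n) \<longlonglongrightarrow> fc G n" for n
    by (rule fc_tendsto) (use f good_norm_le_1[OF f] H in \<open>auto simp: good_def\<close>)
  then have l: "(\<lambda>k. of_real (f k n) :: complex) \<longlonglongrightarrow> fc G n" for n by (simp add: fn)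
  define r where "r = (\<lambda>n. Re (fc G n))"
  have lr: "(\<lambda>k. f k n) \<longlonglongrightarrow> r n" for n using tendsto_Re[OF l] by (simp add: r_def)
  have "fc G n = of_real (r n)" for n
    using LIMSEQ_unique[OF l tendsto_of_real[OF lr]] .
  moreover have "TP r" unfolding TP_def
  proof (intro allI impI)
    fix N a assume a: "sdec N a"
    have "(\<lambda>k. ldet N (\<lambda>i j. f k (a i + int j))) \<longlonglongrightarrow> ldet N (\<lambda>i j. r (a i + int j))"
      by (rule tendsto_ldet) (rule lr)
    then show "0 \<le> ldet N (\<lambda>i j. r (a i + int j))"
      by (rule LIMSEQ_le_const) (use f a in \<open>auto simp: good_def TP_def\<close>)
  qed
  moreover have "0 \<le> r n \<and> r n \<le> 1" for n
    using LIMSEQ_le_const[OF lr, of 0 n] LIMSEQ_le_const2[OF lr, of n 1] f by (auto simp: good_def)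
  moreover have "\<bar>of_int n - M\<bar> * r n \<le> 2 * W" for n
    by (rule LIMSEQ_le[of "\<lambda>k. \<bar>of_int n - m k\<bar> * f k n" _ "\<lambda>k. 2 * w k"])
       (use f in \<open>auto simp: good_def intro!: tendsto_intros m w lr\<close>)
  moreover have "(norm (G u))\<^sup>2 * (1 + 2 * (1 - Re u) * W) \<le> 1" if "norm u = 1" for u
    by (rule LIMSEQ_le_const2[of "\<lambda>k. (norm (H k u))\<^sup>2 * (1 + 2 * (1 - Re u) * w k)"])
       (use f that in \<open>auto simp: good_def intro!: tendsto_intros H w\<close>)
  ultimately show ?thesis by blast
qed

text \<open>The variance of the limiting law: geometric, Bernoulli and Poisson parts.\<close>

definition half_var :: "(nat \<Rightarrow> real) \<Rightarrow> (nat \<Rightarrow> real) \<Rightarrow> real \<Rightarrow> real" where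
  "half_var a b g = (suminf (\<lambda>i. a i * (1 + a i) + b i * (1 - b i))) + g"

lemma half_var_summable:
  assumes "half_param a b"
  shows "summable (\<lambda>i. a i * (1 + a i) + b i * (1 - b i))"
proof -
  have s: "summable (\<lambda>i. (1 + a 0) * (a i + b i))" using half_paramD(5)[OF assms] by (rule summable_mult)
  have "norm (a i * (1 + a i) + b i * (1 - b i)) \<le> (1 + a 0) * (a i + b i)" for i
  proof -
    note h = half_paramD(1-4)[OF assms, of i] half_paramD(1)[OF assms, of 0]
    have "a i * (1 + a i) \<le> a i * (1 + a 0)" using h by (intro mult_left_mono) auto
    moreover have "b i * (1 - b i) \<le> b i * (1 + a 0)" using h by (intro mult_left_mono) auto
    moreover have "0 \<le> a i * (1 + a i)" "0 \<le> b i * (1 - b i)" using h by auto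
    ultimately show ?thesis by (simp add: algebra_simps)
  qed
  then show ?thesis by (intro summable_comparison_test'[OF s, of 0]) auto
qed

text \<open>The minus half enters by reflection, hence the difference in the mean, and
  \<open>gam\<close> completes the sums of the parameters to \<delta>. The term g^2 / (k + 1), by
  which the geometric variance exceeds the Poisson one, disappears in the limit.\<close>

theorem phi_fun_properties:
  assumes "(ap, bp, am, bm, dp, dm) \<in> Omega"
  defines "W \<equiv> half_var ap bp (gam ap bp dp) + half_var am bm (gam am bm dm)"
  shows "\<exists>r. (\<forall>n. phi_fun (ap, bp, am, bm, dp, dm) n = of_real (r n)) \<and> TP r \<and> (\<forall>n. 0 \<le> r n \<and> r n \<le> 1) \<and>
    (\<forall>n. \<bar>of_int n - (dp - dm)\<bar> * r n \<le> 2 * W) \<and>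
    (\<forall>u. norm u = 1 \<longrightarrow> (norm (Phi u (ap, bp, am, bm, dp, dm)))\<^sup>2 * (1 + 2 * (1 - Re u) * W) \<le> 1)"
proof -
  note O = OmegaD[OF assms(1)]
  let ?gp = "gam ap bp dp" and ?gm = "gam am bm dm"
  let ?H = "\<lambda>k u. half_approx ap bp ?gp k u * (half_approx am bm ?gm k (inverse u) * 1)"
  let ?m = "\<lambda>a b k. \<Sum>i<k. a i + b i" and ?v = "\<lambda>a b k. \<Sum>i<k. a i * (1 + a i) + b i * (1 - b i)"
  have "goodH (?H k) (- (0 + ?m am bm k + ?gm) + ?m ap bp k + ?gp)
    ((0 + ?v am bm k + ?gm * (1 + ?gm / Suc k)) + ?v ap bp k + ?gp * (1 + ?gp / Suc k))" for k
    by (rule goodH_half_approx[OF goodH_reflect[OF goodH_half_approx[OF goodH_one]]]) (use O in auto)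
  moreover have "(\<lambda>k. ?H k u) \<longlonglongrightarrow> Phi u (ap, bp, am, bm, dp, dm)" if "norm u = 1" for u
  proof -
    have "(\<lambda>k. ?H k u) \<longlonglongrightarrow> half_gen ap bp ?gp u * (half_gen am bm ?gm (inverse u) * 1)"
      by (intro tendsto_intros half_approx_LIMSEQ) (use O that in \<open>auto simp: norm_inverse\<close>)
    also have "half_gen ap bp ?gp u * (half_gen am bm ?gm (inverse u) * 1) = Phi u (ap, bp, am, bm, dp, dm)"
      using half_rad(1)[OF O(1)] half_rad(1)[OF O(2)] that
        by (subst Phi_split[OF O(1,2)]) (auto simp: norm_inverse)
    finally show ?thesis .
  qed
  moreover have "(\<lambda>k. - (0 + ?m am bm k + ?gm) + ?m ap bp k + ?gp) \<longlonglongrightarrow> dp - dm"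
  proof -
    have "?m ap bp \<longlonglongrightarrow> suminf (\<lambda>i. ap i + bp i)" "?m am bm \<longlonglongrightarrow> suminf (\<lambda>i. am i + bm i)"
      using half_paramD(5)[OF O(1)] half_paramD(5)[OF O(2)] by (auto intro: summable_LIMSEQ)
    then have "(\<lambda>k. - (0 + ?m am bm k + ?gm) + ?m ap bp k + ?gp) \<longlonglongrightarrow> - (0 + suminf (\<lambda>i. am i + bm i) + ?gm)
        + suminf (\<lambda>i. ap i + bp i) + ?gp"
      by (intro tendsto_intros)
    then show ?thesis by (simp add: gam_def)
  qed
  moreover have "(\<lambda>k. (0 + ?v am bm k + ?gm * (1 + ?gm / Suc k)) + ?v ap bp k + ?gp * (1 + ?gp / Suc k)) \<longlonglongrightarrow> W"
  proof -
    have "?v ap bp \<longlonglongrightarrow> suminf (\<lambda>i. ap i * (1 + ap i) + bp i * (1 - bp i))" "?v am bm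
        \<longlonglongrightarrow> suminf (\<lambda>i. am i * (1 + am i) + bm i * (1 - bm i))"
      using half_var_summable[OF O(1)] half_var_summable[OF O(2)] by (auto intro: summable_LIMSEQ)
    moreover have "(\<lambda>k. g / Suc k) \<longlonglongrightarrow> 0" for g :: real by (rule LIMSEQ_Suc) (rule lim_const_over_n)
    ultimately have "(\<lambda>k. (0 + ?v am bm k + ?gm * (1 + ?gm / Suc k)) + ?v ap bp k + ?gp * (1 + ?gp / Suc k)) \<longlonglongrightarrow>
      (0 + suminf (\<lambda>i. am i * (1 + am i) + bm i * (1 - bm i)) + ?gm * (1 + 0)) +
        suminf (\<lambda>i. ap i * (1 + ap i) + bp i * (1 - bp i)) + ?gp * (1 + 0)"
      by (intro tendsto_intros)
    then show ?thesis by (simp add: W_def half_var_def algebra_simps)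
  qed
  ultimately show ?thesis
    unfolding phi_fun_eq_fc[OF assms(1)] by (rule goodH_limit)
qed

subsection \<open>Compact exhaustion of Omega\<close>

definition Om :: "real \<Rightarrow> point set" where
  "Om C = {(ap, bp, am, bm, dp, dm). (ap, bp, am, bm, dp, dm) \<in> Omega \<and> dp \<le> C \<and> dm \<le> C}"

text \<open>Turns summability with a bound into inequalities between finitely many coordinates each,
  which are closed conditions in the product topology.\<close>

lemma summable_le_iff:
  fixes f :: "nat \<Rightarrow> real"
  assumes "\<And>i. 0 \<le> f i"
  shows "summable f \<and> suminf f \<le> d \<longleftrightarrow> (\<forall>n. sum f {..<n} \<le> d)"
proof safe
  fix n assume "summable f" "suminf f \<le> d"
  then show "sum f {..<n} \<le> d" using sum_le_suminf[of f "{..<n}"] assms by force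
next
  assume *: "\<forall>n. sum f {..<n} \<le> d"
  show "summable f" by (rule summableI_nonneg_bounded[of f d]) (use assms * in auto)
  then show "suminf f \<le> d" by (rule suminf_le_const) (use * in auto)
qed

definition half_set :: "real \<Rightarrow> ((nat \<Rightarrow> real) \<times> (nat \<Rightarrow> real) \<times> real) set" where
  "half_set C = {(a, b, d). decseq a \<and> decseq b \<and> (\<forall>i. 0 \<le> a i) \<and> (\<forall>i. 0 \<le> b i) \<and>
     summable (\<lambda>i. a i + b i) \<and> suminf (\<lambda>i. a i + b i) \<le> d \<and> d \<le> C}"

lemma half_set_eq:
  "half_set C = {(a, b, d). (\<forall>i. a (Suc i) \<le> a i) \<and> (\<forall>i. b (Suc i) \<le> b i) \<and> (\<forall>i. 0 \<le> a i) \<and> (\<forall>i. 0 \<le> b i) \<and>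
     (\<forall>n. (\<Sum>i<n. a i + b i) \<le> d) \<and> d \<le> C}"
proof -
  have "summable (\<lambda>i. a i + b i) \<and> suminf (\<lambda>i. a i + b i) \<le> d \<longleftrightarrow> (\<forall>n. (\<Sum>i<n. a i + b i) \<le> d)"
    if "\<forall>i. 0 \<le> a i" "\<forall>i. 0 \<le> b i" for a b :: "nat \<Rightarrow> real" and d
    using that by (intro summable_le_iff) auto
  note * = this
  have "(a, b, d) \<in> half_set C \<longleftrightarrow> (\<forall>i. a (Suc i) \<le> a i) \<and> (\<forall>i. b (Suc i) \<le> b i) \<and> (\<forall>i. 0 \<le> a i)
      \<and> (\<forall>i. 0 \<le> b i) \<and>
     (\<forall>n. (\<Sum>i<n. a i + b i) \<le> d) \<and> d \<le> C" for a b d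
    unfolding half_set_def decseq_Suc_iff mem_Collect_eq prod.case using *[of a b d] by blast
  then show ?thesis by auto
qed

text \<open>The decay C / (i + 1) holds because i + 1 copies of the i-th term of a decreasing
  sequence are below its partial sum. It is uniform over the set and makes squares uniformly
  summable.\<close>

lemma half_set_bounds:
  assumes "(a, b, d) \<in> half_set C"
  shows "0 \<le> a i" "0 \<le> b i" "a i \<le> C / Suc i" "b i \<le> C / Suc i" "0 \<le> d" "d \<le> C"
proof -
  have *: "decseq a" "decseq b" "\<And>i. 0 \<le> a i" "\<And>i. 0 \<le> b i" "\<And>n. (\<Sum>i<n. a i + b i) \<le> d" "d \<le> C"
    using assms unfolding half_set_eq by (auto simp: decseq_Suc_iff)
  show "0 \<le> a i" "0 \<le> b i" "d \<le> C" using * by auto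
  show "0 \<le> d" using *(5)[of 0] by simp
  have "real (Suc i) * s i \<le> C" if s: "s = a \<or> s = b" for s
  proof -
    have "real (Suc i) * s i = (\<Sum>j<Suc i. s i)" by (simp del: of_nat_Suc)
    also have "\<dots> \<le> (\<Sum>j<Suc i. a j + b j)"
    proof (rule sum_mono)
      fix j assume "j \<in> {..<Suc i}"
      then have "s i \<le> s j" using s * by (auto simp: decseq_def)
      also have "s j \<le> a j + b j" using s * by auto
      finally show "s i \<le> a j + b j" .
    qed
    also have "\<dots> \<le> C" using *(5)[of "Suc i"] *(6) by linarith
    finally show ?thesis .
  qed
  then show "a i \<le> C / Suc i" "b i \<le> C / Suc i" by (auto simp: field_simps simp del: of_nat_Suc)
qed

lemma compact_half_set: "compact (half_set C)"
proof -
  let ?B = "PiE UNIV (\<lambda>_::nat. {0..C}) :: (nat \<Rightarrow> real) set"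
  have "compactin (product_topology (\<lambda>_. euclidean) UNIV) ?B"
    by (subst compactin_PiE) auto
  then have B: "compact ?B" by (simp add: euclidean_product_topology)
  have "compact (?B \<times> ?B \<times> {0..C})" by (intro compact_Times B compact_Icc)
  moreover have "closed (half_set C)"
  proof -
    have "half_set C = {p. (\<forall>i. fst p (Suc i) \<le> fst p i) \<and> (\<forall>i. fst (snd p) (Suc i) \<le> fst (snd p) i) \<and>
      (\<forall>i. 0 \<le> fst p i) \<and> (\<forall>i. 0 \<le> fst (snd p) i) \<and>
      (\<forall>n. (\<Sum>i<n. fst p i + fst (snd p) i) \<le> snd (snd p)) \<and> snd (snd p) \<le> C}"
      unfolding half_set_eq by auto
    moreover have "closed \<dots>"
      by (intro closed_Collect_conj closed_Collect_all closed_Collect_le continuous_intros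
          continuous_on_product_then_coordinatewise[where f = fst]
          continuous_on_product_then_coordinatewise[where f = "\<lambda>p. fst (snd p)"])
    ultimately show ?thesis by simp
  qed
  moreover have "half_set C \<subseteq> ?B \<times> ?B \<times> {0..C}"
  proof (rule subsetI)
    fix p assume "p \<in> half_set C"
    then obtain a b d where p: "p = (a, b, d)" and h: "(a, b, d) \<in> half_set C" by (cases p) auto
    have C0: "0 \<le> C" using half_set_bounds(5,6)[OF h] by simp
    have "C / Suc i \<le> C" for i using C0
      by (simp add: divide_le_eq mult_left_le field_simps del: of_nat_Suc) (simp add: algebra_simps)
    then have "a i \<le> C" "b i \<le> C" for i using half_set_bounds(3,4)[OF h] order_trans by blast+
    then show "p \<in> ?B \<times> ?B \<times> {0..C}" using half_set_bounds[OF h] p by auto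
  qed
  ultimately show ?thesis by (metis Int_absorb1 closed_Int_compact Int_commute)
qed

lemma compact_Om: "compact (Om C)"
proof -
  let ?f = "\<lambda>((a, b, d), (a', b', d')). (a, b, a', b', d, d') :: point"
  have "Om C = ?f ` (half_set C \<times> half_set C) \<inter> {p. fst (snd p) 0 + fst (snd (snd (snd p))) 0 \<le> 1}"
    by (auto simp: Om_def Omega_def half_set_def image_iff Bex_def)
  moreover have "compact (?f ` (half_set C \<times> half_set C))"
    by (intro compact_continuous_image compact_Times compact_half_set)
       (auto simp: case_prod_unfold intro!: continuous_on_Pair continuous_on_fst continuous_on_snd
         continuous_on_id)
  moreover have "closed {p :: point. fst (snd p) 0 + fst (snd (snd (snd p))) 0 \<le> 1}"
    by (intro closed_Collect_le continuous_intros
          continuous_on_product_then_coordinatewise[where f = "\<lambda>p. fst (snd p)"]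
          continuous_on_product_then_coordinatewise[where f = "\<lambda>p. fst (snd (snd (snd p)))"])
  ultimately show ?thesis by (simp add: compact_Int_closed)
qed

subsection \<open>Continuity of the generating function\<close>

definition efct :: "real \<Rightarrow> real \<Rightarrow> complex \<Rightarrow> complex" where
  "efct a b u = fct a b u * exp (- (of_real (a + b) * (u - 1)))"

lemma norm_den_ge_1:
  assumes "0 \<le> a" "norm u = 1"
  shows "1 \<le> norm (1 - of_real a * (u - 1) :: complex)"
proof -
  have "1 = norm (of_real (1 + a) :: complex) - norm (of_real a * u)"
    unfolding norm_mult norm_of_real using assms by simp
  also have "\<dots> \<le> norm (of_real (1 + a) - of_real a * u)" by (rule norm_triangle_ineq2)
  also have "\<dots> = norm (1 - of_real a * (u - 1))" by (simp add: algebra_simps)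
  finally show ?thesis .
qed

lemma norm_exp_minus_linear: "norm (exp x - (1 + x)) \<le> exp (norm x) * (norm x)\<^sup>2" for x :: complex
proof -
  have "norm (exp x - (\<Sum>k\<le>1. x ^ k / fact k)) \<le> exp \<bar>Re x\<bar> * norm x ^ Suc 1 / fact 1" by (rule Taylor_exp)
  also have "\<dots> \<le> exp (norm x) * norm x ^ Suc 1 / fact 1" using abs_Re_le_cmod[of x]
    by (simp add: mult_right_mono)
  finally show ?thesis by (simp add: power2_eq_square)
qed

text \<open>The exponential factor removes the linear term of each factor, which makes the product
  converge uniformly on the compact sets, although the sums over \<open>\<alpha>\<close> and \<open>\<beta>\<close> do not.\<close>

lemma norm_efct_minus_1:
  assumes a: "0 \<le> a" "a \<le> C" and b: "0 \<le> b" "b \<le> C" and u: "norm u = 1"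
  shows "norm (efct a b u - 1) \<le> 4 * exp (2 * C) ^ 2 * (a\<^sup>2 + exp (2 * C) * b\<^sup>2)"
proof -
  let ?K = "exp (2 * C)"
  define t where "t = u - 1"
  \<comment> \<open>The two parameters are compensated separately; h1 and h2 differ from 1 by terms
    of second order in b and a, respectively.\<close>
  define h1 where "h1 = (1 + of_real b * t) * exp (- (of_real b * t))"
  define h2 where "h2 = exp (- (of_real a * t)) / (1 - of_real a * t)"
  have t: "norm t \<le> 2" using norm_triangle_ineq4[of u 1] u by (simp add: t_def)
  have C0: "0 \<le> C" using a by simp
  have K1: "1 \<le> ?K" using C0 by simp
  have nt: "norm (of_real c * t) \<le> 2 * C" if "0 \<le> c" "c \<le> C" for c :: real
  proof -
    have "norm (of_real c * t) = c * norm t" using that by (simp add: norm_mult)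
    also have "\<dots> \<le> C * 2" using that t by (intro mult_mono) auto
    finally show ?thesis by simp
  qed
  have ne: "norm (exp (- (of_real c * t))) \<le> ?K" if "0 \<le> c" "c \<le> C" for c :: real
    using norm_exp[of "- (of_real c * t)"] nt[OF that]
      by (metis exp_le_cancel_iff norm_minus_cancel order_trans)
  have sq: "(norm (of_real c * t))\<^sup>2 \<le> 4 * c\<^sup>2" if "0 \<le> c" for c :: real
  proof -
    have "norm (of_real c * t) \<le> c * 2" using that t by (simp add: norm_mult mult_left_mono)
    then have "(norm (of_real c * t))\<^sup>2 \<le> (c * 2)\<^sup>2" by (intro power_mono) auto
    then show ?thesis by (simp add: power_mult_distrib)
  qed
  have lin: "norm (exp x - (1 + x)) \<le> ?K * (norm x)\<^sup>2" if "norm x \<le> 2 * C" for x :: complex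
    by (rule order_trans[OF norm_exp_minus_linear]) (use that in \<open>auto intro!: mult_right_mono\<close>)
  have "h1 - 1 = - (exp (- (of_real b * t)) * (exp (of_real b * t) - (1 + of_real b * t)))"
    by (simp add: h1_def algebra_simps flip: exp_add)
  then have "norm (h1 - 1) = norm (exp (- (of_real b * t))) *
      norm (exp (of_real b * t) - (1 + of_real b * t))"
    by (simp add: norm_mult)
  also have "\<dots> \<le> ?K * (?K * (norm (of_real b * t))\<^sup>2)"
    by (intro mult_mono ne lin nt b) auto
  also have "\<dots> \<le> ?K * (?K * (4 * b\<^sup>2))" by (intro mult_left_mono sq b) auto
  finally have n1: "norm (h1 - 1) \<le> 4 * ?K\<^sup>2 * b\<^sup>2" by (simp add: power2_eq_square)
  have d: "1 \<le> norm (1 - of_real a * t)" unfolding t_def by (rule norm_den_ge_1[OF a(1) u])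
  then have d0: "1 - of_real a * t \<noteq> 0" by auto
  have "norm h2 \<le> ?K / 1" unfolding h2_def norm_divide by (rule frac_le) (use ne[OF a] d in auto)
  then have nh2: "norm h2 \<le> ?K" by simp
  have e2: "h2 - 1 = (exp (- (of_real a * t)) - (1 + - (of_real a * t))) / (1 - of_real a * t)"
    using d0 by (simp add: h2_def divide_simps)
  have "norm (h2 - 1) \<le> norm (exp (- (of_real a * t)) - (1 + - (of_real a * t))) / 1"
    unfolding e2 norm_divide by (rule frac_le) (use d in auto)
  also have "\<dots> \<le> ?K * (norm (- (of_real a * t)))\<^sup>2"
    using lin[of "- (of_real a * t)"] nt[OF a] by simp
  also have "\<dots> \<le> ?K * (4 * a\<^sup>2)" using sq[OF a(1)] by (simp add: mult_left_mono)
  also have "\<dots> \<le> ?K\<^sup>2 * (4 * a\<^sup>2)" using K1 by (intro mult_right_mono) (auto simp: power2_eq_square)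
  finally have n2: "norm (h2 - 1) \<le> 4 * ?K\<^sup>2 * a\<^sup>2" by simp
  have "efct a b u = h1 * h2"
    unfolding efct_def fct_def h1_def h2_def t_def
      by (simp add: exp_add[symmetric] algebra_simps exp_diff exp_minus divide_simps)
  then have "efct a b u - 1 = (h1 - 1) * h2 + (h2 - 1)" by (simp add: algebra_simps)
  then have "norm (efct a b u - 1) \<le> norm (h1 - 1) * norm h2 + norm (h2 - 1)"
    by (metis norm_mult norm_triangle_ineq)
  also have "\<dots> \<le> 4 * ?K\<^sup>2 * b\<^sup>2 * ?K + 4 * ?K\<^sup>2 * a\<^sup>2"
    by (intro add_mono mult_mono n1 n2 nh2) auto
  finally show ?thesis by (simp add: algebra_simps)
qed

text \<open>The compensating exponentials turn \<open>gam a b d\<close> into d. Thus the sum of the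
  parameters, through which mass can escape in a limit, is gone, and d is itself a
  coordinate.\<close>

lemma efct_prodinf:
  assumes h: "half_param a b" and u: "norm u = 1"
  shows "convergent_prod (\<lambda>i. efct (a i) (b i) u)"
    "half_gen a b (gam a b d) u = exp (of_real d * (u - 1)) * prodinf (\<lambda>i. efct (a i) (b i) u)"
proof -
  have ur: "norm u \<le> half_rad a" using half_rad(1)[OF h] u by simp
  note c = convergent_prod_fct[OF h ur]
  let ?x = "\<lambda>i. - (of_real (a i + b i) * (u - 1)) :: complex"
  have s: "summable ?x"
    by (intro summable_minus summable_mult2 summable_of_real half_paramD(5)[OF h])
  note ce = convergent_prod_exp[OF s]
  show "convergent_prod (\<lambda>i. efct (a i) (b i) u)" unfolding efct_def by (rule convergent_prod_mult[OF c ce])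
  have "prodinf (\<lambda>i. efct (a i) (b i) u) = prodinf (\<lambda>i. fct (a i) (b i) u) * exp (suminf ?x)"
    unfolding efct_def prodinf_mult[OF c ce, symmetric] prodinf_exp[OF s] ..
  also have "suminf ?x = - (of_real (suminf (\<lambda>i. a i + b i)) * (u - 1))"
    using half_paramD(5)[OF h]
    by (subst suminf_minus, intro summable_mult2 summable_of_real, assumption)
       (simp only: suminf_mult2[symmetric, OF summable_of_real] suminf_of_real[symmetric])
  finally show "half_gen a b (gam a b d) u = exp (of_real d * (u - 1)) * prodinf (\<lambda>i. efct (a i) (b i) u)"
    by (simp add: half_gen_def gam_def algebra_simps flip: exp_add)
qed

text \<open>The Weierstrass test applies: factors differ from 1 by a multiple of the squared
  parameters, hence by a multiple of 1 / (i + 1)^2, uniformly on A.\<close>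

lemma continuous_on_prodinf_efct:
  fixes A :: "'t::topological_space set" and pa pb :: "'t \<Rightarrow> nat \<Rightarrow> real"
  assumes A: "compact A" and ca: "\<And>i. continuous_on A (\<lambda>x. pa x i)" "\<And>i. continuous_on A (\<lambda>x. pb x i)"
    and h: "\<And>x. x \<in> A \<Longrightarrow> half_param (pa x) (pb x)"
      and bd: "\<And>x i. x \<in> A \<Longrightarrow> pa x i \<le> C / Suc i \<and> pb x i \<le> C / Suc i"
    and u: "norm u = 1" and C: "0 \<le> C"
  shows "continuous_on A (\<lambda>x. prodinf (\<lambda>i. efct (pa x i) (pb x i) u))"
proof -
  let ?f = "\<lambda>i x. efct (pa x i) (pb x i) u"
  let ?P = "\<lambda>n x. \<Prod>i<n. ?f i x"
  have nz: "1 - of_real (pa x i) * (u - 1) \<noteq> 0" if "x \<in> A" for x i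
    using norm_den_ge_1[OF half_paramD(1)[OF h[OF that]] u, of i] by auto
  have cont: "continuous_on A (?f i)" for i
  proof -
    have "continuous_on A (\<lambda>x. complex_of_real (pa x i))" "continuous_on A (\<lambda>x. complex_of_real (pb x i))"
      by (intro continuous_on_of_real ca)+
    then show ?thesis unfolding efct_def fct_def of_real_add
      by (intro continuous_on_mult continuous_on_divide continuous_on_add continuous_on_diff continuous_on_exp
          continuous_on_minus continuous_on_const ballI nz)
  qed
  let ?M = "\<lambda>i. 4 * exp (2 * C) ^ 2 * (C\<^sup>2 + exp (2 * C) * C\<^sup>2) * inverse (real (Suc i) ^ 2)"
  have "summable (\<lambda>i. inverse (real i ^ 2))" by (rule inverse_power_summable) simp
  then have "summable (\<lambda>i. inverse (real (Suc i) ^ 2))"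
    by (rule summable_Suc_iff[of "\<lambda>i. inverse (real i ^ 2)", THEN iffD2])
  then have sM: "summable ?M" by (rule summable_mult)
  have bM: "norm (?f i x - 1) \<le> ?M i" if x: "x \<in> A" for i x
  proof -
    have p: "0 \<le> pa x i" "0 \<le> pb x i" "pa x i \<le> C / Suc i" "pb x i \<le> C / Suc i"
      using half_paramD[OF h[OF x]] bd[OF x] by auto
    have CS: "C / Suc i \<le> C" using C by (simp add: divide_le_eq algebra_simps)
    have "norm (?f i x - 1) \<le> 4 * exp (2 * C) ^ 2 * ((pa x i)\<^sup>2 + exp (2 * C) * (pb x i)\<^sup>2)"
      by (rule norm_efct_minus_1) (use p CS u in auto)
    also have "\<dots> \<le> 4 * exp (2 * C) ^ 2 * ((C / Suc i)\<^sup>2 + exp (2 * C) * (C / Suc i)\<^sup>2)"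
      using p by (intro mult_left_mono add_mono power_mono) auto
    also have "\<dots> = ?M i" by
      (simp add: power_divide divide_inverse algebra_simps power_inverse del: of_nat_Suc)
    finally show ?thesis .
  qed
  have "uniformly_convergent_on A ?P"
  proof (rule uniformly_convergent_on_prod'[OF cont A])
    show "uniformly_convergent_on A (\<lambda>N x. \<Sum>n<N. norm (?f n x - 1))"
      by (rule Weierstrass_m_test'[OF _ sM]) (use bM in auto)
  qed
  then obtain l where l: "uniform_limit A ?P l sequentially" by (auto simp: uniformly_convergent_on_def)
  have "continuous_on A l"
    by (rule uniform_limit_theorem[OF _ l]) (auto intro!: continuous_intros cont always_eventually)
  moreover have "l x = prodinf (\<lambda>i. ?f i x)" if x: "x \<in> A" for x
  proof -
    have "(\<lambda>n. ?P n x) \<longlonglongrightarrow> prodinf (\<lambda>i. ?f i x)"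
      using convergent_prod_LIMSEQ[OF efct_prodinf(1)[OF h[OF x] u]] by (simp add: LIMSEQ_lessThan_iff_atMost)
    with tendsto_uniform_limitI[OF l x] show ?thesis by (rule LIMSEQ_unique)
  qed
  ultimately show ?thesis by (simp cong: continuous_on_cong)
qed

lemma Om_half:
  assumes "(ap, bp, am, bm, dp, dm) \<in> Om C"
  shows "(ap, bp, dp) \<in> half_set C" "(am, bm, dm) \<in> half_set C"
  using assms by (auto simp: Om_def Omega_def half_set_def)

lemma continuous_on_Phi_Om:
  assumes u: "norm u = 1" and C: "0 \<le> C"
  shows "continuous_on (Om C) (Phi u)"
proof -
  have iu: "norm (inverse u) = 1" using u by (simp add: norm_inverse)
  let ?ap = "\<lambda>p::point. fst p" and ?bp = "\<lambda>p::point. fst (snd p)" and ?am = "\<lambda>p::point. fst (snd (snd p))"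
    and ?bm = "\<lambda>p::point. fst (snd (snd (snd p)))" and ?dp = "\<lambda>p::point. fst (snd (snd (snd (snd p))))"
    and ?dm = "\<lambda>p::point. snd (snd (snd (snd (snd p))))"
  let ?G = "\<lambda>p. (exp (of_real (?dp p) * (u - 1)) * prodinf (\<lambda>i. efct (?ap p i) (?bp p i) u)) *
      (exp (of_real (?dm p) * (inverse u - 1)) * prodinf (\<lambda>i. efct (?am p i) (?bm p i) (inverse u)))"
  have O: "half_param (?ap p) (?bp p)" "half_param (?am p) (?bm p)" if "p \<in> Om C" for p
  proof -
    obtain ap bp am bm dp dm where "p = (ap, bp, am, bm, dp, dm)" by (metis prod_cases6)
    with that show "half_param (?ap p) (?bp p)" "half_param (?am p) (?bm p)"
      using OmegaD(1,2)[of ap bp am bm dp dm] by (auto simp: Om_def)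
  qed
  have bd: "?ap p i \<le> C / Suc i \<and> ?bp p i \<le> C / Suc i" "?am p i \<le> C / Suc i \<and> ?bm p i \<le> C / Suc i"
    if "p \<in> Om C" for p i
  proof -
    obtain ap bp am bm dp dm where p: "p = (ap, bp, am, bm, dp, dm)" by (metis prod_cases6)
    show "?ap p i \<le> C / Suc i \<and> ?bp p i \<le> C / Suc i" "?am p i \<le> C / Suc i \<and> ?bm p i \<le> C / Suc i"
      using Om_half[OF that[unfolded p]] half_set_bounds(3,4) unfolding p by auto
  qed
  have co: "continuous_on (Om C) (\<lambda>p. ?ap p i)" "continuous_on (Om C) (\<lambda>p. ?bp p i)"
    "continuous_on (Om C) (\<lambda>p. ?am p i)" "continuous_on (Om C) (\<lambda>p. ?bm p i)" for i
    by (rule continuous_on_product_then_coordinatewise, intro continuous_on_fst continuous_on_snd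
      continuous_on_id)+
  have cp: "continuous_on (Om C) (\<lambda>p. prodinf (\<lambda>i. efct (?ap p i) (?bp p i) u))"
    by (rule continuous_on_prodinf_efct[OF compact_Om co(1,2) O(1) bd(1) u C])
  have cm: "continuous_on (Om C) (\<lambda>p. prodinf (\<lambda>i. efct (?am p i) (?bm p i) (inverse u)))"
    by (rule continuous_on_prodinf_efct[OF compact_Om co(3,4) O(2) bd(2) iu C])
  have "continuous_on (Om C) ?G"
    by (intro continuous_on_mult continuous_on_exp continuous_on_of_real continuous_on_fst continuous_on_snd
        continuous_on_id continuous_on_const cp cm)
  moreover have "?G p = Phi u p" if p: "p \<in> Om C" for p
  proof -
    obtain ap bp am bm dp dm where pp: "p = (ap, bp, am, bm, dp, dm)" by (metis prod_cases6)
    have h: "half_param ap bp" "half_param am bm" using O[OF p] by (auto simp: pp)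
    have "Phi u p = half_gen ap bp (gam ap bp dp) u * half_gen am bm (gam am bm dm) (inverse u)"
      unfolding pp by (rule Phi_split[OF h]) (use half_rad(1)[OF h(1)] half_rad(1)[OF h(2)] u iu in auto)
    then show ?thesis unfolding efct_prodinf(2)[OF h(1) u] efct_prodinf(2)[OF h(2) iu] by (simp add: pp)
  qed
  ultimately show ?thesis by (simp cong: continuous_on_cong)
qed

text \<open>A convergent sequence has bounded \<delta> coordinates, so it stays in one compact
  \<open>Om C\<close>. There the generating function is continuous at each u of the circle, which
  suffices for the Fourier coefficients.\<close>

lemma continuous_on_phi_fun: "continuous_on Omega (\<lambda>\<omega>. phi_fun \<omega> n)"
proof (rule continuous_on_sequentiallyI)
  fix p :: "nat \<Rightarrow> point" and q
  assume p: "\<forall>k. p k \<in> Omega" and q: "q \<in> Omega" and l: "p \<longlonglongrightarrow> q"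
  let ?dp = "\<lambda>p::point. fst (snd (snd (snd (snd p))))" and ?dm = "\<lambda>p::point. snd (snd (snd (snd (snd p))))"
  have "Bseq (\<lambda>k. ?dp (p k))" "Bseq (\<lambda>k. ?dm (p k))"
    by (intro convergent_imp_Bseq convergentI[of _ "?dp q"] tendsto_intros l,
        intro convergent_imp_Bseq convergentI[of _ "?dm q"] tendsto_intros l)
  then obtain C1 C2 where C12: "\<And>k. \<bar>?dp (p k)\<bar> \<le> C1" "\<And>k. \<bar>?dm (p k)\<bar> \<le> C2"
    unfolding Bseq_def by auto
  define C where "C = max (max C1 C2) (max (max (?dp q) (?dm q)) 0)"
  have C: "0 \<le> C" by (simp add: C_def)
  have pC: "p k \<in> Om C" for k
  proof -
    obtain ap bp am bm dp dm where pp: "p k = (ap, bp, am, bm, dp, dm)" by (metis prod_cases6)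
    show ?thesis using C12[of k] p[rule_format, of k] unfolding pp Om_def C_def by auto
  qed
  have qC: "q \<in> Om C"
  proof -
    obtain ap bp am bm dp dm where pp: "q = (ap, bp, am, bm, dp, dm)" by (metis prod_cases6)
    show ?thesis using q unfolding pp Om_def C_def by auto
  qed
  have "(\<lambda>k. fc (\<lambda>u. Phi u (p k)) n) \<longlonglongrightarrow> fc (\<lambda>u. Phi u q) n"
  proof (rule fc_tendsto)
    show "(\<lambda>k. Phi u (p k)) \<longlonglongrightarrow> Phi u q" if "norm u = 1" for u
      using continuous_on_Phi_Om[OF that C] l pC qC unfolding continuous_on_sequentially comp_def by blast
  qed (use Phi_circle p in auto)
  then show "(\<lambda>k. phi_fun (p k) n) \<longlonglongrightarrow> phi_fun q n"
    using p q by (simp add: phi_fun_eq_fc)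
qed

subsection \<open>Vanishing at infinity\<close>

text \<open>The bound on the modulus of the generating function at \<open>cis t\<close> that a
  variance K imposes through the norm inequality in \<open>good\<close>.\<close>

definition conc :: "real \<Rightarrow> real \<Rightarrow> real" where
  "conc K t = 1 / sqrt (1 + 2 * (1 - cos t) * K)"

lemma conc_den:
  fixes K t :: real
  shows "0 \<le> K \<Longrightarrow> 1 \<le> 1 + 2 * (1 - cos t) * K"
  using cos_le_one[of t] by (simp del: cos_le_one)

lemma conc_integrable: "0 \<le> K \<Longrightarrow> conc K integrable_on {0..2 * pi}"
  unfolding conc_def
proof (intro integrable_continuous_interval continuous_on_divide continuous_on_real_sqrt continuous_intros
  ballI)
  fix t :: real assume "0 \<le> K"
  from conc_den[OF this, of t] show "sqrt (1 + 2 * (1 - cos t) * K) \<noteq> 0" by simp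
qed

lemma conc_integral_LIMSEQ: "(\<lambda>k. integral {0..2 * pi} (conc (real k))) \<longlonglongrightarrow> 0"
proof -
  let ?g = "\<lambda>t::real. if cos t = 1 then 1 else (0::real)"
  have "(\<lambda>k. integral {0..2 * pi} (conc (real k))) \<longlonglongrightarrow> integral {0..2 * pi} ?g"
  proof (rule dominated_convergence)
    show "conc (real k) integrable_on {0..2 * pi}" for k by (rule conc_integrable) simp
    show "(\<lambda>_. 1::real) integrable_on {0..2 * pi}" by (rule integrable_const_ivl)
    show "norm (conc (real k) t) \<le> 1" for k t
    proof -
      have s: "1 \<le> sqrt (1 + 2 * (1 - cos t) * real k)" using conc_den[of "real k" t] by simp
      have "norm (1 / x) \<le> 1" if "1 \<le> x" for x :: real using that by simp
      from this[OF s] show ?thesis unfolding conc_def .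
    qed
    show "(\<lambda>k. conc (real k) t) \<longlonglongrightarrow> ?g t" for t
    proof (cases "cos t = 1")
      case True
      then show ?thesis by (simp add: conc_def)
    next
      case False
      then have c: "0 < 2 * (1 - cos t)" using cos_le_one[of t] by (simp add: less_le del: cos_le_one)
      have "filterlim (\<lambda>k. sqrt (1 + 2 * (1 - cos t) * real k)) at_top sequentially"
        by (rule filterlim_compose[OF sqrt_at_top], rule filterlim_tendsto_add_at_top[OF tendsto_const],
            rule filterlim_tendsto_pos_mult_at_top[OF tendsto_const c filterlim_real_sequentially])
      then have "(\<lambda>k. conc (real k) t) \<longlonglongrightarrow> 0"
        unfolding conc_def by (rule tendsto_divide_0[OF tendsto_const filterlim_at_top_imp_at_infinity])
      with False show ?thesis by simp
    qed
  qed
  also have "integral {0..2 * pi} ?g = 0"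
  proof -
    have "(?g has_integral 0) {0..2 * pi}"
    proof (rule has_integral_spike_finite[of "{0, 2 * pi}" _ _ "\<lambda>_. 0"])
      fix t :: real assume t: "t \<in> {0..2 * pi} - {0, 2 * pi}"
      show "?g t = 0"
      proof (cases "cos t = 1")
        case True
        then obtain n :: int where n: "t = of_int n * (2 * pi)" by (auto simp: cos_one_2pi_int)
        have "0 < t" "t < 2 * pi" using t by (auto simp: less_le)
        then have "0 < real_of_int n * (2 * pi)" "real_of_int n * (2 * pi) < 1 * (2 * pi)" unfolding n by auto
        then have "0 < real_of_int n" "real_of_int n < 1"
          using zero_less_mult_pos2[of "real_of_int n" "2 * pi"]
            mult_less_cancel_right_pos[of "2 * pi" "real_of_int n" 1] by auto
        then have "0 < n" "n < 1" by simp_all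
        then have False by linarith
        then show ?thesis ..
      qed simp
    qed auto
    then show ?thesis by (rule integral_unique)
  qed
  finally show ?thesis .
qed

lemma norm_fc_le_conc:
  assumes F: "continuous_on (sphere 0 1) F" and K: "0 \<le> K"
    and bd: "\<And>u. norm u = 1 \<Longrightarrow> (norm (F u))\<^sup>2 * (1 + 2 * (1 - Re u) * K) \<le> 1"
  shows "norm (fc F n) \<le> integral {0..2 * pi} (conc K)"
proof -
  have "norm (integral {0..2 * pi} (\<lambda>t. F (cis t) * cis (- of_int n * t))) \<le> integral {0..2 * pi} (conc K)"
  proof (rule integral_norm_bound_integral)
    have "continuous_on {0..2 * pi} (\<lambda>t. F (cis t))"
      by (rule continuous_on_compose2[OF F]) (auto intro!: continuous_intros)
    then show "(\<lambda>t. F (cis t) * cis (- of_int n * t)) integrable_on {0..2 * pi}"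
      by (intro integrable_continuous_interval continuous_on_mult) (auto intro!: continuous_intros)
    show "conc K integrable_on {0..2 * pi}" by (rule conc_integrable[OF K])
    fix t
    have d: "1 \<le> 1 + 2 * (1 - cos t) * K" by (rule conc_den[OF K])
    have "(norm (F (cis t)))\<^sup>2 * (1 + 2 * (1 - cos t) * K) \<le> 1" using bd[of "cis t"] by simp
    then have "(norm (F (cis t)))\<^sup>2 \<le> 1 / (1 + 2 * (1 - cos t) * K)" using d by (simp add: pos_le_divide_eq)
    then have "norm (F (cis t)) \<le> sqrt (1 / (1 + 2 * (1 - cos t) * K))" by (rule real_le_rsqrt)
    then show "norm (F (cis t) * cis (- of_int n * t)) \<le> conc K t"
      by (simp add: norm_mult conc_def real_sqrt_divide)
  qed
  then have "norm (fc F n) \<le> integral {0..2 * pi} (conc K) / (2 * pi)"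
    by (simp add: fc_def norm_divide divide_right_mono)
  also have "\<dots> \<le> integral {0..2 * pi} (conc K)"
  proof -
    have "0 \<le> integral {0..2 * pi} (conc K)"
      by (rule integral_nonneg[OF conc_integrable[OF K]])
        (use conc_den[OF K] in \<open>auto simp: conc_def intro!: divide_nonneg_nonneg\<close>)
    moreover have "1 \<le> 2 * pi" using pi_ge_two by linarith
    ultimately show ?thesis by (simp add: divide_le_eq mult_left_mono mult_le_cancel_left1)
  qed
  finally show ?thesis .
qed

text \<open>If all b i are at most 1/2, then b i \<le> 2 b i (1 - b i), and the mean is controlled
  by the variance. For b i near 1 this fails: such a factor is almost a deterministic shift.\<close>

lemma half_var_bounds:
  assumes h: "half_param a b" and g: "0 \<le> gam a b d"
  shows "0 \<le> half_var a b (gam a b d)" "b 0 \<le> 1 / 2 \<Longrightarrow> d \<le> 2 * half_var a b (gam a b d)"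
proof -
  let ?v = "\<lambda>i. a i * (1 + a i) + b i * (1 - b i)"
  have v: "0 \<le> ?v i" for i using half_paramD[OF h] by (intro add_nonneg_nonneg mult_nonneg_nonneg) auto
  show "0 \<le> half_var a b (gam a b d)"
    unfolding half_var_def using g suminf_nonneg[OF half_var_summable[OF h] v] by simp
  show "d \<le> 2 * half_var a b (gam a b d)" if b: "b 0 \<le> 1 / 2"
  proof -
    have le: "a i + b i \<le> 2 * ?v i" for i
    proof -
      have bi: "b i \<le> 1 / 2" using h b unfolding half_param_def decseq_def by (meson le0 order_trans)
      have "b i * (1 / 2) \<le> b i * (1 - b i)" using bi half_paramD(3)[OF h] by (intro mult_left_mono) auto
      then have "b i \<le> 2 * (b i * (1 - b i))" by simp
      moreover have "a i \<le> 2 * (a i * (1 + a i))" using half_paramD(1)[OF h, of i] by (simp add: distrib_left)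
      ultimately show ?thesis unfolding distrib_left[of 2] by (intro add_mono)
    qed
    have "suminf (\<lambda>i. a i + b i) \<le> suminf (\<lambda>i. 2 * ?v i)"
      by (rule suminf_le[OF le half_paramD(5)[OF h] summable_mult[OF half_var_summable[OF h]]])
    also have "\<dots> = 2 * suminf ?v" by (rule suminf_mult[OF half_var_summable[OF h]])
    finally show ?thesis using g by (simp add: half_var_def gam_def)
  qed
qed

text \<open>If the variance is large, the Fourier integral is small. Otherwise one of \<open>\<delta>\<^sup>+\<close>, \<open>\<delta>\<^sup>-\<close> is bounded,
  because \<open>\<beta>\<^sup>+\<^sub>1 \<le> 1/2\<close> or \<open>\<beta>\<^sup>-\<^sub>1 \<le> 1/2\<close>; the other one is large, hence the mean is far from \<open>n\<close>.\<close>

lemma phi_fun_small: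
  assumes e: "0 < e"
  shows "\<exists>C\<ge>0. \<forall>\<omega>\<in>Omega - Om C. norm (phi_fun \<omega> n) < e"
proof -
  have "eventually (\<lambda>k. integral {0..2 * pi} (conc (real k)) < e) sequentially"
    using conc_integral_LIMSEQ e by (rule order_tendstoD)
  then obtain k where k: "integral {0..2 * pi} (conc (real k)) < e" by (auto simp: eventually_sequentially)
  define K where "K = real k"
  \<comment> \<open>Outside \<open>Om C\<close> with variance below K, the mean is at distance at
    least 2 * K / e + 1 from n. The moment bound, which is below 2 * K, then gives a value below
    e.\<close>
  define C where "C = 2 * K + \<bar>of_int n\<bar> + 2 * K / e + 1"
  have K: "0 \<le> K" "0 \<le> 2 * K / e" using e by (auto simp: K_def)
  have C: "0 \<le> C" using K by (simp add: C_def)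
  have "norm (phi_fun \<omega> n) < e" if w: "\<omega> \<in> Omega - Om C" for \<omega>
  proof -
    obtain ap bp am bm dp dm where p: "\<omega> = (ap, bp, am, bm, dp, dm)" by (metis prod_cases6)
    have Om: "(ap, bp, am, bm, dp, dm) \<in> Omega" using w p by simp
    note O = OmegaD[OF Om]
    let ?Vp = "half_var ap bp (gam ap bp dp)" and ?Vm = "half_var am bm (gam am bm dm)"
    obtain r where r: "\<And>n. phi_fun \<omega> n = of_real (r n)" "\<And>n. 0 \<le> r n" "\<And>n. \<bar>of_int n - (dp - dm)\<bar> * r n
        \<le> 2 * (?Vp + ?Vm)"
      "\<And>u. norm u = 1 \<Longrightarrow> (norm (Phi u \<omega>))\<^sup>2 * (1 + 2 * (1 - Re u) * (?Vp + ?Vm)) \<le> 1"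
      using phi_fun_properties[OF Om] unfolding p by blast
    show ?thesis
    proof (cases "K \<le> ?Vp + ?Vm")
      case True
      have "norm (fc (\<lambda>u. Phi u \<omega>) n) \<le> integral {0..2 * pi} (conc K)"
      proof (rule norm_fc_le_conc)
        show "continuous_on (sphere 0 1) (\<lambda>u. Phi u \<omega>)" using Phi_circle(2) w by auto
        fix u :: complex assume u: "norm u = 1"
        have "(norm (Phi u \<omega>))\<^sup>2 * (1 + 2 * (1 - Re u) * K)
            \<le> (norm (Phi u \<omega>))\<^sup>2 * (1 + 2 * (1 - Re u) * (?Vp + ?Vm))"
          using True Re_le_1[OF u] by (intro mult_left_mono add_left_mono) auto
        also have "\<dots> \<le> 1" by (rule r(4)[OF u])
        finally show "(norm (Phi u \<omega>))\<^sup>2 * (1 + 2 * (1 - Re u) * K) \<le> 1" .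
      qed (rule K)
      then show ?thesis using k w by (simp add: phi_fun_eq_fc K_def)
    next
      case False
      then have V: "?Vp < K" "?Vm < K" "?Vp + ?Vm < K"
        using half_var_bounds(1)[OF O(1,3)] half_var_bounds(1)[OF O(2,4)] by auto
      have d: "C < dp \<or> C < dm" using w p by (auto simp: Om_def)
      have CK: "2 * K \<le> C" using K by (simp add: C_def)
      have far: "C - 2 * K - \<bar>of_int n\<bar> \<le> \<bar>of_int n - (dp - dm)\<bar>"
      proof (cases "bp 0 \<le> 1 / 2")
        case True
        then have "dp < 2 * K" using half_var_bounds(2)[OF O(1,3)] V by linarith
        with d CK show ?thesis by linarith
      next
        case False
        then have "bm 0 \<le> 1 / 2" using O(5) by linarith
        then have "dm < 2 * K" using half_var_bounds(2)[OF O(2,4)] V by linarith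
        with d CK show ?thesis by linarith
      qed
      have "(2 * K / e + 1) * r n \<le> \<bar>of_int n - (dp - dm)\<bar> * r n"
        using far r(2) by (intro mult_right_mono) (auto simp: C_def)
      also have "\<dots> \<le> 2 * (?Vp + ?Vm)" by (rule r(3))
      also have "\<dots> < 2 * K + e" using V(3) e by (simp add: less_add_same_cancel1 add_strict_increasing2)
      also have "\<dots> = (2 * K / e + 1) * e" using e by (simp add: field_simps)
      finally have "r n < e" using K by (simp add: mult_less_cancel_left)
      then show ?thesis using r(1,2) by simp
    qed
  qed
  then show ?thesis using C by blast
qed

lemma phi_fun_small_finite:
  assumes e: "0 < e" and S: "finite S"
  shows "\<exists>C\<ge>0. \<forall>\<omega>\<in>Omega - Om C. \<forall>n\<in>S. norm (phi_fun \<omega> n) < e"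
proof -
  obtain C where C: "\<And>n. 0 \<le> C n" "\<And>n \<omega>. \<omega> \<in> Omega - Om (C n) \<Longrightarrow> norm (phi_fun \<omega> n) < e"
    using phi_fun_small[OF e] by metis
  have mono: "Om (C n) \<subseteq> Om (sum C S)" if "n \<in> S" for n
    using member_le_sum[OF that, of C] C(1) S by (auto simp: Om_def)
  have "norm (phi_fun \<omega> n) < e" if "\<omega> \<in> Omega - Om (sum C S)" "n \<in> S" for \<omega> n
    using mono[OF that(2)] that(1) by (intro C(2)) auto
  then show ?thesis using C(1) by (intro exI[of _ "sum C S"]) (auto intro: sum_nonneg)
qed

lemma norm_phi_fun_le_1: "\<omega> \<in> Omega \<Longrightarrow> norm (phi_fun \<omega> n) \<le> 1"
proof -
  assume w: "\<omega> \<in> Omega"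
  obtain ap bp am bm dp dm where p: "\<omega> = (ap, bp, am, bm, dp, dm)" by (metis prod_cases6)
  obtain r where "\<And>n. phi_fun \<omega> n = of_real (r n)" "\<And>n. 0 \<le> r n \<and> r n \<le> 1"
    using phi_fun_properties w unfolding p by blast
  then show ?thesis by simp
qed

text \<open>One small row makes the whole determinant small, as all entries have norm at most 1; so
  it is enough to control the finitely many coefficients in row 0. Such a row exists as N \<ge> 1;
  for N = 0 the function would be constant.\<close>

theorem sigma_fun_C0:
  assumes l: "l \<in> nonempty_signatures"
  shows "\<sigma>_fun l \<in> C0 top_Omega"
proof -
  obtain N where N: "l \<in> signatures N" "N \<ge> 1" using l by (auto simp: nonempty_signatures_def)
  note len = signatures_length[OF N(1)]
  have eq: "\<sigma>_fun l \<omega> = ldet N (\<lambda>i j. phi_fun \<omega> (sx l i + int j))" if "\<omega> \<in> Omega" for \<omega>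
    using that len by (simp add: \<sigma>_fun_def jacobi_trudi_sx)
  have "continuous_on Omega (\<lambda>\<omega>. ldet N (\<lambda>i j. phi_fun \<omega> (sx l i + int j)))"
    unfolding continuous_on_def
    by (intro ballI tendsto_ldet continuous_on_phi_fun[unfolded continuous_on_def, rule_format])
  then have "continuous_on Omega (\<sigma>_fun l)" by (rule continuous_on_eq) (simp add: eq)
  then have 1: "continuous_map top_Omega euclidean (\<sigma>_fun l)" by simp
  have 2: "\<exists>K. compactin top_Omega K \<and> (\<forall>x\<in>topspace top_Omega - K. norm (\<sigma>_fun l x) < e)" if e: "0 < e" for e
  proof -
    have e': "0 < e / (2 * fact N)" using e by simp
    obtain C where C: "\<And>\<omega> n. \<omega> \<in> Omega - Om C \<Longrightarrow> n \<in> (\<lambda>j. sx l 0 + int j) ` {..<N}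
        \<Longrightarrow> norm (phi_fun \<omega> n) < e / (2 * fact N)"
      using phi_fun_small_finite[OF e', of "(\<lambda>j. sx l 0 + int j) ` {..<N}"] by auto
    have "norm (\<sigma>_fun l \<omega>) < e" if w: "\<omega> \<in> Omega - Om C" for \<omega>
    proof -
      have "norm (ldet N (\<lambda>i j. phi_fun \<omega> (sx l i + int j))) \<le> fact N * (e / (2 * fact N))"
      proof (rule norm_ldet_le)
        show "0 < N" using N by simp
        show "norm (phi_fun \<omega> (sx l 0 + int j)) \<le> e / (2 * fact N)" if "j < N" for j
          using C[OF w, of "sx l 0 + int j"] that by auto
      qed (use w norm_phi_fun_le_1 in auto)
      also have "\<dots> < e" using e by simp
      finally show ?thesis using eq w by simp
    qed
    moreover have "compactin top_Omega (Om C)"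
      unfolding compactin_subtopology using compact_Om by (auto simp: Om_def)
    ultimately show ?thesis by auto
  qed
  show ?thesis unfolding C0_def using 1 2 by (auto simp: \<sigma>_fun_def)
qed

subsection \<open>Moments of the Laurent coefficients\<close>

lemma polynomial_le_exponential:
  fixes s :: real
  assumes "0 < s"
  obtains C where "0 \<le> C" "\<And>k::nat. real k ^ j \<le> C * (1 + s) ^ k"
proof -
  have "(\<lambda>k. real k ^ j / (1 + s) ^ k) \<longlonglongrightarrow> 0"
    using assms by real_asymp
  then have "Bseq (\<lambda>k. real k ^ j / (1 + s) ^ k)" by (intro convergent_imp_Bseq convergentI)
  then obtain C where C: "0 < C" "\<And>k. norm (real k ^ j / (1 + s) ^ k) \<le> C" by (auto simp: Bseq_def)
  have "real k ^ j \<le> C * (1 + s) ^ k" for k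
    using C(2)[of k] assms by (simp add: pos_divide_le_eq)
  with C(1) show thesis by (intro that[of C]) auto
qed

text \<open>The expansion converges slightly beyond the circle on either side. Comparing with 1 + s
  and 1 - s gives exponential decay in both directions, which beats any power.\<close>

lemma phi_fun_moments_summable:
  assumes w: "\<omega> \<in> Omega"
  shows "(\<lambda>n. of_int n ^ j * phi_fun \<omega> n) summable_on UNIV"
proof -
  obtain r where r: "r > 0" "\<And>u. 1 - r < norm u \<Longrightarrow> norm u < 1 + r
      \<Longrightarrow> ((\<lambda>n. phi_fun \<omega> n * u powi n) has_sum Phi u \<omega>) UNIV"
    using phi_fun_expansion[OF w] by blast
  define s where "s = min (r / 2) (1 / 2)"
  have s: "0 < s" "s < r" "s < 1" using r(1) by (auto simp: s_def)
  obtain C where C: "0 \<le> C" "\<And>k::nat. real k ^ j \<le> C * (1 + s) ^ k"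
    using polynomial_le_exponential[OF s(1), of j] by blast
  have "(\<lambda>n. norm (phi_fun \<omega> n * of_real (1 + s) powi n)) summable_on UNIV"
    "(\<lambda>n. norm (phi_fun \<omega> n * of_real (1 - s) powi n)) summable_on UNIV"
    using r(2)[of "of_real (1 + s)"] r(2)[of "of_real (1 - s)"] s
    unfolding norm_of_real summable_on_iff_abs_summable_on_complex[symmetric] summable_on_def
      by (auto simp del: of_real_add of_real_diff)
  then have sm: "(\<lambda>n. C *
      (norm (phi_fun \<omega> n * of_real (1 + s) powi n) + norm (phi_fun \<omega> n * of_real (1 - s) powi n)))
        summable_on UNIV"
    by (intro summable_on_cmult_right summable_on_add)
  have le: "norm (of_int n ^ j * phi_fun \<omega> n)
      \<le> C * (norm (phi_fun \<omega> n * of_real (1 + s) powi n) + norm (phi_fun \<omega> n * of_real (1 - s) powi n))" for n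
  proof -
    have "(1 + s) ^ nat \<bar>n\<bar> \<le> (1 + s) powi n + (1 - s) powi n"
    proof (cases "0 \<le> n")
      case True
      then have "(1 + s) ^ nat \<bar>n\<bar> = (1 + s) powi n" by (simp add: power_int_def)
      then show ?thesis using s by simp
    next
      case False
      have "(1 + s) * (1 - s) \<le> 1" using s by (simp add: algebra_simps)
      then have "1 + s \<le> inverse (1 - s)" using s by (simp add: field_simps)
      then have "(1 + s) ^ nat \<bar>n\<bar> \<le> inverse (1 - s) ^ nat \<bar>n\<bar>" using s by (intro power_mono) auto
      also have "\<dots> = (1 - s) powi n" using False by (simp add: power_int_def)
      finally show ?thesis using s by (simp add: add_increasing)
    qed
    moreover have "\<bar>real_of_int n\<bar> ^ j \<le> C * (1 + s) ^ nat \<bar>n\<bar>" using C(2)[of "nat \<bar>n\<bar>"] by simp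
    ultimately have "\<bar>real_of_int n\<bar> ^ j \<le> C * ((1 + s) powi n + (1 - s) powi n)"
      using C(1) mult_left_mono order_trans by blast
    then have "\<bar>real_of_int n\<bar> ^ j * norm (phi_fun \<omega> n) \<le> C * ((1 + s) powi n + (1 - s) powi n) *
        norm (phi_fun \<omega> n)"
      by (intro mult_right_mono) auto
    then show ?thesis
      using s by (simp add: norm_mult norm_power norm_power_int algebra_simps del: of_real_add of_real_diff)
  qed
  have "(\<lambda>n. norm (of_int n ^ j * phi_fun \<omega> n)) summable_on UNIV"
    by (rule Infinite_Sum.abs_summable_on_comparison_test'[OF sm le])
  then show ?thesis by (rule abs_summable_summable)
qed

lemma Phi_1: "Phi 1 \<omega> = 1"
proof -
  obtain ap bp am bm dp dm where p: "\<omega> = (ap, bp, am, bm, dp, dm)" by (metis prod_cases6)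
  show ?thesis unfolding p by simp
qed

lemma phi_fun_sum: "\<omega> \<in> Omega \<Longrightarrow> ((\<lambda>n. phi_fun \<omega> n) has_sum 1) UNIV"
  using phi_fun_has_sum[of \<omega> 1] by (simp add: Phi_1)

subsection \<open>Summation over all strictly decreasing sequences\<close>

lemma has_sum_prod_PiE:
  fixes h :: "'a \<Rightarrow> 'b \<Rightarrow> complex"
  assumes "finite I" "\<And>i. i \<in> I \<Longrightarrow> (h i has_sum s i) UNIV"
  shows "((\<lambda>a. \<Prod>i\<in>I. h i (a i)) has_sum (\<Prod>i\<in>I. s i)) (PiE I (\<lambda>_. UNIV))"
  using assms
proof (induction I rule: finite_induct)
  case empty
  show ?case by (simp add: has_sum_finite_iff)
next
  case (insert x I)
  let ?h = "\<lambda>(y, g). g(x := y)"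
  have IH: "((\<lambda>a. \<Prod>i\<in>I. h i (a i)) has_sum (\<Prod>i\<in>I. s i)) (PiE I (\<lambda>_. UNIV))" using insert by auto
  have inj: "inj_on ?h (UNIV \<times> PiE I (\<lambda>_. UNIV))"
    using insert.hyps(2) by (rule inj_combinator)
  have pr: "(\<Prod>i\<in>insert x I. h i ((g(x := y)) i)) = h x y * (\<Prod>i\<in>I. h i (g i))" for g y
    using insert.hyps by (subst prod.insert) (auto intro!: prod.cong)
  have "((\<lambda>(y, g). h x y * (\<Prod>i\<in>I. h i (g i))) has_sum (s x * (\<Prod>i\<in>I. s i))) (UNIV \<times> PiE I (\<lambda>_. UNIV))"
    by (rule has_sum_times[OF insert.prems IH]) simp
  moreover have "(\<lambda>a. \<Prod>i\<in>insert x I. h i (a i)) \<circ> ?h = (\<lambda>(y, g). h x y * (\<Prod>i\<in>I. h i (g i)))"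
    unfolding comp_def case_prod_unfold pr ..
  ultimately have "((\<lambda>a. \<Prod>i\<in>insert x I. h i (a i)) has_sum (s x * (\<Prod>i\<in>I. s i)))
      (?h ` (UNIV \<times> PiE I (\<lambda>_. UNIV)))"
    by (intro has_sum_reindex[OF inj, THEN iffD2]) (simp only:)
  then show ?case using insert.hyps by (simp add: PiE_insert_eq)
qed

lemma has_sum_finite_sum:
  fixes f :: "'a \<Rightarrow> 'b \<Rightarrow> complex"
  assumes "finite I" "\<And>i. i \<in> I \<Longrightarrow> (f i has_sum s i) A"
  shows "((\<lambda>x. \<Sum>i\<in>I. f i x) has_sum (\<Sum>i\<in>I. s i)) A"
  using assms by (induction I rule: finite_induct) (auto intro: has_sum_add)

lemma sdec_unique:
  assumes "sdec N x" "sdec N y" "x ` {..<N} = y ` {..<N}" "i < N"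
  shows "x i = y i"
proof -
  have st: "sorted_wrt (<) (rev (map z [0..<N]))" if "sdec N z" for z
    unfolding sorted_wrt_rev using that by (auto simp: sorted_wrt_iff_nth_less sdec_def)
  have "rev (map x [0..<N]) = rev (map y [0..<N])"
    by (rule strict_sorted_equal[OF st[OF assms(2)] st[OF assms(1)]])
      (use assms(3) in \<open>auto simp: atLeast0LessThan\<close>)
  then show ?thesis using assms(4) by (simp add: map_eq_conv)
qed

lemma sx_sdec: "l \<in> signatures N \<Longrightarrow> sdec N (sx l)"
  by (auto simp: sdec_def signatures_sx)

text \<open>Every tuple of \<open>N\<close> distinct integers is a permutation of a unique strictly decreasing one.\<close>

definition arr :: "nat \<Rightarrow> int list \<times> (nat \<Rightarrow> nat) \<Rightarrow> nat \<Rightarrow> int" where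
  "arr N = (\<lambda>(l, p). restrict (\<lambda>i. sx l (p i)) {..<N})"

lemma arr_bij:
  "bij_betw (arr N) (signatures N \<times> {p. p permutes {..<N}}) {a \<in> PiE {..<N} (\<lambda>_. UNIV). inj_on a {..<N}}"
proof (rule bij_betwI')
  fix q q' assume q: "q \<in> signatures N \<times> {p. p permutes {..<N}}" "q' \<in> signatures N \<times> {p. p permutes {..<N}}"
  obtain l p l' p' where lp: "q = (l, p)" "q' = (l', p')" by (cases q, cases q')
  have l: "l \<in> signatures N" "l' \<in> signatures N" and p: "p permutes {..<N}" "p' permutes {..<N}" using q lp
    by auto
  show "arr N q = arr N q' \<longleftrightarrow> q = q'"
  proof
    assume "arr N q = arr N q'"
    then have "arr N q i = arr N q' i" for i by simp
    then have e: "sx l (p i) = sx l' (p' i)" if "i < N" for i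
      using that unfolding arr_def lp prod.case by (metis lessThan_iff restrict_apply')
    have "(\<lambda>i. sx l (p i)) ` {..<N} = (\<lambda>i. sx l' (p' i)) ` {..<N}" using e by (intro image_cong) auto
    then have "sx l ` p ` {..<N} = sx l' ` p' ` {..<N}" by (simp add: image_image)
    then have im: "sx l ` {..<N} = sx l' ` {..<N}" using p by (simp add: permutes_image)
    have xx: "sx l i = sx l' i" if "i < N" for i
      by (rule sdec_unique[OF sx_sdec[OF l(1)] sx_sdec[OF l(2)] im that])
    then have "l ! i = l' ! i" if "i < N" for i using that by (simp add: sx_def)
    then have "l = l'" using l by (intro nth_equalityI) (auto simp: signatures_length)
    moreover have "p = p'"
    proof
      fix i
      show "p i = p' i"
      proof (cases "i < N")
        case True
        then have "sx l (p i) = sx l (p' i)" using e \<open>l = l'\<close> by simp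
        then show ?thesis using sx_inj_on[OF l(1)] permutes_lessThan[OF p(1) True]
          permutes_lessThan[OF p(2) True]
          by (auto simp: inj_on_def)
      qed (use p in \<open>auto simp: permutes_def\<close>)
    qed
    ultimately show "q = q'" by (simp add: lp)
  qed simp
next
  fix q assume "q \<in> signatures N \<times> {p. p permutes {..<N}}"
  then obtain l p where lp: "q = (l, p)" "l \<in> signatures N" "p permutes {..<N}" by auto
  have "inj_on (sx l \<circ> p) {..<N}"
    using lp by (intro comp_inj_on) (auto simp: permutes_inj_on permutes_image sx_inj_on)
  then show "arr N q \<in> {a \<in> PiE {..<N} (\<lambda>_. UNIV). inj_on a {..<N}}"
    by (auto simp: arr_def lp inj_on_def)
next
  fix a assume "a \<in> {a \<in> PiE {..<N} (\<lambda>_. UNIV :: int set). inj_on a {..<N}}"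
  then have a: "a \<in> PiE {..<N} (\<lambda>_. UNIV)" "inj_on a {..<N}" by auto
  define xs where "xs = rev (sorted_list_of_set (a ` {..<N}))"
  have len: "length xs = N" and set: "set xs = a ` {..<N}" and dist: "distinct xs"
    using a(2) by (auto simp: xs_def card_image)
  have srt: "sorted_wrt (>) xs" unfolding xs_def sorted_wrt_rev by simp
  \<comment> \<open>Adding the position undoes the shift in \<open>sx\<close>, so the strictly
    decreasing list becomes a weakly decreasing one.\<close>
  define l where "l = map (\<lambda>k. xs ! k + int k) [0..<N]"
  have sxl: "sx l k = xs ! k" if "k < N" for k using that by (simp add: sx_def l_def)
  have l: "l \<in> signatures N"
    unfolding signatures_iff using srt len sxl
      by (auto simp: l_def[symmetric] sorted_wrt_iff_nth_less) (simp add: l_def)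
  have "\<exists>k<N. xs ! k = a i" if "i < N" for i
    using that set len by (metis imageI in_set_conv_nth lessThan_iff)
  then obtain k where k: "\<And>i. i < N \<Longrightarrow> k i < N \<and> xs ! (k i) = a i" by metis
  define p where "p = (\<lambda>i. if i < N then k i else i)"
  have "inj_on p {..<N}"
    using a(2) k unfolding inj_on_def p_def by (metis lessThan_iff)
  moreover have "p ` {..<N} \<subseteq> {..<N}" using k by (auto simp: p_def)
  ultimately have "bij_betw p {..<N} {..<N}" by (simp add: bij_betw_def endo_inj_surj)
  then have p: "p permutes {..<N}" by (rule bij_imp_permutes) (auto simp: p_def)
  have "a = arr N (l, p)"
  proof
    fix i show "a i = arr N (l, p) i"
      using a(1) k[of i] sxl[of "k i"] by (cases "i < N") (auto simp: arr_def p_def PiE_def extensional_def)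
  qed
  then show "\<exists>q\<in>signatures N \<times> {p. p permutes {..<N}}. a = arr N q" using l p by blast
qed

text \<open>The reference points - i are the coordinates of the zero signature, whose dimension is
  1.\<close>

lemma Dim_vandermonde:
  assumes "length l = N"
  shows "ldet N (\<lambda>i j. of_int (sx l i) ^ j) = of_real (Dim l) * (ldet N (\<lambda>i j. (- of_nat i) ^ j) :: complex)"
proof -
  have "(\<Prod>j<N. \<Prod>i<j. (of_int (sx l j) - of_int (sx l i) :: complex)) =
     (\<Prod>j<N. \<Prod>i<j. of_real (real_of_int (sx l i - sx l j) / real (j - i)) * (- of_nat j - - of_nat i))"
    by (intro prod.cong refl) (auto simp: of_nat_diff field_simps)
  also have "\<dots> = (\<Prod>j<N. \<Prod>i<j. of_real (real_of_int (sx l i - sx l j) / real (j - i))) *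
      (\<Prod>j<N. \<Prod>i<j. (- of_nat j - - of_nat i :: complex))"
    by (simp only: prod.distrib)
  also have "(\<Prod>j<N. \<Prod>i<j. of_real (real_of_int (sx l i - sx l j) / real (j - i)) :: complex)
      = of_real (Dim l)"
    by (simp only: Dim_eq assms prod_pairs[symmetric] of_real_prod)
  finally show ?thesis by (simp only: vandermonde)
qed

lemma ldet_neg_nat_nonzero: "(ldet N (\<lambda>i j. (- of_nat i) ^ j) :: complex) \<noteq> 0"
  by (subst vandermonde) (auto simp: prod_zero_iff)

text \<open>\<open>M i j\<close> is the j-th moment of the law shifted by - i. By the binomial
  theorem it is a polynomial of degree j in - i, monic because the total mass is 1; all other
  moments drop out of the determinant.\<close>

lemma ldet_moments:
  assumes w: "\<omega> \<in> Omega"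
  shows "\<exists>M. (\<forall>i j. ((\<lambda>n. of_int n ^ j * phi_fun \<omega> (n + int i)) has_sum M i j) UNIV) \<and>
    ldet N M = ldet N (\<lambda>i j. (- of_nat i) ^ j)"
proof -
  define m where "m = (\<lambda>j. \<Sum>\<^sub>\<infinity>n. of_int n ^ j * phi_fun \<omega> n)"
  have m: "((\<lambda>n. of_int n ^ j * phi_fun \<omega> n) has_sum m j) UNIV" for j
    unfolding m_def using phi_fun_moments_summable[OF w] by (rule has_sum_infsum)
  have m0: "m 0 = 1" using m[of 0] phi_fun_sum[OF w] has_sum_unique by fastforce
  define P where "P = (\<lambda>j. \<Sum>k\<le>j. Polynomial.monom (of_nat (j choose k) * m (j - k)) k)"
  have coeffP: "Polynomial.coeff (P j) i = (if i \<le> j then of_nat (j choose i) * m (j - i) else 0)" for i j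
    unfolding P_def by (simp add: Polynomial.coeff_sum)
  have P: "degree (P j) \<le> j" "Polynomial.coeff (P j) j = 1" for j
    by (rule degree_le) (auto simp: coeffP m0)
  define M where "M = (\<lambda>i j. poly (P j) (- of_nat i))"
  have "((\<lambda>n. of_int n ^ j * phi_fun \<omega> (n + int i)) has_sum M i j) UNIV" for i j
  proof -
    have "((\<lambda>n. \<Sum>k\<le>j. of_nat (j choose k) * (- of_nat i) ^ k * (of_int n ^ (j - k) * phi_fun \<omega> n)) has_sum
       (\<Sum>k\<le>j. of_nat (j choose k) * (- of_nat i) ^ k * m (j - k))) UNIV"
      by (intro has_sum_finite_sum has_sum_cmult_right m) simp
    moreover have "(\<Sum>k\<le>j. of_nat (j choose k) * (- of_nat i) ^ k * m (j - k)) = M i j"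
      by (simp add: M_def P_def poly_sum poly_monom mult_ac)
    moreover have "(\<Sum>k\<le>j. of_nat (j choose k) * (- of_nat i) ^ k * (of_int n ^ (j - k) * phi_fun \<omega> n))
        = of_int (n - int i) ^ j * phi_fun \<omega> n" for n
    proof -
      have "(\<Sum>k\<le>j. of_nat (j choose k) * (- of_nat i) ^ k * (of_int n ^ (j - k) * phi_fun \<omega> n)) =
        (\<Sum>k\<le>j. of_nat (j choose k) * (- of_nat i) ^ k * of_int n ^ (j - k)) * phi_fun \<omega> n"
        by (simp only: sum_distrib_right mult.assoc)
      also have "\<dots> = (- of_nat i + of_int n) ^ j * phi_fun \<omega> n" unfolding binomial_ring ..
      finally show ?thesis by simp
    qed
    ultimately have "((\<lambda>n. of_int (n - int i) ^ j * phi_fun \<omega> n) has_sum M i j) UNIV" by (simp only:)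
    moreover have "bij_betw (\<lambda>n. n + int i) UNIV UNIV"
      by (rule bij_betw_byWitness[where f' = "\<lambda>n. n - int i"]) auto
    ultimately have "((\<lambda>n. of_int (n + int i - int i) ^ j * phi_fun \<omega> (n + int i)) has_sum M i j) UNIV"
      using has_sum_reindex_bij_betw[of "\<lambda>n. n + int i" UNIV UNIV
        "\<lambda>n. of_int (n - int i) ^ j * phi_fun \<omega> n"] by blast
    then show ?thesis by simp
  qed
  moreover have "ldet N M = ldet N (\<lambda>i j. (- of_nat i) ^ j)"
    unfolding M_def by (rule ldet_monic) (use P in auto)
  ultimately show ?thesis by blast
qed

text \<open>The Vandermonde determinant of a, weighted with the product of \<phi>(a i + i), is
  summed over all integer tuples in two ways. Summed factor by factor it is the determinant of
  moments \<open>?c\<close>. Tuples with a repetition contribute nothing; the others, grouped by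
  their decreasing rearrangement, give \<open>?c\<close> times \<open>Dim l\<close> times
  \<open>\<sigma>_fun l \<omega>\<close>.\<close>

theorem sum_Dim_sigma:
  assumes w: "\<omega> \<in> Omega"
  shows "((\<lambda>l. of_real (Dim l) * \<sigma>_fun l \<omega>) has_sum 1) (signatures N)"
proof -
  let ?f = "phi_fun \<omega>"
  let ?V = "\<lambda>a. ldet N (\<lambda>i j. of_int (a i) ^ j) :: complex"
  let ?c = "ldet N (\<lambda>i j. (- of_nat i) ^ j) :: complex"
  let ?X = "PiE {..<N} (\<lambda>_. UNIV :: int set)"
  obtain M where M: "\<And>i j. ((\<lambda>n. of_int n ^ j * ?f (n + int i)) has_sum M i j) UNIV" "ldet N M = ?c"
    using ldet_moments[OF w] by blast
  have "((\<lambda>a. \<Sum>p | p permutes {..<N}. of_int (sign p) * (\<Prod>i<N. of_int (a i) ^ p i * ?f (a i + int i))) has_sum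
    (\<Sum>p | p permutes {..<N}. of_int (sign p) * (\<Prod>i<N. M i (p i)))) ?X"
    by (intro has_sum_finite_sum has_sum_cmult_right has_sum_prod_PiE M) (auto simp: finite_permutations)
  also have "(\<Sum>p | p permutes {..<N}. of_int (sign p) * (\<Prod>i<N. M i (p i))) = ?c" using M(2)
    by (simp add: ldet_def)
  also have "(\<lambda>a. \<Sum>p | p permutes {..<N}. of_int (sign p) * (\<Prod>i<N. of_int (a i) ^ p i * ?f (a i + int i))) =
    (\<lambda>a. ?V a * (\<Prod>i<N. ?f (a i + int i)))"
    by (rule ext) (simp add: ldet_def prod.distrib sum_distrib_right mult.assoc)
  finally have "((\<lambda>a. ?V a * (\<Prod>i<N. ?f (a i + int i))) has_sum ?c) ?X" .
  then have "((\<lambda>a. ?V a * (\<Prod>i<N. ?f (a i + int i))) has_sum ?c) {a \<in> ?X. inj_on a {..<N}}"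
  proof (subst has_sum_cong_neutral[where T = ?X and g = "\<lambda>a. ?V a * (\<Prod>i<N. ?f (a i + int i))"])
    fix a assume "a \<in> ?X - {a \<in> ?X. inj_on a {..<N}}"
    then obtain i j where "i < N" "j < N" "i \<noteq> j" "a i = a j" by (auto simp: inj_on_def)
    then have "?V a = 0" by (intro ldet_equal_rows[of i _ j]) auto
    then show "?V a * (\<Prod>i<N. ?f (a i + int i)) = 0" by simp
  qed auto
  then have "((\<lambda>q. ?V (arr N q) * (\<Prod>i<N. ?f (arr N q i + int i))) has_sum ?c)
      (signatures N \<times> {p. p permutes {..<N}})"
    by (subst has_sum_reindex_bij_betw[OF arr_bij, of "\<lambda>a. ?V a * (\<Prod>i<N. ?f (a i + int i))"])
  moreover have "((\<lambda>p. ?V (arr N (l, p)) * (\<Prod>i<N. ?f (arr N (l, p) i + int i))) has_sum of_real (Dim l) *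
      ?c * \<sigma>_fun l \<omega>) {p. p permutes {..<N}}"
    if l: "l \<in> signatures N" for l
  proof -
    note len = signatures_length[OF l]
    have V: "?V (arr N (l, p)) = of_int (sign p) * ?V (sx l)" if p: "p permutes {..<N}" for p
    proof -
      have "?V (arr N (l, p)) = ldet N (\<lambda>i j. of_int (sx l (p i)) ^ j)"
        by (rule ldet_cong) (simp add: arr_def)
      also have "\<dots> = of_int (sign p) * ?V (sx l)" by (rule ldet_permute_rows[OF p])
      finally show ?thesis .
    qed
    have "(\<Sum>p | p permutes {..<N}. ?V (arr N (l, p)) * (\<Prod>i<N. ?f (arr N (l, p) i + int i))) =
      (\<Sum>p | p permutes {..<N}. ?V (sx l) * (of_int (sign p) * (\<Prod>i<N. ?f (sx l (p i) + int i))))"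
      by (intro sum.cong refl) (simp only: mem_Collect_eq V, simp add: arr_def mult_ac)
    also have "\<dots> = ?V (sx l) * ldet N (\<lambda>i j. ?f (sx l j + int i))"
      by (simp add: ldet_def sum_distrib_left)
    also have "ldet N (\<lambda>i j. ?f (sx l j + int i)) = ldet N (\<lambda>i j. ?f (sx l i + int j))"
      by (rule ldet_transpose)
    also have "ldet N (\<lambda>i j. ?f (sx l i + int j)) = \<sigma>_fun l \<omega>" using w len
      by (simp add: \<sigma>_fun_def jacobi_trudi_sx)
    also have "?V (sx l) = of_real (Dim l) * ?c" by (rule Dim_vandermonde[OF len])
    finally show ?thesis by (simp add: has_sum_finite_iff finite_permutations)
  qed
  ultimately have "((\<lambda>l. of_real (Dim l) * ?c * \<sigma>_fun l \<omega>) has_sum ?c) (signatures N)"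
    by (rule has_sum_Sigma')
  then have "((\<lambda>l. inverse ?c * (of_real (Dim l) * ?c * \<sigma>_fun l \<omega>)) has_sum inverse ?c * ?c) (signatures N)"
    by (rule has_sum_cmult_right)
  moreover have "inverse ?c * (of_real (Dim l) * ?c * \<sigma>_fun l \<omega>) = of_real (Dim l) * \<sigma>_fun l \<omega>" for l
    using ldet_neg_nat_nonzero[of N] by (simp add: field_simps)
  moreover have lc: "inverse ?c * ?c = 1" using ldet_neg_nat_nonzero[of N] by (rule left_inverse)
  ultimately show ?thesis by (simp only: lc)
qed

section \<open>The links as contractions\<close>

lemma sigma_fun_nonneg:
  assumes w: "\<omega> \<in> Omega" and l: "l \<in> signatures N"
  obtains s where "\<sigma>_fun l \<omega> = of_real s" "0 \<le> s"
proof -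
  obtain ap bp am bm dp dm where p: "\<omega> = (ap, bp, am, bm, dp, dm)" by (metis prod_cases6)
  obtain r where r: "\<And>n. phi_fun \<omega> n = of_real (r n)" "TP r"
    using phi_fun_properties w unfolding p by blast
  have "\<sigma>_fun l \<omega> = ldet N (\<lambda>i j. of_real (r (sx l i + int j)))"
    using w signatures_length[OF l] by (simp add: \<sigma>_fun_def jacobi_trudi_sx r(1))
  also have "\<dots> = of_real (ldet N (\<lambda>i j. r (sx l i + int j)))" by (simp add: ldet_def)
  finally show thesis using r(2) sx_sdec[OF l] by (intro that) (auto simp: TP_def)
qed

lemma sum_norm_Dim_sigma:
  assumes w: "\<omega> \<in> Omega"
  shows "((\<lambda>l. norm (of_real (Dim l) * \<sigma>_fun l \<omega>)) has_sum 1) (signatures N)"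
proof -
  have "((\<lambda>l. Re (of_real (Dim l) * \<sigma>_fun l \<omega>)) has_sum Re 1) (signatures N)"
    by (rule has_sum_Re[OF sum_Dim_sigma[OF w]])
  moreover have "Re (of_real (Dim l) * \<sigma>_fun l \<omega>) = norm (of_real (Dim l) * \<sigma>_fun l \<omega>)"
    if l: "l \<in> signatures N" for l
  proof -
    obtain s where "\<sigma>_fun l \<omega> = of_real s" "0 \<le> s" by (rule sigma_fun_nonneg[OF w l])
    then show ?thesis using Dim_pos[OF l] by (simp add: norm_mult)
  qed
  ultimately have "((\<lambda>l. norm (of_real (Dim l) * \<sigma>_fun l \<omega>)) has_sum Re 1) (signatures N)"
    using has_sum_cong[of "signatures N" "\<lambda>l. Re (of_real (Dim l) * \<sigma>_fun l \<omega>)"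
      "\<lambda>l. norm (of_real (Dim l) * \<sigma>_fun l \<omega>)" "Re 1"] by blast
  moreover have "Re 1 = (1::real)" by simp
  ultimately show ?thesis by (simp only:)
qed

lemma link_bound:
  assumes w: "\<omega> \<in> Omega" and f: "\<And>l. l \<in> signatures N \<Longrightarrow> norm (f l) \<le> B"
  shows "(\<lambda>l. of_real (Dim l) * \<sigma>_fun l \<omega> * f l) summable_on signatures N" "norm (link N f \<omega>) \<le> B"
proof -
  have B: "((\<lambda>l. norm (of_real (Dim l) * \<sigma>_fun l \<omega>) * B) has_sum 1 * B) (signatures N)"
    by (rule has_sum_cmult_left[OF sum_norm_Dim_sigma[OF w]])
  have le: "norm (of_real (Dim l) * \<sigma>_fun l \<omega> * f l) \<le> norm (of_real (Dim l) * \<sigma>_fun l \<omega>) * B"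
    if "l \<in> signatures N" for l
    unfolding norm_mult[of _ "f l"] by (rule mult_left_mono[OF f[OF that]]) simp
  have a: "(\<lambda>l. norm (of_real (Dim l) * \<sigma>_fun l \<omega> * f l)) summable_on signatures N"
    by (rule Infinite_Sum.abs_summable_on_comparison_test'[OF _ le]) (use B summable_on_def in blast)
  then show "(\<lambda>l. of_real (Dim l) * \<sigma>_fun l \<omega> * f l) summable_on signatures N" by (rule abs_summable_summable)
  have "norm (link N f \<omega>) \<le> (\<Sum>\<^sub>\<infinity>l\<in>signatures N. norm (of_real (Dim l) * \<sigma>_fun l \<omega> * f l))"
    unfolding link_def by (rule norm_infsum_bound[OF a])
  also have "\<dots> \<le> (\<Sum>\<^sub>\<infinity>l\<in>signatures N. norm (of_real (Dim l) * \<sigma>_fun l \<omega>) * B)"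
    by (rule infsum_mono[OF a _ le]) (use B summable_on_def in blast)
  also have "\<dots> = B" using infsumI[OF B] by simp
  finally show "norm (link N f \<omega>) \<le> B" .
qed

subsection \<open>Evaluation of formal series at a point of Omega\<close>

definition mev :: "point \<Rightarrow> int multiset \<Rightarrow> complex" where
  "mev \<omega> M = prod_mset (image_mset (phi_fun \<omega>) M)"

text \<open>\<open>\<phi>_total\<close> evaluates to 1 at every point of \<Omega>, so multiplication
  by it hands the value of the degree k part over to degree k + 1, together with its
  convergence.\<close>

lemma has_sum_phi_total_times:
  assumes w: "\<omega> \<in> Omega" and h: "((\<lambda>M. coeff h M * mev \<omega> M) has_sum s) {M. size M = k}"
  shows "((\<lambda>M. coeff (\<phi>_total * h) M * mev \<omega> M) has_sum s) {M. size M = Suc k}"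
proof (rule has_sum_Sigma')
  let ?t = "\<lambda>(M, n). phi_fun \<omega> n * (coeff h (M - {#n#}) * mev \<omega> (M - {#n#}))"
  have "((\<lambda>(n, M). phi_fun \<omega> n * (coeff h M * mev \<omega> M)) has_sum 1 * s) (UNIV \<times> {M. size M = k})"
    by (rule has_sum_times[OF phi_fun_sum[OF w] h])
  then show "(?t has_sum s) (Sigma {M. size M = Suc k} set_mset)"
    by (subst has_sum_reindex_bij_witness[where i = "\<lambda>(n, M). (add_mset n M, n)"
      and j = "\<lambda>(M, n). (n, M - {#n#})"
          and T = "UNIV \<times> {M. size M = k}" and h = "\<lambda>(n, M). phi_fun \<omega> n * (coeff h M * mev \<omega> M)"])
       (auto simp: size_Diff_singleton)
  fix M :: "int multiset"
  have "coeff (\<phi>_total * h) M * mev \<omega> M = (\<Sum>n\<in>set_mset M. ?t (M, n))"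
  proof -
    have "mev \<omega> M = phi_fun \<omega> n * mev \<omega> (M - {#n#})" if "n \<in># M" for n
    proof -
      have "mev \<omega> (add_mset n (M - {#n#})) = phi_fun \<omega> n * mev \<omega> (M - {#n#})" by (simp add: mev_def)
      then show ?thesis using that by simp
    qed
    then show ?thesis
      unfolding coeff_phi_total_times sum_distrib_right by (intro sum.cong) (simp_all add: mult_ac)
  qed
  then show "((\<lambda>n. ?t (M, n)) has_sum (coeff (\<phi>_total * h) M * mev \<omega> M)) (set_mset M)"
    using has_sum_finite[of "set_mset M" "\<lambda>n. ?t (M, n)"] by (simp only: finite_set_mset simp_thms)
qed

text \<open>In f = \<open>\<phi>_total\<close> h - h the degree k part of h is determined by that of
  degree k - 1 and by f, which has finite support. So each homogeneous part of h can be evaluated;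
  since h has bounded degree, a late one is zero, and this is the claim.\<close>

lemma eval_ideal_eq_0:
  assumes w: "\<omega> \<in> Omega" and T: "finite T" "\<And>M. coeff f M \<noteq> 0 \<Longrightarrow> M \<in> T" and f: "f \<in> J"
  shows "(\<Sum>M\<in>T. coeff f M * mev \<omega> M) = 0"
proof -
  let ?t = "\<lambda>g M. coeff g M * mev \<omega> M"
  obtain h where "f = (\<phi>_total - 1) * h" using f by (auto simp: J_def)
  then have fh: "f = \<phi>_total * h - h" by (simp add: left_diff_distrib)
  obtain d where d: "deg_le h d" using ex_deg_le by blast
  define t where "t = (\<lambda>k. \<Sum>M\<in>{M\<in>T. size M = k}. ?t f M)"
  have tf: "(?t f has_sum t k) {M. size M = k}" for k
    unfolding t_def by (rule has_sum_finite_neutralI) (use T in auto)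
  \<comment> \<open>Comparing degrees gives s k = s (k - 1) - t k, started by s 0 = - t 0.\<close>
  define s where "s = (\<lambda>k. - (\<Sum>j\<le>k. t j))"
  have hs: "(?t h has_sum s k) {M. size M = k}" for k
  proof (induction k)
    case 0
    have "?t h M = - ?t f M" if "size M = 0" for M
      using that by (simp add: fh coeff_phi_total_times)
    moreover have "((\<lambda>M. - ?t f M) has_sum - t 0) {M. size M = 0}" using tf[of 0]
      by (simp add: has_sum_uminus)
    ultimately show ?case
      using has_sum_cong[of "{M. size M = 0}" "?t h" "\<lambda>M. - ?t f M" "- t 0"] by (simp add: s_def)
  next
    case (Suc k)
    have "?t h M = ?t (\<phi>_total * h) M + - ?t f M" for M by (simp add: fh algebra_simps)
    moreover have "((\<lambda>M. ?t (\<phi>_total * h) M + - ?t f M) has_sum (s k + - t (Suc k))) {M. size M = Suc k}"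
      using has_sum_phi_total_times[OF w Suc] tf[of "Suc k"]
        by (intro has_sum_add) (auto simp: has_sum_uminus)
    moreover have "s k + - t (Suc k) = s (Suc k)" by (simp add: s_def)
    ultimately show ?case by (simp only:)
  qed
  \<comment> \<open>K exceeds the degree of h, so s K = 0, and it bounds the size of all monomials
    in T, so the sum of t up to K is the whole sum.\<close>
  define K where "K = Suc d + (\<Sum>M\<in>T. size M)"
  have "(?t h has_sum 0) {M. size M = K}"
    by (rule has_sum_0) (use d in \<open>auto simp: deg_le_def K_def\<close>)
  then have "s K = 0" using hs[of K] has_sum_unique by blast
  then have "(\<Sum>j\<le>K. t j) = 0" by (simp add: s_def)
  moreover have "(\<Sum>j\<le>K. t j) = (\<Sum>M\<in>T. ?t f M)"
  proof -
    have "size ` T \<subseteq> {..K}"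
    proof (rule image_subsetI)
      fix M assume "M \<in> T"
      then have "size M \<le> (\<Sum>M\<in>T. size M)" by (rule member_le_sum) (use T in auto)
      then show "size M \<in> {..K}" by (simp add: K_def)
    qed
    then show ?thesis unfolding t_def by (intro sum.group) (use T in auto)
  qed
  ultimately show ?thesis by simp
qed

definition sigma_supp :: "int list \<Rightarrow> int multiset set" where
  "sigma_supp l = (\<lambda>p. image_mset (\<lambda>k. sx l k + int (p k)) (mset_set {..<length l})) ` {p.
      p permutes {..<length l}}"

lemma finite_sigma_supp [simp]: "finite (sigma_supp l)"
  by (simp add: sigma_supp_def finite_permutations)

lemma coeff_sigma:
  "coeff (\<sigma> l) M = (\<Sum>p | p permutes {..<length l}. of_int (sign p) *
     (if M = image_mset (\<lambda>k. sx l k + int (p k)) (mset_set {..<length l}) then 1 else 0))"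
proof -
  have "\<sigma> l = (\<Sum>p | p permutes {..<length l}.
      of_int (sign p) \<bullet>\<^sub>R mon (image_mset (\<lambda>k. sx l k + int (p k)) (mset_set {..<length l})))"
    unfolding \<sigma>_def jacobi_trudi_sx[OF refl] ldet_def by (simp add: mon_prod of_int_times)
  then show ?thesis by (simp add: coeff_mon)
qed

lemma coeff_sigma_supp: "coeff (\<sigma> l) M \<noteq> 0 \<Longrightarrow> M \<in> sigma_supp l"
proof (rule ccontr)
  assume "coeff (\<sigma> l) M \<noteq> 0" "M \<notin> sigma_supp l"
  moreover from this(2) have "coeff (\<sigma> l) M = 0"
    unfolding coeff_sigma by (intro sum.neutral) (auto simp: sigma_supp_def)
  ultimately show False by simp
qed

lemma eval_sigma:
  assumes w: "\<omega> \<in> Omega" and T: "finite T" "sigma_supp l \<subseteq> T"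
  shows "(\<Sum>M\<in>T. coeff (\<sigma> l) M * mev \<omega> M) = \<sigma>_fun l \<omega>"
proof -
  let ?A = "\<lambda>p. image_mset (\<lambda>k. sx l k + int (p k)) (mset_set {..<length l})"
  have "(\<Sum>M\<in>T. coeff (\<sigma> l) M * mev \<omega> M) =
     (\<Sum>p | p permutes {..<length l}. of_int (sign p) * (\<Sum>M\<in>T. if M = ?A p then mev \<omega> M else 0))"
    unfolding coeff_sigma sum_distrib_right sum_distrib_left
    by (subst sum.swap) (intro sum.cong refl, simp)
  also have "\<dots> = (\<Sum>p | p permutes {..<length l}. of_int (sign p) *
      (\<Prod>i<length l. phi_fun \<omega> (sx l i + int (p i))))"
  proof (intro sum.cong refl arg_cong2[of _ _ _ _ "(*)"])
    fix p assume "p \<in> {p. p permutes {..<length l}}"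
    then have "?A p \<in> T" using T(2) by (auto simp: sigma_supp_def)
    then have "(\<Sum>M\<in>T. if M = ?A p then mev \<omega> M else 0) = mev \<omega> (?A p)" using T(1) by simp
    also have "\<dots> = (\<Prod>i<length l. phi_fun \<omega> (sx l i + int (p i)))"
      by (simp add: mev_def image_mset.compositionality comp_def prod_unfold_prod_mset)
    finally show "(\<Sum>M\<in>T. if M = ?A p then mev \<omega> M else 0) = (\<Prod>i<length l. phi_fun \<omega> (sx l i + int (p i)))" .
  qed
  also have "\<dots> = \<sigma>_fun l \<omega>" using w by (simp add: \<sigma>_fun_def jacobi_trudi_sx[OF refl] ldet_def)
  finally show ?thesis .
qed

lemma cls_linear: "cls (f + g) = cls f + cls g" "cls (c \<bullet>\<^sub>R f) = c \<bullet>\<^sub>Q cls f" "cls 0 = 0"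
  by (simp_all add: plus_Rhat.abs_eq scaleRhat.abs_eq zero_Rhat_def)

lemma cls_sum: "cls (\<Sum>l\<in>S. c l \<bullet>\<^sub>R \<sigma> l) = (\<Sum>l\<in>S. c l \<bullet>\<^sub>Q \<sigma>_hat l)"
  by (induction S rule: infinite_finite_induct) (auto simp: cls_linear \<sigma>_hat_def)

text \<open>Consistency of the identification: equal classes differ by an element of
  \<open>J\<close> with finitely many monomials, whose value at every point is 0.\<close>

lemma sigma_fun_sum_eqI:
  assumes S: "finite S" "finite S'" and eq: "(\<Sum>l\<in>S. c l \<bullet>\<^sub>Q \<sigma>_hat l) = (\<Sum>l\<in>S'. c' l \<bullet>\<^sub>Q \<sigma>_hat l)"
  shows "(\<Sum>l\<in>S. c l * \<sigma>_fun l \<omega>) = (\<Sum>l\<in>S'. c' l * \<sigma>_fun l \<omega>)"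
proof (cases "\<omega> \<in> Omega")
  case True
  let ?f = "(\<Sum>l\<in>S. c l \<bullet>\<^sub>R \<sigma> l) - (\<Sum>l\<in>S'. c' l \<bullet>\<^sub>R \<sigma> l)"
  define T where "T = (\<Union>l\<in>S \<union> S'. sigma_supp l)"
  have T: "finite T" "\<And>l. l \<in> S \<or> l \<in> S' \<Longrightarrow> sigma_supp l \<subseteq> T" using S by (auto simp: T_def)
  have "?f \<in> J" using eq unfolding cls_sum[symmetric] Rhat.abs_eq_iff .
  moreover have "M \<in> T" if "coeff ?f M \<noteq> 0" for M
  proof (rule ccontr)
    assume "M \<notin> T"
    then have "coeff (\<sigma> l) M = 0" if "l \<in> S \<or> l \<in> S'" for l using coeff_sigma_supp[of l M] T(2)[OF that]
      by blast
    then have "coeff ?f M = 0" by simp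
    with that show False by simp
  qed
  ultimately have "(\<Sum>M\<in>T. coeff ?f M * mev \<omega> M) = 0" by (intro eval_ideal_eq_0[OF True T(1)])
  moreover have lin: "(\<Sum>M\<in>T. coeff (\<Sum>l\<in>U. d l \<bullet>\<^sub>R \<sigma> l) M * mev \<omega> M) = (\<Sum>l\<in>U. d l * \<sigma>_fun l \<omega>)"
    if U: "U \<subseteq> S \<union> S'" for U d
  proof -
    have "(\<Sum>M\<in>T. coeff (\<Sum>l\<in>U. d l \<bullet>\<^sub>R \<sigma> l) M * mev \<omega> M) = (\<Sum>l\<in>U. d l * (\<Sum>M\<in>T. coeff (\<sigma> l) M * mev \<omega> M))"
      unfolding coeff_R_sum sum_distrib_left sum_distrib_right
      by (subst sum.swap) (simp add: mult.assoc)
    also have "\<dots> = (\<Sum>l\<in>U. d l * \<sigma>_fun l \<omega>)"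
      by (intro sum.cong refl arg_cong2[of _ _ _ _ "(*)"] eval_sigma[OF True T(1)] T(2)) (use U in auto)
    finally show ?thesis .
  qed
  ultimately show ?thesis
    using lin[of S c] lin[of S' c'] by (simp add: left_diff_distrib sum_subtractf)
next
  case False
  then show ?thesis by (simp add: \<sigma>_fun_def)
qed

lemma iota_sum:
  assumes "finite S" "S \<subseteq> nonempty_signatures"
  shows "\<iota> (\<Sum>l\<in>S. c l \<bullet>\<^sub>Q \<sigma>_hat l) = (\<lambda>\<omega>. \<Sum>l\<in>S. c l * \<sigma>_fun l \<omega>)"
  unfolding \<iota>_def
proof (rule the_equality)
  show "\<forall>S' c'. finite S' \<and> S' \<subseteq> nonempty_signatures \<and> (\<Sum>l\<in>S. c l \<bullet>\<^sub>Q \<sigma>_hat l) = (\<Sum>l\<in>S'. c' l \<bullet>\<^sub>Q \<sigma>_hat l) \<longrightarrow>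
     (\<lambda>\<omega>. \<Sum>l\<in>S. c l * \<sigma>_fun l \<omega>) = (\<lambda>\<omega>. \<Sum>l\<in>S'. c' l * \<sigma>_fun l \<omega>)"
    using assms sigma_fun_sum_eqI by blast
qed (use assms in blast)

subsection \<open>Transport of the generator along the links\<close>

lemma C0_finite_support:
  assumes "finite S" "S \<subseteq> A" "\<And>x. x \<notin> S \<Longrightarrow> f x = 0"
  shows "f \<in> C0 (discrete_topology A)"
  unfolding C0_def
proof (intro CollectI conjI allI impI)
  show "continuous_map (discrete_topology A) euclidean f" by simp
  show "\<exists>K. compactin (discrete_topology A) K \<and> (\<forall>x\<in>topspace (discrete_topology A) - K. norm (f x) < e)"
    if "0 < e" for e
    by (rule exI[of _ S]) (use assms that in \<open>auto simp: compactin_discrete_topology\<close>)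
  show "f x = 0" if "x \<notin> topspace (discrete_topology A)" for x using that assms by auto
qed

lemma C0_add:
  assumes f: "f \<in> C0 Y" and g: "g \<in> C0 Y"
  shows "(\<lambda>x. f x + g x) \<in> C0 Y"
  unfolding C0_def
proof (intro CollectI conjI allI impI)
  show "continuous_map Y euclidean (\<lambda>x. f x + g x)"
    using f g by (intro continuous_map_add) (auto simp: C0_def)
  fix e :: real assume e: "0 < e"
  have e2: "0 < e / 2" using e by simp
  obtain K where K: "compactin Y K" "\<forall>x\<in>topspace Y - K. norm (f x) < e / 2" using f e2 unfolding C0_def
    by blast
  obtain L where L: "compactin Y L" "\<forall>x\<in>topspace Y - L. norm (g x) < e / 2" using g e2 unfolding C0_def
    by blast
  have "norm (f x + g x) < e" if "x \<in> topspace Y - (K \<union> L)" for x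
    using norm_triangle_ineq[of "f x" "g x"] K(2)[rule_format, of x] L(2)[rule_format, of x] that by auto
  then show "\<exists>K. compactin Y K \<and> (\<forall>x\<in>topspace Y - K. norm (f x + g x) < e)"
    using compactin_Un[OF K(1) L(1)] by blast
next
  show "f x + g x = 0" if "x \<notin> topspace Y" for x using f g that by (auto simp: C0_def)
qed

lemma C0_cmult:
  assumes f: "f \<in> C0 Y"
  shows "(\<lambda>x. c * f x) \<in> C0 Y"
proof (cases "c = 0")
  case True
  have "(\<lambda>x. 0) \<in> C0 Y" unfolding C0_def by (auto intro!: exI[of _ "{}"])
  then show ?thesis using True by simp
next
  case False
  show ?thesis unfolding C0_def
  proof (intro CollectI conjI allI impI)
    show "continuous_map Y euclidean (\<lambda>x. c * f x)"
      using f continuous_map_compose[of Y euclidean f euclidean "(*) c"]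
      by (simp add: C0_def comp_def continuous_on_mult_left)
    fix e :: real assume e: "0 < e"
    have e2: "0 < e / norm c" using e False by simp
    obtain K where K: "compactin Y K" "\<forall>x\<in>topspace Y - K. norm (f x) < e / norm c" using f e2
      unfolding C0_def by blast
    then show "\<exists>K. compactin Y K \<and> (\<forall>x\<in>topspace Y - K. norm (c * f x) < e)"
      using False by (intro exI[of _ K]) (auto simp: norm_mult pos_less_divide_eq mult.commute)
  next
    show "c * f x = 0" if "x \<notin> topspace Y" for x using f that by (auto simp: C0_def)
  qed
qed

lemma C0_sum:
  assumes "finite S" "\<And>i. i \<in> S \<Longrightarrow> f i \<in> C0 Y"
  shows "(\<lambda>x. \<Sum>i\<in>S. c i * f i x) \<in> C0 Y"
  using assms
proof (induction S rule: finite_induct)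
  case empty
  have "(\<lambda>x. 0) \<in> C0 Y" unfolding C0_def by (auto intro!: exI[of _ "{}"])
  then show ?case by simp
next
  case (insert i S)
  then show ?case using C0_add[OF C0_cmult[of "f i" Y "c i"], of "\<lambda>x. \<Sum>i\<in>S. c i * f i x"] by simp
qed

lemma generator_value_unique:
  assumes "is_generator_value Y P f g" "is_generator_value Y P f g'"
  shows "g = g'"
proof
  fix x
  show "g x = g' x"
  proof (cases "x \<in> topspace Y")
    case True
    have "((\<lambda>t. (P t f x - f x) / of_real t) \<longlongrightarrow> g x) (at_right 0)"
      "((\<lambda>t. (P t f x - f x) / of_real t) \<longlongrightarrow> g' x) (at_right 0)"
      using assms True by (auto simp: is_generator_value_def intro: tendsto_uniform_limitI)
    then show ?thesis using tendsto_unique trivial_limit_at_right_real by blast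
  next
    case False
    then show ?thesis using assms by (auto simp: is_generator_value_def C0_def)
  qed
qed

lemma generator_eqI: "is_generator_value Y P f g \<Longrightarrow> generator Y P f = g"
  unfolding generator_def using generator_value_unique by blast

lemma link_finite:
  assumes "finite S" "S \<subseteq> signatures N" "\<And>n. n \<in> signatures N - S \<Longrightarrow> f n = 0"
  shows "link N f \<omega> = (\<Sum>n\<in>S. of_real (Dim n) * \<sigma>_fun n \<omega> * f n)"
proof -
  have "link N f \<omega> = (\<Sum>\<^sub>\<infinity>n\<in>S. of_real (Dim n) * \<sigma>_fun n \<omega> * f n)"
    unfolding link_def by (rule infsum_cong_neutral) (use assms in auto)
  then show ?thesis using assms(1) by simp
qed

text \<open>By intertwining, the difference quotient on \<Omega> minus its candidate limit is the
  link of the same quantity h on signatures. The link does not increase the supremum norm, so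
  uniform convergence is inherited.\<close>

lemma link_generator_value:
  assumes N: "N \<ge> 1" and Pinf: "is_Pinf PN Pinf"
    and g: "is_generator_value (top_sig N) (PN N) f g"
    and bd: "\<And>n. n \<in> signatures N \<Longrightarrow> norm (f n) \<le> B" "\<And>n. n \<in> signatures N \<Longrightarrow> norm (g n) \<le> B"
    and C0: "link N f \<in> C0 top_Omega" "link N g \<in> C0 top_Omega"
  shows "is_generator_value top_Omega Pinf (link N f) (link N g)"
  unfolding is_generator_value_def
proof (intro conjI C0 uniform_limitI)
  fix e :: real assume e: "0 < e"
  have e2: "0 < e / 2" using e by simp
  have "eventually (\<lambda>t. \<forall>n\<in>signatures N. dist ((PN N t f n - f n) / of_real t) (g n) < e / 2) (at_right 0)"
    using g e2 unfolding is_generator_value_def uniform_limit_iff topspace_discrete_topology by blast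
  moreover have "eventually (\<lambda>t::real. 0 < t) (at_right 0)" by (rule eventually_at_right_less)
  ultimately show "eventually (\<lambda>t. \<forall>\<omega>\<in>topspace top_Omega.
      dist ((Pinf t (link N f) \<omega> - link N f \<omega>) / of_real t) (link N g \<omega>) < e) (at_right 0)"
  proof eventually_elim
    case (elim t)
    define h where "h = (\<lambda>n. (PN N t f n - f n) / of_real t - g n)"
    have hb: "norm (h n) \<le> e / 2" if "n \<in> signatures N" for n
      using elim(1) that by (auto simp: h_def dist_norm less_imp_le)
    have fC0: "f \<in> C0 (top_sig N)" using g by (simp add: is_generator_value_def)
    have P: "Pinf t (link N f) = link N (PN N t f)"
      using Pinf N elim(2) fC0 by (auto simp: is_Pinf_def)
    show ?case
    proof
      fix \<omega> assume "\<omega> \<in> topspace top_Omega"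
      then have w: "\<omega> \<in> Omega" by simp
      let ?T = "\<lambda>k n. of_real (Dim n) * \<sigma>_fun n \<omega> * k n"
      have sh: "?T h summable_on signatures N" and sf: "?T f summable_on signatures N"
        and sg: "?T g summable_on signatures N"
        by (rule link_bound(1)[OF w], fact hb bd)+
      have "PN N t f n = of_real t * h n + of_real t * g n + f n" for n
        using elim(2) by (simp add: h_def field_simps)
      then have "link N (PN N t f) \<omega> = (\<Sum>\<^sub>\<infinity>n\<in>signatures N. of_real t * ?T h n + of_real t * ?T g n + ?T f n)"
        unfolding link_def by (intro infsum_cong) (simp add: algebra_simps)
      also have "\<dots> = of_real t * link N h \<omega> + of_real t * link N g \<omega> + link N f \<omega>"
        unfolding link_def
        by (simp only: infsum_add summable_on_add summable_on_cmult_right infsum_cmult_right' sh sf sg)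
      finally have "(Pinf t (link N f) \<omega> - link N f \<omega>) / of_real t - link N g \<omega> = link N h \<omega>"
        using elim(2) by (simp add: P field_simps)
      moreover have "norm (link N h \<omega>) \<le> e / 2" by (rule link_bound(2)[OF w hb])
      ultimately show "dist ((Pinf t (link N f) \<omega> - link N f \<omega>) / of_real t) (link N g \<omega>) < e"
        using e by (simp add: dist_norm)
    qed
  qed
qed

text \<open>The function \<open>op_DN\<close> f is a multiple of the column of rates into l, which
  is supported on the finite set \<open>nbhd N l\<close>. So it lies in C0, and f is in the domain
  by the characterisation in \<open>is_PN\<close>; the links of both functions are finite
  sums.\<close>

lemma sigma_fun_generator_value:
  assumes N: "N \<ge> 1" and PN: "is_PN z z' w w' N (PN N)" and Pinf: "is_Pinf PN Pinf" and l: "l \<in> signatures N"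
  shows "is_generator_value top_Omega Pinf (\<sigma>_fun l)
     (\<lambda>\<omega>. \<Sum>n\<in>nbhd N l. of_real (Dim n / Dim l) * qmat z z' w w' N n l * \<sigma>_fun n \<omega>)"
proof -
  have D0: "Dim l \<noteq> 0" using Dim_pos[OF l] by simp
  have ne: "n \<in> nonempty_signatures" if "n \<in> signatures N" for n
    using that N unfolding nonempty_signatures_def by auto
  define f where "f = (\<lambda>n. if n = l then 1 / complex_of_real (Dim l) else 0)"
  define g where "g = op_DN z z' w w' N f"
  have gv: "g n = qmat z z' w w' N n l / of_real (Dim l)" if n: "n \<in> signatures N" for n
  proof -
    have "(\<Sum>\<^sub>\<infinity>m\<in>signatures N. qmat z z' w w' N n m * f m) = (\<Sum>\<^sub>\<infinity>m\<in>{l}. qmat z z' w w' N n m * f m)"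
      by (rule infsum_cong_neutral) (use l in \<open>auto simp: f_def\<close>)
    then show ?thesis using n by (simp add: g_def op_DN_def f_def)
  qed
  have g0: "g n = 0" if "n \<notin> nbhd N l" for n
  proof (cases "n \<in> signatures N")
    case True
    then show ?thesis using gv[OF True] qmat_not_nbhd[OF l True that] by simp
  qed (simp add: g_def op_DN_def)
  have fC0: "f \<in> C0 (top_sig N)"
    by (rule C0_finite_support[of "{l}"]) (use l in \<open>auto simp: f_def\<close>)
  have gC0: "g \<in> C0 (top_sig N)"
    by (rule C0_finite_support[of "nbhd N l"]) (use nbhd_subset[OF l] g0 in auto)
  have fd: "f \<in> generator_dom (top_sig N) (PN N)" using PN fC0 gC0 by (simp add: is_PN_def g_def)
  then obtain g' where g': "is_generator_value (top_sig N) (PN N) f g'" by (auto simp: generator_dom_def)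
  moreover have "g' = g" using generator_eqI[OF g'] PN fd by (simp add: is_PN_def g_def)
  ultimately have gen: "is_generator_value (top_sig N) (PN N) f g" by simp
  have lf: "link N f = \<sigma>_fun l"
  proof
    fix \<omega>
    have "link N f \<omega> = (\<Sum>n\<in>{l}. of_real (Dim n) * \<sigma>_fun n \<omega> * f n)"
      by (rule link_finite) (use l in \<open>auto simp: f_def\<close>)
    then show "link N f \<omega> = \<sigma>_fun l \<omega>" using D0 by (simp add: f_def)
  qed
  have lg: "link N g = (\<lambda>\<omega>. \<Sum>n\<in>nbhd N l. of_real (Dim n / Dim l) * qmat z z' w w' N n l * \<sigma>_fun n \<omega>)"
  proof
    fix \<omega>
    have "link N g \<omega> = (\<Sum>n\<in>nbhd N l. of_real (Dim n) * \<sigma>_fun n \<omega> * g n)"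
      by (rule link_finite) (use nbhd_subset[OF l] g0 in auto)
    also have "\<dots> = (\<Sum>n\<in>nbhd N l. of_real (Dim n / Dim l) * qmat z z' w w' N n l * \<sigma>_fun n \<omega>)"
      by (rule sum.cong[OF refl]) (use nbhd_subset[OF l] gv in auto)
    finally show "link N g \<omega> = (\<Sum>n\<in>nbhd N l. of_real (Dim n / Dim l) * qmat z z' w w' N n l * \<sigma>_fun n \<omega>)" .
  qed
  define B where "B = norm (f l) + (\<Sum>n\<in>nbhd N l. norm (g n))"
  have B0: "0 \<le> (\<Sum>n\<in>nbhd N l. norm (g n))" by (rule sum_nonneg) simp
  have bf: "norm (f n) \<le> B" for n using B0 by (simp add: B_def f_def)
  have bg: "norm (g n) \<le> B" for n
  proof (cases "n \<in> nbhd N l")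
    case True
    then have "norm (g n) \<le> (\<Sum>n\<in>nbhd N l. norm (g n))" by (intro member_le_sum) auto
    then show ?thesis by (simp add: B_def add_increasing)
  next
    case False
    then show ?thesis using B0 g0 by (simp add: B_def)
  qed
  have "link N f \<in> C0 top_Omega" unfolding lf by (rule sigma_fun_C0[OF ne[OF l]])
  moreover have "link N g \<in> C0 top_Omega"
    unfolding lg by (rule C0_sum) (use nbhd_subset[OF l] ne sigma_fun_C0 in auto)
  ultimately have "is_generator_value top_Omega Pinf (link N f) (link N g)"
    by (intro link_generator_value[OF N Pinf gen bf bg])
  then show ?thesis unfolding lf lg .
qed

theorem theorem1p1:
  fixes z z' w w' :: complex
    and PN :: "nat \<Rightarrow> real \<Rightarrow> (int list \<Rightarrow> complex) \<Rightarrow> int list \<Rightarrow> complex"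
    and Pinf :: "real \<Rightarrow> (point \<Rightarrow> complex) \<Rightarrow> point \<Rightarrow> complex"
  assumes "admissible z z' w w'"
    and "\<And>N. N \<ge> 1 \<Longrightarrow> is_PN z z' w w' N (PN N)"
    and "is_Pinf PN Pinf"
  shows "\<forall>l\<in>nonempty_signatures.
    op_Dhat z z' w w' (\<sigma>_hat l) \<in> span_\<sigma>_hat \<and>
    \<sigma>_fun l \<in> generator_dom top_Omega Pinf \<and>
    \<iota> (op_Dhat z z' w w' (\<sigma>_hat l)) = generator top_Omega Pinf (\<sigma>_fun l)"
proof
  fix l assume "l \<in> nonempty_signatures"
  then obtain N where N: "N \<ge> 1" and l: "l \<in> signatures N" by (auto simp: nonempty_signatures_def)
  \<comment> \<open>These coefficients occur both in \<open>op_D_sigma\<close> and in the value of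
    the generator, so the two sides agree term by term.\<close>
  let ?c = "\<lambda>n. of_real (Dim n / Dim l) * qmat z z' w w' N n l"
  have S: "finite (nbhd N l)" "nbhd N l \<subseteq> nonempty_signatures"
    using nbhd_subset[OF l] N by (auto simp: nonempty_signatures_def)
  have D: "op_Dhat z z' w w' (\<sigma>_hat l) = (\<Sum>n\<in>nbhd N l. ?c n \<bullet>\<^sub>Q \<sigma>_hat n)"
    unfolding \<sigma>_hat_def[of l] op_Dhat_cls op_D_sigma[OF l] by (rule cls_sum)
  interpret Q: vector_space scaleRhat by (rule vector_space_Rhat)
  have "(\<Sum>n\<in>nbhd N l. ?c n \<bullet>\<^sub>Q \<sigma>_hat n) \<in> Q.span (\<sigma>_hat ` nonempty_signatures)"
    by (intro Q.span_sum Q.span_scale Q.span_base) (use S in auto)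
  moreover have gen: "is_generator_value top_Omega Pinf (\<sigma>_fun l) (\<lambda>\<omega>. \<Sum>n\<in>nbhd N l. ?c n * \<sigma>_fun n \<omega>)"
    by (rule sigma_fun_generator_value[OF N assms(2)[OF N] assms(3) l])
  moreover have "\<iota> (\<Sum>n\<in>nbhd N l. ?c n \<bullet>\<^sub>Q \<sigma>_hat n) = (\<lambda>\<omega>. \<Sum>n\<in>nbhd N l. ?c n * \<sigma>_fun n \<omega>)"
    by (rule iota_sum[OF S])
  ultimately show "op_Dhat z z' w w' (\<sigma>_hat l) \<in> span_\<sigma>_hat \<and>
    \<sigma>_fun l \<in> generator_dom top_Omega Pinf \<and>
    \<iota> (op_Dhat z z' w w' (\<sigma>_hat l)) = generator top_Omega Pinf (\<sigma>_fun l)"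
    unfolding D span_\<sigma>_hat_def generator_dom_def generator_eqI[OF gen] by blast
qed

end
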